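(* Let $a\ge1$, let $\mathcal{H}_a$ be the Hirzebruch surface, let $n\ge3$, and let $\mathsf{\Gamma}=(0,n,m,c)$ be genus $0$ discrete data with $m=2(n-1)$ and contact order $c$ along $\partial\mathcal{H}_a$ given by vectors $\mu_1,\mu_2,\mu_3,\mu_4$. \begin{itemize} \item If either $|\mu_1|>n-1$ or $|\mu_3|>n-1$, then $\mathsf{tropTev}^{\mathcal{H}_a}_{\mathsf{\Gamma}}=0$. \item Otherwise $$\mathsf{tropTev}^{\mathcal{H}_a}_{\mathsf{\Gamma}}=\left(\prod_{i=1}^4\frac{|\mu_i|!\,\prod_{j=1}^{|\mu_i|}\mu_{i,j}}{\prod_{u\ge1}|\{v\mid\mu_{i,v}=u\}|!}\right)a^{\,n-1-|\mu_2|-|\mu_4|}\binom{n-1-|\mu_4|}{|\mu_2|},$$ where the right-hand side is understood to be $0$ whenever $|\mu_2|>n-1-|\mu_4|$. \end{itemize}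
   Context: **Fan and discrete data.** $\mathcal{H}_a=\mathbb{P}(\mathcal{O}\oplus\mathcal{O}(a))$ is the toric surface whose complete fan has rays generated by $n_1=(-1,a)$, $n_2=(0,1)$, $n_3=(1,0)$, $n_4=(0,-1)$ (cyclically consecutive rays span the maximal cones), with toric divisors $D_1,\dots,D_4$. A contact order $c$ for $m$ markings $q_1,\dots,q_m$ consists of a function $\varphi:\{1,\dots,m\}\to\{1,2,3,4\}$ (the marking $q_l$ is sent to $D_{\varphi(l)}$) and, for each $i$, a (possibly empty) vector $\mu_i=(\mu_{i,1},\mu_{i,2},\dots)$ of positive integers, $\mu_{i,j}$ being the contact multiplicity of the $j$-th marking mapping to $D_i$; $|\mu_i|$ is the number of entries of $\mu_i$, so $\sum_i|\mu_i|=m$. If $q_l$ is the $j$-th marking mapping to $D_i$, set $v_l=\mu_{i,j}n_i\in\mathbb{Z}^2$; the balancing condition $\sum_l v_l=0$ is assumed. Let $\Delta=(v_1,\dots,v_m)$. **Tropical Tevelev degree.** $M^{\mathrm{trop}}(\mathbb{R}^2,\mathsf{\Gamma})$ is the moduli space of labelled parametrized rational tropical curves of degree $\Delta$ with $n$ marked points (Gathmann–Kerber–Markwig): isomorphism classes of maps $h:\mathsf{C}\to\mathbb{R}^2$, where $\mathsf{C}$ is a metric tree with all vertices of valence $\ge3$ and $n+m$ labelled unbounded ends $p_1,\dots,p_n,q_1,\dots,q_m$, $h$ is affine with integral direction vector on each edge (on an edge of length $\ell$ it has the form $t\mapsto b+tv$, $t\in[0,\ell]$, $v\in\mathbb{Z}^2$),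 the sum of outgoing direction vectors at each vertex is $0$, each $p_i$ is contracted, and $q_l$ has outgoing direction $v_l$. It is a tropical fan with all weights $1$ (identified with $M^{\mathrm{trop}}_{0,n+m}\times\mathbb{R}^2$ via edge lengths and $h(p_1)$, with the lattice generated by these coordinates). Let $M^{\mathrm{trop}}_{0,n}$ be the moduli fan of $n$-marked abstract rational tropical curves and $$\mathrm{trop}(\tau):M^{\mathrm{trop}}(\mathbb{R}^2,\mathsf{\Gamma})\to M^{\mathrm{trop}}_{0,n}\times(\mathbb{R}^2)^n$$ the morphism given by forgetting the ends $q_1,\dots,q_m$ and stabilizing the domain, together with $(h(p_1),\dots,h(p_n))$. It is a morphism of tropical fans of the same dimension with irreducible target; its degree is the number of preimages of a general point, each counted with the lattice index of the linear map on the cone containing it. Define $$\mathsf{tropTev}^{\mathcal{H}_a}_{\mathsf{\Gamma}}=\frac{\mathrm{degree}(\mathrm{trop}(\tau))}{\prod_{i=1}^4\prod_{u\ge1}|\{v\mid\mu_{i,v}=u\}|!}.$$ *)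

theory Defs
  imports "HOL-Analysis.Analysis"
begin

definition ray :: "nat \<Rightarrow> nat \<Rightarrow> int \<times> int" where
  "ray a i = (if i = 1 then (- 1, int a) else if i = 2 then (0, 1)
              else if i = 3 then (1, 0) else (0, - 1))"

text \<open>If the marking \<open>l\<close> is the \<open>j\<close>-th one mapping to the divisor \<open>i = \<phi> l\<close>, then
  \<open>j - 1\<close> is the cardinality below, and the vector is \<open>\<mu>\<^sub>i\<^sub>,\<^sub>j\<close> times the \<open>i\<close>-th ray generator.\<close>

definition contact_vec ::
    "nat \<Rightarrow> (nat \<Rightarrow> nat) \<Rightarrow> (nat \<Rightarrow> nat list) \<Rightarrow> nat \<Rightarrow> int \<times> int" where
  "contact_vec a \<phi> \<mu> l =
     (let k = int (\<mu> (\<phi> l) ! card {l' \<in> {1..<l}. \<phi> l' = \<phi> l});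
          r = ray a (\<phi> l)
      in (k * fst r, k * snd r))"

definition contact_order ::
    "nat \<Rightarrow> nat \<Rightarrow> (nat \<Rightarrow> nat) \<Rightarrow> (nat \<Rightarrow> nat list) \<Rightarrow> bool" where
  "contact_order a m \<phi> \<mu> \<longleftrightarrow>
     \<phi> \<in> {1..m} \<rightarrow> {1..4} \<and>
     (\<forall>i\<in>{1..4}. length (\<mu> i) = card {l \<in> {1..m}. \<phi> l = i} \<and> (\<forall>k\<in>set (\<mu> i). 0 < k)) \<and>
     (\<Sum>l\<in>{1..m}. contact_vec a \<phi> \<mu> l) = 0"

datatype mark = PMark nat | QMark nat

definition p_marks :: "nat \<Rightarrow> mark set" where
  "p_marks n = PMark ` {1..n}"

definition pq_marks :: "nat \<Rightarrow> nat \<Rightarrow> mark set" where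
  "pq_marks n m = PMark ` {1..n} \<union> QMark ` {1..m}"

text \<open>\<open>edges\<close> are the bounded edges, given by their two endpoints, and \<open>foot l\<close> is the vertex
  at which the unbounded end \<open>l\<close> is attached. Only the values of \<open>len\<close> on \<open>edges\<close> and of
  \<open>foot\<close> on the set of labels under consideration are meaningful. Since trees are considered
  up to isomorphism, natural numbers suffice as vertices.\<close>

record mtree =
  verts :: "nat set"
  edges :: "nat set set"
  len :: "nat set \<Rightarrow> real"
  foot :: "mark \<Rightarrow> nat"

definition is_path :: "'z mtree_scheme \<Rightarrow> nat \<Rightarrow> nat list \<Rightarrow> nat \<Rightarrow> bool" where
  "is_path T u xs w \<longleftrightarrow>
     xs \<noteq> [] \<and> hd xs = u \<and> last xs = w \<and> distinct xs \<and> set xs \<subseteq> verts T \<and>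
     successively (\<lambda>x y. {x, y} \<in> edges T) xs"

definition tree_path :: "'z mtree_scheme \<Rightarrow> nat \<Rightarrow> nat \<Rightarrow> nat list" where
  "tree_path T u w = (THE xs. is_path T u xs w)"

definition path_steps :: "'z mtree_scheme \<Rightarrow> nat \<Rightarrow> nat \<Rightarrow> (nat \<times> nat) list" where
  "path_steps T u w = zip (tree_path T u w) (tl (tree_path T u w))"

definition path_edges :: "'z mtree_scheme \<Rightarrow> nat \<Rightarrow> nat \<Rightarrow> nat set set" where
  "path_edges T u w = (\<lambda>(x, y). {x, y}) ` set (path_steps T u w)"

definition valence :: "mark set \<Rightarrow> 'z mtree_scheme \<Rightarrow> nat \<Rightarrow> nat" where
  "valence L T v = card {e \<in> edges T. v \<in> e} + card {l \<in> L. foot T l = v}"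

definition metric_tree :: "mark set \<Rightarrow> 'z mtree_scheme \<Rightarrow> bool" where
  "metric_tree L T \<longleftrightarrow>
     finite (verts T) \<and>
     edges T \<subseteq> {{u, w} | u w. u \<in> verts T \<and> w \<in> verts T \<and> u \<noteq> w} \<and>
     (\<forall>e\<in>edges T. 0 < len T e) \<and>
     foot T ` L \<subseteq> verts T \<and>
     (\<forall>u\<in>verts T. \<forall>w\<in>verts T. \<exists>!xs. is_path T u xs w) \<and>
     (\<forall>v\<in>verts T. 3 \<le> valence L T v)"

definition tree_iso ::
    "mark set \<Rightarrow> (nat \<Rightarrow> nat) \<Rightarrow> 'y mtree_scheme \<Rightarrow> 'z mtree_scheme \<Rightarrow> bool" where
  "tree_iso L \<sigma> T T' \<longleftrightarrow>
     bij_betw \<sigma> (verts T) (verts T') \<and>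
     edges T' = (\<lambda>e. \<sigma> ` e) ` edges T \<and>
     (\<forall>e\<in>edges T. len T' (\<sigma> ` e) = len T e) \<and>
     (\<forall>l\<in>L. foot T' l = \<sigma> (foot T l))"

text \<open>The points of the moduli fan of abstract \<open>n\<close>-marked rational tropical curves are the
  equivalence classes of the following relation.\<close>

definition tree_rel :: "nat \<Rightarrow> (mtree \<times> mtree) set" where
  "tree_rel n = {(T, T'). metric_tree (p_marks n) T \<and> metric_tree (p_marks n) T' \<and>
                          (\<exists>\<sigma>. tree_iso (p_marks n) \<sigma> T T')}"

text \<open>Forgetting all ends outside \<open>L\<close> leaves the subtree spanned by the ends in \<open>L\<close>. Its
  vertices of valence at least 3 survive; chains of edges through 2-valent vertices are merged
  into one edge (adding lengths) or, if they lead to an end, absorbed into that end.\<close>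

definition span_edges :: "mark set \<Rightarrow> 'z mtree_scheme \<Rightarrow> nat set set" where
  "span_edges L T = (\<Union>i\<in>L. \<Union>j\<in>L. path_edges T (foot T i) (foot T j))"

definition stable_verts :: "mark set \<Rightarrow> 'z mtree_scheme \<Rightarrow> nat set" where
  "stable_verts L T =
     {v \<in> verts T. 3 \<le> card {e \<in> span_edges L T. v \<in> e} + card {l \<in> L. foot T l = v}}"

definition chain_len :: "'z mtree_scheme \<Rightarrow> (nat set \<Rightarrow> real) \<Rightarrow> nat set \<Rightarrow> real" where
  "chain_len T t e = (\<Sum>f \<in> {f. \<exists>u w. e = {u, w} \<and> f \<in> path_edges T u w}. t f)"

definition stabilize :: "mark set \<Rightarrow> 'z mtree_scheme \<Rightarrow> mtree" where
  "stabilize L T = (let S = stable_verts L T in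
     \<lparr> verts = S,
       edges = {{u, w} | u w. u \<in> S \<and> w \<in> S \<and> u \<noteq> w \<and> set (tree_path T u w) \<inter> S = {u, w}},
       len = chain_len T (len T),
       foot = (\<lambda>l. THE w. w \<in> S \<and> set (tree_path T (foot T l) w) \<inter> S = {w}) \<rparr>)"

text \<open>A map from a metric tree to the plane which is affine on edges and has prescribed
  directions on the unbounded ends is given by the images \<open>pos\<close> of the vertices.\<close>

record pcurve = mtree +
  pos :: "nat \<Rightarrow> real \<times> real"

definition edge_dir :: "pcurve \<Rightarrow> nat \<Rightarrow> nat \<Rightarrow> real \<times> real" where
  "edge_dir C u w = (pos C w - pos C u) /\<^sub>R len C {u, w}"

fun end_dir :: "(nat \<Rightarrow> int \<times> int) \<Rightarrow> mark \<Rightarrow> real \<times> real" where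
  "end_dir \<Delta> (PMark i) = 0"
| "end_dir \<Delta> (QMark l) = (real_of_int (fst (\<Delta> l)), real_of_int (snd (\<Delta> l)))"

definition param_curve :: "(nat \<Rightarrow> int \<times> int) \<Rightarrow> nat \<Rightarrow> nat \<Rightarrow> pcurve \<Rightarrow> bool" where
  "param_curve \<Delta> n m C \<longleftrightarrow>
     metric_tree (pq_marks n m) C \<and>
     (\<forall>u w. {u, w} \<in> edges C \<longrightarrow> edge_dir C u w \<in> \<int> \<times> \<int>) \<and>
     (\<forall>v\<in>verts C. (\<Sum>w | {v, w} \<in> edges C. edge_dir C v w)
                  + (\<Sum>l | l \<in> pq_marks n m \<and> foot C l = v. end_dir \<Delta> l) = 0)"

definition curve_rel ::
    "(nat \<Rightarrow> int \<times> int) \<Rightarrow> nat \<Rightarrow> nat \<Rightarrow> (pcurve \<times> pcurve) set" where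
  "curve_rel \<Delta> n m = {(C, C'). param_curve \<Delta> n m C \<and> param_curve \<Delta> n m C' \<and>
     (\<exists>\<sigma>. tree_iso (pq_marks n m) \<sigma> C C' \<and> (\<forall>v\<in>verts C. pos C' (\<sigma> v) = pos C v))}"

definition M_trop :: "(nat \<Rightarrow> int \<times> int) \<Rightarrow> nat \<Rightarrow> nat \<Rightarrow> pcurve set set" where
  "M_trop \<Delta> n m = {C. param_curve \<Delta> n m C} // curve_rel \<Delta> n m"

definition ev :: "pcurve \<Rightarrow> nat \<Rightarrow> real \<times> real" where
  "ev C i = pos C (foot C (PMark i))"

definition trop_tau :: "nat \<Rightarrow> pcurve \<Rightarrow> mtree set \<times> (nat \<Rightarrow> real \<times> real)" where
  "trop_tau n C = (tree_rel n `` {stabilize (p_marks n) C}, \<lambda>i\<in>{1..n}. ev C i)"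

text \<open>The cone of the combinatorial type of \<open>C\<close> has the coordinates \<open>(t, b)\<close>, where
  \<open>t\<close> are the lengths of the bounded edges and \<open>b\<close> is the image of the first marked point,
  and the directions \<open>edge_dir C\<close> are constant on it. The following is the map \<open>trop_tau\<close> in
  these coordinates, the target being parametrized by the edge lengths of the stabilized tree
  and the images of the marked points.\<close>

definition cone_map ::
    "nat \<Rightarrow> pcurve \<Rightarrow> (nat set \<Rightarrow> real) \<times> (real \<times> real)
     \<Rightarrow> (nat set \<Rightarrow> real) \<times> (nat \<Rightarrow> real \<times> real)" where
  "cone_map n C = (\<lambda>(t, b).
     (chain_len C t,
      \<lambda>i. b + (\<Sum>(x, y) \<leftarrow> path_steps C (foot C (PMark 1)) (foot C (PMark i)).
                 t {x, y} *\<^sub>R edge_dir C x y)))"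

definition source_lattice :: "pcurve \<Rightarrow> ((nat set \<Rightarrow> real) \<times> (real \<times> real)) set" where
  "source_lattice C = (edges C \<rightarrow>\<^sub>E \<int>) \<times> (\<int> \<times> \<int>)"

definition target_lattice ::
    "nat \<Rightarrow> pcurve \<Rightarrow> ((nat set \<Rightarrow> real) \<times> (nat \<Rightarrow> real \<times> real)) set" where
  "target_lattice n C = (edges (stabilize (p_marks n) C) \<rightarrow>\<^sub>E \<int>) \<times> ({1..n} \<rightarrow>\<^sub>E \<int> \<times> \<int>)"

text \<open>The order of the quotient of the target lattice by the image of the source lattice
  (0 if this is infinite, that is, if the cone is mapped to a lower-dimensional one).\<close>

definition lattice_index :: "nat \<Rightarrow> pcurve \<Rightarrow> nat" where
  "lattice_index n C = card (target_lattice n C //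
     {(y, y'). y \<in> target_lattice n C \<and> y' \<in> target_lattice n C \<and>
        (\<exists>z\<in>source_lattice C.
           (\<forall>e\<in>edges (stabilize (p_marks n) C). fst y e - fst y' e = fst (cone_map n C z) e) \<and>
           (\<forall>i\<in>{1..n}. snd y i - snd y' i = snd (cone_map n C z) i))})"

definition rep :: "'b set \<Rightarrow> 'b" where
  "rep c = (SOME C. C \<in> c)"

definition fibre ::
    "(nat \<Rightarrow> int \<times> int) \<Rightarrow> nat \<Rightarrow> nat \<Rightarrow> mtree set \<times> (nat \<Rightarrow> real \<times> real) \<Rightarrow> pcurve set set" where
  "fibre \<Delta> n m y = {c \<in> M_trop \<Delta> n m. trop_tau n (rep c) = y}"

text \<open>The maximal cones of the target correspond to the trivalent trees. A point in the
  interior of such a cone is general if it avoids finitely many hyperplanes, each given by a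
  nonzero linear form \<open>(\<alpha>, \<beta>)\<close> in the edge lengths \<open>t\<close> and the points \<open>x\<^sub>1, \<dots>, x\<^sub>n\<close>.\<close>

definition has_degree :: "(nat \<Rightarrow> int \<times> int) \<Rightarrow> nat \<Rightarrow> nat \<Rightarrow> nat \<Rightarrow> bool" where
  "has_degree \<Delta> n m d \<longleftrightarrow>
     (\<forall>T::mtree. metric_tree (p_marks n) T \<and> (\<forall>v\<in>verts T. valence (p_marks n) T v = 3) \<longrightarrow>
       (\<exists>H :: ((nat set \<Rightarrow> real) \<times> (nat \<Rightarrow> real \<times> real)) set.
          finite H \<and>
          (\<forall>(\<alpha>, \<beta>)\<in>H. (\<exists>e\<in>edges T. \<alpha> e \<noteq> 0) \<or> (\<exists>i\<in>{1..n}. \<beta> i \<noteq> 0)) \<and>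
          (\<forall>t x. (\<forall>e\<in>edges T. 0 < t e) \<and>
                 (\<forall>(\<alpha>, \<beta>)\<in>H. (\<Sum>e\<in>edges T. \<alpha> e * t e) + (\<Sum>i\<in>{1..n}. \<beta> i \<bullet> x i) \<noteq> 0) \<longrightarrow>
             (let F = fibre \<Delta> n m (tree_rel n `` {T\<lparr>len := t\<rparr>}, restrict x {1..n})
              in finite F \<and> (\<Sum>c\<in>F. lattice_index n (rep c)) = d))))"

definition trop_degree :: "(nat \<Rightarrow> int \<times> int) \<Rightarrow> nat \<Rightarrow> nat \<Rightarrow> nat" where
  "trop_degree \<Delta> n m = (THE d. has_degree \<Delta> n m d)"

text \<open>The product over all \<open>u \<ge> 1\<close> of the factorials of the number of entries equal to \<open>u\<close>;
  values that do not occur contribute \<open>0! = 1\<close>.\<close>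

definition aut_factor :: "nat list \<Rightarrow> nat" where
  "aut_factor ks = (\<Prod>u\<in>set ks. fact (count_list ks u))"

definition trop_Tev :: "nat \<Rightarrow> nat \<Rightarrow> nat \<Rightarrow> (nat \<Rightarrow> nat) \<Rightarrow> (nat \<Rightarrow> nat list) \<Rightarrow> real" where
  "trop_Tev a n m \<phi> \<mu> =
     real (trop_degree (contact_vec a \<phi> \<mu>) n m) / real (\<Prod>i\<in>{1..4}. aut_factor (\<mu> i))"

end

(* Fix a general point of the target: a metric tree T with ends p_1, ..., p_n and points
   x_1, ..., x_n of the plane. A curve over it arises from T by attaching each end q_j to a point
   of T, given by an edge or leg of T (a "cell", identified with the set of marked points behind
   it as seen from p_1) and by its depth D_j in the tree. The direction of an edge is the sum of
   the directions of the ends q_l behind it, so the images of the marked points are linear in D.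
   For each choice of cells this is a square linear system whose determinant is, up to sign, the
   lattice index; hence the degree is the sum of |det| over those choices of cells for which the
   solution D lies inside them.
   This weighted count is invariant when the points x_i move: when D_j reaches a vertex, the
   columns of the cells meeting there balance, and so do the determinants by multilinearity.
   Moving the points far apart forces all ends q_j onto the legs, so that T may be replaced by a
   star; for suitable points the solutions over the star can be listed, because the ends of each
   of the four directions are then distributed bijectively over a prescribed set of legs. *)

theory Submission
  imports Defs "Jordan_Normal_Form.Determinant"
begin

section \<open>Determinants of matrices given by functions\<close>

text \<open>Rooting \<open>T\<close> at the first marked point leaves \<open>2 * (n - 1)\<close>
  equations, for the differences to its image, in as many unknowns. As the end directions sum to
  zero, all depths may be shifted by a constant; they are measured from the first stable vertex, so
  that an end on the leg of the first marked point has negative depth. The obstacle is the absolute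
  value, which is not multilinear: by Cramer's rule, the sign with which a solution crosses a wall
  times the absolute determinant is the determinant itself times a sign that does not see the moving
  column. This needs a segment that meets one wall at a time. Its far end has coordinates of the
  form plus or minus \<open>s ^ r\<close>: powers avoid all degenerate positions at once, and the
  signs put min(|mu_4|, n-1) points below the first one and the others above the line of slope
  \<open>-a\<close> through it, with decreasing abscissas. Over the star there remain the choice of
  a set \<open>Z\<close> of legs carrying the direction \<open>(0, 1)\<close>, counted by the
  binomial coefficient, and of a bijection for each direction; the centre is forced by the number of
  ends of direction \<open>(1, 0)\<close>.\<close>

definition dt :: "nat => (nat => nat => 'a::comm_ring_1) => 'a" where
 "dt k A = Determinant.det (Matrix.mat k k (\<lambda>(i, j). A i j))"

text \<open>Matrices are functions with an explicit size, so that replacing a column is a case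
  distinction and entries outside the size never matter.\<close>

abbreviation set_col :: "(nat => nat => 'a) => nat => (nat => 'a) => nat => nat => 'a" where
 "set_col A l v \<equiv> \<lambda>i j. if j = l then v i else A i j"

lemma dt_cong: "(\<And>i j. i < k ==> j < k ==> A i j = B i j) ==> dt k A = dt k B"
 unfolding dt_def by (intro arg_cong[of _ _ Determinant.det] eq_matI) auto

text \<open>The coefficients are the cofactors of column \<open>l\<close>, which do not involve that
  column; hence one \<open>c\<close> serves all \<open>v\<close>.\<close>

lemma dt_set_col_linear:
 assumes "l < k"
 obtains c where "\<And>v. dt k (set_col A l v) = (\<Sum>i<k. v i * c i)"
proof -
 define c where "c i = cofactor (Matrix.mat k k (\<lambda>(i, j). A i j)) i l" for i
 have "dt k (set_col A l v) = (\<Sum>i<k. v i * c i)" for v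
 proof -
  let ?M = "Matrix.mat k k (\<lambda>(i, j). set_col A l v i j)"
  have cof: "cofactor ?M i l = c i" if "i < k" for i
   unfolding c_def cofactor_def mat_delete_def using assms that
   by (intro arg_cong[of _ _ "\<lambda>x. _ * Determinant.det x"] eq_matI) auto
  have "dt k (set_col A l v) = (\<Sum>i<k. ?M $$ (i, l) * cofactor ?M i l)"
   unfolding dt_def by (rule laplace_expansion_column) (use assms in auto)
  also have "\<dots> = (\<Sum>i<k. v i * c i)"
   using assms cof by (intro sum.cong) auto
  finally show ?thesis .
 qed
 thus ?thesis using that by blast
qed

lemma dt_set_col_sum:
 fixes A :: "nat => nat => 'a::comm_ring_1"
 assumes "l < k"
 shows "dt k (set_col A l (\<lambda>i. \<Sum>s\<in>S. c s * v s i)) = (\<Sum>s\<in>S. c s * dt k (set_col A l (v s)))"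
proof -
 obtain d where d: "\<And>v. dt k (set_col A l v) = (\<Sum>i<k. v i * d i)"
  using dt_set_col_linear[OF assms, of A] by blast
 have "(\<Sum>i<k. (\<Sum>s\<in>S. c s * v s i) * d i) = (\<Sum>i<k. \<Sum>s\<in>S. c s * (v s i * d i))"
  by (simp add: sum_distrib_right mult.assoc)
 also have "\<dots> = (\<Sum>s\<in>S. c s * (\<Sum>i<k. v s i * d i))"
  by (subst sum.swap) (simp add: sum_distrib_left)
 finally show ?thesis by (simp only: d)
qed

lemma dt_set_col_zero:
 fixes A :: "nat => nat => 'a::comm_ring_1"
 assumes "l < k"
 shows "dt k (set_col A l (\<lambda>i. 0)) = 0"
proof -
 obtain d where d: "\<And>v. dt k (set_col A l v) = (\<Sum>i<k. v i * d i)"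
  using dt_set_col_linear[OF assms, of A] by blast
 show ?thesis using d[of "\<lambda>i. 0"] by simp
qed

text \<open>Cramer's rule in division-free form, valid for singular matrices too. It serves both for
  kernel vectors and for the sign of the velocity of a solution.\<close>

lemma dt_cramer:
 assumes "l < k" and "\<And>i. i < k ==> (\<Sum>j<k. A i j * x j) = b i"
 shows "dt k (set_col A l b) = x l * dt k A"
proof -
 let ?M = "Matrix.mat k k (\<lambda>(i, j). A i j)" and ?x = "Matrix.vec k x"
 have "(?M *\<^sub>v ?x) = Matrix.vec k b"
  using assms(2) by (intro eq_vecI) (auto simp: scalar_prod_def atLeast0LessThan)
 hence "Determinant.det (replace_col ?M (Matrix.vec k b) l) = x l * Determinant.det ?M"
  using cramer_lemma_mat[of ?M k ?x l] assms(1) by simp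
 moreover have "replace_col ?M (Matrix.vec k b) l = Matrix.mat k k (\<lambda>(i, j). set_col A l b i j)"
  by (intro eq_matI) (auto simp: replace_col_def)
 ultimately show ?thesis unfolding dt_def by simp
qed

lemma dt_transpose: "dt k (\<lambda>i j. A j i) = dt k A"
proof -
 have "Matrix.mat k k (\<lambda>(i, j). A j i) = transpose_mat (Matrix.mat k k (\<lambda>(i, j). A i j))"
  by (intro eq_matI) auto
 thus ?thesis unfolding dt_def by (simp add: det_transpose[of _ k])
qed

lemma dt_zero_imp_kernel:
 fixes A :: "nat => nat => real"
 assumes "dt k A = 0"
 obtains v j where "j < k" "v j \<noteq> 0" "\<And>i. i < k ==> (\<Sum>j<k. A i j * v j) = 0"
proof -
 let ?M = "Matrix.mat k k (\<lambda>(i, j). A i j)"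
 obtain v where v: "v \<in> carrier_vec k" "v \<noteq> 0\<^sub>v k" "?M *\<^sub>v v = 0\<^sub>v k"
  using det_0_iff_vec_prod_zero_field[of ?M k] assms unfolding dt_def by auto
 obtain j where j: "j < k" "vec_index v j \<noteq> 0"
  using v(1,2) by (metis carrier_vecD eq_vecI index_zero_vec(1) index_zero_vec(2))
 have "(\<Sum>j<k. A i j * vec_index v j) = 0" if "i < k" for i
 proof -
  have "vec_index (?M *\<^sub>v v) i = (\<Sum>j<k. A i j * vec_index v j)"
   using that v(1) by (auto simp: scalar_prod_def atLeast0LessThan)
  thus ?thesis using v(3) that by simp
 qed
 thus ?thesis using that j by blast
qed

text \<open>A left null vector turns solvability of a singular system into a linear condition on the
  right-hand side, which points in general position violate.\<close>

lemma dt_zero_imp_left_kernel: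
 fixes A :: "nat => nat => real"
 assumes "dt k A = 0"
 obtains y i where "i < k" "y i \<noteq> 0" "\<And>j. j < k ==> (\<Sum>i<k. y i * A i j) = 0"
proof -
 have "dt k (\<lambda>i j. A j i) = 0" using assms dt_transpose[of k A] by metis
 then obtain v j where v: "j < k" "v j \<noteq> 0" "\<And>i. i < k ==> (\<Sum>j<k. A j i * v j) = 0"
  by (rule dt_zero_imp_kernel) blast
 show ?thesis by (rule that[of j v]) (use v in \<open>simp_all add: mult.commute\<close>)
qed

lemma dt_zero_if_kernel:
 fixes A :: "nat => nat => real"
 assumes "j < k" "v j \<noteq> 0" "\<And>i. i < k ==> (\<Sum>j<k. A i j * v j) = 0"
 shows "dt k A = 0"
proof -
 have "dt k (set_col A j (\<lambda>i. 0)) = v j * dt k A"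
  by (rule dt_cramer) (use assms in auto)
 thus ?thesis using dt_set_col_zero[OF assms(1), of A] assms(2) by simp
qed

text \<open>\<open>B\<close> is the adjugate divided by the determinant. The two clauses are
  existence and uniqueness of solutions; since \<open>B\<close> does not depend on \<open>b\<close>,
  solutions are linear in the right-hand side.\<close>

lemma dt_inverse:
 fixes A :: "nat => nat => real"
 assumes "dt k A \<noteq> 0"
 obtains B where
  "\<And>b i. i < k ==> (\<Sum>j<k. A i j * (\<Sum>r<k. B j r * b r)) = b i"
  "\<And>x b j. (\<And>i. i < k ==> (\<Sum>j<k. A i j * x j) = b i) ==> j < k ==> x j = (\<Sum>r<k. B j r * b r)"
proof -
 let ?M = "Matrix.mat k k (\<lambda>(i, j). A i j)"
 define B where "B j r = adj_mat ?M $$ (j, r) / dt k A" for j r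
 have M: "?M \<in> carrier_mat k k" by simp
 note adj = adj_mat[OF M]
 have dim: "dim_row (adj_mat ?M) = k" "dim_col (adj_mat ?M) = k" using adj(1) by auto
 have AB: "(\<Sum>j<k. A i j * B j r) = (if i = r then 1 else 0)" if "i < k" "r < k" for i r
 proof -
  have "(\<Sum>j<k. A i j * adj_mat ?M $$ (j, r)) = (?M * adj_mat ?M) $$ (i, r)"
   using that dim by (auto simp: scalar_prod_def atLeast0LessThan)
  also have "\<dots> = (if i = r then dt k A else 0)"
   unfolding adj(2) dt_def using that by simp
  finally show ?thesis
   using assms by (auto simp: B_def sum_divide_distrib[symmetric])
 qed
 have BA: "(\<Sum>r<k. B j r * A r i) = (if j = i then 1 else 0)" if "i < k" "j < k" for i j
 proof -
  have "(\<Sum>r<k. adj_mat ?M $$ (j, r) * A r i) = (adj_mat ?M * ?M) $$ (j, i)"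
   using that dim by (auto simp: scalar_prod_def atLeast0LessThan)
  also have "\<dots> = (if j = i then dt k A else 0)"
   unfolding adj(3) dt_def using that by simp
  finally show ?thesis
   using assms by (auto simp: B_def sum_divide_distrib[symmetric])
 qed
 have 1: "(\<Sum>j<k. A i j * (\<Sum>r<k. B j r * b r)) = b i" if "i < k" for b i
 proof -
  have "(\<Sum>j<k. A i j * (\<Sum>r<k. B j r * b r)) = (\<Sum>r<k. (\<Sum>j<k. A i j * B j r) * b r)"
   by (subst sum_distrib_right, subst sum.swap) (simp add: sum_distrib_left mult.assoc)
  also have "\<dots> = (\<Sum>r<k. (if i = r then b r else 0))"
   using that by (intro sum.cong) (auto simp: AB)
  finally show ?thesis using that by simp
 qed
 have 2: "x j = (\<Sum>r<k. B j r * b r)"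
  if "\<And>i. i < k ==> (\<Sum>j<k. A i j * x j) = b i" "j < k" for x b j
 proof -
  have "(\<Sum>r<k. B j r * b r) = (\<Sum>r<k. B j r * (\<Sum>i<k. A r i * x i))"
   using that by (intro sum.cong) auto
  also have "\<dots> = (\<Sum>i<k. (\<Sum>r<k. B j r * A r i) * x i)"
   by (subst sum_distrib_right, subst sum.swap) (simp add: sum_distrib_left mult.assoc)
  also have "\<dots> = (\<Sum>i<k. (if j = i then x i else 0))"
   using that by (intro sum.cong) (auto simp: BA)
  finally show ?thesis using that by simp
 qed
 show ?thesis using that 1 2 by blast
qed

text \<open>After renaming rows by \<open>\<pi>\<close>, an off-diagonal entry is nonzero only in a
  column of larger rank. A permutation contributing to the Leibniz formula therefore never increases
  the rank; as the sum of the ranks is preserved, it fixes everything. Ranks need not be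
  injective.\<close>

lemma dt_triangular:
 fixes A :: "nat => nat => real"
 assumes \<pi>: "bij_betw \<pi> {..<k} {..<k}"
  and tri: "\<And>j j'. j < k ==> j' < k ==> j \<noteq> j' ==> A (\<pi> j) j' \<noteq> 0 ==> (rk j :: nat) < rk j'"
 shows "\<bar>dt k A\<bar> = (\<Prod>j<k. \<bar>A (\<pi> j) j\<bar>)"
proof -
 define p0 where "p0 j = (if j < k then \<pi> j else j)" for j
 have bp0: "bij_betw p0 {0..<k} {0..<k}"
  using \<pi> unfolding p0_def atLeast0LessThan by (subst bij_betw_cong[where g = \<pi>]) auto
 have p0: "p0 permutes {0..<k}"
  using bp0 by (intro bij_imp_permutes) (auto simp: p0_def)
 have only: "p = p0" if p: "p permutes {0..<k}" and nz: "(\<Prod>j<k. A (p j) j) \<noteq> 0" for p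
 proof -
  define q where "q j = Hilbert_Choice.inv p0 (p j)" for j
  have q: "q permutes {0..<k}"
   using permutes_compose[OF p permutes_inv[OF p0]] by (simp add: q_def[abs_def] comp_def)
  have qk: "q j < k" if "j < k" for j using permutes_in_image[OF q, of j] that by simp
  have pq: "p j = \<pi> (q j)" if "j < k" for j
  proof -
   have "p0 (q j) = p j" unfolding q_def by (rule permutes_inverses(1)[OF p0])
   thus ?thesis using qk[OF that] by (simp add: p0_def)
  qed
  have le: "rk (q j) \<le> rk j" "q j \<noteq> j ==> rk (q j) < rk j" if "j < k" for j
  proof -
   have "A (\<pi> (q j)) j \<noteq> 0" using nz that pq by force
   hence "q j \<noteq> j ==> rk (q j) < rk j" using tri[of "q j" j] that qk by blast
   thus "rk (q j) \<le> rk j" "q j \<noteq> j ==> rk (q j) < rk j" by (cases "q j = j"; auto)+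
  qed
  have "(\<Sum>j<k. rk (q j)) = (\<Sum>j<k. rk j)"
   using sum.permute[OF q, of rk] by (simp add: comp_def atLeast0LessThan)
  hence "\<forall>j<k. rk (q j) = rk j"
   using le(1) sum_mono_inv[of "\<lambda>j. rk (q j)" "{..<k}" rk] by (metis finite_lessThan lessThan_iff)
  hence "\<forall>j<k. q j = j" using le(2) by (metis less_irrefl)
  hence "p j = p0 j" for j
   using pq p p0 by (cases "j < k") (auto simp: p0_def permutes_def)
  thus ?thesis by auto
 qed
 let ?M = "Matrix.mat k k (\<lambda>(i, j). A i j)"
 have "dt k A = (\<Sum>p | p permutes {0..<k}. signof p * (\<Prod>j<k. ?M $$ (p j, j)))"
  unfolding dt_def by (rule det_col) simp
 also have "\<dots> = (\<Sum>p | p permutes {0..<k}. signof p * (\<Prod>j<k. A (p j) j))"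
 proof (intro sum.cong refl)
  fix p assume "p \<in> {p. p permutes {0..<k}}"
  hence "p j < k" if "j < k" for j using permutes_in_image[of p "{0..<k}" j] that by simp
  thus "signof p * (\<Prod>j<k. ?M $$ (p j, j)) = signof p * (\<Prod>j<k. A (p j) j)" by simp
 qed
 also have "\<dots> = (\<Sum>p\<in>{p0}. signof p * (\<Prod>j<k. A (p j) j))"
  using only p0 by (intro sum.mono_neutral_right) (auto simp: finite_permutations)
 finally have "dt k A = signof p0 * (\<Prod>j<k. A (\<pi> j) j)" by (simp add: p0_def)
 thus ?thesis by (simp add: abs_mult sign_def abs_prod)
qed

section \<open>Column operations and lattices spanned by columns\<close>

lemma dt_add_col:
 fixes A :: "nat => nat => 'a::comm_ring_1"
 assumes "l < k" "l' < k" "l \<noteq> l'"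
 shows "dt k (set_col A l (\<lambda>i. A i l + c * A i l')) = dt k A"
proof -
 let ?M = "Matrix.mat k k (\<lambda>(i, j). A i j)"
 have "addcol c l l' ?M = Matrix.mat k k (\<lambda>(i, j). set_col A l (\<lambda>i. A i l + c * A i l') i j)"
  using assms by (intro eq_matI) (auto simp: algebra_simps)
 thus ?thesis unfolding dt_def using assms by (metis det_addcol mat_carrier)
qed

lemma dt_swap_col:
 fixes A :: "nat => nat => 'a::comm_ring_1"
 assumes "l < k" "l' < k" "l \<noteq> l'"
 shows "dt k (\<lambda>i j. A i (Transposition.transpose l l' j)) = - dt k A"
proof -
 let ?M = "Matrix.mat k k (\<lambda>(i, j). A i j)"
 have "swapcols l l' ?M = Matrix.mat k k (\<lambda>(i, j). A i (Transposition.transpose l l' j))"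
  using assms by (intro eq_matI) (auto simp: Transposition.transpose_def)
 thus ?thesis unfolding dt_def using det_swapcols[of l k l' ?M] assms by simp
qed

lemma dt_last_row:
 fixes A :: "nat => nat => 'a::comm_ring_1"
 assumes "\<And>j. j < k ==> A k j = 0"
 shows "dt (Suc k) A = A k k * dt k A"
proof -
 let ?M = "Matrix.mat (Suc k) (Suc k) (\<lambda>(i, j). A i j)"
 have "dt (Suc k) A = (\<Sum>j<Suc k. ?M $$ (k, j) * cofactor ?M k j)"
  unfolding dt_def by (rule laplace_expansion_row) auto
 also have "\<dots> = A k k * cofactor ?M k k"
  using assms by simp
 also have "cofactor ?M k k = dt k A"
  unfolding cofactor_def dt_def mat_delete_def
  by (simp, intro arg_cong[of _ _ Determinant.det] eq_matI) auto
 finally show ?thesis .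
qed

lemma of_int_dt: "of_int (dt k A) = (dt k (\<lambda>i j. of_int (A i j)) :: real)"
proof -
 have "Matrix.mat k k (\<lambda>(i, j). of_int (A i j)) = map_mat (of_int :: int => real) (Matrix.mat k k (\<lambda>(i, j). A i j))"
  by (intro eq_matI) auto
 thus ?thesis unfolding dt_def by simp
qed

text \<open>A set of representatives of the integer vectors modulo the lattice spanned by the
  columns of \<open>A\<close>. Vectors are functions on all naturals of which only the first
  \<open>k\<close> values count; uniqueness also forbids two members of \<open>R\<close> that agree
  there.\<close>

definition transversal :: "nat => (nat => nat => int) => (nat => int) set => bool" where
 "transversal k A R \<longleftrightarrow> finite R \<and>
   (\<forall>v. \<exists>!r. r \<in> R \<and> (\<exists>D. \<forall>i<k. v i = r i + (\<Sum>j<k. A i j * D j)))"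

text \<open>Only the column lattice matters, and invertible integral column operations preserve
  it.\<close>

lemma transversal_transfer:
 assumes R: "transversal k A R"
  and sub: "\<And>D. \<exists>D'. \<forall>i<k. (\<Sum>j<k. A i j * D j) = (\<Sum>j<k. B i j * D' j)"
   "\<And>D. \<exists>D'. \<forall>i<k. (\<Sum>j<k. B i j * D j) = (\<Sum>j<k. A i j * D' j)"
 shows "transversal k B R"
proof -
 have "(\<exists>D. \<forall>i<k. v i = r i + (\<Sum>j<k. A i j * D j)) \<longleftrightarrow> (\<exists>D. \<forall>i<k. v i = r i + (\<Sum>j<k. B i j * D j))" for v r :: "nat => int"
 proof
  assume "\<exists>D. \<forall>i<k. v i = r i + (\<Sum>j<k. A i j * D j)"
  then obtain D where D: "\<forall>i<k. v i = r i + (\<Sum>j<k. A i j * D j)" by blast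
  from sub(1)[of D] obtain D' where "\<forall>i<k. (\<Sum>j<k. A i j * D j) = (\<Sum>j<k. B i j * D' j)" by blast
  hence "\<forall>i<k. v i = r i + (\<Sum>j<k. B i j * D' j)" using D by simp
  thus "\<exists>D. \<forall>i<k. v i = r i + (\<Sum>j<k. B i j * D j)" by blast
 next
  assume "\<exists>D. \<forall>i<k. v i = r i + (\<Sum>j<k. B i j * D j)"
  then obtain D where D: "\<forall>i<k. v i = r i + (\<Sum>j<k. B i j * D j)" by blast
  from sub(2)[of D] obtain D' where "\<forall>i<k. (\<Sum>j<k. B i j * D j) = (\<Sum>j<k. A i j * D' j)" by blast
  hence "\<forall>i<k. v i = r i + (\<Sum>j<k. A i j * D' j)" using D by simp
  thus "\<exists>D. \<forall>i<k. v i = r i + (\<Sum>j<k. A i j * D j)" by blast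
 qed
 thus ?thesis using R unfolding transversal_def by simp
qed

lemma transversal_add_col:
 fixes A :: "nat => nat => int"
 assumes l: "l < k" "l' < k" "l \<noteq> l'"
  and R: "transversal k (set_col A l (\<lambda>i. A i l + c * A i l')) R"
 shows "transversal k A R"
proof (rule transversal_transfer[OF R])
 have *: "(\<Sum>j<k. set_col A l (\<lambda>i. A i l + c * A i l') i j * D j)
   = (\<Sum>j<k. A i j * (D(l' := D l' + c * D l)) j)" for D :: "nat => int" and i
 proof -
  have "(\<Sum>j<k. set_col A l (\<lambda>i. A i l + c * A i l') i j * D j)
   = (\<Sum>j<k. A i j * D j + (if j = l then c * A i l' * D l else 0))"
   by (intro sum.cong) (auto simp: algebra_simps)
  also have "\<dots> = (\<Sum>j<k. A i j * D j) + c * A i l' * D l"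
   using l by (simp add: sum.distrib)
  also have "\<dots> = (\<Sum>j<k. A i j * D j + (if j = l' then c * A i l' * D l else 0))"
   using l by (simp add: sum.distrib)
  also have "\<dots> = (\<Sum>j<k. A i j * (D(l' := D l' + c * D l)) j)"
   by (intro sum.cong) (auto simp: algebra_simps)
  finally show ?thesis .
 qed
 show "\<exists>D'. \<forall>i<k. (\<Sum>j<k. set_col A l (\<lambda>i. A i l + c * A i l') i j * D j) = (\<Sum>j<k. A i j * D' j)" for D
  using * by blast
 show "\<exists>D'. \<forall>i<k. (\<Sum>j<k. A i j * D j) = (\<Sum>j<k. set_col A l (\<lambda>i. A i l + c * A i l') i j * D' j)" for D
 proof (intro exI allI impI)
  fix i
  have "(D(l' := D l' - c * D l))(l' := (D(l' := D l' - c * D l)) l' + c * (D(l' := D l' - c * D l)) l) = D"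
   using l by auto
  thus "(\<Sum>j<k. A i j * D j) = (\<Sum>j<k. set_col A l (\<lambda>i. A i l + c * A i l') i j * (D(l' := D l' - c * D l)) j)"
   unfolding * by (rule arg_cong[OF sym])
 qed
qed

lemma transversal_swap_col:
 fixes A :: "nat => nat => int"
 assumes l: "l < k" "l' < k"
  and R: "transversal k (\<lambda>i j. A i (Transposition.transpose l l' j)) R"
 shows "transversal k A R"
proof (rule transversal_transfer[OF R])
 have p: "Transposition.transpose l l' permutes {..<k}" using l by (simp add: permutes_swap_id)
 have *: "(\<Sum>j<k. A i (Transposition.transpose l l' j) * D (Transposition.transpose l l' j)) = (\<Sum>j<k. A i j * D j)" for D i
  using sum.permute[OF p, of "\<lambda>j. A i j * D j"] by (simp add: comp_def)
 show "\<exists>D'. \<forall>i<k. (\<Sum>j<k. A i (Transposition.transpose l l' j) * D j) = (\<Sum>j<k. A i j * D' j)" for D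
  using *[of _ "\<lambda>j. D (Transposition.transpose l l' j)"] by (intro exI[of _ "\<lambda>j. D (Transposition.transpose l l' j)"]) simp
 show "\<exists>D'. \<forall>i<k. (\<Sum>j<k. A i j * D j) = (\<Sum>j<k. A i (Transposition.transpose l l' j) * D' j)" for D
  using *[of _ D] by (intro exI[of _ "\<lambda>j. D (Transposition.transpose l l' j)"]) simp
qed

text \<open>With a last row \<open>(0, ..., 0, d)\<close>, the last coordinate fixes the last
  coefficient up to the choice of a residue modulo the absolute value of \<open>d\<close> (which may
  be negative). The rest of the last column is absorbed by shifting the vector, so a representative
  is a residue together with a representative for the upper left block.\<close>

lemma transversal_last_row:
 fixes A :: "nat => nat => int"
 assumes z: "\<And>j. j < k ==> A k j = 0" and d: "A k k \<noteq> 0" and R: "transversal k A R"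
 shows "\<exists>R'. transversal (Suc k) A R' \<and> card R' = nat \<bar>A k k\<bar> * card R"
proof -
 define d where "d = A k k"
 define h where "h = (\<lambda>(c, r). (\<lambda>i. if i < k then r i else if i = k then c else 0 :: int))"
 define R0 where "R0 = (\<lambda>r i. if i < k then r i else 0 :: int) ` R"
 define R' where "R' = h ` ({0..<\<bar>d\<bar>} \<times> R)"
 have d0: "d \<noteq> 0" using d by (simp add: d_def)
 have finR: "finite R" and R1: "\<And>v. \<exists>!r. r \<in> R \<and> (\<exists>D. \<forall>i<k. v i = r i + (\<Sum>j<k. A i j * D j))"
  using R by (auto simp: transversal_def)
 have injR: "r = r'" if "r \<in> R" "r' \<in> R" "\<forall>i<k. r i = r' i" for r r'
 proof -
  have "\<exists>D. \<forall>i<k. r i = r i + (\<Sum>j<k. A i j * D j)" by (rule exI[of _ "\<lambda>j. 0"]) simp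
  moreover have "\<exists>D. \<forall>i<k. r i = r' i + (\<Sum>j<k. A i j * D j)"
   by (rule exI[of _ "\<lambda>j. 0"]) (simp add: that)
  ultimately show ?thesis using R1[of r] that by blast
 qed
 have inj: "inj_on h ({0..<\<bar>d\<bar>} \<times> R)"
 proof (rule inj_onI)
  fix x y assume *: "x \<in> {0..<\<bar>d\<bar>} \<times> R" "y \<in> {0..<\<bar>d\<bar>} \<times> R" "h x = h y"
  obtain c r c' r' where xy: "x = (c, r)" "y = (c', r')" by (metis surj_pair)
  have e: "(if i < k then r i else if i = k then c else 0) = (if i < k then r' i else if i = k then c' else 0)" for i
   using fun_cong[OF *(3), of i] unfolding xy h_def by simp
  have "c = c'" using e[of k] by simp
  moreover have "\<forall>i<k. r i = r' i" using e by (metis (full_types))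
  hence "r = r'" using injR * xy by auto
  ultimately show "x = y" using xy by simp
 qed
 have card: "card R' = nat \<bar>A k k\<bar> * card R"
  unfolding R'_def card_image[OF inj] by (simp add: card_cartesian_product d_def)
 have eqv: "(\<exists>D. \<forall>i<Suc k. v i = h (c, r) i + (\<Sum>j<Suc k. A i j * D j)) \<longleftrightarrow>
   (\<exists>q. v k = c + d * q \<and> (\<exists>D. \<forall>i<k. v i - A i k * q = r i + (\<Sum>j<k. A i j * D j)))" for v c r
 proof
  assume "\<exists>D. \<forall>i<Suc k. v i = h (c, r) i + (\<Sum>j<Suc k. A i j * D j)"
  then obtain D where D: "\<And>i. i < Suc k ==> v i = h (c, r) i + (\<Sum>j<Suc k. A i j * D j)" by blast
  have "v k = c + d * D k" using D[of k] z by (simp add: h_def d_def)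
  moreover have "\<forall>i<k. v i - A i k * D k = r i + (\<Sum>j<k. A i j * D j)"
   using D by (simp add: h_def)
  ultimately show "\<exists>q. v k = c + d * q \<and> (\<exists>D. \<forall>i<k. v i - A i k * q = r i + (\<Sum>j<k. A i j * D j))" by blast
 next
  assume "\<exists>q. v k = c + d * q \<and> (\<exists>D. \<forall>i<k. v i - A i k * q = r i + (\<Sum>j<k. A i j * D j))"
  then obtain q D where q: "v k = c + d * q" and D: "\<And>i. i < k ==> v i - A i k * q = r i + (\<Sum>j<k. A i j * D j)" by blast
  have "\<forall>i<Suc k. v i = h (c, r) i + (\<Sum>j<Suc k. A i j * (D(k := q)) j)"
  proof (intro allI impI)
   fix i assume "i < Suc k"
   show "v i = h (c, r) i + (\<Sum>j<Suc k. A i j * (D(k := q)) j)"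
   proof (cases "i = k")
    case True
    thus ?thesis using q z by (simp add: h_def d_def)
   next
    case False
    hence "i < k" using \<open>i < Suc k\<close> by simp
    thus ?thesis using D[of i] by (simp add: h_def)
   qed
  qed
  thus "\<exists>D. \<forall>i<Suc k. v i = h (c, r) i + (\<Sum>j<Suc k. A i j * D j)" by blast
 qed
 have uq: "c = v k mod \<bar>d\<bar> \<and> q = (v k - v k mod \<bar>d\<bar>) div d" if "v k = c + d * q" "0 \<le> c" "c < \<bar>d\<bar>" for v :: "nat => int" and c q
 proof -
  have "v k mod \<bar>d\<bar> = c"
  proof -
   have "v k = c + \<bar>d\<bar> * (q * sgn d)" using that(1) by (simp add: abs_sgn algebra_simps sgn_if)
   thus ?thesis using that(2,3) by simp
  qed
  thus ?thesis using that(1) d0 by simp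
 qed
 have ex: "v k = v k mod \<bar>d\<bar> + d * ((v k - v k mod \<bar>d\<bar>) div d)" for v :: "nat => int"
 proof -
  have "d dvd v k - v k mod \<bar>d\<bar>" by (metis abs_dvd_iff dvd_minus_mod)
  thus ?thesis by simp
 qed
 have "transversal (Suc k) A R'"
  unfolding transversal_def
 proof (intro conjI allI)
  show "finite R'" unfolding R'_def using finR by auto
  fix v :: "nat => int"
  let ?c = "v k mod \<bar>d\<bar>" let ?q = "(v k - ?c) div d"
  obtain r where r: "r \<in> R" "\<exists>D. \<forall>i<k. v i - A i k * ?q = r i + (\<Sum>j<k. A i j * D j)"
   and ru: "\<And>r'. r' \<in> R ==> \<exists>D. \<forall>i<k. v i - A i k * ?q = r' i + (\<Sum>j<k. A i j * D j) ==> r' = r"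
   using R1[of "\<lambda>i. v i - A i k * ?q"] by blast
  show "\<exists>!r. r \<in> R' \<and> (\<exists>D. \<forall>i<Suc k. v i = r i + (\<Sum>j<Suc k. A i j * D j))"
  proof (rule ex1I[of _ "h (?c, r)"], intro conjI)
   show "h (?c, r) \<in> R'" unfolding R'_def using r d0 by auto
   show "\<exists>D. \<forall>i<Suc k. v i = h (?c, r) i + (\<Sum>j<Suc k. A i j * D j)"
    unfolding eqv using ex r(2) by blast
   fix s assume s: "s \<in> R' \<and> (\<exists>D. \<forall>i<Suc k. v i = s i + (\<Sum>j<Suc k. A i j * D j))"
   then obtain c r' where c: "s = h (c, r')" "0 \<le> c" "c < \<bar>d\<bar>" "r' \<in> R" unfolding R'_def by auto
   from s obtain q where q: "v k = c + d * q" "\<exists>D. \<forall>i<k. v i - A i k * q = r' i + (\<Sum>j<k. A i j * D j)"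
    unfolding c(1) eqv by blast
   have "c = ?c" "q = ?q" using uq[of v c q] q(1) c(2,3) by auto
   thus "s = h (?c, r)" using ru[OF c(4)] q(2) c(1) by simp
  qed
 qed
 thus ?thesis using card by blast
qed

text \<open>Column operations make the last row a multiple of a unit vector, as in the Euclidean
 algorithm; then one expands along that row.\<close>

theorem lattice_transversal:
 fixes A :: "nat => nat => int"
 assumes "dt k A \<noteq> 0"
 shows "\<exists>R. transversal k A R \<and> card R = nat \<bar>dt k A\<bar>"
 using assms
proof (induction k arbitrary: A)
 case 0
 have "transversal 0 A {\<lambda>i. 0}" by (auto simp: transversal_def)
 moreover have "dt 0 A = 1" by (simp add: dt_def)
 ultimately show ?case by (intro exI[of _ "{\<lambda>i. 0}"]) simp
next
 case (Suc k)
 from Suc.prems show ?case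
 proof (induction "\<Sum>j<Suc k. nat \<bar>A k j\<bar>" arbitrary: A rule: less_induct)
  case (less A)
  show ?case
  proof (cases "\<exists>j j'. j < Suc k \<and> j' < Suc k \<and> j \<noteq> j' \<and> A k j' \<noteq> 0 \<and> \<bar>A k j'\<bar> \<le> \<bar>A k j\<bar>")
   case True
   then obtain j j' where j: "j < Suc k" "j' < Suc k" "j \<noteq> j'" "A k j' \<noteq> 0" "\<bar>A k j'\<bar> \<le> \<bar>A k j\<bar>" by blast
   \<comment> \<open>This sign makes \<open>A k j\<close> smaller in absolute value, because
     \<open>A k j'\<close> is nonzero and not larger. The measure of the induction is the sum of the
     absolute values in the last row.\<close>
   define c where "c = - sgn (A k j) * sgn (A k j')"
   let ?B = "set_col A j (\<lambda>i. A i j + c * A i j')"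
   have "\<bar>A k j + c * A k j'\<bar> < \<bar>A k j\<bar>"
    using j(4,5) unfolding c_def by (auto simp: sgn_if split: if_splits)
   hence lt: "nat \<bar>?B k j\<bar> < nat \<bar>A k j\<bar>" by auto
   have "(\<Sum>j<Suc k. nat \<bar>?B k j\<bar>) < (\<Sum>j<Suc k. nat \<bar>A k j\<bar>)"
    by (rule sum_strict_mono_ex1) (use lt j in auto)
   moreover have e: "dt (Suc k) ?B = dt (Suc k) A" by (rule dt_add_col) (use j in auto)
   moreover have "dt (Suc k) ?B \<noteq> 0" using less.prems unfolding e .
   ultimately have "\<exists>R. transversal (Suc k) ?B R \<and> card R = nat \<bar>dt (Suc k) ?B\<bar>"
    using less.hyps[of ?B] by blast
   then obtain R where "transversal (Suc k) ?B R" "card R = nat \<bar>dt (Suc k) A\<bar>"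
    unfolding e by blast
   thus ?thesis using transversal_add_col[OF j(1-3)] by blast
  next
   case False
   obtain l where l: "l < Suc k" "A k l \<noteq> 0"
   proof (rule ccontr)
    assume "\<not> thesis"
    hence "A k j = 0" if "j < Suc k" for j using that \<open>\<And>l. l < Suc k ==> A k l \<noteq> 0 ==> thesis\<close> by blast
    hence "dt (Suc k) A = 0" by (subst dt_last_row) auto
    thus False using less.prems by simp
   qed
   \<comment> \<open>Two nonzero entries of the last row would be comparable in absolute value,
     which the negated case condition excludes.\<close>
   have z: "A k j = 0" if "j < Suc k" "j \<noteq> l" for j
    using False that l by (metis linorder_linear)
   let ?B = "\<lambda>i j. A i (Transposition.transpose l k j)"
   have zB: "?B k j = 0" if "j < k" for j
    using z that l by (auto simp: Transposition.transpose_def)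
   have dB: "dt (Suc k) ?B = dt (Suc k) A \<or> dt (Suc k) ?B = - dt (Suc k) A"
    using dt_swap_col[of l "Suc k" k A] l by (cases "l = k") auto
   have e: "dt (Suc k) ?B = ?B k k * dt k ?B" by (rule dt_last_row) (use zB in auto)
   have nz: "?B k k \<noteq> 0" "dt k ?B \<noteq> 0" using e dB less.prems by auto
   obtain R where R: "transversal k ?B R" "card R = nat \<bar>dt k ?B\<bar>" using Suc.IH[OF nz(2)] by blast
   obtain R' where R': "transversal (Suc k) ?B R'" "card R' = nat \<bar>?B k k\<bar> * card R"
    using transversal_last_row[of k ?B, OF zB nz(1) R(1)] by blast
   have "card R' = nat \<bar>dt (Suc k) ?B\<bar>" unfolding R'(2) R(2) e by (simp add: nat_mult_distrib abs_mult)
   hence "card R' = nat \<bar>dt (Suc k) A\<bar>" using dB by auto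
   moreover have "transversal (Suc k) A R'"
    by (rule transversal_swap_col[OF _ _ R'(1)]) (use l in auto)
   ultimately show ?thesis by blast
  qed
 qed
qed

section \<open>Invariance of the weighted count along a segment\<close>

lemma affine_pos:
 fixes p q r \<alpha> \<beta> :: real
 assumes "p \<le> r" "r \<le> q" "\<alpha> + p * \<beta> > 0" "\<alpha> + q * \<beta> > 0"
 shows "\<alpha> + r * \<beta> > 0"
proof (cases "\<beta> \<ge> 0")
 case True
 hence "p * \<beta> \<le> r * \<beta>" using assms(1) by (rule mult_right_mono[rotated])
 thus ?thesis using assms(3) by linarith
next
 case False
 hence "q * \<beta> \<le> r * \<beta>" using assms(2) by (simp add: mult_right_mono_neg)
 thus ?thesis using assms(4) by linarith
qed

text \<open>Each constraint is an open half-line; the events are the points at which exactly one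
 constraint becomes tight.\<close>

lemma half_line_events:
 fixes \<alpha> \<beta> :: "'k => real" and p q :: real
 assumes "finite K" and "p < q"
  and "\<And>k. k \<in> K ==> \<alpha> k + p * \<beta> k \<noteq> 0" "\<And>k. k \<in> K ==> \<alpha> k + q * \<beta> k \<noteq> 0"
  and "\<And>r k k'. p < r ==> r < q ==> k \<in> K ==> k' \<in> K ==> k \<noteq> k' ==> \<alpha> k + r * \<beta> k = 0 ==> \<alpha> k' + r * \<beta> k' \<noteq> 0"
 shows "of_bool (\<forall>k\<in>K. \<alpha> k + p * \<beta> k > 0) - of_bool (\<forall>k\<in>K. \<alpha> k + q * \<beta> k > 0)
    = - (\<Sum>k\<in>K. sgn (\<beta> k) * of_bool (\<exists>r. p < r \<and> r < q \<and> \<alpha> k + r * \<beta> k = 0 \<and> (\<forall>k'\<in>K - {k}. \<alpha> k' + r * \<beta> k' > 0)))"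
 using assms
proof (induction K arbitrary: p q rule: finite_induct)
 case empty
 thus ?case by simp
next
 case (insert k0 K)
 define P where "P r k = \<alpha> k + r * \<beta> k" for r k
 define E where "E K p q k \<longleftrightarrow> (\<exists>r. p < r \<and> r < q \<and> P r k = 0 \<and> (\<forall>k'\<in>K - {k}. P r k' > 0))" for K p q k
 define S where "S K p q = (\<Sum>k\<in>K. sgn (\<beta> k) * of_bool (E K p q k))" for K p q
 have IH: "of_bool (\<forall>k\<in>K. P p' k > 0) - of_bool (\<forall>k\<in>K. P q' k > 0) = - S K p' q'"
  if "p \<le> p'" "p' < q'" "q' \<le> q" "\<And>k. k \<in> K ==> P p' k \<noteq> 0" "\<And>k. k \<in> K ==> P q' k \<noteq> 0" for p' q'
  unfolding S_def E_def P_def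
 proof (rule insert.IH)
  show "p' < q'" by (rule that(2))
  show "\<alpha> k + p' * \<beta> k \<noteq> 0" "\<alpha> k + q' * \<beta> k \<noteq> 0" if "k \<in> K" for k
   using \<open>\<And>k. k \<in> K ==> P p' k \<noteq> 0\<close> \<open>\<And>k. k \<in> K ==> P q' k \<noteq> 0\<close> that by (auto simp: P_def)
  show "\<alpha> k' + r * \<beta> k' \<noteq> 0"
   if "p' < r" "r < q'" "k \<in> K" "k' \<in> K" "k \<noteq> k'" "\<alpha> k + r * \<beta> k = 0" for r k k'
   by (rule insert.prems(4)[of r k k']) (use that \<open>p \<le> p'\<close> \<open>q' \<le> q\<close> in auto)
 qed
 have nz: "P p k \<noteq> 0" "P q k \<noteq> 0" if "k \<in> insert k0 K" for k
  using insert.prems(2,3) that by (auto simp: P_def)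
 have dis: "P r k' \<noteq> 0" if "p < r" "r < q" "k' \<in> K" "P r k0 = 0" for r k'
  using insert.prems(4)[of r k0 k'] that insert.hyps(2) by (auto simp: P_def)
 have pos: "P r k0 > 0" if "p \<le> r" "r \<le> q" "P p k0 > 0" "P q k0 > 0" for r
  using affine_pos that unfolding P_def by blast
 have neg: "P r k0 < 0" if "p \<le> r" "r \<le> q" "P p k0 < 0" "P q k0 < 0" for r
  using affine_pos[of p r q "- \<alpha> k0" "- \<beta> k0"] that unfolding P_def by simp
 have SI: "S (insert k0 K) p q = sgn (\<beta> k0) * of_bool (E (insert k0 K) p q k0)
   + (\<Sum>k\<in>K. sgn (\<beta> k) * of_bool (E (insert k0 K) p q k))"
  unfolding S_def using insert.hyps by simp
 have Ek0: "E (insert k0 K) p q k0 \<longleftrightarrow> (\<exists>r. p < r \<and> r < q \<and> P r k0 = 0 \<and> (\<forall>k'\<in>K. P r k' > 0))"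
  unfolding E_def using insert.hyps(2) by (metis Diff_insert_absorb)
 have Ek: "E (insert k0 K) p q k \<longleftrightarrow> (\<exists>r. p < r \<and> r < q \<and> P r k0 > 0 \<and> P r k = 0 \<and> (\<forall>k'\<in>K - {k}. P r k' > 0))"
  if "k \<in> K" for k
 proof -
  have "insert k0 K - {k} = insert k0 (K - {k})" using that insert.hyps(2) by auto
  thus ?thesis unfolding E_def by auto
 qed
 have "of_bool (\<forall>k\<in>insert k0 K. P p k > 0) - of_bool (\<forall>k\<in>insert k0 K. P q k > 0) = - S (insert k0 K) p q"
 proof -
  consider "P p k0 > 0" "P q k0 > 0" | "P p k0 < 0" "P q k0 < 0"
   | "P p k0 < 0" "P q k0 > 0" | "P p k0 > 0" "P q k0 < 0"
   using nz[of k0] by fastforce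
  thus ?thesis
  proof cases
   case 1
   have "\<not> E (insert k0 K) p q k0" unfolding Ek0 using pos[OF _ _ 1] by (metis less_eq_real_def less_irrefl)
   moreover have "E (insert k0 K) p q k = E K p q k" if "k \<in> K" for k
    unfolding Ek[OF that] unfolding E_def using pos[OF _ _ 1] by (metis less_eq_real_def)
   ultimately have "S (insert k0 K) p q = S K p q" unfolding SI unfolding S_def by simp
   thus ?thesis using IH[of p q] nz insert.prems(1) 1 by simp
  next
   case 2
   have "\<not> E (insert k0 K) p q k0" unfolding Ek0 using neg[OF _ _ 2] by (metis less_eq_real_def less_irrefl)
   moreover have "\<not> E (insert k0 K) p q k" if "k \<in> K" for k
    unfolding Ek[OF that] using neg[OF _ _ 2] by (meson less_eq_real_def less_asym)
   ultimately have "S (insert k0 K) p q = 0" unfolding SI by simp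
   thus ?thesis using 2 by simp
  next
   case 3
   have b: "\<beta> k0 > 0"
   proof (rule ccontr)
    assume "\<not> \<beta> k0 > 0"
    hence "q * \<beta> k0 \<le> p * \<beta> k0" using insert.prems(1) by (simp add: mult_right_mono_neg)
    thus False using 3 unfolding P_def by linarith
   qed
   \<comment> \<open>The new constraint holds exactly beyond its zero \<open>r0\<close>. Events of
     the other constraints therefore count only between \<open>r0\<close> and \<open>q\<close>,
     where the induction hypothesis applies: no other constraint vanishes at \<open>r0\<close>. The
     event at \<open>r0\<close> supplies the missing boundary term.\<close>
   define r0 where "r0 = - \<alpha> k0 / \<beta> k0"
   have eq: "P r k0 = (r - r0) * \<beta> k0" for r unfolding P_def r0_def using b by (simp add: field_simps)
   have sg: "P r k0 > 0 \<longleftrightarrow> r > r0" "P r k0 = 0 \<longleftrightarrow> r = r0" "P r k0 < 0 \<longleftrightarrow> r < r0" for r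
    unfolding eq using b by (auto simp: zero_less_mult_iff mult_less_0_iff)
   have r0: "p < r0" "r0 < q" using 3 sg by auto
   have "E (insert k0 K) p q k0 \<longleftrightarrow> (\<forall>k\<in>K. P r0 k > 0)" unfolding Ek0 sg using r0 by blast
   moreover have "E (insert k0 K) p q k = E K r0 q k" if "k \<in> K" for k
    unfolding Ek[OF that] unfolding E_def sg using r0 by (meson less_trans)
   ultimately have "S (insert k0 K) p q = of_bool (\<forall>k\<in>K. P r0 k > 0) + S K r0 q"
    unfolding SI unfolding S_def using b by simp
   moreover have "of_bool (\<forall>k\<in>K. P r0 k > 0) - of_bool (\<forall>k\<in>K. P q k > 0) = - S K r0 q"
    by (rule IH) (use r0 dis sg nz in auto)
   ultimately show ?thesis using 3 by simp
  next
   case 4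
   have b: "\<beta> k0 < 0"
   proof (rule ccontr)
    assume "\<not> \<beta> k0 < 0"
    hence "p * \<beta> k0 \<le> q * \<beta> k0" using insert.prems(1) by (simp add: mult_right_mono)
    thus False using 4 unfolding P_def by linarith
   qed
   define r0 where "r0 = - \<alpha> k0 / \<beta> k0"
   have eq: "P r k0 = (r - r0) * \<beta> k0" for r unfolding P_def r0_def using b by (simp add: field_simps)
   have sg: "P r k0 > 0 \<longleftrightarrow> r < r0" "P r k0 = 0 \<longleftrightarrow> r = r0" "P r k0 < 0 \<longleftrightarrow> r0 < r" for r
    unfolding eq using b by (auto simp: zero_less_mult_iff mult_less_0_iff)
   have r0: "p < r0" "r0 < q" using 4 sg by auto
   have "E (insert k0 K) p q k0 \<longleftrightarrow> (\<forall>k\<in>K. P r0 k > 0)" unfolding Ek0 sg using r0 by blast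
   moreover have "E (insert k0 K) p q k = E K p r0 k" if "k \<in> K" for k
    unfolding Ek[OF that] unfolding E_def sg using r0 by (meson less_trans)
   ultimately have "S (insert k0 K) p q = - of_bool (\<forall>k\<in>K. P r0 k > 0) + S K p r0"
    unfolding SI unfolding S_def using b by simp
   moreover have "of_bool (\<forall>k\<in>K. P p k > 0) - of_bool (\<forall>k\<in>K. P r0 k > 0) = - S K p r0"
    by (rule IH) (use r0 dis sg nz in auto)
   ultimately show ?thesis using 4 by simp
  qed
 qed
 thus ?case unfolding P_def S_def E_def .
qed

lemma sum_PiE_split:
 fixes h :: "('i => 'c) => 'b::comm_monoid_add"
 assumes "j \<in> I"
 shows "(\<Sum>\<sigma>\<in>I \<rightarrow>\<^sub>E A. h \<sigma>) = (\<Sum>\<tau>\<in>(I - {j}) \<rightarrow>\<^sub>E A. \<Sum>c\<in>A. h (\<tau>(j := c)))"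
proof -
 have I: "I = insert j (I - {j})" using assms by auto
 have inj: "inj_on (\<lambda>(c, \<tau>). \<tau>(j := c)) (A \<times> ((I - {j}) \<rightarrow>\<^sub>E A))"
  using inj_combinator[of j "I - {j}" "\<lambda>_. A"] by simp
 have "(\<Sum>\<sigma>\<in>I \<rightarrow>\<^sub>E A. h \<sigma>) = (\<Sum>\<sigma>\<in>(\<lambda>(c, \<tau>). \<tau>(j := c)) ` (A \<times> ((I - {j}) \<rightarrow>\<^sub>E A)). h \<sigma>)"
  by (subst I, subst PiE_insert_eq) simp
 also have "\<dots> = (\<Sum>(c, \<tau>)\<in>A \<times> ((I - {j}) \<rightarrow>\<^sub>E A). h (\<tau>(j := c)))"
  by (subst sum.reindex[OF inj]) (simp add: comp_def case_prod_unfold)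
 also have "\<dots> = (\<Sum>c\<in>A. \<Sum>\<tau>\<in>(I - {j}) \<rightarrow>\<^sub>E A. h (\<tau>(j := c)))"
  by (rule sum.cartesian_product[symmetric])
 finally show ?thesis by (subst (asm) sum.swap)
qed

text \<open>The \<open>j\<close>-th parameter, with value \<open>D\<close> in cell \<open>c\<close>,
  contributes \<open>bs j c + D * col j c\<close>; \<open>lf\<close> and \<open>hf\<close> tell
  whether the cell has a lower and an upper bound. In \<open>balanced\<close> the function
  \<open>f\<close> tests points: with the indicator of a point, the columns of the cells ending
  there and of those starting there have the same sum. Thus cells are glued without naming
  vertices.\<close>

locale balanced_cells =
 fixes k :: nat and Cs :: "'c set" and bs col :: "nat => 'c => nat => real"
  and lf hf :: "'c => bool" and lo hi :: "'c => real"
 assumes finite_Cs: "finite Cs"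
  and lo_less_hi: "\<And>c. c \<in> Cs ==> lf c ==> hf c ==> lo c < hi c"
  and balanced: "\<And>j r f. j < k ==> r < k ==>
   (\<Sum>c | c \<in> Cs \<and> hf c. f (\<lambda>r. bs j c r + hi c * col j c r) * col j c r) =
   (\<Sum>c | c \<in> Cs \<and> lf c. f (\<lambda>r. bs j c r + lo c * col j c r) * col j c r :: real)"
begin

abbreviation "Fs \<equiv> {..<k} \<rightarrow>\<^sub>E Cs"

definition inb :: "'c => real => bool" where
 "inb c D \<longleftrightarrow> (lf c \<longrightarrow> lo c < D) \<and> (hf c \<longrightarrow> D < hi c)"

definition ends :: "'c => real set" where
 "ends c = {b. lf c \<and> b = lo c \<or> hf c \<and> b = hi c}"

definition cmat :: "(nat => 'c) => nat => nat => real" where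
 "cmat \<sigma> r j = col j (\<sigma> j) r"

definition solves :: "(nat => 'c) => (nat => real) => (nat => real) => bool" where
 "solves \<sigma> z D \<longleftrightarrow> (\<forall>r<k. (\<Sum>j<k. bs j (\<sigma> j) r + D j * col j (\<sigma> j) r) = z r)"

definition feas :: "(nat => 'c) => (nat => real) => bool" where
 "feas \<sigma> z \<longleftrightarrow> (\<exists>D. (\<forall>j<k. inb (\<sigma> j) (D j)) \<and> solves \<sigma> z D)"

definition count :: "(nat => real) => real" where
 "count z = (\<Sum>\<sigma>\<in>Fs. of_bool (feas \<sigma> z) * \<bar>dt k (cmat \<sigma>)\<bar>)"

lemma solves_cmat: "solves \<sigma> z D \<longleftrightarrow> (\<forall>r<k. (\<Sum>j<k. cmat \<sigma> r j * D j) = z r - (\<Sum>j<k. bs j (\<sigma> j) r))"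
 unfolding solves_def cmat_def by (simp add: sum.distrib algebra_simps eq_diff_eq)

lemma solves_unique:
 assumes "dt k (cmat \<sigma>) \<noteq> 0" "solves \<sigma> z D" "solves \<sigma> z D'" "j < k"
 shows "D j = D' j"
proof -
 obtain B where B: "\<And>x b j. (\<And>i. i < k ==> (\<Sum>j<k. cmat \<sigma> i j * x j) = b i) ==> j < k ==> x j = (\<Sum>r<k. B j r * b r)"
  by (rule dt_inverse[OF assms(1)]) blast
 show ?thesis
  using B[of D "\<lambda>r. z r - (\<Sum>j<k. bs j (\<sigma> j) r)" j] B[of D' "\<lambda>r. z r - (\<Sum>j<k. bs j (\<sigma> j) r)" j] assms
  unfolding solves_cmat by simp
qed

text \<open>No two bounds are attained simultaneously on the open segment from \<open>z\<close> to
 \<open>z + U w\<close>, and none at its endpoints.\<close>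

definition generic_segment :: "(nat => real) => (nat => real) => real => bool" where
 "generic_segment z w U \<longleftrightarrow> (\<forall>\<sigma>\<in>Fs. dt k (cmat \<sigma>) \<noteq> 0 \<longrightarrow> (\<exists>D v.
   solves \<sigma> z D \<and> (\<forall>r<k. (\<Sum>j<k. cmat \<sigma> r j * v j) = w r) \<and>
   (\<forall>j<k. D j \<notin> ends (\<sigma> j) \<and> D j + U * v j \<notin> ends (\<sigma> j)) \<and>
   (\<forall>r j j'. 0 < r \<longrightarrow> r < U \<longrightarrow> j < k \<longrightarrow> j' < k \<longrightarrow> j \<noteq> j' \<longrightarrow> D j + r * v j \<in> ends (\<sigma> j) \<longrightarrow> D j' + r * v j' \<notin> ends (\<sigma> j'))))"

text \<open>The contribution of the \<open>j\<close>-th parameter is frozen at the point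
  \<open>pt\<close>, and its cell is not mentioned. So walls belonging to different cells of
  \<open>j\<close> become the same condition whenever these cells meet.\<close>

definition hit :: "(nat => real) => (nat => real) => real => nat => (nat => 'c) => (nat => real) => bool" where
 "hit z w U j \<tau> pt \<longleftrightarrow> (\<exists>s D. 0 < s \<and> s < U \<and> (\<forall>j'<k. j' \<noteq> j \<longrightarrow> inb (\<tau> j') (D j')) \<and>
   (\<forall>r<k. pt r + (\<Sum>j'\<in>{..<k} - {j}. bs j' (\<tau> j') r + D j' * col j' (\<tau> j') r) = z r + s * w r))"

lemma hit_cong:
 assumes "\<And>j'. j' < k ==> j' \<noteq> j ==> \<tau> j' = \<tau>' j'"
 shows "hit z w U j \<tau> pt = hit z w U j \<tau>' pt"
proof -
 have "(\<Sum>j'\<in>{..<k} - {j}. bs j' (\<tau> j') r + D j' * col j' (\<tau> j') r)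
   = (\<Sum>j'\<in>{..<k} - {j}. bs j' (\<tau>' j') r + D j' * col j' (\<tau>' j') r)" for r D
  using assms by (intro sum.cong) auto
 moreover have "(\<forall>j'<k. j' \<noteq> j \<longrightarrow> inb (\<tau> j') (D j')) = (\<forall>j'<k. j' \<noteq> j \<longrightarrow> inb (\<tau>' j') (D j'))" for D
  using assms by metis
 ultimately show ?thesis unfolding hit_def by simp
qed

text \<open>While the right-hand side moves along the segment, the unique solution moves with
  constant velocity \<open>v\<close>. Feasibility is thus a conjunction of half-line constraints in
  the time, to which \<open>half_line_events\<close> applies, and each event is rewritten as a
  \<open>hit\<close>.\<close>

lemma feas_along_segment:
 assumes \<sigma>: "\<sigma> \<in> Fs" and nz: "dt k (cmat \<sigma>) \<noteq> 0" and U: "U > 0"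
  and gen: "generic_segment z w U"
 shows "(of_bool (feas \<sigma> z) - of_bool (feas \<sigma> (\<lambda>r. z r + U * w r))) * \<bar>dt k (cmat \<sigma>)\<bar>
   = (\<Sum>j<k. sgn (dt k (set_col (cmat \<sigma>) j w)) * dt k (cmat \<sigma>) *
     (of_bool (hf (\<sigma> j)) * of_bool (hit z w U j \<sigma> (\<lambda>r. bs j (\<sigma> j) r + hi (\<sigma> j) * col j (\<sigma> j) r))
     - of_bool (lf (\<sigma> j)) * of_bool (hit z w U j \<sigma> (\<lambda>r. bs j (\<sigma> j) r + lo (\<sigma> j) * col j (\<sigma> j) r))))"
proof -
 obtain D v where D: "solves \<sigma> z D" and v: "\<And>r. r < k ==> (\<Sum>j<k. cmat \<sigma> r j * v j) = w r"
  and e: "\<And>j. j < k ==> D j \<notin> ends (\<sigma> j)" "\<And>j. j < k ==> D j + U * v j \<notin> ends (\<sigma> j)"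
  and dis: "\<And>r j j'. 0 < r ==> r < U ==> j < k ==> j' < k ==> j \<noteq> j' ==> D j + r * v j \<in> ends (\<sigma> j) ==> D j' + r * v j' \<notin> ends (\<sigma> j')"
  using gen[unfolded generic_segment_def, rule_format, OF \<sigma> nz] by blast
 have sol: "solves \<sigma> (\<lambda>r. z r + s * w r) (\<lambda>j. D j + s * v j)" for s
 proof -
  have "(\<Sum>j<k. cmat \<sigma> r j * (D j + s * v j)) = (\<Sum>j<k. cmat \<sigma> r j * D j) + s * (\<Sum>j<k. cmat \<sigma> r j * v j)" for r
   by (simp add: sum.distrib sum_distrib_left algebra_simps)
  thus ?thesis using D v unfolding solves_cmat by simp
 qed
 have feas: "feas \<sigma> (\<lambda>r. z r + s * w r) \<longleftrightarrow> (\<forall>j<k. inb (\<sigma> j) (D j + s * v j))" for s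
  unfolding feas_def using sol solves_unique[OF nz _ sol] by (metis (no_types, lifting))
 have Cs: "\<sigma> j \<in> Cs" if "j < k" for j using \<sigma> that by auto
 \<comment> \<open>The constraints: \<open>(j, True)\<close> is the upper bound of the
   \<open>j\<close>-th parameter and \<open>(j, False)\<close> the lower one, whenever they
   exist.\<close>
 define K where "K = {(j, b). j < k \<and> (if b then hf (\<sigma> j) else lf (\<sigma> j))}"
 define \<alpha> where "\<alpha> = (\<lambda>(j, b). if b then hi (\<sigma> j) - D j else D j - lo (\<sigma> j))"
 define \<beta> where "\<beta> = (\<lambda>(j :: nat, b). if b then - v j else v j)"
 have finK: "finite K" by (rule finite_subset[of _ "{..<k} \<times> UNIV"]) (auto simp: K_def)
 have inb_K: "(\<forall>j<k. inb (\<sigma> j) (D j + s * v j)) \<longleftrightarrow> (\<forall>c\<in>K. \<alpha> c + s * \<beta> c > 0)" for s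
  unfolding K_def \<alpha>_def \<beta>_def inb_def by (auto split: if_splits simp: algebra_simps)
 have zero_K: "\<alpha> (j, b) + s * \<beta> (j, b) = 0 \<longleftrightarrow> D j + s * v j = (if b then hi (\<sigma> j) else lo (\<sigma> j))" for j b s
  by (auto simp: \<alpha>_def \<beta>_def algebra_simps)
 have ends_K: "D j + s * v j \<in> ends (\<sigma> j)" if "(j, b) \<in> K" "\<alpha> (j, b) + s * \<beta> (j, b) = 0" for j b s
  using that unfolding zero_K by (auto simp: K_def ends_def split: if_splits)
 have neK: "s1 = s2" if "(j, s1) \<in> K" "(j, s2) \<in> K" "\<alpha> (j, s1) + s * \<beta> (j, s1) = 0" "\<alpha> (j, s2) + s * \<beta> (j, s2) = 0" for j s1 s2 s
  using that lo_less_hi[OF Cs, of j] unfolding zero_K by (auto simp: K_def split: if_splits)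
 have ev: "(\<exists>s. 0 < s \<and> s < U \<and> \<alpha> c + s * \<beta> c = 0 \<and> (\<forall>c'\<in>K - {c}. \<alpha> c' + s * \<beta> c' > 0))
   \<longleftrightarrow> hit z w U j \<sigma> (\<lambda>r. bs j (\<sigma> j) r + (if b then hi (\<sigma> j) else lo (\<sigma> j)) * col j (\<sigma> j) r)"
  if c: "c \<in> K" "c = (j, b)" for c j b
 proof -
  let ?b = "if b then hi (\<sigma> j) else lo (\<sigma> j)"
  have j: "j < k" using c by (auto simp: K_def)
  have A: "(\<forall>c'\<in>K - {c}. \<alpha> c' + s * \<beta> c' > 0) \<longleftrightarrow> (\<forall>j'<k. j' \<noteq> j \<longrightarrow> inb (\<sigma> j') (D j' + s * v j'))"
   if s: "D j + s * v j = ?b" for s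
  proof
   assume *: "\<forall>c'\<in>K - {c}. \<alpha> c' + s * \<beta> c' > 0"
   show "\<forall>j'<k. j' \<noteq> j \<longrightarrow> inb (\<sigma> j') (D j' + s * v j')"
   proof (intro allI impI)
    fix j' assume j': "j' < k" "j' \<noteq> j"
    have "hf (\<sigma> j') ==> \<alpha> (j', True) + s * \<beta> (j', True) > 0" using *[rule_format, of "(j', True)"] j' c by (simp add: K_def)
    moreover have "lf (\<sigma> j') ==> \<alpha> (j', False) + s * \<beta> (j', False) > 0" using *[rule_format, of "(j', False)"] j' c by (simp add: K_def)
    ultimately show "inb (\<sigma> j') (D j' + s * v j')" unfolding inb_def \<alpha>_def \<beta>_def by auto
   qed
  next
   assume *: "\<forall>j'<k. j' \<noteq> j \<longrightarrow> inb (\<sigma> j') (D j' + s * v j')"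
   show "\<forall>c'\<in>K - {c}. \<alpha> c' + s * \<beta> c' > 0"
   proof
    fix c' assume c': "c' \<in> K - {c}"
    obtain j' b' where c'': "c' = (j', b')" by (metis surj_pair)
    show "\<alpha> c' + s * \<beta> c' > 0"
    proof (cases "j' = j")
     case True
     hence "b' = (\<not> b)" using c' c'' c by auto
     thus ?thesis using c' c'' c s True lo_less_hi[OF Cs, of j] j
      by (cases b) (auto simp: K_def \<alpha>_def \<beta>_def algebra_simps)
    next
     case False
     hence "inb (\<sigma> j') (D j' + s * v j')" using * c' c'' by (auto simp: K_def)
     thus ?thesis using c' c'' by (auto simp: K_def inb_def \<alpha>_def \<beta>_def split: if_splits)
    qed
   qed
  qed
  have sumj: "(\<Sum>j'<k. bs j' (\<sigma> j') r + D' j' * col j' (\<sigma> j') r) = bs j (\<sigma> j) r + D' j * col j (\<sigma> j) r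
    + (\<Sum>j'\<in>{..<k} - {j}. bs j' (\<sigma> j') r + D' j' * col j' (\<sigma> j') r)" for r D'
   using j by (subst sum.remove[of _ j]) auto
  show ?thesis
  proof
   assume "\<exists>s. 0 < s \<and> s < U \<and> \<alpha> c + s * \<beta> c = 0 \<and> (\<forall>c'\<in>K - {c}. \<alpha> c' + s * \<beta> c' > 0)"
   then obtain s where s: "0 < s" "s < U" "\<alpha> c + s * \<beta> c = 0" "\<forall>c'\<in>K - {c}. \<alpha> c' + s * \<beta> c' > 0" by blast
   have "D j + s * v j = ?b" using s(3) unfolding c(2) zero_K .
   thus "hit z w U j \<sigma> (\<lambda>r. bs j (\<sigma> j) r + ?b * col j (\<sigma> j) r)"
    unfolding hit_def using s A sol[of s] unfolding solves_def sumj
    by (intro exI[of _ s] exI[of _ "\<lambda>j. D j + s * v j"]) auto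
  next
   assume "hit z w U j \<sigma> (\<lambda>r. bs j (\<sigma> j) r + ?b * col j (\<sigma> j) r)"
   then obtain s D' where s: "0 < s" "s < U" and D': "\<forall>j'<k. j' \<noteq> j \<longrightarrow> inb (\<sigma> j') (D' j')"
    and eq: "\<forall>r<k. bs j (\<sigma> j) r + ?b * col j (\<sigma> j) r + (\<Sum>j'\<in>{..<k} - {j}. bs j' (\<sigma> j') r + D' j' * col j' (\<sigma> j') r) = z r + s * w r"
    unfolding hit_def by blast
   have "solves \<sigma> (\<lambda>r. z r + s * w r) (D'(j := ?b))"
    unfolding solves_def sumj using eq by simp
   hence DD: "(D'(j := ?b)) j' = D j' + s * v j'" if "j' < k" for j'
    using solves_unique[OF nz _ sol that] by blast
   have b: "D j + s * v j = ?b" using DD[OF j] by simp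
   have "\<forall>j'<k. j' \<noteq> j \<longrightarrow> inb (\<sigma> j') (D j' + s * v j')" using D' DD by (metis fun_upd_other)
   hence "\<forall>c'\<in>K - {c}. \<alpha> c' + s * \<beta> c' > 0" using A[OF b] by blast
   moreover have "\<alpha> c + s * \<beta> c = 0" unfolding c(2) zero_K using b .
   ultimately show "\<exists>s. 0 < s \<and> s < U \<and> \<alpha> c + s * \<beta> c = 0 \<and> (\<forall>c'\<in>K - {c}. \<alpha> c' + s * \<beta> c' > 0)"
    using s by blast
  qed
 qed
 have H: "of_bool (\<forall>c\<in>K. \<alpha> c + 0 * \<beta> c > 0) - of_bool (\<forall>c\<in>K. \<alpha> c + U * \<beta> c > 0)
    = - (\<Sum>c\<in>K. sgn (\<beta> c) * of_bool (\<exists>r. 0 < r \<and> r < U \<and> \<alpha> c + r * \<beta> c = 0 \<and> (\<forall>c'\<in>K - {c}. \<alpha> c' + r * \<beta> c' > 0)))"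
 proof (rule half_line_events[OF finK U])
  show "\<alpha> c + 0 * \<beta> c \<noteq> 0" if "c \<in> K" for c
  proof
   obtain j b where c: "c = (j, b)" by (metis surj_pair)
   assume "\<alpha> c + 0 * \<beta> c = 0"
   hence "D j + 0 * v j \<in> ends (\<sigma> j)" using ends_K that c by blast
   moreover have "j < k" using that c by (auto simp: K_def)
   ultimately show False using e(1) by simp
  qed
  show "\<alpha> c + U * \<beta> c \<noteq> 0" if "c \<in> K" for c
  proof
   obtain j b where c: "c = (j, b)" by (metis surj_pair)
   assume "\<alpha> c + U * \<beta> c = 0"
   hence "D j + U * v j \<in> ends (\<sigma> j)" using ends_K that c by blast
   moreover have "j < k" using that c by (auto simp: K_def)
   ultimately show False using e(2) by simp
  qed
  show "\<alpha> c' + r * \<beta> c' \<noteq> 0"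
   if r: "0 < r" "r < U" "c \<in> K" "c' \<in> K" "c \<noteq> c'" "\<alpha> c + r * \<beta> c = 0" for r c c'
  proof
   assume r': "\<alpha> c' + r * \<beta> c' = 0"
   obtain j b j' b' where c: "c = (j, b)" "c' = (j', b')" by (metis surj_pair)
   have "j \<noteq> j'" using neK r r' c by blast
   moreover have "D j + r * v j \<in> ends (\<sigma> j)" "D j' + r * v j' \<in> ends (\<sigma> j')"
    using ends_K r r' c by blast+
   moreover have "j < k" "j' < k" using r c by (auto simp: K_def)
   ultimately show False using dis[of r j j'] r by blast
  qed
 qed
 define ee where "ee j b \<longleftrightarrow> hit z w U j \<sigma> (\<lambda>r. bs j (\<sigma> j) r + (if b then hi (\<sigma> j) else lo (\<sigma> j)) * col j (\<sigma> j) r)" for j b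
 have "(\<Sum>c\<in>K. sgn (\<beta> c) * of_bool (\<exists>r. 0 < r \<and> r < U \<and> \<alpha> c + r * \<beta> c = 0 \<and> (\<forall>c'\<in>K - {c}. \<alpha> c' + r * \<beta> c' > 0)))
   = (\<Sum>(j, b)\<in>K. sgn (\<beta> (j, b)) * of_bool (ee j b))"
 proof (rule sum.cong[OF refl])
  fix c assume c: "c \<in> K"
  obtain j b where jb: "c = (j, b)" by (metis surj_pair)
  show "sgn (\<beta> c) * of_bool (\<exists>r. 0 < r \<and> r < U \<and> \<alpha> c + r * \<beta> c = 0 \<and> (\<forall>c'\<in>K - {c}. \<alpha> c' + r * \<beta> c' > 0))
   = (case c of (j, b) => sgn (\<beta> (j, b)) * of_bool (ee j b))"
   unfolding ev[OF c jb] unfolding jb ee_def by simp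
 qed
 also have "\<dots> = (\<Sum>(j, b)\<in>{..<k} \<times> {True, False}. of_bool (if b then hf (\<sigma> j) else lf (\<sigma> j)) * (sgn (\<beta> (j, b)) * of_bool (ee j b)))"
  by (rule sum.mono_neutral_cong_left) (auto simp: K_def)
 also have "\<dots> = (\<Sum>j<k. \<Sum>b\<in>{True, False}. of_bool (if b then hf (\<sigma> j) else lf (\<sigma> j)) * (sgn (\<beta> (j, b)) * of_bool (ee j b)))"
  by (rule sum.cartesian_product[symmetric])
 also have "\<dots> = (\<Sum>j<k. - sgn (v j) * (of_bool (hf (\<sigma> j)) * of_bool (ee j True) - of_bool (lf (\<sigma> j)) * of_bool (ee j False)))"
  by (intro sum.cong) (auto simp: \<beta>_def)
 finally have H2: "of_bool (feas \<sigma> z) - of_bool (feas \<sigma> (\<lambda>r. z r + U * w r))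
   = (\<Sum>j<k. sgn (v j) * (of_bool (hf (\<sigma> j)) * of_bool (ee j True) - of_bool (lf (\<sigma> j)) * of_bool (ee j False)))"
  using H feas[of 0] feas[of U] inb_K[of 0] inb_K[of U] by (simp add: sum_negf)
 \<comment> \<open>Here the absolute value disappears: by Cramer's rule the sign of
   \<open>v j\<close> is the quotient of two signs, one of which combines with the absolute
   determinant. What remains is linear in column \<open>j\<close> up to a sign in which that column
   is replaced by \<open>w\<close>.\<close>
 have sg: "sgn (v j) * \<bar>dt k (cmat \<sigma>)\<bar> = sgn (dt k (set_col (cmat \<sigma>) j w)) * dt k (cmat \<sigma>)" if "j < k" for j
 proof -
  have "dt k (set_col (cmat \<sigma>) j w) = v j * dt k (cmat \<sigma>)" by (rule dt_cramer) (use that v in auto)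
  thus ?thesis by (simp add: sgn_mult abs_sgn mult_ac)
 qed
 show ?thesis
  unfolding H2 sum_distrib_right
 proof (rule sum.cong[OF refl])
  fix j assume "j \<in> {..<k}"
  hence *: "sgn (v j) * x * \<bar>dt k (cmat \<sigma>)\<bar> = sgn (dt k (set_col (cmat \<sigma>) j w)) * dt k (cmat \<sigma>) * x" for x
   using sg[of j] by (simp add: mult_ac)
  thus "sgn (v j) * (of_bool (hf (\<sigma> j)) * of_bool (ee j True) - of_bool (lf (\<sigma> j)) * of_bool (ee j False)) * \<bar>dt k (cmat \<sigma>)\<bar>
   = sgn (dt k (set_col (cmat \<sigma>) j w)) * dt k (cmat \<sigma>) *
     (of_bool (hf (\<sigma> j)) * of_bool (hit z w U j \<sigma> (\<lambda>r. bs j (\<sigma> j) r + hi (\<sigma> j) * col j (\<sigma> j) r))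
     - of_bool (lf (\<sigma> j)) * of_bool (hit z w U j \<sigma> (\<lambda>r. bs j (\<sigma> j) r + lo (\<sigma> j) * col j (\<sigma> j) r)))"
   unfolding ee_def * by (simp only: if_True if_False)
 qed
qed

text \<open>The walls hit by the \<open>j\<close>-th parameter are grouped by the position of the remaining
 parameters and by the point at which the cells meet; balancing makes each group cancel.\<close>

theorem count_along_segment:
 assumes U: "U > 0" and gen: "generic_segment z w U"
 shows "count z = count (\<lambda>r. z r + U * w r)"
proof -
 define T where "T j \<sigma> c =
   of_bool (hf c) * of_bool (hit z w U j \<sigma> (\<lambda>r. bs j c r + hi c * col j c r))
  - (of_bool (lf c) * of_bool (hit z w U j \<sigma> (\<lambda>r. bs j c r + lo c * col j c r)) :: real)" for j \<sigma> c
 define g where "g j \<sigma> = sgn (dt k (set_col (cmat \<sigma>) j w)) * dt k (cmat \<sigma>) * T j \<sigma> (\<sigma> j)" for j \<sigma>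
 have "count z - count (\<lambda>r. z r + U * w r)
   = (\<Sum>\<sigma>\<in>Fs. (of_bool (feas \<sigma> z) - of_bool (feas \<sigma> (\<lambda>r. z r + U * w r))) * \<bar>dt k (cmat \<sigma>)\<bar>)"
  unfolding count_def by (simp add: sum_subtractf algebra_simps)
 also have "\<dots> = (\<Sum>\<sigma>\<in>Fs. \<Sum>j<k. g j \<sigma>)"
 proof (rule sum.cong[OF refl])
  fix \<sigma> assume "\<sigma> \<in> Fs"
  thus "(of_bool (feas \<sigma> z) - of_bool (feas \<sigma> (\<lambda>r. z r + U * w r))) * \<bar>dt k (cmat \<sigma>)\<bar> = (\<Sum>j<k. g j \<sigma>)"
   using feas_along_segment[OF _ _ U gen, of \<sigma>] by (cases "dt k (cmat \<sigma>) = 0") (auto simp: g_def T_def)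
 qed
 also have "\<dots> = (\<Sum>j<k. \<Sum>\<sigma>\<in>Fs. g j \<sigma>)" by (rule sum.swap)
 also have "\<dots> = 0"
 proof (rule sum.neutral, rule ballI)
  fix j assume "j \<in> {..<k}"
  hence j: "j < k" by simp
  have "(\<Sum>c\<in>Cs. g j (\<tau>(j := c))) = 0" for \<tau>
  proof -
   \<comment> \<open>As \<open>w\<close> overwrites column \<open>j\<close>, this sign is common to
     all cells \<open>c\<close> of the \<open>j\<close>-th parameter.\<close>
   define W where "W = sgn (dt k (set_col (cmat \<tau>) j w))"
   define fh where "fh pt = (of_bool (hit z w U j \<tau> pt) :: real)" for pt
   have W: "sgn (dt k (set_col (cmat (\<tau>(j := c))) j w)) = W" for c
    unfolding W_def by (intro arg_cong[of _ _ sgn] dt_cong) (simp add: cmat_def)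
   have dtc: "dt k (cmat (\<tau>(j := c))) = dt k (set_col (cmat \<tau>) j (col j c))" for c
    by (rule dt_cong) (simp add: cmat_def)
   have T: "T j (\<tau>(j := c)) c = of_bool (hf c) * fh (\<lambda>r. bs j c r + hi c * col j c r)
     - of_bool (lf c) * fh (\<lambda>r. bs j c r + lo c * col j c r)" for c
    unfolding T_def fh_def by (simp add: hit_cong[of j "\<tau>(j := c)" \<tau>])
   have "(\<Sum>c\<in>Cs. g j (\<tau>(j := c))) = W * (\<Sum>c\<in>Cs. (of_bool (hf c) * fh (\<lambda>r. bs j c r + hi c * col j c r)
     - of_bool (lf c) * fh (\<lambda>r. bs j c r + lo c * col j c r)) * dt k (set_col (cmat \<tau>) j (col j c)))"
    unfolding g_def W dtc fun_upd_same T by (simp add: sum_distrib_left mult_ac)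
   \<comment> \<open>Linearity in column \<open>j\<close> moves the sum over the cells inside the
     determinant, where balancing with the test function \<open>fh\<close> makes the column
     vanish.\<close>
   also have "\<dots> = W * dt k (set_col (cmat \<tau>) j (\<lambda>r. \<Sum>c\<in>Cs. (of_bool (hf c) * fh (\<lambda>r. bs j c r + hi c * col j c r)
     - of_bool (lf c) * fh (\<lambda>r. bs j c r + lo c * col j c r)) * col j c r))"
    by (subst dt_set_col_sum[OF j]) simp
   also have "dt k (set_col (cmat \<tau>) j (\<lambda>r. \<Sum>c\<in>Cs. (of_bool (hf c) * fh (\<lambda>r. bs j c r + hi c * col j c r)
     - of_bool (lf c) * fh (\<lambda>r. bs j c r + lo c * col j c r)) * col j c r)) = dt k (set_col (cmat \<tau>) j (\<lambda>r. 0))"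
   proof (rule dt_cong)
    fix r i :: nat assume r: "r < k"
    have hs: "(\<Sum>c\<in>Cs. of_bool (P c) * F c) = (\<Sum>c | c \<in> Cs \<and> P c. F c)" for P and F :: "'c => real"
     using finite_Cs by (intro sum.mono_neutral_cong_right) auto
    have "(\<Sum>c\<in>Cs. (of_bool (hf c) * fh (\<lambda>r. bs j c r + hi c * col j c r) - of_bool (lf c) * fh (\<lambda>r. bs j c r + lo c * col j c r)) * col j c r)
     = (\<Sum>c\<in>Cs. of_bool (hf c) * (fh (\<lambda>r. bs j c r + hi c * col j c r) * col j c r))
     - (\<Sum>c\<in>Cs. of_bool (lf c) * (fh (\<lambda>r. bs j c r + lo c * col j c r) * col j c r))"
     by (simp add: sum_subtractf algebra_simps)
    also have "\<dots> = 0" unfolding hs using balanced[OF j r, of fh] by simp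
    finally show "set_col (cmat \<tau>) j (\<lambda>r. \<Sum>c\<in>Cs. (of_bool (hf c) * fh (\<lambda>r. bs j c r + hi c * col j c r)
     - of_bool (lf c) * fh (\<lambda>r. bs j c r + lo c * col j c r)) * col j c r) r i = set_col (cmat \<tau>) j (\<lambda>r. 0) r i" by simp
   qed
   also have "\<dots> = 0" by (rule dt_set_col_zero[OF j])
   finally show ?thesis unfolding mult_zero_right .
  qed
  thus "(\<Sum>\<sigma>\<in>Fs. g j \<sigma>) = 0" by (subst sum_PiE_split[of j]) (use j in auto)
 qed
 finally show ?thesis by simp
qed

end

section \<open>Curves over the star\<close>

text \<open>It locates the leg in line with the centre of a star: the number of legs to the left of
  the centre is prescribed by the number of ends of direction \<open>(1, 0)\<close>.\<close>

lemma ex1_rank: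
 fixes Y :: "nat set"
 assumes "finite Y" "r < card Y"
 shows "\<exists>!e. e \<in> Y \<and> card {y \<in> Y. e < y} = r"
proof -
 have inj: "inj_on (\<lambda>e. card {y \<in> Y. e < y}) Y"
 proof (rule inj_onI)
  have *: "card {y \<in> Y. e' < y} < card {y \<in> Y. e < y}" if "e' \<in> Y" "e < e'" for e e'
   by (rule psubset_card_mono) (use that assms in auto)
  fix e e' assume "e \<in> Y" "e' \<in> Y" "card {y \<in> Y. e < y} = card {y \<in> Y. e' < y}"
  thus "e = e'" using *[of e e'] *[of e' e] by (cases e e' rule: linorder_cases) auto
 qed
 have sub: "(\<lambda>e. card {y \<in> Y. e < y}) ` Y \<subseteq> {..<card Y}"
 proof clarsimp
  fix e assume "e \<in> Y"
  thus "card {y \<in> Y. e < y} < card Y" by (intro psubset_card_mono) (use assms in auto)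
 qed
 have "(\<lambda>e. card {y \<in> Y. e < y}) ` Y = {..<card Y}"
  by (rule card_subset_eq) (use sub card_image[OF inj] in auto)
 hence "r \<in> (\<lambda>e. card {y \<in> Y. e < y}) ` Y" using assms(2) by simp
 thus ?thesis using inj by (auto dest: inj_onD)
qed

lemma card_bijections:
 assumes "finite J" "finite L" "card J = card L"
 shows "card {f \<in> extensional J. bij_betw f J L} = fact (card L)"
proof -
 have "{f \<in> extensional J. bij_betw f J L} = {f \<in> J \<rightarrow>\<^sub>E L. inj_on f J}"
 proof (intro equalityI subsetI)
  fix f assume "f \<in> {f \<in> J \<rightarrow>\<^sub>E L. inj_on f J}"
  hence f: "f \<in> J \<rightarrow>\<^sub>E L" "inj_on f J" by auto
  hence "f ` J = L" using assms by (intro card_subset_eq) (auto simp: card_image)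
  thus "f \<in> {f \<in> extensional J. bij_betw f J L}" using f by (auto simp: bij_betw_def PiE_def)
 qed (auto simp: bij_betw_def PiE_def)
 thus ?thesis
  using card_inj_on_subset_funcset[of J L J] assms by (simp add: fact_prod_rev)
qed

lemma card_fibrewise_bijections:
 fixes J :: "'t => 'j set"
 assumes fin: "finite T" "\<And>t. t \<in> T ==> finite (J t)" "\<And>t. t \<in> T ==> finite (L t)"
  and card: "\<And>t. t \<in> T ==> card (J t) = card (L t)"
  and disj: "\<And>t t'. t \<in> T ==> t' \<in> T ==> t \<noteq> t' ==> J t \<inter> J t' = {}"
 shows "card {s \<in> extensional (\<Union>t\<in>T. J t). \<forall>t\<in>T. bij_betw s (J t) (L t)} = (\<Prod>t\<in>T. fact (card (L t)))"
proof -
 let ?S = "{s \<in> extensional (\<Union>t\<in>T. J t). \<forall>t\<in>T. bij_betw s (J t) (L t)}"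
 let ?P = "\<Pi>\<^sub>E t\<in>T. {f \<in> extensional (J t). bij_betw f (J t) (L t)}"
 have "bij_betw (\<lambda>s. \<lambda>t\<in>T. restrict s (J t)) ?S ?P"
 proof -
  have 1: "inj_on (\<lambda>s. \<lambda>t\<in>T. restrict s (J t)) ?S"
  proof (rule inj_onI)
   fix s s' assume s: "s \<in> ?S" "s' \<in> ?S" and eq: "(\<lambda>t\<in>T. restrict s (J t)) = (\<lambda>t\<in>T. restrict s' (J t))"
   show "s = s'"
   proof (rule extensionalityI)
    show "s \<in> extensional (\<Union>t\<in>T. J t)" "s' \<in> extensional (\<Union>t\<in>T. J t)" using s by auto
    fix j assume "j \<in> (\<Union>t\<in>T. J t)"
    then obtain t where t: "t \<in> T" "j \<in> J t" by blast
    show "s j = s' j" using fun_cong[OF fun_cong[OF eq, of t], of j] t by simp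
   qed
  qed
  have 2: "g \<in> ?P" if g: "g \<in> (\<lambda>s. \<lambda>t\<in>T. restrict s (J t)) ` ?S" for g
  proof -
   obtain s where s: "s \<in> ?S" "g = (\<lambda>t\<in>T. restrict s (J t))" using g by blast
   have "bij_betw (restrict s (J t)) (J t) (L t)" if "t \<in> T" for t
    using s(1) that by (auto simp: bij_betw_def inj_on_def)
   thus ?thesis unfolding s(2) by auto
  qed
  have 3: "g \<in> (\<lambda>s. \<lambda>t\<in>T. restrict s (J t)) ` ?S" if g: "g \<in> ?P" for g
  proof -
   define s where "s j = (if j \<in> (\<Union>t\<in>T. J t) then g (THE t. t \<in> T \<and> j \<in> J t) j else undefined)" for j
   have s: "s j = g t j" if "t \<in> T" "j \<in> J t" for t j
   proof -
    have "(THE t. t \<in> T \<and> j \<in> J t) = t" by (rule the_equality) (use that disj in blast)+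
    thus ?thesis using that unfolding s_def by auto
   qed
   have gt: "g t \<in> extensional (J t)" "bij_betw (g t) (J t) (L t)" if "t \<in> T" for t
    using g that by (auto simp: PiE_def Pi_def)
   have r: "restrict s (J t) = g t" if "t \<in> T" for t
    by (rule extensionalityI[of _ "J t"]) (use that s gt in auto)
   have "bij_betw s (J t) (L t)" if "t \<in> T" for t
    using gt(2)[OF that] s[OF that] by (subst bij_betw_cong[where g = "g t"]) auto
   moreover have "s \<in> extensional (\<Union>t\<in>T. J t)" unfolding s_def extensional_def by auto
   moreover have "g = (\<lambda>t\<in>T. restrict s (J t))"
    by (rule extensionalityI[of _ T]) (use g r in \<open>auto simp: PiE_def\<close>)
   ultimately show ?thesis by blast
  qed
  show ?thesis
  proof (rule bij_betw_imageI[OF 1], rule equalityI)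
   show "(\<lambda>s. \<lambda>t\<in>T. restrict s (J t)) ` ?S \<subseteq> ?P" using 2 by (rule subsetI)
   show "?P \<subseteq> (\<lambda>s. \<lambda>t\<in>T. restrict s (J t)) ` ?S" using 3 by (rule subsetI)
  qed
 qed
 hence "card ?S = card ?P" by (rule bij_betw_same_card)
 also have "\<dots> = (\<Prod>t\<in>T. card {f \<in> extensional (J t). bij_betw f (J t) (L t)})"
  by (rule card_PiE[OF fin(1)])
 also have "\<dots> = (\<Prod>t\<in>T. fact (card (L t)))"
  by (rule prod.cong[OF refl], rule card_bijections) (use fin card in auto)
 finally show ?thesis .
qed

text \<open>\<open>leg_x\<close> and \<open>leg_y\<close> are the coordinates of \<open>mu j\<close>
  times the ray generator number \<open>ty j\<close>.\<close>

definition leg_x :: "(nat => nat) => (nat => real) => nat => real" where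
 "leg_x ty mu j = (if ty j = 1 then - mu j else if ty j = 3 then mu j else 0)"

definition leg_y :: "nat => (nat => nat) => (nat => real) => nat => real" where
 "leg_y a ty mu j = (if ty j = 1 then real a * mu j else if ty j = 2 then mu j else if ty j = 4 then - mu j else 0)"

text \<open>The marked points are attached to a single vertex at \<open>(cx, cy)\<close>, and \<open>s j\<close> is the marked point
 on whose leg the \<open>j\<close>-th end sits, at distance \<open>V j\<close> from the vertex. The positions
 \<open>(X i, Y i)\<close> are chosen such that the solutions can be listed.\<close>

locale star =
 fixes a n :: nat and ty :: "nat => nat" and mu :: "nat => real"
  and X Y :: "nat => real" and A C :: "nat set"
 assumes a: "a \<ge> 1" and n: "n \<ge> 3"
  and ty: "\<And>j. j < 2 * (n - 1) ==> ty j \<in> {1, 2, 3, 4}" and mu: "\<And>j. j < 2 * (n - 1) ==> mu j > 0"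
  and AC: "A \<inter> C = {}" "A \<union> C = {2..n}"
  and cardA: "card A = min (card {j. j < 2 * (n - 1) \<and> ty j = 4}) (n - 1)"
  and XA: "\<And>i. i \<in> A ==> Y i < 0" and XC: "\<And>i. i \<in> C ==> Y i > 0" "\<And>i. i \<in> C ==> real a * X i + Y i > 0"
  and X1: "X 1 = 0" "Y 1 = 0"
  and Xdec: "\<And>i i'. 1 \<le> i ==> i < i' ==> i' \<le> n ==> X i' < X i"
begin

definition "k = 2 * (n - 1)"
definition "J t = {j. j < k \<and> ty j = t}"
abbreviation "dx \<equiv> leg_x ty mu"
abbreviation "dy \<equiv> leg_y a ty mu"

text \<open>An end on the leg of the first marked point displaces all differences to that point,
  hence its full column; an end on another leg occurs only in the two rows of that leg. The
  parameter of an end on the first leg is minus its distance from the vertex.\<close>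

definition smat :: "(nat => nat) => nat => nat => real" where
 "smat s r j = (if s j = 1 \<or> r div 2 + 2 = s j then if even r then dx j else dy j else 0)"

definition svalid :: "(nat => nat) => bool" where
 "svalid s \<longleftrightarrow> (\<exists>V cx cy. (\<forall>j<k. V j > 0) \<and>
   (\<forall>i\<in>{1..n}. (\<Sum>j | j < k \<and> s j = i. dx j * V j) = X i - cx \<and> (\<Sum>j | j < k \<and> s j = i. dy j * V j) = Y i - cy))"

definition types :: "(nat => nat) => nat => nat set" where
 "types s i = {ty j | j. j < k \<and> s j = i}"

lemma finite_J [simp]: "finite (J t)" by (simp add: J_def)

lemma Xneg: "i \<in> {2..n} ==> X i < 0" using Xdec[of 1 i] X1 by auto

text \<open>A linear relation among the directions on one leg, extended by zero to the other ends,
  is a kernel vector of \<open>smat s\<close>. So the ends on a leg have linearly independent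
  directions.\<close>

lemma leg_independent:
 assumes nz: "dt k (smat s) \<noteq> 0"
  and sums: "(\<Sum>j | j < k \<and> s j = i. dx j * v j) = 0" "(\<Sum>j | j < k \<and> s j = i. dy j * v j) = 0"
  and j: "j < k" "s j = i"
 shows "v j = 0"
proof (rule ccontr)
 assume vj: "v j \<noteq> 0"
 define v' where "v' j = (if s j = i then v j else 0)" for j
 have "(\<Sum>j<k. smat s r j * v' j) = 0" for r
 proof -
  let ?d = "if even r then dx else dy"
  have "(\<Sum>j<k. smat s r j * v' j) = (\<Sum>j | j < k \<and> s j = i. (if i = 1 \<or> r div 2 + 2 = i then 1 else 0) * (?d j * v j))"
   by (rule sum.mono_neutral_cong_right) (auto simp: v'_def smat_def)
  also have "\<dots> = 0" unfolding sum_distrib_left[symmetric] by (cases "even r") (simp_all add: sums)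
  finally show ?thesis .
 qed
 hence "dt k (smat s) = 0" using dt_zero_if_kernel[of j k v'] j vj by (auto simp: v'_def)
 thus False using nz by simp
qed

lemma sum_two:
 assumes "j < k" "s j = i" "j' < k" "s j' = i" "j \<noteq> j'"
 shows "(\<Sum>l | l < k \<and> s l = i. d l * (if l = j then p else if l = j' then q else 0)) = d j * p + d j' * (q :: real)"
proof -
 have "(\<Sum>l | l < k \<and> s l = i. d l * (if l = j then p else if l = j' then q else 0))
   = (\<Sum>l\<in>{j, j'}. d l * (if l = j then p else if l = j' then q else 0))"
  by (rule sum.mono_neutral_right) (use assms in auto)
 thus ?thesis using assms(5) by simp
qed

lemma sum_three:
 assumes "j < k" "s j = i" "j' < k" "s j' = i" "j'' < k" "s j'' = i" "j \<noteq> j'" "j \<noteq> j''" "j' \<noteq> j''"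
 shows "(\<Sum>l | l < k \<and> s l = i. d l * (if l = j then p else if l = j' then q else if l = j'' then u else 0)) = d j * p + d j' * q + d j'' * (u :: real)"
proof -
 have "(\<Sum>l | l < k \<and> s l = i. d l * (if l = j then p else if l = j' then q else if l = j'' then u else 0))
   = (\<Sum>l\<in>{j, j', j''}. d l * (if l = j then p else if l = j' then q else if l = j'' then u else 0))"
  by (rule sum.mono_neutral_right) (use assms in auto)
 thus ?thesis using assms(7-9) by simp
qed

lemma types_inj:
 assumes nz: "dt k (smat s) \<noteq> 0" and "j < k" "j' < k" "s j = s j'" "ty j = ty j'"
 shows "j = j'"
proof (rule ccontr)
 assume ne: "j \<noteq> j'"
 have "(if j = j then mu j' else if j = j' then - mu j else 0) = 0"
  by (rule leg_independent[OF nz, where v = "\<lambda>l. if l = j then mu j' else if l = j' then - mu j else 0" and i = "s j"])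
    (use assms ne in \<open>auto simp: sum_two leg_x_def leg_y_def\<close>)
 thus False using mu[of j'] assms(3) by (simp add: k_def)
qed

lemma types_not_24:
 assumes nz: "dt k (smat s) \<noteq> 0"
 shows "\<not> (2 \<in> types s i \<and> 4 \<in> types s i)"
proof
 assume "2 \<in> types s i \<and> 4 \<in> types s i"
 then obtain j j' where j: "j < k" "s j = i" "ty j = 2" "j' < k" "s j' = i" "ty j' = 4" unfolding types_def by fastforce
 hence ne: "j \<noteq> j'" by auto
 have "(if j = j then mu j' else if j = j' then mu j else 0) = 0"
  by (rule leg_independent[OF nz, where v = "\<lambda>l. if l = j then mu j' else if l = j' then mu j else 0" and i = i])
    (use j ne in \<open>auto simp: sum_two leg_x_def leg_y_def\<close>)
 thus False using mu[of j'] j by (simp add: k_def)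
qed

lemma types_not_three:
 assumes nz: "dt k (smat s) \<noteq> 0" and t: "t = 2 \<or> t = 4"
 shows "\<not> (1 \<in> types s i \<and> 3 \<in> types s i \<and> t \<in> types s i)"
proof
 assume "1 \<in> types s i \<and> 3 \<in> types s i \<and> t \<in> types s i"
 then obtain j j' j'' where j: "j < k" "s j = i" "ty j = 1" "j' < k" "s j' = i" "ty j' = 3" "j'' < k" "s j'' = i" "ty j'' = t"
  unfolding types_def by fastforce
 hence ne: "j \<noteq> j'" "j \<noteq> j''" "j' \<noteq> j''" using t by auto
 \<comment> \<open>\<open>(-1, a) + (1, 0) = (0, a)\<close> is cancelled by this multiple of the
   vertical direction.\<close>
 define u where "u = (if t = 2 then - real a / mu j'' else real a / mu j'')"
 have m: "mu j > 0" "mu j' > 0" "mu j'' > 0" using mu j by (auto simp: k_def)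
 let ?v = "\<lambda>l. if l = j then 1 / mu j else if l = j' then 1 / mu j' else if l = j'' then u else 0"
 have "?v j = 0"
 proof (rule leg_independent[OF nz, where v = ?v and i = i])
  show "(\<Sum>l | l < k \<and> s l = i. dx l * ?v l) = 0" "(\<Sum>l | l < k \<and> s l = i. dy l * ?v l) = 0"
   unfolding sum_three[where s = s and i = i, OF j(1,2,4,5,7,8) ne]
   using j ne m t by (auto simp: leg_x_def leg_y_def u_def)
 qed (use j in auto)
 thus False using m by simp
qed

lemma finite_types [simp]: "finite (types s i)"
proof -
 have "types s i = ty ` {j. j < k \<and> s j = i}" by (auto simp: types_def)
 thus ?thesis by simp
qed

lemma types_subset: "types s i \<subseteq> {1, 2, 3, 4}"
 unfolding types_def using ty by (auto simp: k_def)

lemma card_types: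
 assumes nz: "dt k (smat s) \<noteq> 0"
 shows "card (types s i) = card {j. j < k \<and> s j = i}"
proof -
 have "types s i = ty ` {j. j < k \<and> s j = i}" by (auto simp: types_def)
 moreover have "inj_on ty {j. j < k \<and> s j = i}" using types_inj[OF nz] by (auto simp: inj_on_def)
 ultimately show ?thesis by (simp add: card_image)
qed

lemma card_types_le:
 assumes nz: "dt k (smat s) \<noteq> 0"
 shows "card (types s i) \<le> 2"
proof -
 have "types s i \<subseteq> {1, 3} \<or> types s i \<subseteq> {1, 2} \<or> types s i \<subseteq> {1, 4} \<or> types s i \<subseteq> {3, 2} \<or> types s i \<subseteq> {3, 4}"
  using types_not_24[OF nz, of i] types_subset[of s i] types_not_three[OF nz, of 2 i] types_not_three[OF nz, of 4 i] by blast
 moreover have "card (types s i) \<le> 2" if "types s i \<subseteq> {x, y}" for x y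
  by (rule order.trans[OF card_mono[OF _ that]]) (auto simp: card_insert_if)
 ultimately show ?thesis by blast
qed

text \<open>By independence a leg carries at most two ends, and \<open>2 * (n - 1)\<close> ends are
  spread over \<open>n\<close> legs. The total deficit is two: some leg is empty, or two legs carry
  exactly one end each.\<close>

lemma deficits:
 assumes nz: "dt k (smat s) \<noteq> 0" and s: "s \<in> {..<k} \<rightarrow>\<^sub>E {1..n}"
 obtains i where "i \<in> {1..n}" "types s i = {}"
  | i i' where "i \<in> {1..n}" "i' \<in> {1..n}" "i < i'" "card (types s i) = 1" "card (types s i') = 1"
proof -
 have "(\<Sum>i\<in>{1..n}. card {j. j < k \<and> s j = i}) = card (\<Union>i\<in>{1..n}. {j. j < k \<and> s j = i})"
  by (subst card_UN_disjoint) auto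
 also have "(\<Union>i\<in>{1..n}. {j. j < k \<and> s j = i}) = {..<k}" using s by auto
 finally have sum: "(\<Sum>i\<in>{1..n}. card (types s i)) = 2 * (n - 1)"
  using card_types[OF nz] by (simp add: k_def)
 show ?thesis
 proof (cases "\<exists>i\<in>{1..n}. types s i = {}")
  case True
  thus ?thesis using that by blast
 next
  case False
  hence pos: "card (types s i) \<noteq> 0" if "i \<in> {1..n}" for i using that by simp
  let ?O = "{i \<in> {1..n}. card (types s i) = 1}"
  have "card (types s i) + (if i \<in> ?O then 1 else 0) = 2" if "i \<in> {1..n}" for i
  proof -
   have *: "c + (if c = 1 then 1 else 0) = 2" if "c \<noteq> 0" "c \<le> 2" for c :: nat using that by auto
   have "i \<in> ?O \<longleftrightarrow> card (types s i) = 1" using that by blast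
   thus ?thesis using *[OF pos[OF that] card_types_le[OF nz, of i]] by presburger
  qed
  hence "(\<Sum>i\<in>{1..n}. card (types s i) + (if i \<in> ?O then 1 else 0)) = 2 * n" by simp
  moreover have "(\<Sum>i\<in>{1..n}. (if i \<in> ?O then 1 else 0 :: nat)) = card ?O"
   by (simp add: sum.If_cases Int_def)
  ultimately have "card ?O = 2" using sum n by (simp add: sum.distrib)
  then obtain i i' where O: "?O = {i, i'}" "i \<noteq> i'" unfolding card_2_iff by blast
  have "i \<in> ?O" "i' \<in> ?O" unfolding O(1) by blast+
  moreover have "i < i' \<or> i' < i" using O(2) by auto
  ultimately show ?thesis using that(2)[of i i'] that(2)[of i' i] by blast
 qed
qed

text \<open>The legs with an end of type \<open>t\<close>. A leg in \<open>C - Z\<close> carries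
  both types 1 and 3, one in \<open>Z\<close> an end of type 2, and one in \<open>A\<close> an end
  of type 4. Leg \<open>e\<close> lies in line with the centre and, if it is not leg 1, carries just
  its vertical end. Every other leg in \<open>Z\<close>, \<open>A\<close> or \<open>{1}\<close>
  reaches its point by type 3 if it is right of the centre and by type 1 if it is left of it; as
  \<open>X\<close> decreases, right means a smaller index.\<close>

definition leg_set :: "nat set => nat => nat => nat set" where
 "leg_set Z e t = (if t = 1 then (C - Z) \<union> {y \<in> Z \<union> A \<union> {1}. e < y}
   else if t = 2 then Z
   else if t = 3 then (C - Z) \<union> {y \<in> Z \<union> A \<union> {1}. y < e}
   else A)"

text \<open>The direction \<open>(0, -1)\<close> is used exactly by the points below the broken line
  \<open>roof\<close>, and the prescribed number of such ends forces them onto \<open>A\<close>. The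
  deficit count then pins the centre to a point \<open>(X e, 0)\<close>, and the side of the centre
  determines the types on each leg.\<close>

lemma svalid_structure:
 assumes nz: "dt k (smat s) \<noteq> 0" and s: "s \<in> {..<k} \<rightarrow>\<^sub>E {1..n}" and val: "svalid s"
 obtains Z e where "Z \<subseteq> C" "e \<in> Z \<union> A \<union> {1}" "\<And>t. t \<in> {1, 2, 3, 4} ==> bij_betw s (J t) (leg_set Z e t)"
proof -
 define L where "L t = {i \<in> {1..n}. t \<in> types s i}" for t
 have bijL: "bij_betw s (J t) (L t)" for t
  unfolding bij_betw_def
 proof
  show "inj_on s (J t)" using types_inj[OF nz] by (auto simp: inj_on_def J_def)
  show "s ` J t = L t"
  proof
   show "s ` J t \<subseteq> L t" using s unfolding J_def L_def types_def PiE_def Pi_def by blast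
   show "L t \<subseteq> s ` J t" unfolding J_def L_def types_def by blast
  qed
 qed
 obtain V cx cy where V: "\<And>j. j < k ==> V j > 0"
  and eq: "\<And>i. i \<in> {1..n} ==> (\<Sum>j | j < k \<and> s j = i. dx j * V j) = X i - cx"
   "\<And>i. i \<in> {1..n} ==> (\<Sum>j | j < k \<and> s j = i. dy j * V j) = Y i - cy"
  using val unfolding svalid_def by blast
 define u where "u t i = (\<Sum>j | j < k \<and> s j = i \<and> ty j = t. mu j * V j)" for t i
 have u0: "u t i = 0" if "t \<notin> types s i" for t i
  unfolding u_def using that by (intro sum.neutral) (auto simp: types_def)
 have up: "u t i > 0" if "t \<in> types s i" for t i
  unfolding u_def using that V mu by (intro sum_pos) (auto simp: types_def k_def)
 have unn: "u t i \<ge> 0" for t i using u0 up by (metis less_eq_real_def order_refl)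
 have split: "(\<Sum>j | j < k \<and> s j = i. f j) = (\<Sum>t\<in>{1,2,3,4}. \<Sum>j | j < k \<and> s j = i \<and> ty j = t. f j)" for f :: "nat => real" and i
 proof -
  have "(\<Sum>j | j < k \<and> s j = i. f j) = (\<Sum>t\<in>{1,2,3,4}. sum f {j \<in> {j. j < k \<and> s j = i}. ty j = t})"
   by (rule sum.group[symmetric]) (use ty in \<open>auto simp: k_def\<close>)
  thus ?thesis by (simp add: conj_assoc)
 qed
 have ux: "X i - cx = u 3 i - u 1 i" if "i \<in> {1..n}" for i
  unfolding eq(1)[OF that, symmetric] split u_def by (simp add: leg_x_def sum_negf)
 have uy: "Y i - cy = a * u 1 i + u 2 i - u 4 i" if "i \<in> {1..n}" for i
  unfolding eq(2)[OF that, symmetric] split u_def by (simp add: leg_y_def sum_negf sum_distrib_left mult.assoc)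
 have no24: "\<not> (2 \<in> types s i \<and> 4 \<in> types s i)" and no123: "\<not> (1 \<in> types s i \<and> 3 \<in> types s i \<and> 2 \<in> types s i)"
  and no134: "\<not> (1 \<in> types s i \<and> 3 \<in> types s i \<and> 4 \<in> types s i)" for i
  using types_not_24[OF nz] types_not_three[OF nz] by auto
 have t1234: "t = 1 \<or> t = 2 \<or> t = 3 \<or> t = 4" if "t \<in> types s i" for t i using types_subset[of s i] that by auto
 \<comment> \<open>The rays from the centre \<open>(cx, cy)\<close> in the directions
   \<open>(1, 0)\<close> and \<open>(-1, a)\<close>, as a graph over the horizontal axis, evaluated
   at \<open>X i\<close>.\<close>
 define roof where "roof i = cy + a * max 0 (cx - X i)" for i
 have a0: "real a \<ge> 1" using a by simp
 have four: "4 \<in> types s i \<longleftrightarrow> Y i < roof i" if i: "i \<in> {1..n}" for i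
 proof
  assume f: "4 \<in> types s i"
  have u2: "u 2 i = 0" using no24 f u0 by blast
  have u13: "u 1 i = 0 \<or> u 3 i = 0" using no134 f u0 by blast
  have "a * max 0 (cx - X i) \<ge> a * u 1 i"
   using u13 ux[OF i] unn[of 1 i] unn[of 3 i] a0 by (intro mult_left_mono) auto
  thus "Y i < roof i" using uy[OF i] u2 up[OF f] unfolding roof_def by linarith
 next
  assume *: "Y i < roof i"
  show "4 \<in> types s i"
  proof (rule ccontr)
   assume "4 \<notin> types s i"
   hence "u 4 i = 0" by (rule u0)
   moreover have "a * max 0 (cx - X i) \<le> a * u 1 i"
    using ux[OF i] unn[of 1 i] unn[of 3 i] a0 by (intro mult_left_mono) auto
   ultimately show False using uy[OF i] unn[of 2 i] * unfolding roof_def by linarith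
  qed
 qed
 have finAC: "finite A" "finite C" using AC by (metis finite_Un finite_atLeastAtMost)+
 have An: "A \<subseteq> {2..n}" "C \<subseteq> {2..n}" using AC by auto
 have Xinj: "X i \<noteq> X i'" if "i \<in> {1..n}" "i' \<in> {1..n}" "i \<noteq> i'" for i i'
  using Xdec[of i i'] Xdec[of i' i] that by (metis atLeastAtMost_iff less_irrefl linorder_neqE_nat)
 have cardL4: "card (L 4) = card (J 4)" using bij_betw_same_card[OF bijL] by simp
 \<comment> \<open>Otherwise the roof passes above the origin and hence above \<open>A\<close>,
   whose points are lower and further left. This needs \<open>card A + 1\<close> ends of type 4, so
   \<open>card A\<close> is \<open>n - 1\<close> and every leg carries one. The deficit then leaves
   two legs without any other end, whose points would both have abscissa \<open>cx\<close>.\<close>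
 have one4: "4 \<notin> types s 1"
 proof
  assume f: "4 \<in> types s 1"
  have r1: "0 < cy + a * max 0 cx" using four[of 1] f n X1 unfolding roof_def by simp
  have sub: "insert 1 A \<subseteq> L 4"
  proof -
   have "4 \<in> types s i" if i: "i \<in> A" for i
   proof -
    have "X i \<le> 0" using Xneg i An by force
    hence "a * max 0 cx \<le> a * max 0 (cx - X i)" using a0 by (intro mult_left_mono) auto
    hence "Y i < roof i" using r1 XA[OF i] unfolding roof_def by linarith
    thus ?thesis using four[of i] i An by auto
   qed
   thus ?thesis unfolding L_def using f An n by auto
  qed
  have finL: "finite (L 4)" unfolding L_def by simp
  have "1 \<notin> A" using An by auto
  hence "card A + 1 \<le> card (J 4)" using card_mono[OF finL sub] cardL4 finAC by simp
  hence cA: "card A = n - 1" using cardA unfolding J_def k_def by simp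
  have "card (L 4) \<ge> n" using card_mono[OF finL sub] \<open>1 \<notin> A\<close> finAC cA n by simp
  hence L4: "L 4 = {1..n}" by (intro card_seteq) (auto simp: L_def)
  hence all4: "4 \<in> types s i" if "i \<in> {1..n}" for i using that unfolding L_def by blast
  show False
  proof (rule deficits[OF nz s])
   fix i assume "i \<in> {1..n}" "types s i = {}"
   thus False using all4[of i] by simp
  next
   fix i i' assume i: "i \<in> {1..n}" "i' \<in> {1..n}" "i < i'" "card (types s i) = 1" "card (types s i') = 1"
   hence "types s i = {4}" "types s i' = {4}" using all4 by (metis card_1_singletonE singletonD)+
   hence "u 1 i = 0" "u 3 i = 0" "u 1 i' = 0" "u 3 i' = 0" using u0 by auto
   thus False using ux[OF i(1)] ux[OF i(2)] Xinj i by auto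
  qed
 qed
 have r1: "cy + a * max 0 cx \<le> 0" using four[of 1] one4 n X1 unfolding roof_def by simp
 \<comment> \<open>By \<open>r1\<close> the height of the roof over \<open>X i\<close> is at most
   \<open>- a * X i\<close>, which is less than \<open>Y i\<close>.\<close>
 have C4: "4 \<notin> types s i" if i: "i \<in> C" for i
 proof -
  have i': "i \<in> {1..n}" "X i < 0" using i An Xneg by auto
  have "max 0 (cx - X i) \<le> max 0 cx + (- X i)" using i' by auto
  hence "a * max 0 (cx - X i) \<le> a * (max 0 cx + (- X i))" using a0 by (intro mult_left_mono) auto
  hence "a * max 0 (cx - X i) \<le> a * max 0 cx - a * X i" by (simp add: algebra_simps)
  hence "roof i < Y i" using r1 XC(2)[OF i] unfolding roof_def by linarith
  thus ?thesis using four[OF i'(1)] by simp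
 qed
 have L4A: "L 4 \<subseteq> A"
 proof
  fix i assume i: "i \<in> L 4"
  hence "i \<noteq> 1" "i \<in> {1..n}" "i \<notin> C" using one4 C4 unfolding L_def by auto
  thus "i \<in> A" using AC by auto
 qed
 have L4: "L 4 = A"
  by (rule card_seteq[OF finAC(1) L4A]) (use cardL4 cardA in \<open>simp add: J_def k_def\<close>)
 have A4: "4 \<in> types s i" if "i \<in> A" for i using L4 that unfolding L_def by blast
 \<comment> \<open>If the centre were right of the origin, every leg would carry type 1. A deficient
   leg other than leg 1 would then carry nothing else, so its point would lie in \<open>C\<close>
   and on the line of slope \<open>-a\<close> through the centre, where \<open>a * X + Y\<close> is
   at most 0 by \<open>r1\<close>.\<close>
 have cx: "cx \<le> 0"
 proof (rule ccontr)
  assume "\<not> cx \<le> 0"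
  hence cx: "cx > 0" by simp
  have all1: "1 \<in> types s i" if i: "i \<in> {1..n}" for i
  proof (rule ccontr)
   assume "1 \<notin> types s i"
   hence "X i \<ge> cx" using ux[OF i] u0 unn[of 3 i] by auto
   moreover have "X i \<le> 0" using Xneg[of i] X1 i by (cases "i = 1") auto
   ultimately show False using cx by simp
  qed
  show False
  proof (rule deficits[OF nz s])
   fix i assume "i \<in> {1..n}" "types s i = {}"
   thus False using all1[of i] by simp
  next
   fix i i' assume i: "i \<in> {1..n}" "i' \<in> {1..n}" "i < i'" "card (types s i) = 1" "card (types s i') = 1"
   hence t: "types s i' = {1}" using all1 by (metis card_1_singletonE singletonD)
   hence "u 2 i' = 0" "u 3 i' = 0" "u 4 i' = 0" using u0 by auto
   moreover have "i' \<in> A \<union> C" using i AC by auto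
   hence iC: "i' \<in> C" using A4[of i'] t by auto
   ultimately have "X i' - cx = - u 1 i'" "Y i' - cy = a * u 1 i'" using ux[OF i(2)] uy[OF i(2)] by auto
   hence e: "X i' = cx - u 1 i'" "Y i' = cy + a * u 1 i'" by linarith+
   have "a * X i' + Y i' = a * cx + cy" unfolding e by (simp add: algebra_simps)
   thus False using XC(2)[OF iC] r1 cx by simp
  qed
 qed
 have cy: "cy \<le> 0" using r1 cx by simp
 \<comment> \<open>A point of \<open>A\<close> already has its end of type 4. A point of
   \<open>C\<close> lies strictly above both rays of the roof, since \<open>cx\<close> and
   \<open>cy\<close> are at most 0; it cannot be reached by type 1 or type 3 alone. So a single end
   is vertical.\<close>
 have legs: "types s i \<subseteq> {2, 4} \<and> card (types s i) = 1 \<and> X i = cx" if i: "i \<in> {2..n}" "card (types s i) \<le> 1" for i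
 proof -
  have i': "i \<in> {1..n}" using i by auto
  have ttt: "types s i = {} \<or> (\<exists>t. types s i = {t} \<and> (t = 1 \<or> t = 2 \<or> t = 3 \<or> t = 4))"
  proof (cases "card (types s i) = 0")
   case False
   hence "card (types s i) = 1" using i(2) by linarith
   then obtain t where "types s i = {t}" by (rule card_1_singletonE)
   thus ?thesis using t1234[of t i] by auto
  qed simp
  have ok: "types s i = {2} \<or> types s i = {4}"
  proof (cases "i \<in> A")
   case True
   thus ?thesis using A4 ttt by (metis empty_iff singletonD)
  next
   case False
   hence iC: "i \<in> C" using AC i by auto
   have 1: "types s i \<noteq> {}"
    using uy[OF i'] u0[of _ i] XC(1)[OF iC] cy by auto
   have 2: "types s i \<noteq> {1}"
   proof
    assume "types s i = {1}"
    hence "u 2 i = 0" "u 3 i = 0" "u 4 i = 0" using u0 by auto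
    hence "X i - cx = - u 1 i" "Y i - cy = a * u 1 i" using ux[OF i'] uy[OF i'] by auto
    hence e: "X i = cx - u 1 i" "Y i = cy + a * u 1 i" by linarith+
    have "a * X i + Y i = a * cx + cy" unfolding e by (simp add: algebra_simps)
    moreover have "a * cx \<le> 0" using cx by (simp add: mult_nonneg_nonpos)
    ultimately show False using XC(2)[OF iC] cy by simp
   qed
   have 3: "types s i \<noteq> {3}"
    using uy[OF i'] u0[of _ i] XC(1)[OF iC] cy by auto
   show ?thesis using ttt 1 2 3 by auto
  qed
  hence "u 1 i = 0" "u 3 i = 0" using u0 by auto
  thus ?thesis using ok ux[OF i'] by auto
 qed
 have leg1: "types s 1 = {} \<and> cx = 0 \<and> cy = 0 \<or> types s 1 = {2} \<and> cx = 0 \<or> types s 1 = {3} \<and> cy = 0 \<and> cx < 0"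
  if "card (types s 1) \<le> 1"
 proof -
  have i': "1 \<in> {1..n}" using n by auto
  have ttt: "types s 1 = {} \<or> (\<exists>t. types s 1 = {t} \<and> (t = 1 \<or> t = 2 \<or> t = 3))"
  proof (cases "card (types s 1) = 0")
   case False
   hence "card (types s 1) = 1" using that by linarith
   then obtain t where "types s 1 = {t}" by (rule card_1_singletonE)
   thus ?thesis using t1234[of t 1] one4 by auto
  qed simp
  have n1: "types s 1 \<noteq> {1}"
  proof
   assume "types s 1 = {1}"
   hence "u 1 1 > 0" "u 3 1 = 0" using up[of 1 1] u0[of 3 1] by auto
   thus False using ux[OF i'] X1 cx by simp
  qed
  have e0: "cx = 0 \<and> cy = 0" if "types s 1 = {}"
   using ux[OF i'] uy[OF i'] u0[of _ 1] X1 that by auto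
  have e2: "cx = 0" if "types s 1 = {2}" using ux[OF i'] u0[of _ 1] X1 that by auto
  have e3: "cy = 0 \<and> cx < 0" if "types s 1 = {3}"
   using ux[OF i'] uy[OF i'] u0[of _ 1] up[of 3 1] X1 that by auto
  have "types s 1 = {} \<or> types s 1 = {2} \<or> types s 1 = {3}" using ttt n1 by auto
  thus ?thesis using e0 e2 e3 by blast
 qed
 \<comment> \<open>Two deficient legs of index at least 2 would have the same abscissa
   \<open>cx\<close>. So leg 1 is deficient: either it is empty and the centre is the origin
   (\<open>e = 1\<close>), or it carries just type 3 and the other deficient leg is
   \<open>e\<close>.\<close>
 obtain e where e: "e \<in> {1..n}" "cx = X e" "cy = 0" "types s e \<subseteq> {2, 4}" "e \<noteq> 1 ==> types s e \<noteq> {}"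
  "types s 1 = (if e = 1 then {} else {3})"
 proof (rule deficits[OF nz s])
  fix i assume i: "i \<in> {1..n}" "types s i = {}"
  have "i = 1"
  proof (rule ccontr)
   assume "i \<noteq> 1"
   thus False using legs[of i] i by auto
  qed
  thus thesis using that[of 1] i leg1 X1 by auto
 next
  fix i i' assume i: "i \<in> {1..n}" "i' \<in> {1..n}" "i < i'" "card (types s i) = 1" "card (types s i') = 1"
  have l': "types s i' \<subseteq> {2, 4}" "X i' = cx" using legs[of i'] i by auto
  have "i = 1"
  proof (rule ccontr)
   assume "i \<noteq> 1"
   hence "X i = cx" using legs[of i] i by auto
   thus False using l' Xinj i by auto
  qed
  have "cx < 0" using l'(2) Xneg[of i'] i by auto
  hence "types s 1 = {3}" "cy = 0" using leg1 i \<open>i = 1\<close> by auto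
  moreover have "types s i' \<noteq> {}" using i(5) by auto
  ultimately show thesis using that[of i'] i(2,3) l' \<open>i = 1\<close> by simp
 qed
 have full: "card (types s i) = 2" if "i \<in> {2..n}" "i \<noteq> e" for i
 proof (rule ccontr)
  assume "card (types s i) \<noteq> 2"
  hence "card (types s i) \<le> 1" using card_types_le[OF nz, of i] by linarith
  hence "X i = X e" using legs[of i] that e(2) by simp
  thus False using Xinj[of i e] that e(1) by auto
 qed
 have left: "X i < cx \<longleftrightarrow> e < i" "X i = cx \<longleftrightarrow> i = e" "cx < X i \<longleftrightarrow> i < e" if "i \<in> {1..n}" for i
  using Xdec[of i e] Xdec[of e i] that e(1,2) by (cases i e rule: linorder_cases; auto)+
 define Z where "Z = L 2"
 have AL: "types s i = (if i = e then {4} else if e < i then {1, 4} else {3, 4})" if i: "i \<in> A" for i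
 proof -
  have i': "i \<in> {1..n}" "i \<in> {2..n}" using i An by auto
  have f: "4 \<in> types s i" using A4 i .
  show ?thesis
  proof (cases "i = e")
   case True
   thus ?thesis using f e(4) no24[of i] by auto
  next
   case False
   obtain x y where xy: "types s i = {x, y}" "x \<noteq> y" using full[OF i'(2) False] by (auto simp: card_2_iff)
   then obtain t where t: "types s i = {t, 4}" "t \<noteq> 4" using f by auto
   hence "t = 1 \<or> t = 3" using t1234[of t i] no24[of i] by auto
   moreover have "e < i" if "t = 1"
    using ux[OF i'(1)] u0[of 3 i] up[of 1 i] t left(1)[OF i'(1)] that by auto
   moreover have "i < e" if "t = 3"
    using ux[OF i'(1)] u0[of 1 i] up[of 3 i] t left(3)[OF i'(1)] that by auto
   ultimately have "t = 1 \<and> e < i \<or> t = 3 \<and> i < e" by blast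
   thus ?thesis using t(1) False by (elim disjE conjE) simp_all
  qed
 qed
 have CL: "types s i = (if i = e then {2} else if i \<notin> Z then {1, 3} else if e < i then {1, 2} else {3, 2})" if i: "i \<in> C" for i
 proof -
  have i': "i \<in> {1..n}" "i \<in> {2..n}" using i An by auto
  have f: "4 \<notin> types s i" using C4 i .
  have Z: "i \<in> Z \<longleftrightarrow> 2 \<in> types s i" unfolding Z_def L_def using i' by simp
  show ?thesis
  proof (cases "i = e")
   case True
   thus ?thesis using f e(4) e(5) i' by auto
  next
   case False
   obtain x y where xy: "types s i = {x, y}" "x \<noteq> y" using full[OF i'(2) False] by (auto simp: card_2_iff)
   show ?thesis
   proof (cases "2 \<in> types s i")
    case True
    then obtain t where t: "types s i = {t, 2}" "t \<noteq> 2" using xy by auto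
    hence "t = 1 \<or> t = 3" using t1234[of t i] f by auto
    moreover have "e < i" if "t = 1"
     using ux[OF i'(1)] u0[of 3 i] up[of 1 i] t left(1)[OF i'(1)] that by auto
    moreover have "i < e" if "t = 3"
     using ux[OF i'(1)] u0[of 1 i] up[of 3 i] t left(3)[OF i'(1)] that by auto
    ultimately have "t = 1 \<and> e < i \<or> t = 3 \<and> i < e" by blast
   thus ?thesis using t(1) False True Z by (elim disjE conjE) simp_all
   next
    case F: False
    have "x \<in> {1, 3}" "y \<in> {1, 3}" using t1234[of x i] t1234[of y i] xy f F by auto
    thus ?thesis using xy F Z False by auto
   qed
  qed
 qed
 have Z: "Z \<subseteq> C"
 proof
  fix i assume i: "i \<in> Z"
  hence "2 \<in> types s i" "i \<in> {1..n}" unfolding Z_def L_def by auto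
  hence "i \<noteq> 1" "i \<notin> A" using e(6) A4 no24 by (auto split: if_splits)
  thus "i \<in> C" using AC \<open>i \<in> {1..n}\<close> by auto
 qed
 have eY: "e \<in> Z \<union> A \<union> {1}"
 proof (cases "e = 1")
  case False
  hence "e \<in> A \<union> C" using e(1) AC by auto
  moreover have "e \<in> Z" if "e \<in> C" using CL[OF that] e(1) unfolding Z_def L_def by simp
  ultimately show ?thesis by blast
 qed simp
 have "L t = leg_set Z e t" if t: "t \<in> {1, 2, 3, 4}" for t
 proof -
  have "i \<in> L t \<longleftrightarrow> i \<in> leg_set Z e t" if i: "i \<in> {1..n}" for i
  proof -
   have Li: "i \<in> L t \<longleftrightarrow> t \<in> types s i" unfolding L_def using i by simp
   consider "i = 1" | "i \<in> A" | "i \<in> C" using i AC by (metis Un_iff atLeastAtMost_iff nat_less_le less_eq_Suc_le numeral_2_eq_2 One_nat_def)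
   thus ?thesis
   proof cases
    case 1
    have "1 \<notin> A" "1 \<notin> C" "1 \<notin> Z" using An Z by auto
    thus ?thesis using 1 t e(1,6) unfolding Li leg_set_def by (auto split: if_splits)
   next
    case 2
    hence "i \<notin> C" "i \<notin> Z" "i \<noteq> 1" using AC Z An by auto
    thus ?thesis using 2 t AL[OF 2] unfolding Li leg_set_def by (auto split: if_splits)
   next
    case 3
    hence "i \<notin> A" "i \<noteq> 1" using AC An by auto
    thus ?thesis using 3 t CL[OF 3] eY unfolding Li leg_set_def by (auto split: if_splits)
   qed
  qed
  moreover have "leg_set Z e t \<subseteq> {1..n}" using An Z n unfolding leg_set_def by (auto split: if_splits)
  ultimately show ?thesis unfolding L_def by blast
 qed
 thus thesis using that[OF Z eY] bijL by metis
qed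

end

section \<open>Construction of the solutions over the star, their determinants and their
  number\<close>

context star
begin

text \<open>The displacement along each ray generator that is forced by the centre
  \<open>(X e, 0)\<close>. On a leg in \<open>C - Z\<close>, type 1 alone has to gain the height
  \<open>Y i\<close>, and type 3 corrects the abscissa.\<close>

definition arm :: "nat set => nat => nat => nat => real" where
 "arm Z e t i = (if t = 1 then if i \<in> C - Z then Y i / a else X e - X i
   else if t = 2 then Y i - a * max 0 (X e - X i)
   else if t = 3 then if i \<in> C - Z then X i - X e + Y i / a else X i - X e
   else - Y i + a * max 0 (X e - X i))"

lemma An: "A \<subseteq> {2..n}" "C \<subseteq> {2..n}" using AC by auto

text \<open>The condition \<open>a * X i + Y i > 0\<close> puts the points of \<open>C\<close> above
  the ray of slope \<open>-a\<close> from any centre \<open>(X e, 0)\<close>, because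
  \<open>X e\<close> is at most 0.\<close>

lemma arm_pos:
 assumes Z: "Z \<subseteq> C" and e: "e \<in> Z \<union> A \<union> {1}" and t: "t \<in> {1, 2, 3, 4}" and i: "i \<in> leg_set Z e t"
 shows "arm Z e t i > 0"
proof -
 have en: "e \<in> {1..n}" using e An Z n by auto
 have Xe: "X e \<le> 0" using Xneg[of e] X1 en by (cases "e = 1") auto
 have a0: "real a > 0" using a by simp
 have aXe: "a * X e \<le> 0" using Xe a0 by (simp add: mult_nonneg_nonpos)
 consider "t = 1" | "t = 2" | "t = 3" | "t = 4" using t by auto
 thus ?thesis
 proof cases
  case 1
  show ?thesis
  proof (cases "i \<in> C - Z")
   case True
   thus ?thesis using 1 XC(1)[of i] a0 by (simp add: arm_def)
  next
   case False
   hence "e < i" "i \<le> n" using i 1 An Z n by (auto simp: leg_set_def)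
   thus ?thesis using 1 False Xdec[of e i] en by (auto simp: arm_def)
  qed
 next
  case 2
  hence iC: "i \<in> C" using i Z by (auto simp: leg_set_def)
  have "a * max 0 (X e - X i) < Y i"
  proof (cases "X e \<le> X i")
   case True
   thus ?thesis using XC(1)[OF iC] by simp
  next
   case False
   hence "a * max 0 (X e - X i) = a * X e - a * X i" by (simp add: algebra_simps)
   thus ?thesis using XC(2)[OF iC] aXe by linarith
  qed
  thus ?thesis using 2 by (simp add: arm_def)
 next
  case 3
  show ?thesis
  proof (cases "i \<in> C - Z")
   case True
   hence "a * X i + Y i > 0" using XC(2) by blast
   hence "(a * X i + Y i) / a > 0" using a0 by (rule divide_pos_pos)
   hence "X i + Y i / a > 0" using a0 by (simp add: add_divide_distrib)
   thus ?thesis using 3 True Xe by (simp add: arm_def)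
  next
   case False
   hence "i < e" "1 \<le> i" using i 3 An Z n by (auto simp: leg_set_def)
   thus ?thesis using 3 False Xdec[of i e] en by (auto simp: arm_def)
  qed
 next
  case 4
  hence iA: "i \<in> A" using i by (simp add: leg_set_def)
  have "a * max 0 (X e - X i) \<ge> 0" using a0 by simp
  moreover have "arm Z e t i = - Y i + a * max 0 (X e - X i)" unfolding arm_def 4 by simp
  ultimately show ?thesis using XA[OF iA] by linarith
 qed
qed

context
 fixes Z e s
 assumes Z: "Z \<subseteq> C" and e: "e \<in> Z \<union> A \<union> {1}" and s: "s \<in> {..<k} \<rightarrow>\<^sub>E {1..n}"
  and bij: "\<And>t. t \<in> {1, 2, 3, 4} ==> bij_betw s (J t) (leg_set Z e t)"
begin

lemma en: "e \<in> {1..n}" using e An Z n by auto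

lemma ty_in: "j < k ==> ty j \<in> {1, 2, 3, 4}" using ty by (simp add: k_def)

lemma s_in: "j < k ==> s j \<in> leg_set Z e (ty j)"
 using bij_betwE[OF bij[OF ty_in], of j] by (auto simp: J_def)

lemma s_inj: "j < k ==> j' < k ==> ty j = ty j' ==> s j = s j' ==> j = j'"
 by (rule inj_onD[OF bij_betw_imp_inj_on[OF bij[OF ty_in]], of j]) (auto simp: J_def)

lemma leg_sum:
 assumes t: "t \<in> {1, 2, 3, 4}" and V: "\<And>j. j < k ==> V j = arm Z e (ty j) (s j) / mu j"
 shows "(\<Sum>j | j < k \<and> s j = i \<and> ty j = t. mu j * V j) = (if i \<in> leg_set Z e t then arm Z e t i else 0)"
proof (cases "i \<in> leg_set Z e t")
 case True
 hence "i \<in> s ` J t" using bij_betw_imp_surj_on[OF bij[OF t]] by simp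
 then obtain j where j: "j < k" "ty j = t" "s j = i" unfolding J_def by blast
 have "{j. j < k \<and> s j = i \<and> ty j = t} = {j}" using s_inj j by auto
 thus ?thesis using True V[OF j(1)] j mu[of j] by (simp add: k_def)
next
 case False
 have *: "{j. j < k \<and> s j = i \<and> ty j = t} = {}" using s_in False by auto
 show ?thesis unfolding * using False by simp
qed

lemma configuration_svalid: "svalid s"
proof -
 define V where "V j = arm Z e (ty j) (s j) / mu j" for j
 have pos: "V j > 0" if "j < k" for j
  unfolding V_def using arm_pos[OF Z e ty_in[OF that] s_in[OF that]] mu that by (simp add: k_def)
 have split: "(\<Sum>j | j < k \<and> s j = i. f j) = (\<Sum>t\<in>{1,2,3,4}. \<Sum>j | j < k \<and> s j = i \<and> ty j = t. f j)" for f :: "nat => real" and i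
 proof -
  have "(\<Sum>j | j < k \<and> s j = i. f j) = (\<Sum>t\<in>{1,2,3,4}. sum f {j \<in> {j. j < k \<and> s j = i}. ty j = t})"
   by (rule sum.group[symmetric]) (use ty in \<open>auto simp: k_def\<close>)
  thus ?thesis by (simp add: conj_assoc)
 qed
 define u where "u t i = (\<Sum>j | j < k \<and> s j = i \<and> ty j = t. mu j * V j)" for t i
 have u: "u t i = (if i \<in> leg_set Z e t then arm Z e t i else 0)" if "t \<in> {1, 2, 3, 4}" for t i
  unfolding u_def by (rule leg_sum[OF that V_def])
 have sx: "(\<Sum>j | j < k \<and> s j = i. dx j * V j) = u 3 i - u 1 i" for i
  unfolding split u_def by (simp add: leg_x_def sum_negf)
 have sy: "(\<Sum>j | j < k \<and> s j = i. dy j * V j) = a * u 1 i + u 2 i - u 4 i" for i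
  unfolding split u_def by (simp add: leg_y_def sum_negf sum_distrib_left mult.assoc)
 have a0: "real a \<noteq> 0" using a by simp
 have *: "u 3 i - u 1 i = X i - X e \<and> a * u 1 i + u 2 i - u 4 i = Y i - 0" if i: "i \<in> {1..n}" for i
 proof -
  have left: "i < e ==> X e < X i" "e < i ==> X i < X e" using Xdec[of i e] Xdec[of e i] i en by auto
  consider "i = 1" | "i \<in> A" | "i \<in> Z" | "i \<in> C - Z"
   using i AC by (metis DiffI Un_iff atLeastAtMost_iff nat_less_le less_eq_Suc_le numeral_2_eq_2 One_nat_def)
  thus ?thesis
  proof cases
   case 1
   have "1 \<notin> A" "1 \<notin> C" "1 \<notin> Z" using An Z by auto
   thus ?thesis using 1 en X1 by (auto simp: u leg_set_def arm_def)
  next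
   case 2
   hence "i \<notin> C" "i \<notin> Z" "i \<noteq> 1" using AC Z An by auto
   thus ?thesis using 2 left by (cases i e rule: linorder_cases) (auto simp: u leg_set_def arm_def algebra_simps)
  next
   case 3
   hence "i \<notin> A" "i \<noteq> 1" using AC Z An by auto
   thus ?thesis using 3 left by (cases i e rule: linorder_cases) (auto simp: u leg_set_def arm_def algebra_simps)
  next
   case 4
   hence "i \<notin> A" "i \<noteq> 1" "i \<noteq> e" using AC Z An e by auto
   thus ?thesis using 4 a0 by (auto simp: u leg_set_def arm_def algebra_simps)
  qed
 qed
 show ?thesis unfolding svalid_def
  by (intro exI[of _ V] exI[of _ "X e"] exI[of _ 0]) (use pos * in \<open>auto simp: sx sy\<close>)
qed

text \<open>Each end is matched with a row such that the matrix becomes triangular. The diagonal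
  entries are \<open>mu j\<close> in absolute value, except for the ends of direction
  \<open>(-1, a)\<close> on legs in \<open>C - Z\<close>, which contribute \<open>a * mu j\<close>
  and so produce the power of \<open>a\<close>.\<close>

lemma configuration_dt: "\<bar>dt k (smat s)\<bar> = (\<Prod>j<k. mu j) * real a ^ card (C - Z)"
proof -
 \<comment> \<open>Columns of rank 0 meet only their own row. A column of type 1 also meets the
   other row of its leg, and the end of type 3 on leg 1 meets every horizontal row, so these come
   later.\<close>
 define rk where "rk j = (if ty j = 1 then 1 else if ty j = 3 \<and> s j = 1 then 2 else 0 :: nat)" for j
 have nA: "1 \<notin> A" "1 \<notin> C" "1 \<notin> Z" using An Z by auto
 have ZA: "Z \<inter> A = {}" "(C - Z) \<inter> A = {}" using Z AC by auto
 define F where "F i \<longleftrightarrow> i \<in> C - Z" for i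
 define E where "E i \<longleftrightarrow> i \<in> Z \<union> A" for i
 define vt where "vt j \<longleftrightarrow> ty j = 2 \<or> ty j = 4" for j
 define P where "P j \<longleftrightarrow> vt j \<or> ty j = 1 \<and> F (s j)" for j
 \<comment> \<open>Vertical ends, and those of type 1 on legs in \<open>C - Z\<close>, take the
   vertical row of their leg; the others take the horizontal one. Leg 1 has no rows: its end takes
   the horizontal row of leg \<open>e\<close>, which is left over.\<close>
 define row where "row j = (if P j then 2 * (s j - 2) + 1 else if s j = 1 then 2 * (e - 2) else 2 * (s j - 2))" for j
 have FE: "\<not> E i" "i \<noteq> 1" "i \<noteq> e" if "F i" for i
  using that nA ZA e unfolding F_def E_def by auto
 have E1: "i \<noteq> 1" if "E i" for i using that nA unfolding E_def by auto
 have L1: "F (s j) \<or> E (s j) \<and> e < s j" if "j < k" "ty j = 1" for j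
  using s_in[OF that(1)] that(2) en unfolding leg_set_def F_def E_def by auto
 have L3: "F (s j) \<or> E (s j) \<and> s j < e \<or> s j = 1 \<and> 1 < e" if "j < k" "ty j = 3" for j
  using s_in[OF that(1)] that(2) unfolding leg_set_def F_def E_def by auto
 have Lv: "E (s j)" if "j < k" "vt j" for j
  using s_in[OF that(1)] that(2) unfolding leg_set_def E_def vt_def by auto
 have Lu: "ty j = ty j'" if "j < k" "j' < k" "vt j" "vt j'" "s j = s j'" for j j'
  using s_in[OF that(1)] s_in[OF that(2)] that(3-5) ZA(1) unfolding leg_set_def vt_def by auto
 have Q: "ty j = 1 \<and> E (s j) \<and> e < s j \<or> ty j = 3 \<and> F (s j) \<or> ty j = 3 \<and> E (s j) \<and> s j < e \<or> ty j = 3 \<and> s j = 1 \<and> 1 < e"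
  if "j < k" "\<not> P j" for j
  using ty_in[OF that(1)] L1[OF that(1)] L3[OF that(1)] that(2) unfolding P_def vt_def by blast
 have Q2: "ty j = 1 \<and> s j \<noteq> 1 \<and> e < s j \<and> \<not> F (s j) \<or> ty j = 3 \<and> s j \<noteq> 1 \<and> s j \<noteq> e \<and> (F (s j) \<or> s j < e) \<or> ty j = 3 \<and> s j = 1 \<and> 1 < e"
  if "j < k" "\<not> P j" for j
  using Q[OF that] FE[of "s j"] E1[of "s j"] by blast
 have P_ne: "s j \<noteq> 1" if "j < k" "P j" for j
  using that(2) Lv[OF that(1)] FE E1 unfolding P_def by blast
 have legs: "ty j = 1 \<and> (F (s j) \<or> E (s j) \<and> e < s j) \<or> vt j \<and> E (s j)
   \<or> ty j = 3 \<and> (F (s j) \<or> E (s j) \<and> s j < e \<or> s j = 1 \<and> 1 < e)" if "j < k" for j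
  using ty_in[OF that] L1[OF that] L3[OF that] Lv[OF that] unfolding vt_def by blast
 have s2: "s j \<noteq> 1 ==> 2 \<le> s j \<and> s j \<le> n" if "j < k" for j
  using legs[OF that] An Z unfolding F_def E_def by auto
 have div: "row j div 2 + 2 = (if s j = 1 then e else s j)" "even (row j) \<longleftrightarrow> \<not> P j" if "j < k" for j
  using s2[OF that] P_ne[OF that] Q2[OF that] unfolding row_def by (cases "P j"; auto)+
 have rowk: "row j < k" if "j < k" for j
 proof -
  have "row j div 2 + 2 \<le> n" unfolding div(1)[OF that] using s2[OF that] en by auto
  thus ?thesis using n unfolding k_def by linarith
 qed
 have row_eq: "j = j'" if j: "j < k" "j' < k" and r: "row j = row j'" for j j'
 proof -
  have d: "(if s j = 1 then e else s j) = (if s j' = 1 then e else s j')" using div(1) j r by metis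
  have ev: "P j \<longleftrightarrow> P j'"
   using div(2) j r by metis
  have "ty j = ty j' \<and> s j = s j'"
  proof (cases "P j")
   case True
   hence P': "P j'" using ev by simp
   have ss: "s j = s j'" using d P_ne[OF j(1) True] P_ne[OF j(2) P'] by simp
   show ?thesis
   proof (cases "vt j")
    case True
    hence "\<not> F (s j')" using Lv[OF j(1)] FE ss by auto
    hence "vt j'" using P' by (simp add: P_def)
    thus ?thesis using Lu[OF j True] ss by simp
   next
    case False
    hence F: "ty j = 1" "F (s j)" using True by (auto simp: P_def)
    hence "\<not> vt j'" using Lv[OF j(2)] FE ss by auto
    thus ?thesis using P' F ss by (simp add: P_def)
   qed
  next
   case False
   hence "\<not> P j'" using ev by simp
   from Q2[OF j(1) False] Q2[OF j(2) this] d show ?thesis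
    by (elim disjE conjE) simp_all
  qed
  thus ?thesis using s_inj j by blast
 qed
 have bijr: "bij_betw row {..<k} {..<k}"
  unfolding bij_betw_def
 proof
  show inj: "inj_on row {..<k}" using row_eq by (auto simp: inj_on_def)
  show "row ` {..<k} = {..<k}"
   by (rule endo_inj_surj[OF _ _ inj]) (use rowk in auto)
 qed
 have tri: "rk j < rk j'" if j: "j < k" "j' < k" "j \<noteq> j'" "smat s (row j) j' \<noteq> 0" for j j'
 proof -
  have d: "s j' = 1 \<or> (if s j = 1 then e else s j) = s j'"
   using j(4) unfolding smat_def div(1)[OF j(1)] by (auto split: if_splits)
  have ev: "if P j then dy j' \<noteq> 0 else dx j' \<noteq> 0"
   using j(4) unfolding smat_def div(2)[OF j(1)] by (auto split: if_splits)
  have ne: "\<not> (ty j = ty j' \<and> s j = s j')" using s_inj j by blast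
  have dd: "dx j' \<noteq> 0 ==> ty j' = 1 \<or> ty j' = 3" "dy j' \<noteq> 0 ==> ty j' = 1 \<or> ty j' = 2 \<or> ty j' = 4"
   unfolding leg_x_def leg_y_def by (auto split: if_splits)
  show ?thesis
  proof (cases "P j")
   case True
   hence t': "ty j' = 1 \<or> vt j'" using ev dd by (auto simp: vt_def)
   hence "s j' \<noteq> 1" using L1[OF j(2)] Lv[OF j(2)] FE E1 by blast
   hence ss: "s j' = s j" using d P_ne[OF j(1) True] by auto
   show ?thesis
   proof (cases "vt j")
    case v: True
    hence "\<not> vt j'" using Lu[OF j(1,2) v] ne ss by auto
    thus ?thesis using t' v by (auto simp: rk_def vt_def)
   next
    case False
    hence F: "ty j = 1" "F (s j)" using True by (auto simp: P_def)
    hence "\<not> vt j'" using Lv[OF j(2)] FE ss by auto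
    thus ?thesis using t' F ss ne by simp
   qed
  next
   case False
   hence t': "ty j' = 1 \<or> ty j' = 3" using ev dd by auto
   show ?thesis using t'
   proof
    assume t1: "ty j' = 1"
    hence s1: "s j' \<noteq> 1" "s j' \<noteq> e" using L1[OF j(2)] FE E1 by auto
    hence "s j \<noteq> 1" "s j' = s j" using d by (auto split: if_splits)
    moreover have "ty j \<noteq> 1" using ne t1 \<open>s j' = s j\<close> by auto
    ultimately show ?thesis using Q[OF j(1) False] t1 by (auto simp: rk_def)
   next
    assume t3: "ty j' = 3"
    show ?thesis
    proof (cases "s j' = 1")
     case True
     hence "\<not> (ty j = 3 \<and> s j = 1)" using ne t3 by auto
     thus ?thesis using t3 True by (auto simp: rk_def)
    next
     case s1: False
     hence "(if s j = 1 then e else s j) = s j'" using d by simp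
     moreover have "s j' \<noteq> e" "F (s j') \<or> s j' < e" using L3[OF j(2) t3] s1 FE[of "s j'"] by auto
     ultimately show ?thesis using Q2[OF j(1) False] s1 t3 ne
      by (elim disjE conjE) (simp_all add: rk_def)
    qed
   qed
  qed
 qed
 have "\<bar>dt k (smat s)\<bar> = (\<Prod>j<k. \<bar>smat s (row j) j\<bar>)"
  by (rule dt_triangular[OF bijr tri])
 also have "\<dots> = (\<Prod>j<k. mu j * (if ty j = 1 \<and> s j \<in> C - Z then real a else 1))"
 proof (rule prod.cong[OF refl])
  fix j assume "j \<in> {..<k}"
  hence j: "j < k" by simp
  have "mu j > 0" using mu j by (simp add: k_def)
  moreover have "smat s (row j) j = (if P j then dy j else dx j)"
   using div[OF j] unfolding smat_def by simp
  ultimately show "\<bar>smat s (row j) j\<bar> = mu j * (if ty j = 1 \<and> s j \<in> C - Z then real a else 1)"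
   using ty_in[OF j] unfolding P_def F_def[symmetric] vt_def leg_x_def leg_y_def
   by (elim insertE) (simp_all add: abs_mult)
 qed
 also have "\<dots> = (\<Prod>j<k. mu j) * (\<Prod>j<k. if ty j = 1 \<and> s j \<in> C - Z then real a else 1)"
  by (rule prod.distrib)
 also have "(\<Prod>j<k. if ty j = 1 \<and> s j \<in> C - Z then real a else 1) = real a ^ card {j. j < k \<and> ty j = 1 \<and> s j \<in> C - Z}"
  by (subst prod.If_cases) (auto simp: Int_def)
 also have "card {j. j < k \<and> ty j = 1 \<and> s j \<in> C - Z} = card (C - Z)"
 proof (rule bij_betw_same_card)
  have b: "bij_betw s (J 1) (leg_set Z e 1)" by (rule bij) simp
  show "bij_betw s {j. j < k \<and> ty j = 1 \<and> s j \<in> C - Z} (C - Z)"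
   by (rule bij_betw_subset[OF b]) (use bij_betw_imp_surj_on[OF b] in \<open>auto simp: J_def leg_set_def\<close>)
 qed
 finally show ?thesis .
qed

end

lemma card_leg_sets:
 assumes Z: "Z \<subseteq> C" and e: "e \<in> Z \<union> A \<union> {1}"
 shows "card (leg_set Z e 1) = card (C - Z) + card {y \<in> Z \<union> A \<union> {1}. e < y}"
  and "card (leg_set Z e 3) + card {y \<in> Z \<union> A \<union> {1}. e < y} = n - 1"
  and "card (Z \<union> A \<union> {1}) = card Z + card A + 1" and "card (C - Z) + card Z + card A = n - 1"
  and "card {y \<in> Z \<union> A \<union> {1}. e < y} \<le> card Z + card A"
proof -
 have fin: "finite A" "finite C" "finite Z" using An Z by (meson finite_atLeastAtMost finite_subset)+
 have nA: "1 \<notin> A" "1 \<notin> C" "1 \<notin> Z" using An Z by auto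
 have dj: "Z \<inter> A = {}" "(C - Z) \<inter> (Z \<union> A \<union> {1}) = {}" using Z AC nA by auto
 show cY: "card (Z \<union> A \<union> {1}) = card Z + card A + 1"
  using fin nA dj by (subst card_Un_disjoint; simp add: card_Un_disjoint)
 have "card (A \<union> C) = n - 1" using AC(2) by simp
 moreover have "card C = card (C - Z) + card Z"
  using card_Un_disjoint[of "C - Z" Z] fin Z by (simp add: Un_absorb2 Diff_disjoint Int_commute)
 ultimately show cC: "card (C - Z) + card Z + card A = n - 1"
  using AC(1) fin by (simp add: card_Un_disjoint)
 show "card (leg_set Z e 1) = card (C - Z) + card {y \<in> Z \<union> A \<union> {1}. e < y}"
  unfolding leg_set_def using fin dj by (simp, subst card_Un_disjoint) auto
 have "card (leg_set Z e 3) = card (C - Z) + card {y \<in> Z \<union> A \<union> {1}. y < e}"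
  unfolding leg_set_def using fin dj by (simp, subst card_Un_disjoint) auto
 moreover have sp: "card {y \<in> Z \<union> A \<union> {1}. y < e} + 1 + card {y \<in> Z \<union> A \<union> {1}. e < y} = card (Z \<union> A \<union> {1})"
 proof -
  have "Z \<union> A \<union> {1} = {y \<in> Z \<union> A \<union> {1}. y < e} \<union> {e} \<union> {y \<in> Z \<union> A \<union> {1}. e < y}" using e by auto
  hence "card (Z \<union> A \<union> {1}) = card ({y \<in> Z \<union> A \<union> {1}. y < e} \<union> {e} \<union> {y \<in> Z \<union> A \<union> {1}. e < y})" by (rule arg_cong)
  also have "\<dots> = card ({y \<in> Z \<union> A \<union> {1}. y < e} \<union> {e}) + card {y \<in> Z \<union> A \<union> {1}. e < y}"
   using fin by (intro card_Un_disjoint) auto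
  also have "card ({y \<in> Z \<union> A \<union> {1}. y < e} \<union> {e}) = card {y \<in> Z \<union> A \<union> {1}. y < e} + 1"
   using fin by (subst card_Un_disjoint) auto
  finally show ?thesis by simp
 qed
 ultimately show "card (leg_set Z e 3) + card {y \<in> Z \<union> A \<union> {1}. e < y} = n - 1"
  using cY cC by linarith
 show "card {y \<in> Z \<union> A \<union> {1}. e < y} \<le> card Z + card A" using sp cY by linarith
qed

lemma card_J_sum: "card (J 1) + card (J 2) + card (J 3) + card (J 4) = 2 * (n - 1)"
proof -
 have "{..<k} = J 1 \<union> J 2 \<union> J 3 \<union> J 4" using ty by (auto simp: J_def k_def)
 moreover have "card (J 1 \<union> J 2 \<union> J 3 \<union> J 4) = card (J 1) + card (J 2) + card (J 3) + card (J 4)"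
  by (subst card_Un_disjoint, simp, simp, force simp: J_def)+ simp
 ultimately show ?thesis by (metis card_lessThan k_def)
qed

text \<open>For fixed \<open>(Z, e)\<close> the solutions are the families of bijections onto the
  sets \<open>leg_set Z e t\<close>, all with the same determinant. \<open>Z\<close> ranges over the
  subsets of \<open>C\<close> of size \<open>card (J 2)\<close>, which gives the binomial
  coefficient; then \<open>e\<close> is determined, since exactly \<open>n - 1 - card (J 3)\<close>
  elements of \<open>Z \<union> A \<union> {1}\<close> exceed it.\<close>

theorem star_count:
 "(\<Sum>s\<in>{..<k} \<rightarrow>\<^sub>E {1..n}. of_bool (svalid s) * \<bar>dt k (smat s)\<bar>) =
  (if card (J 1) \<le> n - 1 \<and> card (J 3) \<le> n - 1 \<and> card (J 2) + card (J 4) \<le> n - 1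
   then fact (card (J 1)) * fact (card (J 2)) * fact (card (J 3)) * fact (card (J 4)) * (\<Prod>j<k. mu j)
    * real a ^ (n - 1 - card (J 2) - card (J 4)) * real ((n - 1 - card (J 4)) choose card (J 2)) else 0)"
 (is "?l = ?r")
proof -
 let ?F = "{..<k} \<rightarrow>\<^sub>E {1..n}" and ?T = "{1, 2, 3, 4 :: nat}"
 define S where "S Z e = {s \<in> ?F. \<forall>t\<in>?T. bij_betw s (J t) (leg_set Z e t)}" for Z e
 define P where "P = {(Z, e). Z \<subseteq> C \<and> e \<in> Z \<union> A \<union> {1} \<and> S Z e \<noteq> {}}"
 have finF: "finite ?F" by (simp add: finite_PiE)
 have fin: "finite A" "finite C" using An by (meson finite_atLeastAtMost finite_subset)+
 have cards: "card (leg_set Z e t) = card (J t)" if "S Z e \<noteq> {}" "t \<in> ?T" for Z e t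
  using that bij_betw_same_card unfolding S_def by fastforce
 have Pcard: "card Z = card (J 2) \<and> card A = card (J 4) \<and> card (J 1) \<le> n - 1 \<and> card (J 3) \<le> n - 1 \<and> card (J 2) + card (J 4) \<le> n - 1
   \<and> card {y \<in> Z \<union> A \<union> {1}. e < y} = n - 1 - card (J 3)" if "(Z, e) \<in> P" for Z e
 proof -
  have Z: "Z \<subseteq> C" "e \<in> Z \<union> A \<union> {1}" "S Z e \<noteq> {}" using that by (auto simp: P_def)
  have c: "card (leg_set Z e 1) = card (J 1)" "card Z = card (J 2)" "card (leg_set Z e 3) = card (J 3)" "card A = card (J 4)"
   using cards[OF Z(3), of 1] cards[OF Z(3), of 2] cards[OF Z(3), of 3] cards[OF Z(3), of 4] by (auto simp: leg_set_def)
  show ?thesis using c card_leg_sets[OF Z(1,2)] card_J_sum by (intro conjI) linarith+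
 qed
 have SP: "s \<in> (\<Union>(Z, e)\<in>P. S Z e)" if s: "s \<in> ?F" "svalid s" "dt k (smat s) \<noteq> 0" for s
 proof -
  obtain Z e where "Z \<subseteq> C" "e \<in> Z \<union> A \<union> {1}" "\<And>t. t \<in> ?T ==> bij_betw s (J t) (leg_set Z e t)"
   by (rule svalid_structure[OF s(3,1,2)]) blast
  hence "(Z, e) \<in> P" "s \<in> S Z e" using s(1) unfolding P_def S_def by blast+
  thus ?thesis by blast
 qed
 have val: "of_bool (svalid s) * \<bar>dt k (smat s)\<bar> = (\<Prod>j<k. mu j) * real a ^ (n - 1 - card (J 2) - card (J 4))"
  if "(Z, e) \<in> P" "s \<in> S Z e" for Z e s
 proof -
  have Z: "Z \<subseteq> C" "e \<in> Z \<union> A \<union> {1}" "s \<in> ?F" "\<And>t. t \<in> ?T ==> bij_betw s (J t) (leg_set Z e t)"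
   using that by (auto simp: P_def S_def)
  have "card (C - Z) = n - 1 - card (J 2) - card (J 4)"
   using card_leg_sets(4)[OF Z(1,2)] Pcard[OF that(1)] by linarith
  thus ?thesis using configuration_svalid[OF Z] configuration_dt[OF Z] by simp
 qed
 have finP: "finite P"
  by (rule finite_subset[of _ "Pow C \<times> (C \<union> A \<union> {1})"]) (use fin in \<open>auto simp: P_def\<close>)
 have finS: "finite (S Z e)" for Z e unfolding S_def using finF by simp
 \<comment> \<open>\<open>Z\<close> is recovered as the image of the ends of type 2, and
   \<open>e\<close> from its rank.\<close>
 have disj: "S Z e \<inter> S Z' e' = {}" if "(Z, e) \<in> P" "(Z', e') \<in> P" "(Z, e) \<noteq> (Z', e')" for Z e Z' e'
 proof (rule ccontr)
  assume "S Z e \<inter> S Z' e' \<noteq> {}"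
  then obtain s where s: "bij_betw s (J 2) Z" "bij_betw s (J 2) Z'" unfolding S_def leg_set_def by fastforce
  hence ZZ: "Z = Z'" by (metis bij_betw_imp_surj_on)
  have "finite (Z \<union> A \<union> {1})" using fin that by (auto simp: P_def intro: finite_subset)
  moreover have "n - 1 - card (J 3) < card (Z \<union> A \<union> {1})"
   using that(1) Pcard[OF that(1)] card_leg_sets(3)[of Z e] card_J_sum by (auto simp: P_def)
  ultimately have "\<exists>!e. e \<in> Z \<union> A \<union> {1} \<and> card {y \<in> Z \<union> A \<union> {1}. e < y} = n - 1 - card (J 3)"
   by (rule ex1_rank)
  hence "e = e'" using that Pcard[OF that(1)] Pcard[OF that(2)] unfolding P_def ZZ by blast
  thus False using ZZ that(3) by simp
 qed
 have cardS: "card (S Z e) = fact (card (J 1)) * fact (card (J 2)) * fact (card (J 3)) * fact (card (J 4))"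
  if c: "Z \<subseteq> C" "e \<in> Z \<union> A \<union> {1}" "\<And>t. t \<in> ?T ==> card (leg_set Z e t) = card (J t)" for Z e
 proof -
  have U: "(\<Union>t\<in>?T. J t) = {..<k}" using ty by (auto simp: J_def k_def)
  have "leg_set Z e t \<subseteq> C \<union> Z \<union> A \<union> {1}" for t unfolding leg_set_def by auto
  moreover have "C \<union> Z \<union> A \<union> {1} \<subseteq> {1..n}" using c(1) An n by auto
  ultimately have lsub: "leg_set Z e t \<subseteq> {1..n}" for t by blast
  have "S Z e = {s \<in> extensional (\<Union>t\<in>?T. J t). \<forall>t\<in>?T. bij_betw s (J t) (leg_set Z e t)}"
  proof (intro equalityI subsetI)
   fix s assume s: "s \<in> {s \<in> extensional (\<Union>t\<in>?T. J t). \<forall>t\<in>?T. bij_betw s (J t) (leg_set Z e t)}"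
   have "s j \<in> {1..n}" if "j < k" for j
   proof -
    have "j \<in> (\<Union>t\<in>?T. J t)" unfolding U using that by simp
    then obtain t where "t \<in> ?T" "j \<in> J t" by blast
    thus ?thesis using s lsub[of t] bij_betwE by blast
   qed
   thus "s \<in> S Z e" unfolding S_def using s unfolding U by (auto simp: PiE_def)
  next
   fix s assume "s \<in> S Z e"
   thus "s \<in> {s \<in> extensional (\<Union>t\<in>?T. J t). \<forall>t\<in>?T. bij_betw s (J t) (leg_set Z e t)}"
    unfolding U S_def by (simp add: PiE_def)
  qed
  hence "card (S Z e) = (\<Prod>t\<in>?T. fact (card (leg_set Z e t)))"
  proof (simp only:, intro card_fibrewise_bijections)
   show "finite (leg_set Z e t)" for t using lsub[of t] by (rule finite_subset) simp
   show "J t \<inter> J t' = {}" if "t \<noteq> t'" for t t' using that by (auto simp: J_def)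
  qed (use c(3) in auto)
  also have "\<dots> = (\<Prod>t\<in>?T. fact (card (J t)))" by (rule prod.cong) (use c(3) in auto)
  also have "\<dots> = fact (card (J 1)) * fact (card (J 2)) * fact (card (J 3)) * fact (card (J 4))" by simp
  finally show ?thesis .
 qed
 define N where "N = fact (card (J 1)) * fact (card (J 2)) * fact (card (J 3)) * (fact (card (J 4)) :: nat)"
 define W where "W = (\<Prod>j<k. mu j) * real a ^ (n - 1 - card (J 2) - card (J 4))"
 have "?l = (\<Sum>s\<in>(\<Union>(Z, e)\<in>P. S Z e). of_bool (svalid s) * \<bar>dt k (smat s)\<bar>)"
  by (rule sum.mono_neutral_right[OF finF]) (use SP in \<open>auto simp: S_def\<close>)
 also have "\<dots> = (\<Sum>(Z, e)\<in>P. \<Sum>s\<in>S Z e. of_bool (svalid s) * \<bar>dt k (smat s)\<bar>)"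
 proof (subst sum.UNION_disjoint[OF finP])
  show "\<forall>p\<in>P. finite (case p of (Z, e) => S Z e)" using finS by auto
  show "\<forall>p\<in>P. \<forall>q\<in>P. p \<noteq> q \<longrightarrow> (case p of (Z, e) => S Z e) \<inter> (case q of (Z, e) => S Z e) = {}"
   using disj by (metis (no_types, lifting) case_prod_conv surj_pair)
 qed (simp add: case_prod_unfold)
 also have "\<dots> = (\<Sum>(Z, e)\<in>P. real (card (S Z e)) * W)"
  by (intro sum.cong refl) (use val in \<open>auto simp: W_def\<close>)
 also have "\<dots> = (\<Sum>(Z, e)\<in>P. real N * W)"
 proof (intro sum.cong refl, clarify)
  fix Z e assume P: "(Z, e) \<in> P"
  hence "card (S Z e) = N" unfolding N_def by (intro cardS cards) (auto simp: P_def)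
  thus "real (card (S Z e)) * W = real N * W" by simp
 qed
 also have "\<dots> = real (card P) * (real N * W)" by simp
 finally have l: "?l = real (card P) * (real N * W)" .
 show ?thesis
 proof (cases "card (J 1) \<le> n - 1 \<and> card (J 3) \<le> n - 1 \<and> card (J 2) + card (J 4) \<le> n - 1")
  case False
  hence "P = {}" using Pcard by fastforce
  thus ?thesis unfolding l by (subst if_not_P[OF False]) simp
 next
  case True
  have cA: "card A = card (J 4)" using cardA True unfolding J_def k_def by simp
  have cC: "card C = n - 1 - card (J 4)"
   using card_leg_sets(4)[of "{}" 1] cA by simp
  have ex1: "\<exists>!e. (Z, e) \<in> P" if Z: "Z \<subseteq> C" "card Z = card (J 2)" for Z
  proof -
   have finZ: "finite (Z \<union> A \<union> {1})" using fin Z by (auto intro: finite_subset)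
   have r: "n - 1 - card (J 3) < card (Z \<union> A \<union> {1})"
    using Z True cA card_leg_sets(3)[of Z 1] card_J_sum by auto
   obtain e where e: "e \<in> Z \<union> A \<union> {1}" "card {y \<in> Z \<union> A \<union> {1}. e < y} = n - 1 - card (J 3)"
    using ex1_rank[OF finZ r] by blast
   have cl: "card (leg_set Z e t) = card (J t)" if "t \<in> ?T" for t
   proof -
    have "card (leg_set Z e 2) = card (J 2)" "card (leg_set Z e 4) = card (J 4)"
     using Z cA by (auto simp: leg_set_def)
    moreover have "card (leg_set Z e 1) = card (J 1)" "card (leg_set Z e 3) = card (J 3)"
     using card_leg_sets[OF Z(1) e(1)] e(2) Z(2) cA card_J_sum True by linarith+
    ultimately show ?thesis using that by auto
   qed
   have "card (S Z e) \<noteq> 0" using cardS[OF Z(1) e(1) cl] by simp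
   hence "S Z e \<noteq> {}" by auto
   hence "(Z, e) \<in> P" using Z e by (auto simp: P_def)
   moreover have "e' = e" if "(Z, e') \<in> P" for e'
    using ex1_rank[OF finZ r] e Pcard[OF that] that unfolding P_def by blast
   ultimately show ?thesis by blast
  qed
  have "bij_betw fst P {Z. Z \<subseteq> C \<and> card Z = card (J 2)}"
   unfolding bij_betw_def
  proof
   have Psub: "Z \<subseteq> C \<and> card Z = card (J 2)" if "(Z, e) \<in> P" for Z e
    using Pcard[OF that] that by (auto simp: P_def)
   show "inj_on fst P"
   proof (rule inj_onI, clarsimp)
    fix Z e e' assume "(Z, e) \<in> P" "(Z, e') \<in> P"
    thus "e = e'" using ex1[of Z] Psub by blast
   qed
   show "fst ` P = {Z. Z \<subseteq> C \<and> card Z = card (J 2)}"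
   proof (intro equalityI subsetI)
    fix Z assume "Z \<in> {Z. Z \<subseteq> C \<and> card Z = card (J 2)}"
    then obtain e where "(Z, e) \<in> P" using ex1 by blast
    thus "Z \<in> fst ` P" by force
   next
    fix Z assume "Z \<in> fst ` P"
    then obtain e where "(Z, e) \<in> P" by force
    thus "Z \<in> {Z. Z \<subseteq> C \<and> card Z = card (J 2)}" using Psub by blast
   qed
  qed
  hence "card P = card {Z. Z \<subseteq> C \<and> card Z = card (J 2)}" by (rule bij_betw_same_card)
  also have "\<dots> = card C choose card (J 2)" by (rule n_subsets[OF fin(2)])
  finally have "card P = (n - 1 - card (J 4)) choose card (J 2)" unfolding cC .
  thus ?thesis unfolding l N_def W_def using True by (simp add: mult_ac)
 qed
qed

end

section \<open>Hierarchies of clusters\<close>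

text \<open>The sets of marked points behind the vertices of a rooted tree, together with the distances of
 the vertices from the root vertex.\<close>

locale hierarchy =
 fixes n :: nat and F :: "nat set set" and dpt :: "nat set => real"
 assumes n: "n \<ge> 3"
  and top_in: "{2..n} \<in> F"
  and sub: "\<And>R. R \<in> F ==> R \<subseteq> {2..n} \<and> 2 \<le> card R"
  and laminar: "\<And>R R'. R \<in> F ==> R' \<in> F ==> R \<subseteq> R' \<or> R' \<subseteq> R \<or> R \<inter> R' = {}"
  and dpt_top: "dpt {2..n} = 0"
  and dpt_less: "\<And>R R'. R \<in> F ==> R' \<in> F ==> R \<subset> R' ==> dpt R' < dpt R"

text \<open>The edges and legs of the tree, each named by the marked points behind it; the root
  cluster names the leg of the first marked point.\<close>

definition cells :: "nat => nat set set => nat set set" where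
 "cells n F = F \<union> (\<lambda>i. {i}) ` {2..n}"

text \<open>The vertex farthest from the root behind which all of \<open>X\<close> lies: by
  laminarity the clusters containing \<open>X\<close> form a chain, and their intersection is the
  smallest.\<close>

definition join :: "nat set set => nat set => nat set" where
 "join F X = \<Inter>{R \<in> F. X \<subseteq> R}"

definition above :: "nat set set => nat set => nat set" where
 "above F Q = \<Inter>{R \<in> F. Q \<subset> R}"

lemma Inter_chain_mem:
 assumes "finite S" "S \<noteq> {}" "\<And>A B. A \<in> S ==> B \<in> S ==> A \<subseteq> B \<or> B \<subseteq> A"
 shows "\<Inter>S \<in> S"
 using assms
proof (induction S rule: finite_ne_induct)
 case (insert A S)
 have "\<Inter>S \<in> S" by (rule insert.IH) (use insert.prems in blast)
 hence "A \<subseteq> \<Inter>S \<or> \<Inter>S \<subseteq> A" using insert.prems by blast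
 hence "\<Inter>(insert A S) = A \<or> \<Inter>(insert A S) = \<Inter>S" by auto
 thus ?case using \<open>\<Inter>S \<in> S\<close> by auto
qed simp

context hierarchy
begin

lemma finite_F: "finite F" using sub by (intro finite_subset[of F "Pow {2..n}"]) auto

lemma finite_cells: "finite (cells n F)" unfolding cells_def using finite_F by simp

lemma cell_sub: "Q \<in> cells n F ==> Q \<subseteq> {2..n}" "Q \<in> cells n F ==> Q \<noteq> {}"
 using sub unfolding cells_def by force+

lemma cell_laminar:
 assumes "Q \<in> cells n F" "Q' \<in> cells n F"
 shows "Q \<subseteq> Q' \<or> Q' \<subseteq> Q \<or> Q \<inter> Q' = {}"
 using assms laminar unfolding cells_def by auto

lemma above_in:
 assumes Q: "Q \<in> cells n F" "Q \<noteq> {2..n}"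
 shows "above F Q \<in> F" "Q \<subset> above F Q" "\<And>R. R \<in> F ==> Q \<subset> R ==> above F Q \<subseteq> R"
proof -
 have "\<Inter>{R \<in> F. Q \<subset> R} \<in> {R \<in> F. Q \<subset> R}"
 proof (rule Inter_chain_mem)
  show "{R \<in> F. Q \<subset> R} \<noteq> {}" using top_in cell_sub(1)[OF Q(1)] Q(2) by blast
  show "A \<subseteq> B \<or> B \<subseteq> A" if "A \<in> {R \<in> F. Q \<subset> R}" "B \<in> {R \<in> F. Q \<subset> R}" for A B
   using that laminar[of A B] cell_sub(2)[OF Q(1)] by blast
 qed (use finite_F in simp)
 thus "above F Q \<in> F" "Q \<subset> above F Q" unfolding above_def by auto
 show "above F Q \<subseteq> R" if "R \<in> F" "Q \<subset> R" for R unfolding above_def using that by blast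
qed

lemma join_in:
 assumes "X \<noteq> {}" "X \<subseteq> {2..n}"
 shows "join F X \<in> F" "X \<subseteq> join F X"
proof -
 have "\<Inter>{R \<in> F. X \<subseteq> R} \<in> {R \<in> F. X \<subseteq> R}"
 proof (rule Inter_chain_mem)
  show "{R \<in> F. X \<subseteq> R} \<noteq> {}" using top_in assms by blast
  show "A \<subseteq> B \<or> B \<subseteq> A" if "A \<in> {R \<in> F. X \<subseteq> R}" "B \<in> {R \<in> F. X \<subseteq> R}" for A B
   using that laminar[of A B] assms by blast
 qed (use finite_F in simp)
 thus "join F X \<in> F" "X \<subseteq> join F X" unfolding join_def by auto
qed

text \<open>Continuity at the vertex \<open>above F Q\<close>: for a marked point outside
  \<open>Q\<close>, the paths separate either at this vertex or where they do so for the parent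
  cell.\<close>

lemma join_above:
 assumes Q: "Q \<in> cells n F" "Q \<noteq> {2..n}" and i: "i \<notin> Q"
 shows "join F (insert i Q) = (if i \<in> above F Q then above F Q else join F (insert i (above F Q)))"
proof (cases "i \<in> above F Q")
 case True
 have "R \<in> F \<and> insert i Q \<subseteq> R \<longleftrightarrow> R \<in> F \<and> Q \<subset> R" for R
  using above_in(3)[OF Q, of R] True i by blast
 thus ?thesis using True unfolding join_def above_def by simp
next
 case False
 have "R \<in> F \<and> insert i Q \<subseteq> R \<longleftrightarrow> R \<in> F \<and> insert i (above F Q) \<subseteq> R" for R
  using above_in(2)[OF Q] above_in(3)[OF Q, of R] i by blast
 thus ?thesis using False unfolding join_def by simp
qed

text \<open>The cells containing \<open>i\<close> form a chain from \<open>{i}\<close> to the root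
  cluster, and \<open>above F\<close> moves one step along it. All of them except \<open>{i}\<close>
  are clusters.\<close>

lemma above_bij:
 assumes i: "i \<in> {2..n}"
 shows "bij_betw (above F) {Q \<in> cells n F. Q \<noteq> {2..n} \<and> i \<in> Q} {R \<in> F. i \<in> R}"
 unfolding bij_betw_def
proof (intro conjI equalityI subsetI)
 show "inj_on (above F) {Q \<in> cells n F. Q \<noteq> {2..n} \<and> i \<in> Q}"
 proof (rule inj_onI)
  have *: False if QQ: "Q \<in> cells n F" "Q \<noteq> {2..n}" "Q' \<in> cells n F" "Q' \<noteq> {2..n}" "Q \<subset> Q'" "above F Q = above F Q'" for Q Q'
  proof -
   have "Q' \<in> F"
   proof (rule ccontr)
    assume "Q' \<notin> F"
    then obtain i' where "Q' = {i'}" using QQ(3) by (auto simp: cells_def)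
    thus False using QQ(5) cell_sub(2)[OF QQ(1)] by blast
   qed
   hence "above F Q \<subseteq> Q'" using above_in(3)[OF that(1,2)] that(5) by blast
   thus False using above_in(2)[OF that(3,4)] that(6) by blast
  qed
  fix Q Q' assume Q: "Q \<in> {Q \<in> cells n F. Q \<noteq> {2..n} \<and> i \<in> Q}" "Q' \<in> {Q \<in> cells n F. Q \<noteq> {2..n} \<and> i \<in> Q}" "above F Q = above F Q'"
  hence "Q \<subseteq> Q' \<or> Q' \<subseteq> Q" using cell_laminar[of Q Q'] by blast
  thus "Q = Q'" using *[of Q Q'] *[of Q' Q] Q by auto
 qed
 fix R assume R: "R \<in> {R \<in> F. i \<in> R}"
 let ?S = "{Q \<in> cells n F. i \<in> Q \<and> Q \<subset> R}"
 have "2 \<le> card R" "R \<subseteq> {2..n}" using R sub by auto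
 hence "R \<noteq> {i}" by auto
 hence "{i} \<subset> R" using R by blast
 hence ne: "?S \<noteq> {}" using i unfolding cells_def by blast
 have "finite ?S" using finite_cells by simp
 from finite_has_maximal[OF this ne] obtain Q where Q: "Q \<in> ?S" and "\<forall>Q'\<in>?S. Q \<subseteq> Q' \<longrightarrow> Q = Q'"
  by (rule bexE)
 hence Qmax: "Q' \<in> ?S ==> Q \<subseteq> Q' ==> Q = Q'" for Q' by simp
 have Q': "Q \<in> cells n F" "Q \<noteq> {2..n}" using Q \<open>R \<subseteq> {2..n}\<close> by auto
 have a: "above F Q \<subseteq> R" using above_in(3)[OF Q'] Q R by blast
 have "above F Q = R"
 proof (rule ccontr)
  assume "above F Q \<noteq> R"
  hence "above F Q \<in> ?S" using a above_in(1,2)[OF Q'] Q by (auto simp: cells_def)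
  thus False using Qmax above_in(2)[OF Q'] by blast
 qed
 thus "R \<in> above F ` {Q \<in> cells n F. Q \<noteq> {2..n} \<and> i \<in> Q}" using Q Q' by blast
next
 fix R assume "R \<in> above F ` {Q \<in> cells n F. Q \<noteq> {2..n} \<and> i \<in> Q}"
 thus "R \<in> {R \<in> F. i \<in> R}" using above_in by blast
qed

end

text \<open>The parameter of a cell \<open>Q\<close> is the depth of a point on the edge above the cluster \<open>Q\<close>, or
 on the leg of a marked point if \<open>Q\<close> is a singleton; on the leg above the root cluster it is
 negative. Row \<open>r\<close> stands for the coordinate \<open>r mod 2\<close> of the marked point \<open>r div 2 + 2\<close>.\<close>

definition cell_base :: "nat set set => (nat set => real) => (nat => nat => real) => nat => nat set => nat => real" where
 "cell_base F dpt dl j Q r = (if r div 2 + 2 \<in> Q then 0 else dpt (join F (insert (r div 2 + 2) Q))) * dl j r"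

definition cell_col :: "(nat => nat => real) => nat => nat set => nat => real" where
 "cell_col dl j Q r = of_bool (r div 2 + 2 \<in> Q) * dl j r"

context hierarchy
begin

text \<open>At the vertex of a cluster \<open>R\<close> the edge above \<open>R\<close> ends and the
  cells \<open>Q\<close> with \<open>above F Q = R\<close> start. The row of a marked point
  \<open>i\<close> in \<open>R\<close> sees exactly one of these \<open>Q\<close>, with the same
  entry as for \<open>R\<close>; and by \<open>join_above\<close> all these cells give the same
  point there.\<close>

lemma hierarchy_balanced:
 "balanced_cells (2 * (n - 1)) (cells n F) (cell_base F dpt dl) (cell_col dl)
   (\<lambda>Q. Q \<noteq> {2..n}) (\<lambda>Q. Q \<in> F) (\<lambda>Q. dpt (above F Q)) dpt"
proof
 show "finite (cells n F)" by (rule finite_cells)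
 show "dpt (above F Q) < dpt Q" if "Q \<in> cells n F" "Q \<noteq> {2..n}" "Q \<in> F" for Q
  using dpt_less above_in[OF that(1,2)] that(3) by blast
 fix j r :: nat and f :: "(nat => real) => real"
 assume r: "r < 2 * (n - 1)"
 define i where "i = r div 2 + 2"
 have i: "i \<in> {2..n}" unfolding i_def using r by auto
 have pt: "(\<lambda>r. cell_base F dpt dl j Q r + dpt (above F Q) * cell_col dl j Q r)
   = (\<lambda>r. cell_base F dpt dl j (above F Q) r + dpt (above F Q) * cell_col dl j (above F Q) r)"
  if "Q \<in> cells n F" "Q \<noteq> {2..n}" for Q
  using above_in(2)[OF that] join_above[OF that] unfolding cell_base_def cell_col_def by (auto simp: fun_eq_iff)
 let ?f = "\<lambda>R. f (\<lambda>r. cell_base F dpt dl j R r + dpt R * cell_col dl j R r) * dl j r"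
 have "(\<Sum>Q | Q \<in> cells n F \<and> Q \<in> F. f (\<lambda>r. cell_base F dpt dl j Q r + dpt Q * cell_col dl j Q r) * cell_col dl j Q r)
   = (\<Sum>R | R \<in> F \<and> i \<in> R. ?f R)"
  by (rule sum.mono_neutral_cong_right) (use finite_cells in \<open>auto simp: cell_col_def cells_def i_def\<close>)
 also have "\<dots> = (\<Sum>Q | Q \<in> cells n F \<and> Q \<noteq> {2..n} \<and> i \<in> Q. ?f (above F Q))"
  by (rule sum.reindex_bij_betw[OF above_bij[OF i], symmetric])
 also have "\<dots> = (\<Sum>Q | Q \<in> cells n F \<and> Q \<noteq> {2..n}. f (\<lambda>r. cell_base F dpt dl j Q r + dpt (above F Q) * cell_col dl j Q r) * cell_col dl j Q r)"
 proof (rule sum.mono_neutral_cong_left)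
  fix Q assume "Q \<in> {Q \<in> cells n F. Q \<noteq> {2..n} \<and> i \<in> Q}"
  thus "?f (above F Q) = f (\<lambda>r. cell_base F dpt dl j Q r + dpt (above F Q) * cell_col dl j Q r) * cell_col dl j Q r"
   using pt[of Q] by (simp add: cell_col_def i_def)
 qed (use finite_cells in \<open>auto simp: cell_col_def i_def\<close>)
 finally show "(\<Sum>Q | Q \<in> cells n F \<and> Q \<in> F. f (\<lambda>r. cell_base F dpt dl j Q r + dpt Q * cell_col dl j Q r) * cell_col dl j Q r)
   = (\<Sum>Q | Q \<in> cells n F \<and> Q \<noteq> {2..n}. f (\<lambda>r. cell_base F dpt dl j Q r + dpt (above F Q) * cell_col dl j Q r) * cell_col dl j Q r)" .
qed

end

section \<open>General position\<close>

text \<open>A point of the moment curve lies on a given hyperplane only if its parameter is a root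
  of a nonzero polynomial. So all large parameters except finitely many avoid finitely many
  hyperplanes.\<close>

lemma avoid_roots:
 fixes Y :: "(nat => real) set"
 assumes "finite Y" "\<And>y. y \<in> Y ==> \<exists>r<k. y r \<noteq> 0"
 obtains s :: real where "s > s0" "\<And>y. y \<in> Y ==> (\<Sum>r<k. y r * s ^ r) \<noteq> 0"
proof -
 have "finite {s. (\<Sum>r<k. y r * s ^ r) = 0}" if y: "y \<in> Y" for y
 proof -
  obtain r where r: "r < k" "y r \<noteq> 0" using assms(2)[OF y] by blast
  hence "finite {s. (\<Sum>i\<le>k - 1. y i * s ^ i) = 0}"
   unfolding polyfun_finite_roots by (intro exI[of _ r]) auto
  moreover have "{..<k} = {..k - 1}" using r by auto
  ultimately show ?thesis by simp
 qed
 hence fin: "finite (\<Union>y\<in>Y. {s. (\<Sum>r<k. y r * s ^ r) = 0})" using assms(1) by blast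
 have "\<not> {s0<..} \<subseteq> (\<Union>y\<in>Y. {s. (\<Sum>r<k. y r * s ^ r) = 0})"
  using infinite_Ioi[of s0] fin finite_subset by blast
 thus ?thesis using that by auto
qed

definition form :: "'e set => nat => ('e => real) => (nat => real \<times> real) => ('e => real) => (nat => real \<times> real) => real" where
 "form E n \<alpha> \<beta> t x = (\<Sum>e\<in>E. \<alpha> e * t e) + (\<Sum>i\<in>{1..n}. \<beta> i \<bullet> x i)"

definition diff_vec :: "(nat => real \<times> real) => nat => real" where
 "diff_vec x r = (if even r then fst (x (r div 2 + 2) - x 1) else snd (x (r div 2 + 2) - x 1))"

lemma sum_even_odd: "(\<Sum>r<2 * (N :: nat). f r) = (\<Sum>i<N. f (2 * i) + f (2 * i + 1) :: real)"
 by (induction N) auto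

text \<open>A form in the differences \<open>x i - x 1\<close> is a form in the points, the
  coefficient of \<open>x 1\<close> being minus the sum of the others. A nonzero coefficient
  survives at an index at least 2.\<close>

lemma form_diff_vec:
 assumes "r < 2 * (n - 1)" "y r \<noteq> 0"
 obtains \<beta> where "\<exists>i\<in>{1..n}. \<beta> i \<noteq> 0"
  "\<And>\<alpha> t x. form E n \<alpha> \<beta> t x = (\<Sum>e\<in>E. \<alpha> e * t e) + (\<Sum>r<2 * (n - 1). y r * diff_vec x r)"
proof -
 define b where "b i = (y (2 * (i - 2)), y (2 * (i - 2) + 1))" for i
 define \<beta> where "\<beta> i = (if i = 1 then - (\<Sum>i\<in>{2..n}. b i) else b i)" for i
 have SS: "Suc (Suc (i - 2)) = i" if "2 \<le> i" for i :: nat using that by simp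
 have n1: "n \<ge> 2" using assms by linarith
 hence I: "{1..n} = insert 1 {2..n}" by auto
 have *: "(\<Sum>i\<in>{1..n}. \<beta> i \<bullet> x i) = (\<Sum>r<2 * (n - 1). y r * diff_vec x r)" for x
 proof -
  have "(\<Sum>i\<in>{1..n}. \<beta> i \<bullet> x i) = \<beta> 1 \<bullet> x 1 + (\<Sum>i\<in>{2..n}. \<beta> i \<bullet> x i)" unfolding I by simp
  also have "(\<Sum>i\<in>{2..n}. \<beta> i \<bullet> x i) = (\<Sum>i\<in>{2..n}. b i \<bullet> x i)" by (rule sum.cong) (auto simp: \<beta>_def)
  also have "\<beta> 1 \<bullet> x 1 = - (\<Sum>i\<in>{2..n}. b i \<bullet> x 1)" by (simp add: \<beta>_def inner_sum_left)
  also have "- (\<Sum>i\<in>{2..n}. b i \<bullet> x 1) + (\<Sum>i\<in>{2..n}. b i \<bullet> x i) = (\<Sum>i\<in>{2..n}. b i \<bullet> (x i - x 1))"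
   by (simp add: inner_diff_right sum_subtractf)
  also have "\<dots> = (\<Sum>i<n - 1. b (i + 2) \<bullet> (x (i + 2) - x 1))"
   by (rule sum.reindex_bij_witness[of _ "\<lambda>i. i + 2" "\<lambda>i. i - 2"]) (auto simp: SS)
  also have "\<dots> = (\<Sum>i<n - 1. y (2 * i) * diff_vec x (2 * i) + y (2 * i + 1) * diff_vec x (2 * i + 1))"
   by (rule sum.cong) (auto simp: b_def inner_prod_def diff_vec_def)
  also have "\<dots> = (\<Sum>r<2 * (n - 1). y r * diff_vec x r)" by (rule sum_even_odd[symmetric])
  finally show ?thesis .
 qed
 have "\<beta> (r div 2 + 2) \<noteq> 0"
  using assms(2) by (cases "even r") (auto simp: \<beta>_def b_def zero_prod_def elim!: evenE oddE)
 moreover have "r div 2 + 2 \<in> {1..n}" using assms(1) by auto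
 ultimately have "\<exists>i\<in>{1..n}. \<beta> i \<noteq> 0" by blast
 thus ?thesis by (rule that) (unfold form_def *, rule refl)
qed

definition lin :: "'e set => (('e => real) => real) => bool" where
 "lin E f \<longleftrightarrow> (\<exists>\<alpha>. \<forall>t. f t = (\<Sum>e\<in>E. \<alpha> e * t e))"

lemma lin_0: "lin E (\<lambda>t. 0)" unfolding lin_def by (rule exI[of _ "\<lambda>e. 0"]) simp

lemma lin_add: assumes "lin E f" "lin E g" shows "lin E (\<lambda>t. f t + g t)"
proof -
 from assms obtain \<alpha> \<beta> where "\<forall>t. f t = (\<Sum>e\<in>E. \<alpha> e * t e)" "\<forall>t. g t = (\<Sum>e\<in>E. \<beta> e * t e)" unfolding lin_def by blast
 thus ?thesis unfolding lin_def by (intro exI[of _ "\<lambda>e. \<alpha> e + \<beta> e"]) (simp add: sum.distrib distrib_right)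
qed

lemma lin_mult: assumes "lin E f" shows "lin E (\<lambda>t. c * f t)"
proof -
 from assms obtain \<alpha> where "\<forall>t. f t = (\<Sum>e\<in>E. \<alpha> e * t e)" unfolding lin_def by blast
 thus ?thesis unfolding lin_def by (intro exI[of _ "\<lambda>e. c * \<alpha> e"]) (simp add: sum_distrib_left mult.assoc)
qed

lemma lin_diff: "lin E f ==> lin E g ==> lin E (\<lambda>t. f t - g t)"
 using lin_add[of E f "\<lambda>t. -1 * g t"] lin_mult[of E g "-1"] by simp

lemma lin_sum: "(\<And>s. s \<in> S ==> lin E (f s)) ==> lin E (\<lambda>t. \<Sum>s\<in>S. f s t)"
 by (induction S rule: infinite_finite_induct) (auto intro: lin_0 lin_add)

lemma forms_exist:
 assumes "finite Ps"
  and "\<And>P. P \<in> Ps ==> \<exists>y f r. r < 2 * (n - 1) \<and> y r \<noteq> 0 \<and> lin E f \<and> (\<forall>t x. P t x = (\<Sum>r<2 * (n - 1). y r * diff_vec x r) + f t)"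
 obtains H :: "(('e => real) \<times> (nat => real \<times> real)) set" where "finite H" "\<And>\<alpha> \<beta>. (\<alpha>, \<beta>) \<in> H ==> \<exists>i\<in>{1..n}. \<beta> i \<noteq> 0"
  "\<And>t x P. (\<forall>(\<alpha>, \<beta>)\<in>H. form E n \<alpha> \<beta> t x \<noteq> 0) ==> P \<in> Ps ==> P t x \<noteq> 0"
proof -
 have "\<exists>h. (\<exists>i\<in>{1..n}. snd h i \<noteq> 0) \<and> (\<forall>t x. P t x = form E n (fst h) (snd h) t x)" if P: "P \<in> Ps" for P
 proof -
  obtain y f r where y: "r < 2 * (n - 1)" "y r \<noteq> 0" "lin E f" "\<And>t x. P t x = (\<Sum>r<2 * (n - 1). y r * diff_vec x r) + f t"
   using assms(2)[OF P] by blast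
  from y(3) obtain \<alpha> where a: "\<And>t. f t = (\<Sum>e\<in>E. \<alpha> e * t e)" unfolding lin_def by blast
  obtain \<beta> where b: "\<exists>i\<in>{1..n}. \<beta> i \<noteq> 0"
   "\<And>\<alpha> t x. form E n \<alpha> \<beta> t x = (\<Sum>e\<in>E. \<alpha> e * t e) + (\<Sum>r<2 * (n - 1). y r * diff_vec x r)"
   using form_diff_vec[where y = y and r = r and n = n, OF y(1,2)] by blast
  show ?thesis by (rule exI[of _ "(\<alpha>, \<beta>)"]) (use b y(4) a in simp)
 qed
 then obtain h where h: "\<And>P. P \<in> Ps ==> \<exists>i\<in>{1..n}. snd (h P) i \<noteq> 0"
   "\<And>P t x. P \<in> Ps ==> P t x = form E n (fst (h P)) (snd (h P)) t x"
  by metis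
 show ?thesis
 proof (rule that[of "h ` Ps"])
  show "finite (h ` Ps)" using assms(1) by simp
  show "\<exists>i\<in>{1..n}. \<beta> i \<noteq> 0" if "(\<alpha>, \<beta>) \<in> h ` Ps" for \<alpha> \<beta> using that h(1) by (metis (no_types, lifting) imageE snd_conv)
  show "P t x \<noteq> 0" if "\<forall>(\<alpha>, \<beta>)\<in>h ` Ps. form E n \<alpha> \<beta> t x \<noteq> 0" "P \<in> Ps" for t x P
   using that h(2) by (auto simp: case_prod_unfold)
 qed
qed

section \<open>The weighted count over an arbitrary tree in general position\<close>

definition cell_solution ::
  "nat => nat set set => (nat set => real) => (nat => nat => real) => (nat => nat set) => (nat => real) => (nat => real) => bool" where
 "cell_solution n F dpt dl \<sigma> z D \<longleftrightarrow>
   (\<forall>j<2 * (n - 1). (\<sigma> j \<noteq> {2..n} \<longrightarrow> dpt (above F (\<sigma> j)) < D j) \<and> (\<sigma> j \<in> F \<longrightarrow> D j < dpt (\<sigma> j))) \<and>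
   (\<forall>r<2 * (n - 1). (\<Sum>j<2 * (n - 1). cell_base F dpt dl j (\<sigma> j) r + D j * cell_col dl j (\<sigma> j) r) = z r)"

definition cell_matrix :: "(nat => nat => real) => (nat => nat set) => nat => nat => real" where
 "cell_matrix dl \<sigma> r j = cell_col dl j (\<sigma> j) r"

text \<open>The count is carried along a segment in a fixed direction \<open>w\<close> until every
  parameter has left all bounded cells. Only legs remain, so the far count is that of a star,
  whatever \<open>F\<close> is. The direction is chosen before the hyperplanes, since these must be
  independent of the lengths and the points; the length \<open>U\<close> of the segment may depend
  on both.\<close>

theorem generic_cell_count:
 fixes F :: "nat set set" and E :: "'e set" and c :: "nat set => 'e => real"
 assumes a: "a \<ge> 1" and n: "n \<ge> 3"
  and ty: "\<And>j. j < 2 * (n - 1) ==> ty j \<in> {1, 2, 3, 4 :: nat}" and mu: "\<And>j. j < 2 * (n - 1) ==> mu j > (0 :: real)"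
  and hier: "\<And>t. (\<And>e. e \<in> E ==> t e > 0) ==> hierarchy n F (\<lambda>R. \<Sum>e\<in>E. c R e * t e)"
  and dl: "dl = (\<lambda>j r. if even r then leg_x ty mu j else leg_y a ty mu j)"
  and J: "J = (\<lambda>t. card {j. j < 2 * (n - 1) \<and> ty j = t})"
 obtains H :: "(('e => real) \<times> (nat => real \<times> real)) set" where
  "finite H" "\<And>\<alpha> \<beta>. (\<alpha>, \<beta>) \<in> H ==> \<exists>i\<in>{1..n}. \<beta> i \<noteq> 0"
  "\<And>t x dpt. (\<And>e. e \<in> E ==> t e > 0) ==> (\<forall>(\<alpha>, \<beta>)\<in>H. form E n \<alpha> \<beta> t x \<noteq> 0) ==> dpt = (\<lambda>R. \<Sum>e\<in>E. c R e * t e) ==>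
   (\<Sum>\<sigma>\<in>{..<2 * (n - 1)} \<rightarrow>\<^sub>E cells n F. of_bool (\<exists>D. cell_solution n F dpt dl \<sigma> (diff_vec x) D) * \<bar>dt (2 * (n - 1)) (cell_matrix dl \<sigma>)\<bar>)
   = (if J 1 \<le> n - 1 \<and> J 3 \<le> n - 1 \<and> J 2 + J 4 \<le> n - 1
     then fact (J 1) * fact (J 2) * fact (J 3) * fact (J 4) * (\<Prod>j<2 * (n - 1). mu j)
      * real a ^ (n - 1 - J 2 - J 4) * real ((n - 1 - J 4) choose J 2) else 0)"
  "\<And>t x dpt \<sigma> D. (\<And>e. e \<in> E ==> t e > 0) ==> (\<forall>(\<alpha>, \<beta>)\<in>H. form E n \<alpha> \<beta> t x \<noteq> 0) ==> dpt = (\<lambda>R. \<Sum>e\<in>E. c R e * t e) ==>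
   \<sigma> \<in> {..<2 * (n - 1)} \<rightarrow>\<^sub>E cells n F ==>
   (\<And>r. r < 2 * (n - 1) ==> (\<Sum>j<2 * (n - 1). cell_base F dpt dl j (\<sigma> j) r + D j * cell_col dl j (\<sigma> j) r) = diff_vec x r) ==>
   dt (2 * (n - 1)) (cell_matrix dl \<sigma>) \<noteq> 0 \<and> inj_on D {..<2 * (n - 1)} \<and>
   (\<forall>j<2 * (n - 1). D j \<noteq> dpt (\<sigma> j) \<and> D j \<noteq> dpt (above F (\<sigma> j)))"
proof -
 define k where "k = 2 * (n - 1)"
 define Fs where "Fs = {..<k} \<rightarrow>\<^sub>E cells n F"
 define A where "A = cell_matrix dl"
 define dp where "dp t R = (\<Sum>e\<in>E. c R e * t e)" for t R
 define base where "base \<sigma> t r = (\<Sum>j<k. cell_base F (dp t) dl j (\<sigma> j) r)" for \<sigma> t r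
 have h1: "hierarchy n F (dp (\<lambda>e. 1))" unfolding dp_def by (rule hier) simp
 have finF: "finite F" "finite (cells n F)"
  using hierarchy.finite_F[OF h1] hierarchy.finite_cells[OF h1] by auto
 have finFs: "finite Fs" unfolding Fs_def using finF by (simp add: finite_PiE)
 have lin_dp: "lin E (\<lambda>t. dp t R)" for R unfolding lin_def dp_def by blast
 have lin_base: "lin E (\<lambda>t. base \<sigma> t r)" for \<sigma> r
  unfolding base_def
 proof (rule lin_sum)
  fix j
  show "lin E (\<lambda>t. cell_base F (dp t) dl j (\<sigma> j) r)"
   unfolding cell_base_def using lin_mult[OF lin_dp, of "dl j r"] lin_0[of E]
   by (cases "r div 2 + 2 \<in> \<sigma> j") (auto simp: mult.commute)
 qed
 have "\<forall>\<sigma>. \<exists>B. dt k (A \<sigma>) \<noteq> 0 \<longrightarrow> (\<forall>b i. i < k \<longrightarrow> (\<Sum>j<k. A \<sigma> i j * (\<Sum>r<k. B j r * b r)) = b i) \<and>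
  (\<forall>x b j. (\<forall>i<k. (\<Sum>j<k. A \<sigma> i j * x j) = b i) \<longrightarrow> j < k \<longrightarrow> x j = (\<Sum>r<k. B j r * b r))"
 proof
  fix \<sigma>
  show "\<exists>B. dt k (A \<sigma>) \<noteq> 0 \<longrightarrow> (\<forall>b i. i < k \<longrightarrow> (\<Sum>j<k. A \<sigma> i j * (\<Sum>r<k. B j r * b r)) = b i) \<and>
   (\<forall>x b j. (\<forall>i<k. (\<Sum>j<k. A \<sigma> i j * x j) = b i) \<longrightarrow> j < k \<longrightarrow> x j = (\<Sum>r<k. B j r * b r))"
  proof (cases "dt k (A \<sigma>) = 0")
   case False
   thus ?thesis by (rule dt_inverse) blast
  qed simp
 qed
 from choice[OF this] obtain B where
  B1: "\<And>\<sigma> b i. dt k (A \<sigma>) \<noteq> 0 ==> i < k ==> (\<Sum>j<k. A \<sigma> i j * (\<Sum>r<k. B \<sigma> j r * b r)) = b i" and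
  B2: "\<And>\<sigma> x b j. dt k (A \<sigma>) \<noteq> 0 ==> (\<And>i. i < k ==> (\<Sum>j<k. A \<sigma> i j * x j) = b i) ==> j < k ==> x j = (\<Sum>r<k. B \<sigma> j r * b r)"
  by blast
 have BA: "(\<Sum>r<k. B \<sigma> j r * A \<sigma> r j') = of_bool (j = j')" if "dt k (A \<sigma>) \<noteq> 0" "j < k" "j' < k" for \<sigma> j j'
 proof -
  have "(\<Sum>l<k. A \<sigma> i l * of_bool (l = j')) = A \<sigma> i j'" for i
   using that(3) by (simp add: of_bool_def if_distrib[of "(*) _"] cong: if_cong)
  thus ?thesis using B2[OF that(1), of "\<lambda>l. of_bool (l = j')" "\<lambda>r. A \<sigma> r j'" j] that(2) by simp
 qed
 \<comment> \<open>The rows of the inverse matrix are linearly independent. So a parameter, or a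
   combination of two that involves the first, depends nontrivially on the points.\<close>
 have comb: "\<exists>r<k. p * B \<sigma> j r - q * B \<sigma> j' r \<noteq> 0"
  if s: "dt k (A \<sigma>) \<noteq> 0" "j < k" "j' < k" "p \<noteq> 0" "j \<noteq> j' \<or> q = 0" for \<sigma> j j' p q
 proof (rule ccontr)
  assume "\<not> ?thesis"
  hence "(\<Sum>r<k. (p * B \<sigma> j r - q * B \<sigma> j' r) * A \<sigma> r j) = 0" by (intro sum.neutral) auto
  moreover have "(\<Sum>r<k. (p * B \<sigma> j r - q * B \<sigma> j' r) * A \<sigma> r j) = p * (\<Sum>r<k. B \<sigma> j r * A \<sigma> r j) - q * (\<Sum>r<k. B \<sigma> j' r * A \<sigma> r j)"
   by (simp add: sum_subtractf sum_distrib_left algebra_simps)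
  ultimately show False using BA[OF s(1)] s by auto
 qed
 have "\<forall>\<sigma>. \<exists>y. dt k (A \<sigma>) = 0 \<longrightarrow> (\<exists>r<k. y r \<noteq> 0) \<and> (\<forall>j<k. (\<Sum>i<k. y i * A \<sigma> i j) = 0)"
 proof
  fix \<sigma>
  show "\<exists>y. dt k (A \<sigma>) = 0 \<longrightarrow> (\<exists>r<k. y r \<noteq> 0) \<and> (\<forall>j<k. (\<Sum>i<k. y i * A \<sigma> i j) = 0)"
  proof (cases "dt k (A \<sigma>) = 0")
   case True
   thus ?thesis by (rule dt_zero_imp_left_kernel) blast
  qed simp
 qed
 from choice[OF this] obtain y0 where
  y0: "\<And>\<sigma>. dt k (A \<sigma>) = 0 ==> \<exists>r<k. y0 \<sigma> r \<noteq> 0" "\<And>\<sigma> j. dt k (A \<sigma>) = 0 ==> j < k ==> (\<Sum>i<k. y0 \<sigma> i * A \<sigma> i j) = 0"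
  by blast

 \<comment> \<open>The size is the one required by \<open>star\<close>; the shift by one is there
   because the legs start at 2.\<close>
 define A0 where "A0 = {2..min (J 4) (n - 1) + 1}"
 define C0 where "C0 = {2..n} - A0"
 define eps where "eps r = (if even r \<or> r div 2 + 2 \<in> A0 then - 1 else 1 :: real)" for r :: nat
 define Fnz where "Fnz = {\<sigma> \<in> Fs. dt k (A \<sigma>) \<noteq> 0}"
 have finFnz: "finite Fnz" unfolding Fnz_def using finFs by simp
 \<comment> \<open>\<open>s > a\<close> yields \<open>a * X + Y > 0\<close> on \<open>C0\<close>,
   \<open>s > 1\<close> makes the abscissas decrease, and avoiding the roots makes all velocities
   \<open>v\<close> nonzero.\<close>
 obtain s :: real where s: "s > max 1 (real a)"
  and s_root: "\<And>y. y \<in> (\<lambda>(\<sigma>, j). \<lambda>r. B \<sigma> j r * eps r) ` (Fnz \<times> {..<k}) ==> (\<Sum>r<k. y r * s ^ r) \<noteq> 0"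
 proof (rule avoid_roots)
  show "finite ((\<lambda>(\<sigma>, j). \<lambda>r. B \<sigma> j r * eps r) ` (Fnz \<times> {..<k}))" using finFnz by simp
  fix y assume "y \<in> (\<lambda>(\<sigma>, j). \<lambda>r. B \<sigma> j r * eps r) ` (Fnz \<times> {..<k})"
  then obtain \<sigma> j where y: "y = (\<lambda>r. B \<sigma> j r * eps r)" "\<sigma> \<in> Fnz" "j < k" by auto
  have "\<exists>r<k. 1 * B \<sigma> j r - 0 * B \<sigma> j r \<noteq> 0" by (rule comb) (use y in \<open>auto simp: Fnz_def\<close>)
  thus "\<exists>r<k. y r \<noteq> 0" unfolding y eps_def by auto
 qed blast
 \<comment> \<open>By \<open>w_XY\<close> below, the entries of \<open>w\<close> are the coordinates
   of the points of the star.\<close>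
 define w where "w r = eps r * s ^ r" for r
 define v where "v \<sigma> j = (\<Sum>r<k. B \<sigma> j r * w r)" for \<sigma> j
 have vnz: "v \<sigma> j \<noteq> 0" if "\<sigma> \<in> Fnz" "j < k" for \<sigma> j
  using s_root[of "\<lambda>r. B \<sigma> j r * eps r"] that unfolding v_def w_def by (force simp: mult.assoc)
 define X where "X i = (if i = 1 then 0 else - (s ^ (2 * (i - 2))))" for i :: nat
 define Y where "Y i = (if i = 1 then 0 else if i \<in> A0 then - (s ^ (2 * (i - 2) + 1)) else s ^ (2 * (i - 2) + 1))" for i :: nat
 have s0: "s > 1" "s > a" using s by auto
 interpret st: star a n ty mu X Y A0 C0
 proof
  show "a \<ge> 1" "n \<ge> 3" by fact+
  show "ty j \<in> {1, 2, 3, 4}" "mu j > 0" if "j < 2 * (n - 1)" for j using ty mu that by auto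
  show "A0 \<inter> C0 = {}" "A0 \<union> C0 = {2..n}" unfolding C0_def A0_def using n by auto
  show "card A0 = min (card {j. j < 2 * (n - 1) \<and> ty j = 4}) (n - 1)" unfolding A0_def J by simp
  show "Y i < 0" if "i \<in> A0" for i using that s0 unfolding Y_def A0_def by auto
  show "Y i > 0" if "i \<in> C0" for i using that s0 unfolding Y_def C0_def by auto
  show "real a * X i + Y i > 0" if "i \<in> C0" for i
  proof -
   have "real a * X i + Y i = (s - a) * s ^ (2 * (i - 2))"
    using that unfolding X_def Y_def C0_def by (auto simp: algebra_simps)
   thus ?thesis using s0 by simp
  qed
  show "X 1 = 0" "Y 1 = 0" unfolding X_def Y_def by auto
  show "X i' < X i" if "1 \<le> i" "i < i'" "i' \<le> n" for i i'
  proof (cases "i = 1")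
   case True
   thus ?thesis using that s0 unfolding X_def by auto
  next
   case False
   hence "s ^ (2 * (i - 2)) < s ^ (2 * (i' - 2))" using that s0 by (intro power_strict_increasing) auto
   thus ?thesis using False that unfolding X_def by auto
  qed
 qed
 have kk: "st.k = k" unfolding st.k_def k_def by simp
 have w_XY: "w r = (if even r then X (r div 2 + 2) else Y (r div 2 + 2))" for r
  unfolding w_def eps_def X_def Y_def by (auto elim!: evenE oddE)

 define sol where "sol \<sigma> t z j = (\<Sum>r<k. B \<sigma> j r * (z r - base \<sigma> t r))" for \<sigma> t z j
 define en where "en b Q t = (if b then dp t Q else dp t (above F Q))" for b Q t
 \<comment> \<open>Nonvanishing of the four families says: \<open>P0\<close>, a singular system has
   no solution; \<open>P1\<close>, no parameter sits at an end of its cell; \<open>P2\<close>, no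
   two parameters agree; \<open>P3\<close>, no two parameters reach ends of their cells at the same
   time. \<open>P3\<close> is obtained by eliminating the time from the two equations.\<close>
 define P0 where "P0 \<sigma> t x = (\<Sum>r<k. y0 \<sigma> r * (diff_vec x r - base \<sigma> t r))" for \<sigma> t x
 define P1 where "P1 = (\<lambda>(\<sigma>, j, b) t x. sol \<sigma> t (diff_vec x) j - en b (\<sigma> j) t)"
 define P2 where "P2 = (\<lambda>(\<sigma>, j, j') t x. sol \<sigma> t (diff_vec x) j - sol \<sigma> t (diff_vec x) j')"
 define P3 where "P3 = (\<lambda>(\<sigma>, j, j', b, b') t x. v \<sigma> j' * (sol \<sigma> t (diff_vec x) j - en b (\<sigma> j) t) - v \<sigma> j * (sol \<sigma> t (diff_vec x) j' - en b' (\<sigma> j') t))"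
 define Ps where "Ps = P0 ` {\<sigma> \<in> Fs. dt k (A \<sigma>) = 0} \<union> P1 ` (Fnz \<times> {..<k} \<times> UNIV)
  \<union> P2 ` {(\<sigma>, j, j'). \<sigma> \<in> Fnz \<and> j < k \<and> j' < k \<and> j \<noteq> j'}
  \<union> P3 ` {(\<sigma>, j, j', b, b'). \<sigma> \<in> Fnz \<and> j < k \<and> j' < k \<and> j \<noteq> j'}"
 have lin_en: "lin E (\<lambda>t. en b Q t)" for b Q unfolding en_def using lin_dp by (cases b) auto
 have finPs: "finite Ps"
 proof -
  have "finite {(\<sigma>, j, j'). \<sigma> \<in> Fnz \<and> j < k \<and> j' < k \<and> j \<noteq> j'}"
   by (rule finite_subset[of _ "Fnz \<times> {..<k} \<times> {..<k}"]) (use finFnz in auto)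
  moreover have "finite {(\<sigma>, j, j', b :: bool, b' :: bool). \<sigma> \<in> Fnz \<and> j < k \<and> j' < k \<and> j \<noteq> j'}"
   by (rule finite_subset[of _ "Fnz \<times> {..<k} \<times> {..<k} \<times> UNIV \<times> UNIV"]) (use finFnz in auto)
  ultimately show ?thesis unfolding Ps_def using finFs finFnz by auto
 qed
 have mk: "\<exists>y f r. r < 2 * (n - 1) \<and> y r \<noteq> 0 \<and> lin E f \<and> (\<forall>t x. P t x = (\<Sum>r<2 * (n - 1). y r * diff_vec x r) + f t)"
  if P: "\<exists>r<k. y r \<noteq> 0" "lin E g" "\<And>t x. P t x = (\<Sum>r<k. y r * (diff_vec x r - base \<sigma> t r)) + g t" for P y g \<sigma>
 proof -
  have "lin E (\<lambda>t. g t - (\<Sum>r<k. y r * base \<sigma> t r))"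
   by (intro lin_diff P(2) lin_sum lin_mult lin_base)
  moreover have "P t x = (\<Sum>r<k. y r * diff_vec x r) + (g t - (\<Sum>r<k. y r * base \<sigma> t r))" for t x
   unfolding P(3) by (simp add: algebra_simps sum_subtractf)
  ultimately show ?thesis using P(1) unfolding k_def by blast
 qed
 have solc: "p * sol \<sigma> t z j - q * sol \<sigma> t z j' = (\<Sum>r<k. (p * B \<sigma> j r - q * B \<sigma> j' r) * (z r - base \<sigma> t r))" for p q \<sigma> t z j j'
  unfolding sol_def by (simp add: sum_distrib_left sum_subtractf[symmetric] algebra_simps)
 have forms: "\<exists>y f r. r < 2 * (n - 1) \<and> y r \<noteq> 0 \<and> lin E f \<and> (\<forall>t x. P t x = (\<Sum>r<2 * (n - 1). y r * diff_vec x r) + f t)"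
  if P: "P \<in> Ps" for P
 proof -
  from P consider (0) \<sigma> where "P = P0 \<sigma>" "dt k (A \<sigma>) = 0"
   | (1) \<sigma> j b where "P = P1 (\<sigma>, j, b)" "\<sigma> \<in> Fnz" "j < k"
   | (2) \<sigma> j j' where "P = P2 (\<sigma>, j, j')" "\<sigma> \<in> Fnz" "j < k" "j' < k" "j \<noteq> j'"
   | (3) \<sigma> j j' b b' where "P = P3 (\<sigma>, j, j', b, b')" "\<sigma> \<in> Fnz" "j < k" "j' < k" "j \<noteq> j'"
   unfolding Ps_def by blast
  thus ?thesis
  proof cases
   case 0
   show ?thesis by (rule mk[of "y0 \<sigma>" "\<lambda>t. 0" P \<sigma>]) (use y0(1)[OF 0(2)] lin_0 in \<open>auto simp: 0 P0_def\<close>)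
  next
   case 1
   show ?thesis
   proof (rule mk[of "\<lambda>r. 1 * B \<sigma> j r - 0 * B \<sigma> j r" "\<lambda>t. 0 - en b (\<sigma> j) t" P \<sigma>])
    show "\<exists>r<k. 1 * B \<sigma> j r - 0 * B \<sigma> j r \<noteq> 0" by (rule comb) (use 1 in \<open>auto simp: Fnz_def\<close>)
    show "lin E (\<lambda>t. 0 - en b (\<sigma> j) t)" by (intro lin_diff lin_0 lin_en)
   qed (simp add: 1 P1_def sol_def)
  next
   case 2
   show ?thesis
   proof (rule mk[of "\<lambda>r. 1 * B \<sigma> j r - 1 * B \<sigma> j' r" "\<lambda>t. 0" P \<sigma>])
    show "\<exists>r<k. 1 * B \<sigma> j r - 1 * B \<sigma> j' r \<noteq> 0" by (rule comb) (use 2 in \<open>auto simp: Fnz_def\<close>)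
    show "P t x = (\<Sum>r<k. (1 * B \<sigma> j r - 1 * B \<sigma> j' r) * (diff_vec x r - base \<sigma> t r)) + 0" for t x
     unfolding solc[symmetric] by (simp add: 2 P2_def)
   qed (rule lin_0)
  next
   case 3
   show ?thesis
   proof (rule mk[of "\<lambda>r. v \<sigma> j' * B \<sigma> j r - v \<sigma> j * B \<sigma> j' r" "\<lambda>t. v \<sigma> j * en b' (\<sigma> j') t - v \<sigma> j' * en b (\<sigma> j) t" P \<sigma>])
    show "\<exists>r<k. v \<sigma> j' * B \<sigma> j r - v \<sigma> j * B \<sigma> j' r \<noteq> 0"
     by (rule comb) (use 3 vnz in \<open>auto simp: Fnz_def\<close>)
    show "lin E (\<lambda>t. v \<sigma> j * en b' (\<sigma> j') t - v \<sigma> j' * en b (\<sigma> j) t)" by (intro lin_diff lin_mult lin_en)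
    show "P t x = (\<Sum>r<k. (v \<sigma> j' * B \<sigma> j r - v \<sigma> j * B \<sigma> j' r) * (diff_vec x r - base \<sigma> t r)) + (v \<sigma> j * en b' (\<sigma> j') t - v \<sigma> j' * en b (\<sigma> j) t)" for t x
     unfolding solc[symmetric] by (simp add: 3 P3_def algebra_simps)
   qed
  qed
 qed
 from forms_exist[OF finPs forms] obtain H :: "(('e => real) \<times> (nat => real \<times> real)) set" where H: "finite H" "\<And>\<alpha> \<beta>. (\<alpha>, \<beta>) \<in> H ==> \<exists>i\<in>{1..n}. \<beta> i \<noteq> 0"
  "\<And>t x P. (\<forall>(\<alpha>, \<beta>)\<in>H. form E n \<alpha> \<beta> t x \<noteq> 0) ==> P \<in> Ps ==> P t x \<noteq> 0"
  by blast
 have nz_dt: "dt k (A \<sigma>) \<noteq> 0"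
  if g: "\<forall>(\<alpha>, \<beta>)\<in>H. form E n \<alpha> \<beta> t x \<noteq> 0" and \<sigma>: "\<sigma> \<in> Fs"
   and eq: "\<And>r. r < k ==> (\<Sum>j<k. A \<sigma> r j * D j) = diff_vec x r - base \<sigma> t r" for t x \<sigma> D
 proof
  assume d: "dt k (A \<sigma>) = 0"
  have "P0 \<sigma> t x = (\<Sum>r<k. y0 \<sigma> r * (\<Sum>j<k. A \<sigma> r j * D j))" unfolding P0_def using eq by simp
  also have "\<dots> = (\<Sum>j<k. (\<Sum>r<k. y0 \<sigma> r * A \<sigma> r j) * D j)"
   by (subst sum_distrib_right, subst sum.swap) (simp add: sum_distrib_left mult.assoc)
  also have "\<dots> = 0" using y0(2)[OF d] by simp
  finally show False using H(3)[OF g, of "P0 \<sigma>"] \<sigma> d unfolding Ps_def by blast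
 qed
 have eqs: "(\<Sum>j<k. cell_base F (dp t) dl j (\<sigma> j) r + D j * cell_col dl j (\<sigma> j) r) = z r
   \<longleftrightarrow> (\<Sum>j<k. A \<sigma> r j * D j) = z r - base \<sigma> t r" for t \<sigma> r D and z :: "nat => real"
  unfolding A_def cell_matrix_def base_def by (auto simp: sum.distrib mult.commute)
 show ?thesis
 proof (rule that[OF H(1,2)])
  fix t :: "'e => real" and x dpt
  assume t: "\<And>e. e \<in> E ==> t e > 0" and g: "\<forall>(\<alpha>, \<beta>)\<in>H. form E n \<alpha> \<beta> t x \<noteq> 0"
   and dpt: "dpt = (\<lambda>R. \<Sum>e\<in>E. c R e * t e)"
  have dpt': "dpt = dp t" unfolding dpt dp_def ..
  { fix \<sigma> D
   assume \<sigma>: "\<sigma> \<in> {..<2 * (n - 1)} \<rightarrow>\<^sub>E cells n F"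
    and eq: "\<And>r. r < 2 * (n - 1) ==> (\<Sum>j<2 * (n - 1). cell_base F dpt dl j (\<sigma> j) r + D j * cell_col dl j (\<sigma> j) r) = diff_vec x r"
   have \<sigma>': "\<sigma> \<in> Fs" using \<sigma> unfolding Fs_def k_def .
   have eq': "(\<Sum>j<k. A \<sigma> r j * D j) = diff_vec x r - base \<sigma> t r" if "r < k" for r
    using eq[folded k_def, OF that] unfolding dpt' eqs .
   have d: "dt k (A \<sigma>) \<noteq> 0" by (rule nz_dt[OF g \<sigma>' eq'])
   hence F: "\<sigma> \<in> Fnz" using \<sigma>' unfolding Fnz_def by simp
   have D: "D j = sol \<sigma> t (diff_vec x) j" if "j < k" for j
    unfolding sol_def by (rule B2[OF d eq' that])
   have "inj_on D {..<k}"
   proof (rule inj_onI, rule ccontr)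
    fix j j' assume j: "j \<in> {..<k}" "j' \<in> {..<k}" "D j = D j'" "j \<noteq> j'"
    hence "P2 (\<sigma>, j, j') \<in> Ps" unfolding Ps_def using F by blast
    from H(3)[OF g this] show False using D j by (simp add: P2_def)
   qed
   moreover have "D j \<noteq> dpt (\<sigma> j) \<and> D j \<noteq> dpt (above F (\<sigma> j))" if j: "j < k" for j
   proof -
    have "P1 (\<sigma>, j, b) \<in> Ps" for b unfolding Ps_def using F j by blast
    from H(3)[OF g this[of True]] H(3)[OF g this[of False]] show ?thesis using D[OF j]
     by (simp add: P1_def en_def dpt')
   qed
   ultimately show "dt (2 * (n - 1)) (cell_matrix dl \<sigma>) \<noteq> 0 \<and> inj_on D {..<2 * (n - 1)} \<and>
    (\<forall>j<2 * (n - 1). D j \<noteq> dpt (\<sigma> j) \<and> D j \<noteq> dpt (above F (\<sigma> j)))"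
    using d unfolding A_def k_def by blast
  }
  interpret hi: hierarchy n F dpt unfolding dpt by (rule hier[OF t])
  interpret bc: balanced_cells k "cells n F" "cell_base F dpt dl" "cell_col dl" "\<lambda>Q. Q \<noteq> {2..n}" "\<lambda>Q. Q \<in> F" "\<lambda>Q. dpt (above F Q)" dpt
   unfolding k_def by (rule hi.hierarchy_balanced)
  have cm: "bc.cmat \<sigma> = A \<sigma>" for \<sigma> unfolding bc.cmat_def A_def cell_matrix_def by (simp add: fun_eq_iff)
  have solves: "bc.solves \<sigma> z D \<longleftrightarrow> (\<forall>r<k. (\<Sum>j<k. A \<sigma> r j * D j) = z r - base \<sigma> t r)" for \<sigma> z D
   unfolding bc.solves_def unfolding dpt' eqs ..
  have sol_solves: "bc.solves \<sigma> z (sol \<sigma> t z)" if "\<sigma> \<in> Fnz" for \<sigma> z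
   unfolding solves sol_def using B1[of \<sigma>] that unfolding Fnz_def by simp
  have v_solves: "(\<Sum>j<k. A \<sigma> r j * v \<sigma> j) = w r" if "\<sigma> \<in> Fnz" "r < k" for \<sigma> r
   unfolding v_def using B1[of \<sigma>] that unfolding Fnz_def by simp
  define z where "z = diff_vec x"
  define SS where "SS = (\<lambda>(\<sigma>, j, b). \<bar>sol \<sigma> t z j - en b (\<sigma> j) t\<bar> / \<bar>v \<sigma> j\<bar>) ` (Fnz \<times> {..<k} \<times> UNIV)"
  \<comment> \<open>The quotients are the times at which some parameter passes an end of its cell,
    up to sign; \<open>U\<close> exceeds them all.\<close>
  define U where "U = Max (insert 0 SS) + 1"
  have finSS: "finite SS" unfolding SS_def using finFnz by simp
  have "0 \<le> Max (insert 0 SS)" by (rule Max_ge) (use finSS in simp_all)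
  hence U0: "U > 0" unfolding U_def by linarith
  have Ubig: "\<bar>sol \<sigma> t z j - en b (\<sigma> j) t\<bar> < U * \<bar>v \<sigma> j\<bar>" if F: "\<sigma> \<in> Fnz" "j < k" for \<sigma> j b
  proof -
   have "\<bar>sol \<sigma> t z j - en b (\<sigma> j) t\<bar> / \<bar>v \<sigma> j\<bar> \<in> SS" unfolding SS_def using F by force
   hence "\<bar>sol \<sigma> t z j - en b (\<sigma> j) t\<bar> / \<bar>v \<sigma> j\<bar> \<le> Max (insert 0 SS)"
    by (intro Max_ge) (use finSS in simp_all)
   hence "\<bar>sol \<sigma> t z j - en b (\<sigma> j) t\<bar> / \<bar>v \<sigma> j\<bar> < U" unfolding U_def by linarith
   thus ?thesis using vnz[OF F] by (simp add: pos_divide_less_eq)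
  qed
  have far: "(v \<sigma> j > 0 \<longrightarrow> sol \<sigma> t z j + U * v \<sigma> j > en b (\<sigma> j) t) \<and> (v \<sigma> j < 0 \<longrightarrow> sol \<sigma> t z j + U * v \<sigma> j < en b (\<sigma> j) t)"
   if F: "\<sigma> \<in> Fnz" "j < k" for \<sigma> j b
   using Ubig[OF F, of b] by (auto simp: abs_if split: if_splits)
  have ends_en: "\<exists>b'. b = en b' Q t" if "b \<in> bc.ends Q" for b Q
  proof -
   have "b = dpt Q \<or> b = dpt (above F Q)" using that unfolding bc.ends_def by blast
   hence "b = en True Q t \<or> b = en False Q t" by (simp add: en_def dpt')
   thus ?thesis by blast
  qed
  have seg: "bc.generic_segment z w U"
   unfolding bc.generic_segment_def
  proof (intro ballI impI)
   fix \<sigma> assume "\<sigma> \<in> bc.Fs" "dt k (bc.cmat \<sigma>) \<noteq> 0"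
   hence F: "\<sigma> \<in> Fnz" unfolding Fnz_def Fs_def cm by simp
   show "\<exists>D va. bc.solves \<sigma> z D \<and> (\<forall>r<k. (\<Sum>j<k. bc.cmat \<sigma> r j * va j) = w r) \<and>
     (\<forall>j<k. D j \<notin> bc.ends (\<sigma> j) \<and> D j + U * va j \<notin> bc.ends (\<sigma> j)) \<and>
     (\<forall>r j j'. 0 < r \<longrightarrow> r < U \<longrightarrow> j < k \<longrightarrow> j' < k \<longrightarrow> j \<noteq> j' \<longrightarrow> D j + r * va j \<in> bc.ends (\<sigma> j) \<longrightarrow> D j' + r * va j' \<notin> bc.ends (\<sigma> j'))"
   proof (rule exI[of _ "sol \<sigma> t z"], rule exI[of _ "v \<sigma>"], intro conjI allI impI)
    show "bc.solves \<sigma> z (sol \<sigma> t z)" by (rule sol_solves[OF F])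
    show "(\<Sum>j<k. bc.cmat \<sigma> r j * v \<sigma> j) = w r" if "r < k" for r unfolding cm by (rule v_solves[OF F that])
    show "sol \<sigma> t z j \<notin> bc.ends (\<sigma> j)" if j: "j < k" for j
    proof
     assume "sol \<sigma> t z j \<in> bc.ends (\<sigma> j)"
     then obtain b where b: "sol \<sigma> t z j = en b (\<sigma> j) t" using ends_en by blast
     have "P1 (\<sigma>, j, b) \<in> Ps" unfolding Ps_def using F j by blast
     from H(3)[OF g this] show False using b unfolding z_def by (simp add: P1_def)
    qed
    show "sol \<sigma> t z j + U * v \<sigma> j \<notin> bc.ends (\<sigma> j)" if j: "j < k" for j
    proof
     assume "sol \<sigma> t z j + U * v \<sigma> j \<in> bc.ends (\<sigma> j)"
     then obtain b where b: "sol \<sigma> t z j + U * v \<sigma> j = en b (\<sigma> j) t" using ends_en by blast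
     show False using far[OF F j, of b] b vnz[OF F j] by linarith
    qed
    fix r j j' assume r: "0 < r" "r < U" "j < k" "j' < k" "j \<noteq> j'" "sol \<sigma> t z j + r * v \<sigma> j \<in> bc.ends (\<sigma> j)"
    show "sol \<sigma> t z j' + r * v \<sigma> j' \<notin> bc.ends (\<sigma> j')"
    proof
     assume "sol \<sigma> t z j' + r * v \<sigma> j' \<in> bc.ends (\<sigma> j')"
     then obtain b b' where b: "sol \<sigma> t z j + r * v \<sigma> j = en b (\<sigma> j) t" "sol \<sigma> t z j' + r * v \<sigma> j' = en b' (\<sigma> j') t"
      using ends_en r(6) by blast
     have "P3 (\<sigma>, j, j', b, b') \<in> Ps" unfolding Ps_def using F r by blast
     from H(3)[OF g this] have "v \<sigma> j' * (sol \<sigma> t z j - en b (\<sigma> j) t) - v \<sigma> j * (sol \<sigma> t z j' - en b' (\<sigma> j') t) \<noteq> 0"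
      unfolding z_def by (simp add: P3_def)
     thus False unfolding b[symmetric] by (simp add: algebra_simps)
    qed
   qed
  qed
  define z' where "z' = (\<lambda>r. z r + U * w r)"
  have cnt: "bc.count z = bc.count z'" unfolding z'_def by (rule bc.count_along_segment[OF U0 seg])
  \<comment> \<open>At time \<open>U\<close>, a parameter with positive velocity is admissible only
    in a cell without upper bound, which is the leg of a marked point other than the first. One with
    negative velocity must be on the leg of the first marked point.\<close>
  define esc where "esc \<sigma> \<longleftrightarrow> (\<forall>j<k. v \<sigma> j > 0 \<and> \<sigma> j \<notin> F \<or> v \<sigma> j < 0 \<and> \<sigma> j = {2..n})" for \<sigma>
  have feas: "bc.feas \<sigma> z' \<longleftrightarrow> esc \<sigma>" if F: "\<sigma> \<in> Fnz" for \<sigma>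
  proof -
   have sol': "bc.solves \<sigma> z' (\<lambda>j. sol \<sigma> t z j + U * v \<sigma> j)"
   proof -
    have "(\<Sum>j<k. A \<sigma> r j * (sol \<sigma> t z j + U * v \<sigma> j)) = (\<Sum>j<k. A \<sigma> r j * sol \<sigma> t z j) + U * (\<Sum>j<k. A \<sigma> r j * v \<sigma> j)" for r
     by (simp add: sum.distrib sum_distrib_left algebra_simps)
    thus ?thesis using sol_solves[OF F, of z] v_solves[OF F] unfolding solves z'_def by simp
   qed
   have nz: "dt k (bc.cmat \<sigma>) \<noteq> 0" using F unfolding cm Fnz_def by simp
   have "bc.feas \<sigma> z' \<longleftrightarrow> (\<forall>j<k. bc.inb (\<sigma> j) (sol \<sigma> t z j + U * v \<sigma> j))"
    unfolding bc.feas_def using sol' bc.solves_unique[OF nz _ sol'] by (metis (no_types, lifting))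
   also have "\<dots> \<longleftrightarrow> esc \<sigma>"
   proof -
    have "bc.inb (\<sigma> j) (sol \<sigma> t z j + U * v \<sigma> j) \<longleftrightarrow> v \<sigma> j > 0 \<and> \<sigma> j \<notin> F \<or> v \<sigma> j < 0 \<and> \<sigma> j = {2..n}" if j: "j < k" for j
    proof (cases "v \<sigma> j > 0")
     case True
     hence "dpt (\<sigma> j) < sol \<sigma> t z j + U * v \<sigma> j" "dpt (above F (\<sigma> j)) < sol \<sigma> t z j + U * v \<sigma> j"
      using far[OF F j, of True] far[OF F j, of False] unfolding en_def dpt' by auto
     thus ?thesis using True unfolding bc.inb_def by auto
    next
     case False
     hence v: "v \<sigma> j < 0" using vnz[OF F j] by simp
     hence "sol \<sigma> t z j + U * v \<sigma> j < dpt (\<sigma> j)" "sol \<sigma> t z j + U * v \<sigma> j < dpt (above F (\<sigma> j))"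
      using far[OF F j, of True] far[OF F j, of False] unfolding en_def dpt' by auto
     thus ?thesis using v unfolding bc.inb_def by auto
    qed
    thus ?thesis unfolding esc_def by blast
   qed
   finally show ?thesis .
  qed
  define leg where "leg i = (if i = 1 then {2..n} else {i})" for i :: nat
  define h where "h s = (\<lambda>j\<in>{..<k}. leg (s j))" for s :: "nat => nat"
  let ?S = "{..<k} \<rightarrow>\<^sub>E {1..n}"
  have leg_cell: "leg i \<in> cells n F" if "i \<in> {1..n}" for i
   using that hi.top_in unfolding leg_def cells_def by auto
  have leg_inj: "i = i'" if "leg i = leg i'" "i \<in> {1..n}" "i' \<in> {1..n}" for i i'
  proof -
   have "{2..n} \<noteq> {i}" for i
   proof
    assume "{2..n} = {i}"
    hence "2 \<in> {i}" "3 \<in> {i}" using n by auto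
    thus False by simp
   qed
   thus ?thesis using that unfolding leg_def by (metis singleton_inject)
  qed
  have hF: "h s \<in> Fs" if s: "s \<in> ?S" for s
  proof -
   have "leg (s j) \<in> cells n F" if "j < k" for j
    by (rule leg_cell, rule PiE_mem[OF s]) (use that in simp)
   thus ?thesis unfolding h_def Fs_def by (simp add: restrict_PiE_iff)
  qed
  have hinj: "inj_on h ?S"
  proof (rule inj_onI)
   fix s s' assume s: "s \<in> ?S" "s' \<in> ?S" "h s = h s'"
   show "s = s'"
   proof (rule PiE_ext[OF s(1,2)])
    fix j assume j: "j \<in> {..<k}"
    have "leg (s j) = leg (s' j)" using fun_cong[OF s(3), of j] j unfolding h_def by simp
    thus "s j = s' j" using leg_inj s(1,2) j by (metis PiE_mem)
   qed
  qed
  have smat: "A (h s) r j = st.smat s r j" if "s \<in> ?S" "r < k" "j < k" for s r j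
  proof -
   have sj: "s j \<in> {1..n}" by (rule PiE_mem[OF that(1)]) (use that(3) in simp)
   have ri: "r div 2 + 2 \<in> {2..n}" using that unfolding k_def by auto
   have "r div 2 + 2 \<in> leg (s j) \<longleftrightarrow> s j = 1 \<or> r div 2 + 2 = s j" using sj ri unfolding leg_def by auto
   thus ?thesis using that unfolding A_def cell_matrix_def cell_col_def h_def st.smat_def dl by simp
  qed
  have dts: "dt k (A (h s)) = dt k (st.smat s)" if "s \<in> ?S" for s by (rule dt_cong) (use smat that in auto)
  have valid: "st.svalid s \<longleftrightarrow> esc (h s)" if s: "s \<in> ?S" and nz: "dt k (A (h s)) \<noteq> 0" for s
  proof -
   have F: "h s \<in> Fnz" using hF[OF s] nz unfolding Fnz_def by simp
   have split: "(\<Sum>j<k. A (h s) r j * u j) = (\<Sum>j | j < k \<and> s j = r div 2 + 2. dl j r * u j) + (\<Sum>j | j < k \<and> s j = 1. dl j r * u j)"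
    if r: "r < k" for u r
   proof -
    have "(\<Sum>j<k. A (h s) r j * u j) = (\<Sum>j\<in>{j. j < k \<and> s j = r div 2 + 2} \<union> {j. j < k \<and> s j = 1}. dl j r * u j)"
     by (rule sum.mono_neutral_cong_right) (use smat[OF s r] in \<open>auto simp: st.smat_def dl split: if_splits\<close>)
    also have "\<dots> = (\<Sum>j | j < k \<and> s j = r div 2 + 2. dl j r * u j) + (\<Sum>j | j < k \<and> s j = 1. dl j r * u j)"
     by (rule sum.union_disjoint) auto
    finally show ?thesis .
   qed
   have sing: "{i} \<notin> F" for i using hi.sub[of "{i}"] by auto
   have ne: "{2..n} \<noteq> {i}" for i using sing hi.top_in by metis
   have esc: "esc (h s) \<longleftrightarrow> (\<forall>j<k. if s j = 1 then v (h s) j < 0 else v (h s) j > 0)"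
   proof -
    have "v (h s) j > 0 \<and> h s j \<notin> F \<or> v (h s) j < 0 \<and> h s j = {2..n} \<longleftrightarrow> (if s j = 1 then v (h s) j < 0 else v (h s) j > 0)"
     if "j < k" for j
    proof -
     have hj: "h s j = leg (s j)" using that by (simp add: h_def)
     show ?thesis unfolding hj leg_def using sing[of "s j"] hi.top_in ne[of "s j"] by (cases "s j = 1") auto
    qed
    thus ?thesis unfolding esc_def by blast
   qed
   have XY: "(if even r then X i else Y i) = w r" if "r div 2 + 2 = i" for r i using w_XY that by simp
   show ?thesis
   proof
    assume "st.svalid s"
    then obtain V cx cy where V: "\<And>j. j < k ==> V j > 0"
     and eqV: "\<And>i. i \<in> {1..n} ==> (\<Sum>j | j < k \<and> s j = i. st.dx j * V j) = X i - cx"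
      "\<And>i. i \<in> {1..n} ==> (\<Sum>j | j < k \<and> s j = i. st.dy j * V j) = Y i - cy"
     unfolding st.svalid_def kk by blast
    \<comment> \<open>Depths on the leg of the first marked point are negative, whereas
      \<open>star\<close> measures distances from the vertex.\<close>
    define u where "u j = (if s j = 1 then - V j else V j)" for j
    have "(\<Sum>j<k. A (h s) r j * u j) = w r" if r: "r < k" for r
    proof -
     have i: "r div 2 + 2 \<in> {1..n}" using r unfolding k_def by auto
     have 1: "(\<Sum>j | j < k \<and> s j = r div 2 + 2. dl j r * u j) = (\<Sum>j | j < k \<and> s j = r div 2 + 2. dl j r * V j)"
      by (rule sum.cong) (auto simp: u_def)
     have 2: "(\<Sum>j | j < k \<and> s j = 1. dl j r * u j) = - (\<Sum>j | j < k \<and> s j = 1. dl j r * V j)"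
      unfolding sum_negf[symmetric] by (rule sum.cong) (auto simp: u_def)
     have one: "1 \<in> {1..n}" using n by simp
     show ?thesis unfolding split[OF r] 1 2 using eqV[OF i] eqV[OF one] st.X1 w_XY[of r]
      unfolding dl by (cases "even r") simp_all
    qed
    hence uv: "u j = v (h s) j" if "j < k" for j unfolding v_def by (intro B2[OF nz _ that])
    show "esc (h s)" unfolding esc
    proof (intro allI impI)
     fix j assume j: "j < k"
     show "if s j = 1 then v (h s) j < 0 else v (h s) j > 0"
      using uv[OF j] V[OF j] unfolding u_def by (cases "s j = 1") simp_all
    qed
   next
    assume e: "esc (h s)"
    define V where "V j = \<bar>v (h s) j\<bar>" for j
    define cx where "cx = (\<Sum>j | j < k \<and> s j = 1. st.dx j * v (h s) j)"
    define cy where "cy = (\<Sum>j | j < k \<and> s j = 1. st.dy j * v (h s) j)"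
    have pos: "V j > 0" if "j < k" for j using vnz[OF F that] by (simp add: V_def)
    have V2: "(\<Sum>j | j < k \<and> s j = i. d j * V j) = (\<Sum>j | j < k \<and> s j = i. d j * v (h s) j)" if "i \<noteq> 1" for i and d :: "nat => real"
     using e that unfolding esc by (intro sum.cong) (auto simp: V_def)
    have V1: "(\<Sum>j | j < k \<and> s j = 1. d j * V j) = - (\<Sum>j | j < k \<and> s j = 1. d j * v (h s) j)" for d :: "nat => real"
     unfolding sum_negf[symmetric] using e unfolding esc by (intro sum.cong) (auto simp: V_def)
    have "(\<Sum>j | j < k \<and> s j = i. st.dx j * V j) = X i - cx \<and> (\<Sum>j | j < k \<and> s j = i. st.dy j * V j) = Y i - cy" if i: "i \<in> {1..n}" for i
    proof (cases "i = 1")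
     case True
     thus ?thesis using st.X1 V1 by (simp add: cx_def cy_def)
    next
     case False
     define r where "r = 2 * (i - 2)"
     have r: "r < k" "r + 1 < k" "even r" "odd (r + 1)" "r div 2 + 2 = i" "(r + 1) div 2 + 2 = i"
      using i False unfolding r_def k_def by auto
     have "(\<Sum>j | j < k \<and> s j = i. st.dx j * v (h s) j) + cx = X i"
      using v_solves[OF F r(1)] r(3) unfolding split[OF r(1)] w_XY r(5) cx_def by (simp add: dl)
     moreover have "(\<Sum>j | j < k \<and> s j = i. st.dy j * v (h s) j) + cy = Y i"
      using v_solves[OF F r(2)] r(4) unfolding split[OF r(2)] w_XY r(6) cy_def by (simp add: dl)
     ultimately show ?thesis unfolding V2[OF False] by linarith
    qed
    thus "st.svalid s" unfolding st.svalid_def kk using pos by blast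
   qed
  qed
  have img: "\<sigma> \<in> h ` ?S" if "\<sigma> \<in> Fnz" "esc \<sigma>" for \<sigma>
  proof -
   have \<sigma>: "\<sigma> \<in> {..<k} \<rightarrow>\<^sub>E cells n F" using that unfolding Fnz_def Fs_def by simp
   have "\<exists>i\<in>{1..n}. \<sigma> j = leg i" if "j < k" for j
   proof -
    have "\<sigma> j \<notin> F \<or> \<sigma> j = {2..n}" "\<sigma> j \<in> cells n F" using \<open>esc \<sigma>\<close> that \<sigma> unfolding esc_def by auto
    then consider "\<sigma> j = {2..n}" | i where "i \<in> {2..n}" "\<sigma> j = {i}" unfolding cells_def by blast
    thus ?thesis
    proof cases
     case 1
     hence "\<sigma> j = leg 1" by (simp add: leg_def)
     moreover have "1 \<in> {1..n}" using n by simp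
     ultimately show ?thesis by blast
    next
     case 2
     hence "\<sigma> j = leg i" "i \<in> {1..n}" by (auto simp: leg_def)
     thus ?thesis by blast
    qed
   qed
   then obtain s where s: "\<And>j. j < k ==> s j \<in> {1..n} \<and> \<sigma> j = leg (s j)" by metis
   have "\<sigma> = h (restrict s {..<k})"
    by (rule PiE_ext[OF \<sigma>]) (use hF s in \<open>auto simp: h_def leg_cell\<close>)
   moreover have "restrict s {..<k} \<in> ?S" using s by auto
   ultimately show ?thesis by blast
  qed
  have "(\<Sum>\<sigma>\<in>Fs. of_bool (\<exists>D. cell_solution n F dpt dl \<sigma> (diff_vec x) D) * \<bar>dt k (A \<sigma>)\<bar>) = bc.count z"
   unfolding cell_solution_def k_def[symmetric] bc.count_def cm Fs_def bc.feas_def bc.inb_def bc.solves_def z_def ..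
  also have "\<dots> = (\<Sum>\<sigma>\<in>Fs. of_bool (bc.feas \<sigma> z') * \<bar>dt k (A \<sigma>)\<bar>)" unfolding cnt unfolding bc.count_def cm Fs_def ..
  also have "\<dots> = (\<Sum>\<sigma>\<in>h ` ?S. of_bool (bc.feas \<sigma> z') * \<bar>dt k (A \<sigma>)\<bar>)"
  proof (rule sum.mono_neutral_right[OF finFs])
   show "h ` ?S \<subseteq> Fs" using hF by blast
   show "\<forall>\<sigma>\<in>Fs - h ` ?S. of_bool (bc.feas \<sigma> z') * \<bar>dt k (A \<sigma>)\<bar> = 0"
   proof
    fix \<sigma> assume \<sigma>: "\<sigma> \<in> Fs - h ` ?S"
    show "of_bool (bc.feas \<sigma> z') * \<bar>dt k (A \<sigma>)\<bar> = 0"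
    proof (cases "\<sigma> \<in> Fnz")
     case True
     thus ?thesis using feas[OF True] img[OF True] \<sigma> by auto
    next
     case False
     thus ?thesis using \<sigma> unfolding Fnz_def by simp
    qed
   qed
  qed
  also have "\<dots> = (\<Sum>s\<in>?S. of_bool (bc.feas (h s) z') * \<bar>dt k (A (h s))\<bar>)"
   using sum.reindex[OF hinj] by simp
  also have "\<dots> = (\<Sum>s\<in>?S. of_bool (st.svalid s) * \<bar>dt k (st.smat s)\<bar>)"
  proof (rule sum.cong[OF refl])
   fix s assume s: "s \<in> ?S"
   show "of_bool (bc.feas (h s) z') * \<bar>dt k (A (h s))\<bar> = of_bool (st.svalid s) * \<bar>dt k (st.smat s)\<bar>"
   proof (cases "dt k (A (h s)) = 0")
    case True
    thus ?thesis using dts[OF s] by simp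
   next
    case False
    hence "h s \<in> Fnz" using hF[OF s] unfolding Fnz_def by simp
    thus ?thesis using dts[OF s] feas valid[OF s False] by simp
   qed
  qed
  also note st.star_count[unfolded kk st.J_def]
  finally show "(\<Sum>\<sigma>\<in>{..<2 * (n - 1)} \<rightarrow>\<^sub>E cells n F. of_bool (\<exists>D. cell_solution n F dpt dl \<sigma> (diff_vec x) D) * \<bar>dt (2 * (n - 1)) (cell_matrix dl \<sigma>)\<bar>)
   = (if J 1 \<le> n - 1 \<and> J 3 \<le> n - 1 \<and> J 2 + J 4 \<le> n - 1
     then fact (J 1) * fact (J 2) * fact (J 3) * fact (J 4) * (\<Prod>j<2 * (n - 1). mu j)
      * real a ^ (n - 1 - J 2 - J 4) * real ((n - 1 - J 4) choose J 2) else 0)"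
   unfolding J Fs_def A_def k_def by (simp only:)
 qed
qed

section \<open>Trees as orders\<close>

text \<open>A tree as a finite order with least element \<open>r\<close> in which the elements below
  any given one form a chain; its edges are the covering pairs. Trees given by unique paths and
  trees built from sets of ends both have this form, and their paths can be computed from the order
  alone.\<close>

locale otree_graph =
 fixes T :: "'z mtree_scheme" and r :: nat and le :: "nat => nat => bool"
 assumes finite_verts: "finite (verts T)" and root: "r \<in> verts T"
  and le_refl: "\<And>v. v \<in> verts T ==> le v v"
  and le_trans: "\<And>u v w. u \<in> verts T ==> v \<in> verts T ==> w \<in> verts T ==> le u v ==> le v w ==> le u w"
  and le_antisym: "\<And>u v. u \<in> verts T ==> v \<in> verts T ==> le u v ==> le v u ==> u = v"
  and le_root: "\<And>v. v \<in> verts T ==> le r v"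
  and le_chain: "\<And>u u' v. u \<in> verts T ==> u' \<in> verts T ==> v \<in> verts T ==> le u v ==> le u' v ==> le u u' \<or> le u' u"
  and edges_cover: "edges T = {{u, v} | u v. u \<in> verts T \<and> v \<in> verts T \<and> le u v \<and> u \<noteq> v \<and>
   (\<forall>z\<in>verts T. le u z \<longrightarrow> le z v \<longrightarrow> z = u \<or> z = v)}"
begin

abbreviation "V \<equiv> verts T"

definition cov :: "nat => nat => bool" where
 "cov u v \<longleftrightarrow> u \<in> V \<and> v \<in> V \<and> le u v \<and> u \<noteq> v \<and> (\<forall>z\<in>V. le u z \<longrightarrow> le z v \<longrightarrow> z = u \<or> z = v)"

definition par :: "nat => nat" where "par v = (THE u. cov u v)"

lemma edge_iff: "{u, v} \<in> edges T \<longleftrightarrow> cov u v \<or> cov v u"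
 unfolding edges_cover cov_def by (auto simp: doubleton_eq_iff)

lemma ex_maximal:
 assumes "S \<subseteq> V" "S \<noteq> {}" "\<And>u u'. u \<in> S ==> u' \<in> S ==> le u u' \<or> le u' u"
 obtains m where "m \<in> S" "\<And>u. u \<in> S ==> le u m"
proof -
 have "finite S" using assms(1) finite_verts finite_subset by blast
 hence "S \<subseteq> V ==> (\<And>u u'. u \<in> S ==> u' \<in> S ==> le u u' \<or> le u' u) ==> \<exists>m\<in>S. \<forall>u\<in>S. le u m"
  using assms(2)
 proof (induction S rule: finite_ne_induct)
  case (singleton x)
  thus ?case using le_refl by auto
 next
  case (insert x S)
  then obtain m where m: "m \<in> S" "\<forall>u\<in>S. le u m" by (metis insert_iff insert_subset)
  have xm: "le x m \<or> le m x" using insert.prems(2) m(1) by blast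
  show ?case
  proof (cases "le x m")
   case True
   thus ?thesis using m by blast
  next
   case False
   hence "le m x" using xm by blast
   hence "\<forall>u\<in>insert x S. le u x"
    using m insert.prems(1) le_refl le_trans by (metis insert_iff subset_iff)
   thus ?thesis by blast
  qed
 qed
 thus ?thesis using assms that by blast
qed

lemma par_cov:
 assumes "v \<in> V" "v \<noteq> r"
 shows "cov (par v) v"
proof -
 let ?S = "{u \<in> V. le u v \<and> u \<noteq> v}"
 have "r \<in> ?S" using assms root le_root by auto
 then obtain m where m: "m \<in> ?S" "\<And>u. u \<in> ?S ==> le u m"
  using ex_maximal[of ?S] le_chain assms(1) by (metis (no_types, lifting) empty_iff mem_Collect_eq subsetI)
 have "cov m v" unfolding cov_def using m assms(1) le_antisym by blast
 moreover have "u = m" if "cov u v" for u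
  using that m unfolding cov_def by blast
 ultimately show ?thesis unfolding par_def by (metis theI)
qed

lemma par_props:
 assumes "v \<in> V" "v \<noteq> r"
 shows "par v \<in> V" "le (par v) v" "par v \<noteq> v" "\<And>u. u \<in> V ==> le u v ==> u \<noteq> v ==> le u (par v)"
proof -
 have c: "cov (par v) v" by (rule par_cov[OF assms])
 show "par v \<in> V" "le (par v) v" "par v \<noteq> v" using c unfolding cov_def by auto
 fix u assume u: "u \<in> V" "le u v" "u \<noteq> v"
 show "le u (par v)" using le_chain[of u "par v" v] c u le_refl unfolding cov_def by metis
qed

lemma cov_par: "cov u v \<longleftrightarrow> v \<in> V \<and> v \<noteq> r \<and> u = par v"
proof
 assume c: "cov u v"
 hence v: "v \<in> V" "v \<noteq> r" using le_root le_antisym root unfolding cov_def by blast+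
 have "le u (par v)" using par_props(4)[OF v, of u] c unfolding cov_def by blast
 hence "par v = u" using c par_props(1-3)[OF v] unfolding cov_def by blast
 thus "v \<in> V \<and> v \<noteq> r \<and> u = par v" using v by simp
qed (use par_cov in blast)

lemma edges_par: "edges T = (\<lambda>v. {par v, v}) ` (V - {r})"
proof -
 have "edges T = {{u, v} | u v. cov u v}" unfolding edges_cover cov_def ..
 also have "\<dots> = (\<lambda>v. {par v, v}) ` (V - {r})" unfolding cov_par by auto
 finally show ?thesis .
qed

lemma par_edge_inj: "inj_on (\<lambda>v. {par v, v}) (V - {r})"
proof (rule inj_onI)
 fix v w assume v: "v \<in> V - {r}" "w \<in> V - {r}" "{par v, v} = {par w, w}"
 show "v = w"
 proof (rule ccontr)
  assume "v \<noteq> w"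
  hence "par v = w" "par w = v" using v(3) by (auto simp: doubleton_eq_iff)
  hence "le w v" "le v w" using par_props(2)[of v] par_props(2)[of w] v by auto
  thus False using le_antisym v \<open>v \<noteq> w\<close> by blast
 qed
qed

text \<open>The edge from \<open>par z\<close> to \<open>z\<close> is the only one between the
  descendants of \<open>z\<close> and the other vertices: they are left only through
  \<open>par z\<close> and entered only through \<open>z\<close>.\<close>

lemma adjacent_below:
 assumes "{x, y} \<in> edges T" "z \<in> V"
 shows "le z x ==> y \<noteq> par z ==> z \<noteq> r ==> le z y" and "\<not> le z x ==> y \<noteq> z ==> \<not> le z y"
proof -
 consider "cov x y" | "cov y x" using assms(1) edge_iff by blast
 hence A: "(le z x \<longrightarrow> y \<noteq> par z \<longrightarrow> z \<noteq> r \<longrightarrow> le z y) \<and> (\<not> le z x \<longrightarrow> y \<noteq> z \<longrightarrow> \<not> le z y)"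
 proof cases
  case 1
  hence y: "y \<in> V" "y \<noteq> r" "x = par y" using cov_par by auto
  thus ?thesis using par_props[OF y(1,2)] assms(2) le_trans by blast
 next
  case 2
  hence x: "x \<in> V" "x \<noteq> r" "y = par x" using cov_par by auto
  thus ?thesis using par_props[OF x(1,2)] assms(2) le_trans by blast
 qed
 show "le z x ==> y \<noteq> par z ==> z \<noteq> r ==> le z y" "\<not> le z x ==> y \<noteq> z ==> \<not> le z y" using A by blast+
qed

lemma walk_stays_below:
 assumes "successively (\<lambda>x y. {x, y} \<in> edges T) ys" "ys \<noteq> []" "le z (hd ys)" "par z \<notin> set ys" "z \<in> V" "z \<noteq> r"
 shows "\<forall>y\<in>set ys. le z y"
 using assms
proof (induction ys)
 case (Cons x ys)
 show ?case
 proof (cases ys)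
  case (Cons y ys')
  hence "le z y" using adjacent_below(1)[of x y z] Cons.prems by auto
  thus ?thesis using Cons.IH Cons.prems Cons by auto
 qed (use Cons.prems in simp)
qed simp

lemma walk_stays_outside:
 assumes "successively (\<lambda>x y. {x, y} \<in> edges T) ys" "ys \<noteq> []" "\<not> le z (hd ys)" "z \<notin> set ys" "z \<in> V"
 shows "\<forall>y\<in>set ys. \<not> le z y"
 using assms
proof (induction ys)
 case (Cons x ys)
 show ?case
 proof (cases ys)
  case (Cons y ys')
  hence "\<not> le z y" using adjacent_below(2)[of x y z] Cons.prems by auto
  thus ?thesis using Cons.IH Cons.prems Cons by auto
 qed (use Cons.prems in simp)
qed simp

text \<open>A path that has stepped down to a child cannot leave the descendants of this child
  again, and one that has stepped up cannot return, as either would revisit its first vertex. So the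
  target decides the first step, which gives uniqueness of paths by induction.\<close>

lemma path_first_step:
 assumes p: "is_path T u (u # y # xs) w"
 shows "if le u w then cov u y \<and> le y w else y = par u \<and> u \<noteq> r"
proof -
 have e: "{u, y} \<in> edges T" and s: "successively (\<lambda>x y. {x, y} \<in> edges T) (y # xs)"
  and d: "u \<notin> set (y # xs)" "last (y # xs) = w" and V: "u \<in> V" "y \<in> V"
  using p unfolding is_path_def by auto
 have w: "w \<in> set (y # xs)" using d(2) last_in_set[of "y # xs"] by simp
 consider "cov u y" | "cov y u" using e edge_iff by blast
 thus ?thesis
 proof cases
  case 1
  hence y: "y \<noteq> r" "par y = u" using cov_par by auto
  have "\<forall>x\<in>set (y # xs). le y x"
   by (rule walk_stays_below[OF s]) (use y d V le_refl in auto)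
  hence "le y w" using w by blast
  moreover have "le u w" using calculation 1 le_trans[of u y w] w p unfolding cov_def is_path_def by auto
  ultimately show ?thesis using 1 by simp
 next
  case 2
  hence u: "u \<noteq> r" "y = par u" using cov_par by auto
  have "\<not> le u y" using 2 le_antisym V unfolding cov_def by blast
  hence "\<forall>x\<in>set (y # xs). \<not> le u x"
   by (intro walk_stays_outside[OF s]) (use d V in auto)
  thus ?thesis using w u by auto
 qed
qed

lemma path_unique:
 assumes "is_path T u xs w" "is_path T u ys w"
 shows "xs = ys"
 using assms
proof (induction xs arbitrary: u ys)
 case Nil
 thus ?case by (simp add: is_path_def)
next
 case (Cons x xs)
 hence x: "x = u" by (simp add: is_path_def)
 obtain ys' where ys: "ys = u # ys'" using Cons.prems(2) unfolding is_path_def by (cases ys) auto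
 have single: "zs = []" if "is_path T u (u # zs) u" for zs
  using that unfolding is_path_def by (cases zs) (auto split: if_splits dest: last_in_set)
 show ?case
 proof (cases "u = w")
  case True
  thus ?thesis using Cons.prems single x ys by auto
 next
  case False
  then obtain y xs' y' ys'' where xy: "xs = y # xs'" "ys' = y' # ys''"
   using Cons.prems unfolding x ys is_path_def by (cases xs; cases ys'; auto)
  note st = path_first_step[OF Cons.prems(1)[unfolded x xy]] path_first_step[OF Cons.prems(2)[unfolded ys xy]]
  have V: "w \<in> V" "y \<in> V" "y' \<in> V" "u \<in> V" using Cons.prems unfolding x ys xy is_path_def
   by (auto dest: last_in_set split: if_splits)
  have "y = y'"
  proof (cases "le u w")
   case True
   hence c: "cov u y" "le y w" "cov u y'" "le y' w" using st by auto
   hence "le y y' \<or> le y' y" using le_chain V by blast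
   thus ?thesis using c V unfolding cov_def by blast
  next
   case False
   thus ?thesis using st by simp
  qed
  moreover have "is_path T y (y # xs') w" "is_path T y' (y' # ys'') w"
   using Cons.prems unfolding x ys xy is_path_def by auto
  ultimately show ?thesis using Cons.IH unfolding x ys xy by blast
 qed
qed

definition steps :: "'a list => ('a \<times> 'a) set" where "steps xs = set (zip xs (tl xs))"

lemma steps_Cons: "steps (x # xs) = (if xs = [] then {} else insert (x, hd xs) (steps xs))"
 unfolding steps_def by (cases xs) auto

lemma steps_single [simp]: "steps [] = {}" "steps [x] = {}"
 unfolding steps_def by auto

lemma steps_append: "xs \<noteq> [] ==> ys \<noteq> [] ==> steps (xs @ ys) = steps xs \<union> {(last xs, hd ys)} \<union> steps ys"
 by (induction xs) (auto simp: steps_Cons)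

lemma steps_rev: "steps (rev xs) = prod.swap ` steps xs"
proof (induction xs)
 case (Cons x xs)
 show ?case
 proof (cases "xs = []")
  case False
  hence "steps (rev (x # xs)) = insert (hd xs, x) (steps (rev xs))"
   by (simp add: steps_append last_rev)
  thus ?thesis using Cons False by (simp add: steps_Cons)
 qed (simp add: steps_def)
qed (simp add: steps_def)

lemma down_path:
 assumes "v \<in> V" "m \<in> V" "le m v"
 shows "\<exists>xs. is_path T m xs v \<and> set xs = {z \<in> V. le m z \<and> le z v} \<and> steps xs = {(par z, z) | z. z \<in> V \<and> le m z \<and> le z v \<and> z \<noteq> m}"
 using assms
proof (induction "card {z \<in> V. le z v}" arbitrary: v rule: less_induct)
 case (less v)
 show ?case
 proof (cases "v = m")
  case True
  have "{z \<in> V. le m z \<and> le z m} = {m}" using le_antisym le_refl less.prems by blast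
  moreover have "{(par z, z) | z. z \<in> V \<and> le m z \<and> le z m \<and> z \<noteq> m} = {}" using le_antisym less.prems by blast
  ultimately show ?thesis using True less.prems by (intro exI[of _ "[m]"]) (auto simp: is_path_def steps_def)
 next
  case False
  hence vr: "v \<noteq> r" using le_root le_antisym less.prems root by blast
  note pp = par_props[OF less.prems(1) vr]
  have mp: "le m (par v)" using pp(4) less.prems False by blast
  have vp: "\<not> le v (par v)" using pp le_antisym less.prems by blast
  have below: "z \<in> V \<and> le z v \<longleftrightarrow> z \<in> V \<and> (le z (par v) \<or> z = v)" for z
   using pp le_trans less.prems le_refl by blast
  have fin: "finite {z \<in> V. le z v}" using finite_verts by simp
  have "{z \<in> V. le z (par v)} \<subset> {z \<in> V. le z v}" using below vp less.prems le_refl by blast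
  hence "card {z \<in> V. le z (par v)} < card {z \<in> V. le z v}" by (rule psubset_card_mono[OF fin])
  from less.hyps[OF this pp(1) less.prems(2) mp] obtain xs where xs: "is_path T m xs (par v)"
   "set xs = {z \<in> V. le m z \<and> le z (par v)}" "steps xs = {(par z, z) | z. z \<in> V \<and> le m z \<and> le z (par v) \<and> z \<noteq> m}" by blast
  have ne: "xs \<noteq> []" "last xs = par v" using xs(1) by (auto simp: is_path_def)
  have e: "{par v, v} \<in> edges T" using edge_iff par_cov less.prems vr by blast
  have "is_path T m (xs @ [v]) v"
   using xs(1,2) e ne vp less.prems unfolding is_path_def by (auto simp: successively_append_iff)
  moreover have "set (xs @ [v]) = {z \<in> V. le m z \<and> le z v}" using xs(2) below less.prems by auto
  moreover have "steps (xs @ [v]) = {(par z, z) | z. z \<in> V \<and> le m z \<and> le z v \<and> z \<noteq> m}"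
  proof -
   have "{z. z \<in> V \<and> le m z \<and> le z v \<and> z \<noteq> m} = insert v {z. z \<in> V \<and> le m z \<and> le z (par v) \<and> z \<noteq> m}"
    using below less.prems False by blast
   thus ?thesis using ne xs(3) unfolding setcompr_eq_image by (simp add: steps_append)
  qed
  ultimately show ?thesis by blast
 qed
qed

definition meet :: "nat => nat => nat" where
 "meet u w = (THE m. m \<in> V \<and> le m u \<and> le m w \<and> (\<forall>z\<in>V. le z u \<longrightarrow> le z w \<longrightarrow> le z m))"

lemma meet:
 assumes "u \<in> V" "w \<in> V"
 shows "meet u w \<in> V" "le (meet u w) u" "le (meet u w) w" "\<And>z. z \<in> V ==> le z u ==> le z w ==> le z (meet u w)"
proof -
 let ?S = "{z \<in> V. le z u \<and> le z w}"
 have "r \<in> ?S" using root le_root assms by blast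
 then obtain m where m: "m \<in> ?S" "\<And>z. z \<in> ?S ==> le z m"
  using ex_maximal[of ?S] le_chain assms(1) by (metis (no_types, lifting) empty_iff mem_Collect_eq subsetI)
 let ?P = "\<lambda>m. m \<in> V \<and> le m u \<and> le m w \<and> (\<forall>z\<in>V. le z u \<longrightarrow> le z w \<longrightarrow> le z m)"
 have "?P m" using m by blast
 moreover have "m' = m" if "?P m'" for m' using that calculation le_antisym by blast
 ultimately have "?P (meet u w)" unfolding meet_def by (rule theI)
 thus "meet u w \<in> V" "le (meet u w) u" "le (meet u w) w" "\<And>z. z \<in> V ==> le z u ==> le z w ==> le z (meet u w)"
  by blast+
qed

text \<open>The path goes up to the meet and then down. Its edges are those above the vertices
  \<open>z\<close> that separate \<open>u\<close> from \<open>w\<close>; the inequality of truth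
  values is an exclusive or.\<close>

lemma ex_path:
 assumes u: "u \<in> V" and w: "w \<in> V"
 shows "\<exists>xs. is_path T u xs w \<and> set xs = {z \<in> V. le z u \<noteq> le z w \<or> z = meet u w} \<and>
  (\<lambda>(x, y). {x, y}) ` steps xs = {{par z, z} | z. z \<in> V \<and> le z u \<noteq> le z w}"
proof -
 let ?m = "meet u w"
 note m = meet[OF assms]
 obtain xs where xs: "is_path T ?m xs u" "set xs = {z \<in> V. le ?m z \<and> le z u}" "steps xs = {(par z, z) | z. z \<in> V \<and> le ?m z \<and> le z u \<and> z \<noteq> ?m}"
  using down_path[OF u m(1,2)] by blast
 obtain ys where ys: "is_path T ?m ys w" "set ys = {z \<in> V. le ?m z \<and> le z w}" "steps ys = {(par z, z) | z. z \<in> V \<and> le ?m z \<and> le z w \<and> z \<noteq> ?m}"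
  using down_path[OF w m(1,3)] by blast
 have zu: "z \<in> V ==> le ?m z \<and> le z u \<and> z \<noteq> ?m \<longleftrightarrow> le z u \<and> \<not> le z w" for z
  using m le_chain[of ?m z u] le_antisym le_trans u w by blast
 have zw: "z \<in> V ==> le ?m z \<and> le z w \<and> z \<noteq> ?m \<longleftrightarrow> \<not> le z u \<and> le z w" for z
  using m le_chain[of ?m z w] le_antisym le_trans u w by blast
 obtain ys' where y: "ys = ?m # ys'" using ys(1) unfolding is_path_def by (cases ys) auto
 obtain xs' where x: "xs = ?m # xs'" using xs(1) unfolding is_path_def by (cases xs) auto
 have sx: "set xs = {z \<in> V. le z u \<and> \<not> le z w \<or> z = ?m}" unfolding xs(2) using zu m le_refl by blast
 have sy: "set ys' = {z \<in> V. \<not> le z u \<and> le z w}"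
 proof -
  have "set ys' = set ys - {?m}" using ys(1) unfolding y is_path_def by auto
  thus ?thesis unfolding ys(2) using zw by blast
 qed
 have suc: "successively (\<lambda>x y. {x, y} \<in> edges T) (rev xs @ ys')"
 proof -
  have "successively (\<lambda>x y. {x, y} \<in> edges T) (rev xs)"
   using xs(1) unfolding is_path_def successively_rev by (simp add: insert_commute)
  moreover have "successively (\<lambda>x y. {x, y} \<in> edges T) (?m # ys')" using ys(1) unfolding y is_path_def by simp
  ultimately show ?thesis unfolding x by (cases ys') (auto simp: successively_append_iff)
 qed
 have "is_path T u (rev xs @ ys') w"
  unfolding is_path_def
 proof (intro conjI)
  show "rev xs @ ys' \<noteq> []" using x by simp
  show "hd (rev xs @ ys') = u" using xs(1) by (simp add: is_path_def hd_append hd_rev)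
  show "last (rev xs @ ys') = w" using ys(1) unfolding y x is_path_def by (auto split: if_splits)
  show "distinct (rev xs @ ys')" using xs(1) ys(1) sx sy m unfolding y is_path_def by auto
  show "set (rev xs @ ys') \<subseteq> V" using sx sy by auto
 qed (rule suc)
 moreover have "set (rev xs @ ys') = {z \<in> V. le z u \<noteq> le z w \<or> z = ?m}" using sx sy by auto
 moreover have "(\<lambda>(x, y). {x, y}) ` steps (rev xs @ ys') = {{par z, z} | z. z \<in> V \<and> le z u \<noteq> le z w}"
 proof -
  have "steps (rev xs @ ys') = steps (rev xs) \<union> steps ys"
   unfolding y x by (cases ys') (simp_all add: steps_append steps_Cons del: rev.simps, simp)
  hence "(\<lambda>(x, y). {x, y}) ` steps (rev xs @ ys') = (\<lambda>(x, y). {x, y}) ` steps xs \<union> (\<lambda>(x, y). {x, y}) ` steps ys"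
   unfolding steps_rev by (auto simp: image_Un image_image case_prod_unfold insert_commute)
  also have "\<dots> = {{par z, z} | z. z \<in> V \<and> le z u \<noteq> le z w}"
  proof -
   have "{z. z \<in> V \<and> le ?m z \<and> le z u \<and> z \<noteq> ?m} \<union> {z. z \<in> V \<and> le ?m z \<and> le z w \<and> z \<noteq> ?m} = {z. z \<in> V \<and> le z u \<noteq> le z w}"
    using zu zw by blast
   thus ?thesis unfolding xs(3) ys(3) setcompr_eq_image image_image prod.case image_Un[symmetric] by simp
  qed
  finally show ?thesis .
 qed
 ultimately show ?thesis by blast
qed

lemma tree_path_eq: "is_path T u xs w ==> tree_path T u w = xs"
 unfolding tree_path_def using path_unique by blast

lemma ex1_path:
 assumes "u \<in> V" "w \<in> V"
 shows "\<exists>!xs. is_path T u xs w"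
proof -
 obtain xs where "is_path T u xs w" using ex_path[OF assms] by blast
 thus ?thesis using path_unique by blast
qed

lemma tree_path_is_path:
 assumes "u \<in> V" "w \<in> V"
 shows "is_path T u (tree_path T u w) w"
 unfolding tree_path_def by (rule theI'[OF ex1_path[OF assms]])

lemma set_tree_path:
 assumes "u \<in> V" "w \<in> V"
 shows "set (tree_path T u w) = {z \<in> V. le z u \<noteq> le z w \<or> z = meet u w}"
proof -
 obtain xs where xs: "is_path T u xs w" "set xs = {z \<in> V. le z u \<noteq> le z w \<or> z = meet u w}" using ex_path[OF assms] by blast
 show ?thesis unfolding tree_path_eq[OF xs(1)] by (rule xs(2))
qed

lemma path_edges_eq:
 assumes "u \<in> V" "w \<in> V"
 shows "path_edges T u w = {{par z, z} | z. z \<in> V \<and> le z u \<noteq> le z w}"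
proof -
 obtain xs where xs: "is_path T u xs w" "(\<lambda>(x, y). {x, y}) ` steps xs = {{par z, z} | z. z \<in> V \<and> le z u \<noteq> le z w}"
  using ex_path[OF assms] by blast
 show ?thesis unfolding path_edges_def path_steps_def tree_path_eq[OF xs(1)] by (rule xs(2)[unfolded steps_def])
qed

lemma set_down_path:
 assumes "u \<in> V" "w \<in> V" "le u w"
 shows "set (tree_path T u w) = {z \<in> V. le u z \<and> le z w}"
proof -
 obtain xs where xs: "is_path T u xs w" "set xs = {z \<in> V. le u z \<and> le z w}"
  using down_path[OF assms(2,1,3)] by blast
 show ?thesis unfolding tree_path_eq[OF xs(1)] by (rule xs(2))
qed

lemma set_root_path: "w \<in> V ==> set (tree_path T r w) = {z \<in> V. le z w}"
 using set_down_path[OF root _ le_root] le_root by auto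

lemma path_steps_down:
 assumes "u \<in> V" "w \<in> V" "le u w"
 shows "set (path_steps T u w) = {(par z, z) | z. z \<in> V \<and> le u z \<and> le z w \<and> z \<noteq> u}"
proof -
 obtain xs where xs: "is_path T u xs w" "steps xs = {(par z, z) | z. z \<in> V \<and> le u z \<and> le z w \<and> z \<noteq> u}"
  using down_path[OF assms(2,1,3)] by blast
 show ?thesis unfolding path_steps_def tree_path_eq[OF xs(1)] by (rule xs(2)[unfolded steps_def])
qed

lemma distinct_path_steps: "u \<in> V ==> w \<in> V ==> distinct (path_steps T u w)"
 unfolding path_steps_def using tree_path_is_path by (auto simp: is_path_def distinct_zipI1)

lemma sum_path_steps:
 assumes "u \<in> V" "w \<in> V" "le u w"
 shows "(\<Sum>(x, y)\<leftarrow>path_steps T u w. f x y) = (\<Sum>z | z \<in> V \<and> le u z \<and> le z w \<and> z \<noteq> u. f (par z) z)"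
proof -
 have "(\<Sum>(x, y)\<leftarrow>path_steps T u w. f x y) = (\<Sum>(x, y)\<in>set (path_steps T u w). f x y)"
  by (rule sum_list_distinct_conv_sum_set[OF distinct_path_steps[OF assms(1,2)]])
 also have "set (path_steps T u w) = (\<lambda>z. (par z, z)) ` {z. z \<in> V \<and> le u z \<and> le z w \<and> z \<noteq> u}"
  unfolding path_steps_down[OF assms] by auto
 finally show ?thesis by (subst (asm) sum.reindex) (auto simp: inj_on_def)
qed

lemma ne_root: "z \<in> V ==> u \<in> V ==> le u z ==> z \<noteq> u ==> z \<noteq> r"
 using le_root le_antisym by blast

lemma sum_path_edges:
 assumes "u \<in> V" "w \<in> V" "le u w"
 shows "(\<Sum>e\<in>path_edges T u w. f e) = (\<Sum>z | z \<in> V \<and> le u z \<and> le z w \<and> z \<noteq> u. f {par z, z})"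
proof -
 have "path_edges T u w = (\<lambda>z. {par z, z}) ` {z. z \<in> V \<and> le u z \<and> le z w \<and> z \<noteq> u}"
  unfolding path_edges_def path_steps_down[OF assms] by force
 moreover have "inj_on (\<lambda>z. {par z, z}) {z. z \<in> V \<and> le u z \<and> le z w \<and> z \<noteq> u}"
  by (rule inj_on_subset[OF par_edge_inj]) (use ne_root assms in auto)
 ultimately show ?thesis by (simp add: sum.reindex)
qed

text \<open>Every function on the edges is the coboundary of the potential obtained by summing along
 the paths from the root.\<close>

definition pot :: "(nat set => 'b::ab_group_add) => nat => 'b" where
 "pot t v = (\<Sum>z | z \<in> V \<and> le z v \<and> z \<noteq> r. t {par z, z})"

lemma pot_root: "pot t r = 0"
 unfolding pot_def using le_root le_antisym root by (intro sum.neutral) blast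

lemma pot_diff:
 assumes "u \<in> V" "w \<in> V" "le u w"
 shows "(\<Sum>z | z \<in> V \<and> le u z \<and> le z w \<and> z \<noteq> u. t {par z, z}) = pot t w - pot t u"
proof -
 have "{z. z \<in> V \<and> le z w \<and> z \<noteq> r} = {z. z \<in> V \<and> le u z \<and> le z w \<and> z \<noteq> u} \<union> {z. z \<in> V \<and> le z u \<and> z \<noteq> r}"
  using assms le_chain le_trans ne_root le_refl by blast
 moreover have "{z. z \<in> V \<and> le u z \<and> le z w \<and> z \<noteq> u} \<inter> {z. z \<in> V \<and> le z u \<and> z \<noteq> r} = {}"
  using assms le_antisym by blast
 ultimately have "pot t w = (\<Sum>z | z \<in> V \<and> le u z \<and> le z w \<and> z \<noteq> u. t {par z, z}) + pot t u"
  unfolding pot_def using finite_verts by (simp add: sum.union_disjoint)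
 thus ?thesis by simp
qed

lemma pot_par:
 assumes "v \<in> V" "v \<noteq> r"
 shows "pot t v = pot t (par v) + t {par v, v}"
proof -
 note pp = par_props[OF assms]
 have "{z. z \<in> V \<and> le (par v) z \<and> le z v \<and> z \<noteq> par v} = {v}"
  using par_cov[OF assms] assms(1) le_refl unfolding cov_def by auto
 thus ?thesis using pot_diff[OF pp(1) assms(1) pp(2), of t] by simp
qed

lemma pot_mono:
 fixes t :: "nat set => real"
 assumes "u \<in> V" "w \<in> V" "le u w" "u \<noteq> w" "\<And>e. e \<in> edges T ==> t e > 0"
 shows "pot t u < pot t w"
proof -
 have "(\<Sum>z | z \<in> V \<and> le u z \<and> le z w \<and> z \<noteq> u. t {par z, z}) > 0"
 proof (rule sum_pos)
  show "{z. z \<in> V \<and> le u z \<and> le z w \<and> z \<noteq> u} \<noteq> {}" using assms le_refl by blast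
  show "0 < t {par z, z}" if "z \<in> {z. z \<in> V \<and> le u z \<and> le z w \<and> z \<noteq> u}" for z
   using that ne_root[of z u] assms edges_par by auto
 qed (use finite_verts in simp)
 thus ?thesis using pot_diff[OF assms(1-3), of t] by simp
qed

lemma chain_len_pot:
 assumes "u \<in> V" "w \<in> V" "le u w"
 shows "chain_len T t {u, w} = pot t w - pot t u"
proof -
 \<comment> \<open>\<open>chain_len\<close> names the endpoints by an unordered pair, so both
   orientations occur in its index set.\<close>
 have "path_edges T w u = path_edges T u w" using assms by (auto simp: path_edges_eq)
 hence "{f. \<exists>u' w'. {u, w} = {u', w'} \<and> f \<in> path_edges T u' w'} = path_edges T u w"
  by (auto simp: doubleton_eq_iff)
 thus ?thesis unfolding chain_len_def using sum_path_edges[OF assms, of t] pot_diff[OF assms, of t] by simp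
qed

end

lemma doubletons_cong:
 "(\<And>u v. u \<in> V ==> v \<in> V ==> P u v = Q u v) ==>
  {{u, v} | u v. u \<in> V \<and> v \<in> V \<and> P u v} = {{u, v} | u v. u \<in> V \<and> v \<in> V \<and> Q u v}"
 by (intro Collect_cong ex_cong1) auto

context otree_graph
begin

lemma tree_induct [consumes 1, case_names base step]:
 assumes "v \<in> V" "P r" "\<And>v. v \<in> V ==> v \<noteq> r ==> P (par v) ==> P v"
 shows "P v"
 using assms(1)
proof (induction "card {z \<in> V. le z v}" arbitrary: v rule: less_induct)
 case (less v)
 show ?case
 proof (cases "v = r")
  case False
  note pp = par_props[OF less.prems False]
  have "v \<notin> {z \<in> V. le z (par v)}" using pp(1-3) le_antisym less.prems by blast
  moreover have "{z \<in> V. le z (par v)} \<subseteq> {z \<in> V. le z v}" using pp(1,2) le_trans less.prems by blast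
  ultimately have "{z \<in> V. le z (par v)} \<subset> {z \<in> V. le z v}" using le_refl[OF less.prems] less.prems by blast
  hence "card {z \<in> V. le z (par v)} < card {z \<in> V. le z v}"
   using finite_verts by (intro psubset_card_mono) auto
  thus ?thesis using less.hyps pp(1) assms(3) less.prems False by blast
 qed (use assms(2) in simp)
qed

lemma child_toward:
 assumes "u \<in> V" "x \<in> V" "le u x" "u \<noteq> x"
 obtains c where "cov u c" "le c x"
proof -
 have "u \<in> V \<longrightarrow> le u x \<longrightarrow> u \<noteq> x \<longrightarrow> (\<exists>c. cov u c \<and> le c x)"
  using assms(2)
 proof (induction x rule: tree_induct)
  case base
  thus ?case using le_root le_antisym root by blast
 next
  case (step v)
  note pp = par_props[OF step(1,2)]
  show ?case
  proof (intro impI)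
   assume u: "u \<in> V" "le u v" "u \<noteq> v"
   hence "le u (par v)" using pp by blast
   show "\<exists>c. cov u c \<and> le c v"
   proof (cases "u = par v")
    case True
    thus ?thesis using par_cov[OF step(1,2)] le_refl step(1) by blast
   next
    case False
    then obtain c where c: "cov u c" "le c (par v)" using step(3) u \<open>le u (par v)\<close> by blast
    hence "le c v" using le_trans[of c "par v" v] pp step(1) unfolding cov_def by blast
    thus ?thesis using c by blast
   qed
  qed
 qed
 thus ?thesis using assms that by blast
qed

end

text \<open>The order is that of lying on the path from \<open>r\<close>. By uniqueness every prefix
  of a path from \<open>r\<close> is the path to its last vertex, so two vertices on one path are
  comparable and an edge extends one root path by a single vertex.\<close>

lemma metric_tree_otree_graph:
 assumes T: "metric_tree L T" and r: "r \<in> verts T"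
 shows "otree_graph T r (\<lambda>u v. u \<in> set (tree_path T r v))"
proof -
 let ?V = "verts T"
 define P where "P v = tree_path T r v" for v
 have ex1: "\<exists>!xs. is_path T u xs w" if "u \<in> ?V" "w \<in> ?V" for u w using T that unfolding metric_tree_def by blast
 have pth: "is_path T r (P v) v" if "v \<in> ?V" for v
  unfolding P_def tree_path_def by (rule theI'[OF ex1[OF r that]])
 have uniq: "P v = xs" if "is_path T r xs v" for xs v
 proof -
  have "v \<in> ?V" using that unfolding is_path_def by (auto dest: last_in_set)
  thus ?thesis using ex1[OF r] pth that by blast
 qed
 have prefix: "P u = xs @ [u]" if "v \<in> ?V" "P v = xs @ u # ys" for u v xs ys
 proof (rule uniq)
  have p: "is_path T r (xs @ u # ys) v" using pth that by metis
  have "xs @ u # ys = (xs @ [u]) @ ys" by simp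
  hence "successively (\<lambda>x y. {x, y} \<in> edges T) ((xs @ [u]) @ ys)" using p unfolding is_path_def by metis
  hence "successively (\<lambda>x y. {x, y} \<in> edges T) (xs @ [u])" by (rule successively_append_iff[THEN iffD1, THEN conjunct1])
  thus "is_path T r (xs @ [u]) u"
   using p unfolding is_path_def by (cases xs) auto
 qed
 have in_V: "u \<in> ?V" if "u \<in> set (P v)" "v \<in> ?V" for u v using pth[OF that(2)] that(1) unfolding is_path_def by auto
 have prefix': "\<exists>ys. P v = P u @ ys" if uv: "u \<in> set (P v)" "v \<in> ?V" for u v
 proof -
  obtain xs ys where "P v = xs @ u # ys" using uv(1) by (auto simp: in_set_conv_decomp)
  thus ?thesis using prefix[OF uv(2)] by (intro exI[of _ ys]) simp
 qed
 have lastP: "P v \<noteq> [] \<and> last (P v) = v \<and> hd (P v) = r \<and> distinct (P v)" if "v \<in> ?V" for v using pth[OF that] unfolding is_path_def by auto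
 have refl: "v \<in> set (P v)" if "v \<in> ?V" for v using lastP[OF that] last_in_set by metis
 have anti: "u = v" if uv: "u \<in> set (P v)" "v \<in> set (P u)" "u \<in> ?V" "v \<in> ?V" for u v
 proof -
  obtain ys zs where "P v = P u @ ys" "P u = P v @ zs" using prefix'[OF uv(1,4)] prefix'[OF uv(2,3)] by blast
  hence "P u = P v" by simp
  moreover have "last (P u) = u" "last (P v) = v" using lastP uv by blast+
  ultimately show ?thesis by metis
 qed
 have tr: "u \<in> set (P w)" if uv: "u \<in> set (P v)" "v \<in> set (P w)" "w \<in> ?V" for u v w
 proof -
  obtain ys where "P w = P v @ ys" using prefix'[OF uv(2,3)] by blast
  thus ?thesis using uv(1) by simp
 qed
 have edgeV: "u \<in> ?V \<and> v \<in> ?V \<and> u \<noteq> v" if uv: "{u, v} \<in> edges T" for u v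
 proof -
  have "edges T \<subseteq> {{u, w} | u w. u \<in> ?V \<and> w \<in> ?V \<and> u \<noteq> w}" using T unfolding metric_tree_def by (elim conjE)
  then obtain a b where "{u, v} = {a, b}" "a \<in> ?V" "b \<in> ?V" "a \<noteq> b" using uv by blast
  thus ?thesis by (auto simp: doubleton_eq_iff)
 qed
 have ext: "P v = P u @ [v]" if "{u, v} \<in> edges T" "v \<notin> set (P u)" for u v
 proof (rule uniq)
  have "is_path T r (P u) u" using pth edgeV[OF that(1)] by blast
  thus "is_path T r (P u @ [v]) v"
   using that edgeV[OF that(1)] unfolding is_path_def by (auto simp: successively_append_iff)
 qed
 let ?cov = "\<lambda>u v. u \<in> ?V \<and> v \<in> ?V \<and> u \<in> set (P v) \<and> u \<noteq> v \<and> (\<forall>z\<in>?V. u \<in> set (P z) \<longrightarrow> z \<in> set (P v) \<longrightarrow> z = u \<or> z = v)"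
 have cov1: "?cov u v" if "{u, v} \<in> edges T" "v \<notin> set (P u)" for u v
 proof -
  note e = ext[OF that] edgeV[OF that(1)]
  have "z = u \<or> z = v" if "z \<in> ?V" "u \<in> set (P z)" "z \<in> set (P v)" for z
   using that anti[of u z] e by auto
  thus ?thesis using e refl[of u] by auto
 qed
 have edge_cov: "{u, v} \<in> edges T \<longleftrightarrow> ?cov u v \<or> ?cov v u" for u v
 proof
  assume e: "{u, v} \<in> edges T"
  hence "\<not> (v \<in> set (P u) \<and> u \<in> set (P v))" using anti edgeV by blast
  then consider "v \<notin> set (P u)" | "u \<notin> set (P v)" by blast
  thus "?cov u v \<or> ?cov v u"
  proof cases
   case 1
   show ?thesis by (rule disjI1, rule cov1[OF e 1])
  next
   case 2
   have "{v, u} \<in> edges T" using e by (simp add: insert_commute)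
   thus ?thesis by (intro disjI2 cov1 2)
  qed
 next
  have *: "{u, v} \<in> edges T" if c: "?cov u v" for u v
  proof -
   obtain ys where ys: "P v = P u @ ys" using prefix' c by blast
   have "ys \<noteq> []"
   proof
    assume "ys = []"
    hence "P u = P v" using ys by simp
    thus False using lastP c by metis
   qed
   then obtain z zs where z: "ys = z # zs" by (cases ys) auto
   have p: "is_path T r (P u @ z # zs) v" using pth[of v] c ys z by simp
   have zV: "z \<in> ?V" using p unfolding is_path_def by auto
   have "P z = P u @ [z]" using prefix[of v "P u" z zs] c ys z by simp
   hence "u \<in> set (P z)" "z \<in> set (P v)" using refl[of u] c ys z by auto
   moreover have "z \<noteq> u" using p refl[of u] c unfolding is_path_def by auto
   ultimately have "z = v" using c zV by blast
   moreover have "{last (P u), z} \<in> edges T" using p lastP[of u] c unfolding is_path_def by (auto simp: successively_append_iff)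
   ultimately show ?thesis using lastP[of u] c by simp
  qed
  assume "?cov u v \<or> ?cov v u"
  thus "{u, v} \<in> edges T"
  proof
   assume "?cov v u"
   hence "{v, u} \<in> edges T" by (rule *)
   thus ?thesis by (simp add: insert_commute)
  qed (rule *)
 qed
 show ?thesis
  unfolding P_def[symmetric]
 proof
  show "finite ?V" using T unfolding metric_tree_def by blast
  show "r \<in> set (P v)" if "v \<in> ?V" for v using lastP[OF that] hd_in_set by metis
  show "u \<in> set (P u') \<or> u' \<in> set (P u)" if uv: "u \<in> ?V" "u' \<in> ?V" "v \<in> ?V" "u \<in> set (P v)" "u' \<in> set (P v)" for u u' v
  proof -
   obtain ys zs where "P v = P u @ ys" "P v = P u' @ zs" using prefix'[OF uv(4,3)] prefix'[OF uv(5,3)] by blast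
   hence "P u @ ys = P u' @ zs" by simp
   then obtain us where "P u = P u' @ us \<or> P u @ us = P u'" unfolding append_eq_append_conv2 by blast
   hence "set (P u') \<subseteq> set (P u) \<or> set (P u) \<subseteq> set (P u')" by (metis Un_upper1 set_append)
   thus ?thesis using refl[OF uv(1)] refl[OF uv(2)] by auto
  qed
  have "edges T = {{u, v} | u v. {u, v} \<in> edges T}"
   using T unfolding metric_tree_def by blast
  also have "\<dots> = {{u, v} | u v. ?cov u v}"
   unfolding edge_cov by (auto simp: insert_commute) 
  finally show "edges T = {{u, v} | u v. ?cov u v}" .
 qed (use r refl anti tr in blast)+
qed

section \<open>Trees with clusters of marked ends\<close>

text \<open>A vertex is identified by the set of ends (other than the first marked point) that lie
 behind it, as seen from the first marked point.\<close>

locale keyed_tree =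
 fixes L :: "mark set" and T :: "'z mtree_scheme" and K :: "nat => mark set" and d :: "nat => real"
 assumes finV: "finite (verts T)" and root_mark: "PMark 1 \<in> L"
  and K_inj: "inj_on K (verts T)"
  and K_sub: "\<And>v. v \<in> verts T ==> K v \<noteq> {} \<and> K v \<subseteq> L - {PMark 1}"
  and K_laminar: "\<And>u v. u \<in> verts T ==> v \<in> verts T ==> K u \<subseteq> K v \<or> K v \<subseteq> K u \<or> K u \<inter> K v = {}"
  and K_root: "foot T (PMark 1) \<in> verts T" "K (foot T (PMark 1)) = L - {PMark 1}"
  and K_foot: "\<And>l. l \<in> L ==> l \<noteq> PMark 1 ==> foot T l \<in> verts T"
   "\<And>l v. l \<in> L ==> l \<noteq> PMark 1 ==> v \<in> verts T ==> l \<in> K v \<longleftrightarrow> K (foot T l) \<subseteq> K v"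
  and K_edges: "edges T = {{u, v} | u v. u \<in> verts T \<and> v \<in> verts T \<and> K v \<subset> K u \<and>
   (\<forall>z\<in>verts T. K v \<subseteq> K z \<longrightarrow> K z \<subseteq> K u \<longrightarrow> K z = K u \<or> K z = K v)}"
  and K_len: "\<And>u v. {u, v} \<in> edges T ==> K v \<subset> K u ==> len T {u, v} = d v - d u"

text \<open>The root has all ends behind it, so the order is reverse inclusion of keys.\<close>

sublocale keyed_tree \<subseteq> otree_graph T "foot T (PMark 1)" "\<lambda>u v. K v \<subseteq> K u"
proof
 show "u = v" if "u \<in> verts T" "v \<in> verts T" "K v \<subseteq> K u" "K u \<subseteq> K v" for u v
  using that K_inj by (auto dest: inj_onD)
 show "K u' \<subseteq> K u \<or> K u \<subseteq> K u'" if "u \<in> verts T" "u' \<in> verts T" "v \<in> verts T" "K v \<subseteq> K u" "K v \<subseteq> K u'" for u u' v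
  using that K_laminar[of u u'] K_sub[of v] by blast
 have *: "(K v \<subset> K u \<and> (\<forall>z\<in>verts T. K v \<subseteq> K z \<longrightarrow> K z \<subseteq> K u \<longrightarrow> K z = K u \<or> K z = K v))
   \<longleftrightarrow> K v \<subseteq> K u \<and> u \<noteq> v \<and> (\<forall>z\<in>verts T. K z \<subseteq> K u \<longrightarrow> K v \<subseteq> K z \<longrightarrow> z = u \<or> z = v)"
  if "u \<in> verts T" "v \<in> verts T" for u v
  using that K_inj by (metis inj_on_contraD psubsetE psubsetI)
 show "edges T = {{u, v} | u v. u \<in> verts T \<and> v \<in> verts T \<and> K v \<subseteq> K u \<and> u \<noteq> v \<and>
   (\<forall>z\<in>verts T. K z \<subseteq> K u \<longrightarrow> K v \<subseteq> K z \<longrightarrow> z = u \<or> z = v)}"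
  unfolding K_edges by (rule doubletons_cong) (rule *)
qed (use finV K_root K_sub in auto)

text \<open>The keys can be recovered from the graph and its feet; hence isomorphisms preserve
  them.\<close>

lemma (in keyed_tree) K_by_paths:
 assumes "v \<in> verts T"
 shows "K v = {l \<in> L - {PMark 1}. v \<in> set (tree_path T (foot T (PMark 1)) (foot T l))}"
proof -
 have "l \<in> K v \<longleftrightarrow> v \<in> set (tree_path T (foot T (PMark 1)) (foot T l))" if "l \<in> L - {PMark 1}" for l
  using set_root_path[OF K_foot(1)[of l]] K_foot(2)[of l v] that assms by auto
 thus ?thesis using K_sub[OF assms] by blast
qed

lemma (in keyed_tree) d_par:
 assumes "v \<in> verts T" "v \<noteq> foot T (PMark 1)"
 shows "d v = d (par v) + len T {par v, v}"
proof -
 have c: "cov (par v) v" by (rule par_cov[OF assms])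
 hence "{par v, v} \<in> edges T" using edge_iff by blast
 moreover have "K v \<subset> K (par v)" using c K_inj unfolding cov_def by (metis inj_on_contraD psubsetI)
 ultimately show ?thesis using K_len by simp
qed

lemma (in keyed_tree) d_pot:
 assumes "v \<in> verts T"
 shows "d v = d (foot T (PMark 1)) + pot (len T) v"
 using assms
proof (induction v rule: tree_induct)
 case (step v)
 show ?case using step(3) unfolding d_par[OF step(1,2)] pot_par[OF step(1,2)] by simp
next
 case base
 show ?case unfolding pot_root by simp
qed

text \<open>Keys are injective, and covering pairs, feet and lengths can be expressed through keys
  and depths. So matching vertices by their keys is an isomorphism.\<close>

lemma keyed_tree_iso:
 assumes "keyed_tree L T K d" "keyed_tree L T' K' d'"
  and keys: "(\<lambda>v. (K v, d v)) ` verts T = (\<lambda>v. (K' v, d' v)) ` verts T'"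
 obtains \<sigma> where "tree_iso L \<sigma> T T'" "\<And>v. v \<in> verts T ==> \<sigma> v \<in> verts T' \<and> K' (\<sigma> v) = K v \<and> d' (\<sigma> v) = d v"
proof -
 interpret A: keyed_tree L T K d by fact
 interpret B: keyed_tree L T' K' d' by fact
 have "\<exists>w. w \<in> verts T' \<and> K' w = K v \<and> d' w = d v" if "v \<in> verts T" for v
 proof -
  have "(K v, d v) \<in> (\<lambda>v. (K' v, d' v)) ` verts T'" using keys that by blast
  thus ?thesis by auto
 qed
 then obtain \<sigma> where \<sigma>: "\<And>v. v \<in> verts T ==> \<sigma> v \<in> verts T' \<and> K' (\<sigma> v) = K v \<and> d' (\<sigma> v) = d v" by metis
 have KK: "K ` verts T = K' ` verts T'" using arg_cong[OF keys, of "(`) fst"] by (simp add: image_image)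
 have bij: "bij_betw \<sigma> (verts T) (verts T')"
  unfolding bij_betw_def
 proof
  show "inj_on \<sigma> (verts T)" using \<sigma> A.K_inj by (metis inj_on_def)
  show "\<sigma> ` verts T = verts T'"
  proof (intro equalityI subsetI)
   fix w assume w: "w \<in> verts T'"
   then obtain v where "v \<in> verts T" "K v = K' w" using KK by (metis imageE image_eqI)
   hence "\<sigma> v = w" using \<sigma> B.K_inj w by (metis inj_on_contraD)
   thus "w \<in> \<sigma> ` verts T" using \<open>v \<in> verts T\<close> by blast
  qed (use \<sigma> in auto)
 qed
 have surj: "\<exists>v\<in>verts T. w = \<sigma> v" if "w \<in> verts T'" for w using bij that by (metis bij_betw_imp_surj_on imageE)
 have cov: "B.cov (\<sigma> u) (\<sigma> v) \<longleftrightarrow> A.cov u v" if "u \<in> verts T" "v \<in> verts T" for u v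
 proof -
  have eq: "\<sigma> x = \<sigma> y \<longleftrightarrow> x = y" if "x \<in> verts T" "y \<in> verts T" for x y
   using bij that by (meson bij_betw_imp_inj_on inj_on_eq_iff)
  have all: "(\<forall>z\<in>verts T'. Q z) \<longleftrightarrow> (\<forall>z\<in>verts T. Q (\<sigma> z))" for Q
   unfolding bij_betw_imp_surj_on[OF bij, symmetric] by simp
  show ?thesis unfolding A.cov_def B.cov_def all using \<sigma> that eq by simp
 qed
 have "tree_iso L \<sigma> T T'"
  unfolding tree_iso_def
 proof (intro conjI ballI)
  show "bij_betw \<sigma> (verts T) (verts T')" by (rule bij)
  have eA: "edges T = {{u, v} | u v. A.cov u v}" unfolding A.edges_cover A.cov_def ..
  have eB: "edges T' = {{u, v} | u v. B.cov u v}" unfolding B.edges_cover B.cov_def ..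
  show "edges T' = (`) \<sigma> ` edges T"
  proof (intro equalityI subsetI)
   fix e assume "e \<in> edges T'"
   then obtain u v where e: "e = {u, v}" "B.cov u v" unfolding eB by blast
   then obtain u' v' where u': "u' \<in> verts T" "v' \<in> verts T" "u = \<sigma> u'" "v = \<sigma> v'" using surj unfolding B.cov_def by metis
   hence "{u', v'} \<in> edges T" unfolding eA using cov e(2) by blast
   thus "e \<in> (`) \<sigma> ` edges T" unfolding e u'(3,4) by (intro image_eqI[of _ _ "{u', v'}"]) auto
  next
   fix e assume "e \<in> (`) \<sigma> ` edges T"
   then obtain u v where e: "e = {\<sigma> u, \<sigma> v}" "A.cov u v" unfolding eA by auto
   hence "B.cov (\<sigma> u) (\<sigma> v)" using cov unfolding A.cov_def by blast
   thus "e \<in> edges T'" unfolding eB e by blast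
  qed
  show "len T' (\<sigma> ` e) = len T e" if eT: "e \<in> edges T" for e
  proof -
   obtain u v where e: "e = {u, v}" "A.cov u v" using eT unfolding eA by blast
   hence uv: "u \<in> verts T" "v \<in> verts T" "v \<noteq> foot T (PMark 1)" "A.par v = u" using A.cov_par unfolding A.cov_def by auto
   have "B.cov (\<sigma> u) (\<sigma> v)" using cov e(2) uv by blast
   hence "\<sigma> v \<in> verts T'" "\<sigma> v \<noteq> foot T' (PMark 1)" "B.par (\<sigma> v) = \<sigma> u" using B.cov_par by auto
   thus ?thesis using A.d_par[OF uv(2,3)] B.d_par[of "\<sigma> v"] \<sigma> uv e(1) by simp
  qed
  show "foot T' l = \<sigma> (foot T l)" if "l \<in> L" for l
  proof (cases "l = PMark 1")
   case True
   thus ?thesis using A.K_root B.K_root \<sigma> B.K_inj by (metis inj_onD)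
  next
   case False
   note fA = A.K_foot[OF that False] and fB = B.K_foot[OF that False]
   have "l \<in> K (foot T l)" "l \<in> K' (foot T' l)" using fA fB by auto
   obtain v where v: "v \<in> verts T" "foot T' l = \<sigma> v" using surj[OF fB(1)] by blast
   have "K (foot T l) \<subseteq> K v" using fA(2)[OF v(1)] \<sigma>[OF v(1)] v(2) \<open>l \<in> K' (foot T' l)\<close> by simp
   moreover have "K v \<subseteq> K (foot T l)" using fB(2)[of "\<sigma> (foot T l)"] \<sigma>[OF fA(1)] \<sigma>[OF v(1)] v(2) \<open>l \<in> K (foot T l)\<close> by simp
   ultimately have "v = foot T l" using A.K_inj v(1) fA(1) by (metis inj_onD subset_antisym)
   thus ?thesis using v(2) by simp
  qed
 qed
 thus ?thesis using that \<sigma> by blast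
qed

lemma tree_iso_path:
 assumes iso: "tree_iso L \<sigma> T T'" and p: "is_path T u xs w"
 shows "is_path T' (\<sigma> u) (map \<sigma> xs) (\<sigma> w)"
proof -
 have inj: "inj_on \<sigma> (verts T)" and im: "\<sigma> ` verts T = verts T'" and e: "edges T' = (`) \<sigma> ` edges T"
  using iso unfolding tree_iso_def bij_betw_def by auto
 have "successively (\<lambda>x y. {\<sigma> x, \<sigma> y} \<in> edges T') xs"
  by (rule successively_mono[of "\<lambda>x y. {x, y} \<in> edges T"]) (use p e in \<open>auto simp: is_path_def intro: image_eqI[rotated]\<close>)
 moreover have "distinct (map \<sigma> xs)" using p inj unfolding is_path_def distinct_map by (auto intro: inj_on_subset)
 ultimately show ?thesis
  using p im unfolding is_path_def by (auto simp: hd_map last_map successively_map)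
qed

lemma keyed_tree_iso_keys:
 assumes "keyed_tree L T K d" "keyed_tree L T' K' d'" and iso: "tree_iso L \<sigma> T T'" and v: "v \<in> verts T"
 shows "K' (\<sigma> v) = K v" "d' (\<sigma> v) - d' (foot T' (PMark 1)) = d v - d (foot T (PMark 1))"
proof -
 interpret A: keyed_tree L T K d by fact
 interpret B: keyed_tree L T' K' d' by fact
 have inj: "inj_on \<sigma> (verts T)" and im: "\<sigma> ` verts T = verts T'" and e: "edges T' = (`) \<sigma> ` edges T"
  and fo: "\<And>l. l \<in> L ==> foot T' l = \<sigma> (foot T l)" and le: "\<And>e. e \<in> edges T ==> len T' (\<sigma> ` e) = len T e"
  using iso unfolding tree_iso_def bij_betw_def by auto
 have KK: "K' (\<sigma> v) = K v" if v: "v \<in> verts T" for v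
 proof -
  have "\<sigma> v \<in> set (tree_path T' (foot T' (PMark 1)) (foot T' l)) \<longleftrightarrow> v \<in> set (tree_path T (foot T (PMark 1)) (foot T l))"
   if l: "l \<in> L - {PMark 1}" for l
  proof -
   have f: "foot T l \<in> verts T" using A.K_foot(1) l by simp
   have p: "is_path T (foot T (PMark 1)) (tree_path T (foot T (PMark 1)) (foot T l)) (foot T l)"
    by (rule A.tree_path_is_path[OF A.K_root(1) f])
   have "tree_path T' (foot T' (PMark 1)) (foot T' l) = map \<sigma> (tree_path T (foot T (PMark 1)) (foot T l))"
    by (rule B.tree_path_eq) (use tree_iso_path[OF iso p] fo l A.root_mark in simp)
   thus ?thesis using inj v p unfolding is_path_def by (auto dest: inj_onD)
  qed
  thus ?thesis using A.K_by_paths[OF v] B.K_by_paths[of "\<sigma> v"] v im by blast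
 qed
 show "K' (\<sigma> v) = K v" by (rule KK[OF v])
 show "d' (\<sigma> v) - d' (foot T' (PMark 1)) = d v - d (foot T (PMark 1))"
  using v
 proof (induction v rule: A.tree_induct)
  case base
  thus ?case using fo[OF A.root_mark] by simp
 next
  case (step v)
  note pp = A.par_props[OF step(1,2)]
  have c: "A.cov (A.par v) v" by (rule A.par_cov[OF step(1,2)])
  hence eT: "{A.par v, v} \<in> edges T" using A.edge_iff by blast
  hence eT': "{\<sigma> (A.par v), \<sigma> v} \<in> edges T'" unfolding e by (intro image_eqI[of _ _ "{A.par v, v}"]) auto
  have "K v \<subset> K (A.par v)" using pp A.K_inj step(1) by (metis inj_on_contraD psubsetI)
  hence "len T' {\<sigma> (A.par v), \<sigma> v} = d' (\<sigma> v) - d' (\<sigma> (A.par v))"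
   using B.K_len[OF eT'] KK step(1) pp(1) by simp
  thus ?case using A.d_par[OF step(1,2)] le[OF eT] step(3) by simp
 qed
qed

definition clus :: "mark set => 'z mtree_scheme => nat => mark set" where
 "clus L T v = {l \<in> L - {PMark 1}. v \<in> set (tree_path T (foot T (PMark 1)) (foot T l))}"

definition depth :: "'z mtree_scheme => nat => real" where
 "depth T v = chain_len T (len T) {foot T (PMark 1), v}"

lemma (in otree_graph) incident_edges:
 assumes "v \<in> V"
 shows "{e \<in> edges T. v \<in> e} = (\<lambda>w. {v, w}) ` {w. cov v w} \<union> (if v = r then {} else {{par v, v}})"
proof -
 have "{e \<in> edges T. v \<in> e} = {{v, w} | w. {v, w} \<in> edges T}"
  unfolding edges_cover by (auto simp: insert_commute)
 also have "\<dots> = (\<lambda>w. {v, w}) ` {w. cov v w} \<union> (if v = r then {} else {{par v, v}})"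
  unfolding edge_iff using cov_par[of _ v] assms by (auto simp: insert_commute)
 finally show ?thesis .
qed

text \<open>Valence at least three makes the set of ends behind a vertex shrink strictly along every
  edge and have at least two elements. This is why these sets can serve as names of the
  vertices.\<close>

lemma metric_tree_keyed:
 assumes T: "metric_tree L T" and L: "PMark 1 \<in> L" "finite L"
 shows "keyed_tree L T (clus L T) (depth T)" and "\<And>v. v \<in> verts T ==> 2 \<le> card (clus L T v)"
proof -
 let ?r = "foot T (PMark 1)" and ?CL = "clus L T"
 have foots: "foot T l \<in> verts T" if "l \<in> L" for l using T that unfolding metric_tree_def by blast
 have r: "?r \<in> verts T" by (rule foots[OF L(1)])
 interpret O: otree_graph T ?r "\<lambda>u v. u \<in> set (tree_path T ?r v)" by (rule metric_tree_otree_graph[OF T r])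
 define le where "le u v \<longleftrightarrow> u \<in> set (tree_path T ?r v)" for u v
 have CL: "l \<in> ?CL v \<longleftrightarrow> l \<in> L \<and> l \<noteq> PMark 1 \<and> le v (foot T l)" for l v unfolding clus_def le_def by auto
 have val: "3 \<le> valence L T v" if "v \<in> verts T" for v using T that unfolding metric_tree_def by blast
 have covD: "u \<in> verts T" "v \<in> verts T" "le u v" "u \<noteq> v" if "O.cov u v" for u v
  using that unfolding O.cov_def le_def by auto
 have finE: "finite {w. O.cov v w}" for v
  by (rule finite_subset[OF _ O.finite_verts]) (use covD(2) in blast)
 \<comment> \<open>With at most one child, a vertex has at most one more incidence besides it: the
   edge to its parent or, at the root, the first marked end. The valence then requires a further
   end.\<close>
 have few: "\<exists>l\<in>L - {PMark 1}. foot T l = v" if v: "v \<in> verts T" and ch: "{w. O.cov v w} \<subseteq> S" "card S \<le> 1" "finite S" for v S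
 proof (rule ccontr)
  assume "\<not> ?thesis"
  hence "{l \<in> L. foot T l = v} \<subseteq> (if v = ?r then {PMark 1} else {})" by auto
  hence "card {l \<in> L. foot T l = v} \<le> card (if v = ?r then {PMark 1} else {})"
   by (rule card_mono[rotated]) simp
  hence c1: "card {l \<in> L. foot T l = v} \<le> (if v = ?r then 1 else 0)" by (simp split: if_splits)
  have "card ((\<lambda>w. {v, w}) ` {w. O.cov v w}) \<le> card {w. O.cov v w}" by (rule card_image_le[OF finE])
  also have "\<dots> \<le> card S" by (rule card_mono[OF ch(3,1)])
  finally have "card ((\<lambda>w. {v, w}) ` {w. O.cov v w}) \<le> 1" using ch(2) by simp
  hence "card {e \<in> edges T. v \<in> e} \<le> 1 + (if v = ?r then 0 else 1)"
   unfolding O.incident_edges[OF v]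
   by (intro order.trans[OF card_Un_le] add_mono) auto
  thus False using c1 val[OF v] unfolding valence_def by (auto split: if_splits)
 qed
 have trans: "le u w" if "le u v" "le v w" "u \<in> verts T" "v \<in> verts T" "w \<in> verts T" for u v w
  using O.le_trans that unfolding le_def by blast
 have mono: "?CL v \<subseteq> ?CL u" if "le u v" "u \<in> verts T" "v \<in> verts T" for u v
  using that trans foots CL by blast
 have ne: "?CL v \<noteq> {}" if "v \<in> verts T" for v
  using that
 proof (induction "card {z \<in> verts T. le v z}" arbitrary: v rule: less_induct)
  case (less v)
  show ?case
  proof (cases "{w. O.cov v w} = {}")
   case True
   then obtain l where "l \<in> L - {PMark 1}" "foot T l = v" using few[OF less.prems, of "{}"] by auto
   thus ?thesis using CL[of l v] O.le_refl[OF less.prems] unfolding le_def by auto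
  next
   case False
   then obtain w where w: "O.cov v w" by blast
   have "{z \<in> verts T. le w z} \<subset> {z \<in> verts T. le v z}"
    using covD[OF w] trans O.le_antisym O.le_refl unfolding le_def by blast
   hence "card {z \<in> verts T. le w z} < card {z \<in> verts T. le v z}"
    using O.finite_verts by (intro psubset_card_mono) auto
   hence "?CL w \<noteq> {}" using less.hyps covD[OF w] by blast
   thus ?thesis using mono covD[OF w] by blast
  qed
 qed
 have disj: "le u v \<or> le v u" if uv: "u \<in> verts T" "v \<in> verts T" "?CL u \<inter> ?CL v \<noteq> {}" for u v
 proof -
  obtain l where l: "l \<in> L" "le u (foot T l)" "le v (foot T l)" using uv(3) CL by blast
  thus ?thesis using O.le_chain[of u v "foot T l"] uv foots unfolding le_def by blast
 qed
 have strict_cov: "?CL w \<noteq> ?CL v" if c: "O.cov v w" for v w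
 proof
  assume eq: "?CL w = ?CL v"
  note cd = covD[OF c]
  have nle: "\<not> le w v" using cd O.le_antisym unfolding le_def by blast
  have "{w. O.cov v w} \<subseteq> {w}"
  proof
   fix w' assume "w' \<in> {w. O.cov v w}"
   hence w': "O.cov v w'" by simp
   note cd' = covD[OF w']
   have "?CL w' \<inter> ?CL w \<noteq> {}" using mono[of v w'] ne[of w'] cd cd' eq by blast
   hence "le w' w \<or> le w w'" using disj cd cd' by blast
   thus "w' \<in> {w}" using c w' unfolding O.cov_def le_def by blast
  qed
  then obtain l where "l \<in> L - {PMark 1}" "foot T l = v" using few[OF cd(1), of "{w}"] by auto
  hence "l \<in> ?CL v" "l \<notin> ?CL w" using CL nle O.le_refl[OF cd(1)] unfolding le_def by auto
  thus False using eq by simp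
 qed
 have strict: "?CL v \<noteq> ?CL u" if uv: "le u v" "u \<noteq> v" "u \<in> verts T" "v \<in> verts T" for u v
 proof -
  obtain c where c: "O.cov u c" "le c v"
   by (rule O.child_toward[OF uv(3,4) uv(1)[unfolded le_def] uv(2)]) (auto simp: le_def)
  thus ?thesis using strict_cov[OF c(1)] mono[of c v] mono[of u c] covD[OF c(1)] uv by blast
 qed
 have iff: "?CL v \<subseteq> ?CL u \<longleftrightarrow> le u v" if "u \<in> verts T" "v \<in> verts T" for u v
 proof
  assume s: "?CL v \<subseteq> ?CL u"
  hence "?CL u \<inter> ?CL v \<noteq> {}" using ne[OF that(2)] by blast
  hence "le u v \<or> le v u" using disj that by blast
  thus "le u v" using s mono[of v u] strict[of v u] that by blast
 qed (use mono that in blast)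
 have inj: "inj_on ?CL (verts T)"
 proof (rule inj_onI)
  fix u v assume "u \<in> verts T" "v \<in> verts T" "?CL u = ?CL v"
  thus "u = v" using iff[of u v] iff[of v u] O.le_antisym[of u v] unfolding le_def by blast
 qed
 have pos: "0 < len T e" if "e \<in> edges T" for e using T that unfolding metric_tree_def by blast
 have dp: "depth T v = O.pot (len T) v" if "v \<in> verts T" for v
  unfolding depth_def using O.chain_len_pot[OF r that O.le_root[OF that], of "len T"] O.pot_root by simp
 show "keyed_tree L T ?CL (depth T)"
 proof
  show "?CL v \<noteq> {} \<and> ?CL v \<subseteq> L - {PMark 1}" if "v \<in> verts T" for v using ne[OF that] CL by blast
  show "?CL u \<subseteq> ?CL v \<or> ?CL v \<subseteq> ?CL u \<or> ?CL u \<inter> ?CL v = {}" if "u \<in> verts T" "v \<in> verts T" for u v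
   using disj[OF that] iff that by blast
  show "?CL ?r = L - {PMark 1}" using CL O.le_root foots unfolding le_def by blast
  show "l \<in> ?CL v \<longleftrightarrow> ?CL (foot T l) \<subseteq> ?CL v" if "l \<in> L" "l \<noteq> PMark 1" "v \<in> verts T" for l v
   using CL iff[OF that(3) foots[OF that(1)]] that by blast
  have cv: "(?CL v \<subset> ?CL u \<and> (\<forall>z\<in>verts T. ?CL v \<subseteq> ?CL z \<longrightarrow> ?CL z \<subseteq> ?CL u \<longrightarrow> ?CL z = ?CL u \<or> ?CL z = ?CL v))
   \<longleftrightarrow> le u v \<and> u \<noteq> v \<and> (\<forall>z\<in>verts T. le u z \<longrightarrow> le z v \<longrightarrow> z = u \<or> z = v)"
   if "u \<in> verts T" "v \<in> verts T" for u v
  proof -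
   have "?CL v \<subset> ?CL u \<longleftrightarrow> le u v \<and> u \<noteq> v" using iff[OF that] inj_onD[OF inj, of u v] that by blast
   moreover have "?CL z = ?CL x \<longleftrightarrow> z = x" if "z \<in> verts T" "x \<in> verts T" for z x using inj_onD[OF inj] that by blast
   ultimately show ?thesis using iff that by (metis (no_types, lifting))
  qed
  show "edges T = {{u, v} | u v. u \<in> verts T \<and> v \<in> verts T \<and> ?CL v \<subset> ?CL u \<and>
   (\<forall>z\<in>verts T. ?CL v \<subseteq> ?CL z \<longrightarrow> ?CL z \<subseteq> ?CL u \<longrightarrow> ?CL z = ?CL u \<or> ?CL z = ?CL v)}"
   unfolding O.edges_cover le_def[symmetric] by (rule doubletons_cong) (rule cv[symmetric])
  show "len T {u, v} = depth T v - depth T u" if "{u, v} \<in> edges T" "?CL v \<subset> ?CL u" for u v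
  proof -
   have "O.cov u v \<or> O.cov v u" using that(1) O.edge_iff by blast
   moreover have "\<not> O.cov v u" using mono covD that(2) by blast
   ultimately have "v \<in> verts T" "v \<noteq> ?r" "u = O.par v" "u \<in> verts T" using O.cov_par covD by blast+
   thus ?thesis using O.pot_par[of v "len T"] dp by simp
  qed
 qed (use O.finite_verts L r inj foots in auto)
 show "2 \<le> card (?CL v)" if v: "v \<in> verts T" for v
 proof (rule ccontr)
  assume c: "\<not> 2 \<le> card (?CL v)"
  have fin: "finite (?CL v)" using L(2) unfolding clus_def by simp
  hence "card (?CL v) \<noteq> 0" using ne[OF v] by simp
  hence "card (?CL v) = 1" using c by linarith
  then obtain l where l: "?CL v = {l}" by (rule card_1_singletonE)
  have "{w. O.cov v w} = {}"
  proof (rule ccontr)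
   assume "\<not> ?thesis"
   then obtain w where w: "O.cov v w" by blast
   have "?CL w \<subseteq> {l}" "?CL w \<noteq> {}" using mono[of v w] covD[OF w] ne[of w] l by auto
   hence "?CL w = {l}" by (metis subset_singletonD)
   with strict_cov[OF w] l show False by metis
  qed
  hence one: "card {e \<in> edges T. v \<in> e} \<le> (if v = ?r then 0 else 1)"
  proof -
   assume ch: "{w. O.cov v w} = {}"
   have "{e \<in> edges T. v \<in> e} = (if v = ?r then {} else {{O.par v, v}})"
    unfolding O.incident_edges[OF v] ch by simp
   thus ?thesis by simp
  qed
  have "{l \<in> L. foot T l = v} \<subseteq> insert l (if v = ?r then {PMark 1} else {})"
  proof
   fix l' assume l': "l' \<in> {l \<in> L. foot T l = v}"
   have "l' \<in> ?CL v" if "l' \<noteq> PMark 1" using l' that O.le_refl[OF v] unfolding CL le_def by simp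
   thus "l' \<in> insert l (if v = ?r then {PMark 1} else {})" using l l' by (cases "l' = PMark 1") auto
  qed
  hence "card {l \<in> L. foot T l = v} \<le> card (insert l (if v = ?r then {PMark 1} else {}))"
   by (rule card_mono[rotated]) auto
  also have "\<dots> \<le> 1 + (if v = ?r then 1 else 0)" by (simp add: card_insert_if)
  finally show False using one val[OF v] unfolding valence_def by (auto split: if_splits)
 qed
qed

text \<open>Children and ends at a vertex, the first marked end apart, number at least two: a single
  end would make the key a singleton, and a single child would have the same key. The third
  incidence is the parent edge or the first marked end.\<close>

lemma keyed_tree_metric:
 assumes "keyed_tree L T K d" and L: "finite L" and pos: "\<And>e. e \<in> edges T ==> 0 < len T e"
  and two: "\<And>v. v \<in> verts T ==> 2 \<le> card (K v)"
 shows "metric_tree L T"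
proof -
 interpret keyed_tree L T K d by fact
 have val: "3 \<le> valence L T v" if v: "v \<in> verts T" for v
 proof -
  let ?r = "foot T (PMark 1)"
  let ?Ch = "{w. cov v w}" and ?Lb = "{l \<in> L - {PMark 1}. foot T l = v}"
  have finCh: "finite ?Ch" by (rule finite_subset[OF _ finV]) (auto simp: cov_def)
  have finLb: "finite ?Lb" using L by simp
  have KU: "K v \<subseteq> ?Lb \<union> (\<Union>w\<in>?Ch. K w)"
  proof
   fix l assume l: "l \<in> K v"
   hence l': "l \<in> L" "l \<noteq> PMark 1" using K_sub[OF v] by auto
   have le: "K (foot T l) \<subseteq> K v" using K_foot(2)[OF l' v] l by simp
   show "l \<in> ?Lb \<union> (\<Union>w\<in>?Ch. K w)"
   proof (cases "foot T l = v")
    case False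
    obtain c where c: "cov v c" "K (foot T l) \<subseteq> K c"
     by (rule child_toward[OF v K_foot(1)[OF l'] le]) (use False in auto)
    hence "l \<in> K c" using K_foot(2)[OF l', of c] unfolding cov_def by blast
    thus ?thesis using c by blast
   qed (use l' in simp)
  qed
  have "2 \<le> card ?Ch + card ?Lb"
  proof (rule ccontr)
   assume "\<not> ?thesis"
   then consider "card ?Ch = 0" "card ?Lb \<le> 1" | "card ?Ch = 1" "card ?Lb = 0" by linarith
   thus False
   proof cases
    case 1
    hence "K v \<subseteq> ?Lb" using KU finCh by simp
    hence "card (K v) \<le> card ?Lb" by (rule card_mono[OF finLb])
    thus False using two[OF v] 1 by simp
   next
    case 2
    then obtain w where w: "?Ch = {w}" by (metis card_1_singletonE)
    have "?Lb = {}" using 2 finLb by simp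
    hence "K v \<subseteq> K w" using KU unfolding w by blast
    moreover have c: "cov v w" using w by blast
    ultimately show False using K_inj unfolding cov_def by (metis inj_onD subset_antisym)
   qed
  qed
  moreover have "card {l \<in> L. foot T l = v} = card ?Lb + (if v = ?r then 1 else 0)"
  proof -
   have "{l \<in> L. foot T l = v} = ?Lb \<union> (if v = ?r then {PMark 1} else {})" using root_mark by auto
   moreover have "PMark 1 \<notin> ?Lb" by simp
   ultimately show ?thesis using finLb by (cases "v = ?r") simp_all
  qed
  moreover have "card {e \<in> edges T. v \<in> e} = card ?Ch + (if v = ?r then 0 else 1)"
  proof -
   have i: "inj_on (\<lambda>w. {v, w}) ?Ch" by (auto simp: inj_on_def doubleton_eq_iff)
   have "{par v, v} \<notin> (\<lambda>w. {v, w}) ` ?Ch" if "v \<noteq> ?r"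
   proof
    assume "{par v, v} \<in> (\<lambda>w. {v, w}) ` ?Ch"
    hence "cov v (par v)" using par_props(3)[OF v that] by (auto simp: doubleton_eq_iff)
    thus False using par_cov[OF v that] le_antisym unfolding cov_def by blast
   qed
   thus ?thesis unfolding incident_edges[OF v] using card_image[OF i] finCh by (cases "v = ?r") simp_all
  qed
  ultimately show ?thesis unfolding valence_def by (simp split: if_splits)
 qed
 show ?thesis
  unfolding metric_tree_def
 proof (intro conjI ballI)
  show "edges T \<subseteq> {{u, w} | u w. u \<in> verts T \<and> w \<in> verts T \<and> u \<noteq> w}" unfolding edges_cover by blast
  show "foot T ` L \<subseteq> verts T"
  proof (rule image_subsetI)
   fix l assume "l \<in> L"
   thus "foot T l \<in> verts T" using K_foot(1)[of l] K_root(1) by (cases "l = PMark 1") auto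
  qed
  show "\<exists>!xs. is_path T u xs w" if "u \<in> verts T" "w \<in> verts T" for u w using ex1_path that by blast
 qed (use finV pos val in auto)
qed

text \<open>Every laminar family containing the full set is the family of keys of a tree, with
  arbitrary depths that increase away from the root. An end is attached at the smallest set that
  contains it.\<close>

lemma ex_keyed_tree:
 fixes S :: "mark set set" and dd :: "mark set => real"
 assumes L: "PMark 1 \<in> L" and S: "finite S" "\<And>A. A \<in> S ==> A \<noteq> {} \<and> A \<subseteq> L - {PMark 1}" "L - {PMark 1} \<in> S"
  and lam: "\<And>A B. A \<in> S ==> B \<in> S ==> A \<subseteq> B \<or> B \<subseteq> A \<or> A \<inter> B = {}"
  and dd: "\<And>A B. A \<in> S ==> B \<in> S ==> A \<subset> B ==> dd B < dd A"
 obtains T :: mtree and K where "keyed_tree L T K (\<lambda>v. dd (K v))" "K ` verts T = S" "\<And>e. e \<in> edges T ==> 0 < len T e"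
proof -
 obtain K :: "nat => mark set" where K: "bij_betw K {..<card S} S"
  using ex_bij_betw_nat_finite[OF S(1)] by (auto simp: atLeast0LessThan)
 let ?V = "{..<card S}"
 have inj: "inj_on K ?V" and im: "K ` ?V = S" using K unfolding bij_betw_def by auto
 have KS: "K v \<in> S" if "v \<in> ?V" for v using im that by blast
 have surj: "\<exists>v\<in>?V. K v = A" if "A \<in> S" for A using im that by (metis imageE)
 define E where "E = {{u, v} | u v. u \<in> ?V \<and> v \<in> ?V \<and> K v \<subset> K u \<and>
   (\<forall>z\<in>?V. K v \<subseteq> K z \<longrightarrow> K z \<subseteq> K u \<longrightarrow> K z = K u \<or> K z = K v)}"
 define least where "least l = \<Inter>{A \<in> S. l \<in> A}" for l
 have least: "least l \<in> S" "l \<in> least l" "\<And>A. A \<in> S ==> l \<in> A \<longleftrightarrow> least l \<subseteq> A" if l: "l \<in> L" "l \<noteq> PMark 1" for l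
 proof -
  have "\<Inter>{A \<in> S. l \<in> A} \<in> {A \<in> S. l \<in> A}"
  proof (rule Inter_chain_mem)
   show "{A \<in> S. l \<in> A} \<noteq> {}" using S(3) l by blast
   show "A \<subseteq> B \<or> B \<subseteq> A" if "A \<in> {A \<in> S. l \<in> A}" "B \<in> {A \<in> S. l \<in> A}" for A B
    using lam[of A B] that by blast
  qed (use S(1) in simp)
  thus "least l \<in> S" "l \<in> least l" "\<And>A. A \<in> S ==> l \<in> A \<longleftrightarrow> least l \<subseteq> A" unfolding least_def by blast+
 qed
 define ft where "ft l = (SOME v. v \<in> ?V \<and> K v = (if l = PMark 1 then L - {PMark 1} else least l))" for l
 have ft: "ft l \<in> ?V" "K (ft l) = (if l = PMark 1 then L - {PMark 1} else least l)" if "l \<in> L" for l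
 proof -
  have "\<exists>v. v \<in> ?V \<and> K v = (if l = PMark 1 then L - {PMark 1} else least l)"
   using surj least(1)[OF that] S(3) by (cases "l = PMark 1") auto
  from someI_ex[OF this] have "ft l \<in> ?V \<and> K (ft l) = (if l = PMark 1 then L - {PMark 1} else least l)" unfolding ft_def .
  thus "ft l \<in> ?V" "K (ft l) = (if l = PMark 1 then L - {PMark 1} else least l)" by blast+
 qed
 \<comment> \<open>Lengths are functions of unordered pairs, so the difference of depths is written
   as maximum minus minimum.\<close>
 define ln where "ln e = Max ((\<lambda>v. dd (K v)) ` e) - Min ((\<lambda>v. dd (K v)) ` e)" for e :: "nat set"
 have ln: "ln {u, v} = dd (K v) - dd (K u)" if "u \<in> ?V" "v \<in> ?V" "K v \<subset> K u" for u v
  using dd[OF KS KS, of v u] that unfolding ln_def by (simp add: max_def min_def)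
 define T where "T = \<lparr>verts = ?V, edges = E, len = ln, foot = ft\<rparr>"
 have kt: "keyed_tree L T K (\<lambda>v. dd (K v))"
 proof
  show "K u \<subseteq> K v \<or> K v \<subseteq> K u \<or> K u \<inter> K v = {}" if "u \<in> verts T" "v \<in> verts T" for u v
   using lam KS that by (simp add: T_def)
  show "K v \<noteq> {} \<and> K v \<subseteq> L - {PMark 1}" if "v \<in> verts T" for v using S(2) KS that by (simp add: T_def)
  show "l \<in> K v \<longleftrightarrow> K (foot T l) \<subseteq> K v" if "l \<in> L" "l \<noteq> PMark 1" "v \<in> verts T" for l v
   using least(3)[OF that(1,2), of "K v"] ft[OF that(1)] that KS by (simp add: T_def)
  show "len T {u, v} = dd (K v) - dd (K u)" if "{u, v} \<in> edges T" "K v \<subset> K u" for u v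
  proof -
   have "u \<in> ?V \<and> v \<in> ?V" using that(1) unfolding T_def E_def by (auto simp: doubleton_eq_iff)
   thus ?thesis using ln that(2) by (simp add: T_def)
  qed
 qed (use L inj ft in \<open>auto simp: T_def E_def\<close>)
 moreover have "0 < len T e" if eT: "e \<in> edges T" for e
 proof -
  obtain u v where e: "e = {u, v}" "u \<in> ?V" "v \<in> ?V" "K v \<subset> K u" using eT unfolding T_def E_def by auto
  thus ?thesis using ln[of u v] dd[OF KS KS, of v u] by (simp add: T_def)
 qed
 moreover have "K ` verts T = S" using im by (simp add: T_def)
 ultimately show ?thesis using that by blast
qed

section \<open>Stabilization\<close>

locale pq_tree = keyed_tree "pq_marks n m" T K d
 for n m :: nat and T :: "'z mtree_scheme" and K :: "nat => mark set" and d :: "nat => real" +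
 assumes n: "n \<ge> 3"
begin

abbreviation "rt \<equiv> foot T (PMark 1)"
abbreviation le (infix "\<preceq>" 50) where "u \<preceq> v \<equiv> K v \<subseteq> K u"

definition cln :: "nat => nat set" where "cln v = {i \<in> {2..n}. PMark i \<in> K v}"

text \<open>The vertices that survive stabilization, by \<open>stable_verts_eq\<close>: among the
  vertices with the same marked points behind them, the one farthest from the root, provided that
  there are at least two such points.\<close>

definition stab :: "nat => bool" where
 "stab v \<longleftrightarrow> v \<in> V \<and> 2 \<le> card (cln v) \<and> (\<forall>w\<in>V. v \<preceq> w \<longrightarrow> w \<noteq> v \<longrightarrow> cln w \<noteq> cln v)"

lemma pq_mark_in: "i \<in> {1..n} ==> PMark i \<in> pq_marks n m" "l \<in> {1..m} ==> QMark l \<in> pq_marks n m"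
 unfolding pq_marks_def by auto

lemma foot_p: "i \<in> {1..n} ==> foot T (PMark i) \<in> V"
 using K_foot(1)[OF pq_mark_in(1)] K_root(1) by (cases "i = 1") auto

lemma foot_q: "l \<in> {1..m} ==> foot T (QMark l) \<in> V"
 using K_foot(1)[OF pq_mark_in(2)] by auto

lemma cln_iff: "v \<in> V ==> i \<in> cln v \<longleftrightarrow> i \<in> {2..n} \<and> v \<preceq> foot T (PMark i)"
 unfolding cln_def using K_foot(2)[OF pq_mark_in(1), of i v] by auto

lemma q_iff: "v \<in> V ==> l \<in> {1..m} ==> QMark l \<in> K v \<longleftrightarrow> v \<preceq> foot T (QMark l)"
 using K_foot(2)[OF pq_mark_in(2), of l v] by auto

lemma cln_sub: "cln v \<subseteq> {2..n}" unfolding cln_def by auto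

lemma finite_cln [simp]: "finite (cln v)" using cln_sub finite_subset by blast

lemma cln_mono: "u \<preceq> v ==> cln v \<subseteq> cln u" unfolding cln_def by auto

lemma cln_root: "cln rt = {2..n}"
 unfolding cln_def K_root(2) using pq_mark_in(1) by auto

lemma cln_comparable: "u \<in> V ==> v \<in> V ==> i \<in> cln u ==> i \<in> cln v ==> u \<preceq> v \<or> v \<preceq> u"
 using K_laminar[of u v] unfolding cln_def by blast

lemma V_eq: "u \<in> V ==> v \<in> V ==> u \<preceq> v ==> v \<preceq> u ==> u = v"
 by (rule le_antisym)

lemma stabD: "stab v ==> v \<in> V" "stab v ==> cln v \<noteq> {}" unfolding stab_def by auto

lemma stab_le: "stab u ==> stab v ==> u \<preceq> v \<longleftrightarrow> cln v \<subseteq> cln u"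
proof
 assume s: "stab u" "stab v" "cln v \<subseteq> cln u"
 then obtain i where "i \<in> cln v" "i \<in> cln u" using stabD(2) by blast
 then consider "u \<preceq> v" | "v \<preceq> u" using cln_comparable stabD(1) s by blast
 thus "u \<preceq> v"
 proof cases
  case 2
  hence "cln u = cln v" using cln_mono s(3) by blast
  hence "u = v" using s(1,2) 2 unfolding stab_def by blast
  thus ?thesis by simp
 qed
qed (rule cln_mono)

lemma stab_inj: "stab u ==> stab v ==> cln u = cln v ==> u = v"
 using stab_le[of u v] stab_le[of v u] V_eq stabD(1) by blast

text \<open>Two marked points separate at this meet, so every vertex further away loses one of
  them.\<close>

lemma stab_meet:
 assumes u: "u \<in> V" "i \<in> cln u" and w: "w \<in> V" "j \<in> cln w" and nle: "\<not> u \<preceq> w" "\<not> w \<preceq> u"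
 shows "stab (meet u w)"
proof -
 let ?m = "meet u w"
 note m = meet[OF u(1) w(1)]
 have ij: "i \<in> cln ?m" "j \<in> cln ?m" using cln_mono[OF m(2)] cln_mono[OF m(3)] u w by auto
 have "i \<noteq> j" using cln_comparable[OF u(1) w(1)] u w nle by blast
 hence "2 \<le> card (cln ?m)" using ij card_mono[of "cln ?m" "{i, j}"] by auto
 moreover have "cln x \<noteq> cln ?m" if x: "x \<in> V" "?m \<preceq> x" "x \<noteq> ?m" for x
 proof
  assume "cln x = cln ?m"
  hence "i \<in> cln x" "j \<in> cln x" using ij by auto
  hence "x \<preceq> u \<or> u \<preceq> x" "x \<preceq> w \<or> w \<preceq> x" using cln_comparable x(1) u w by blast+
  moreover have "\<not> (x \<preceq> u \<and> x \<preceq> w)" using m(4)[OF x(1)] V_eq[OF x(1) m(1)] x by blast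
  moreover have "\<not> (u \<preceq> x \<and> w \<preceq> x)" using le_chain[OF u(1) w(1) x(1)] nle by blast
  ultimately show False using nle by blast
 qed
 ultimately show ?thesis unfolding stab_def using m(1) by blast
qed

lemma stab_meet_foot:
 assumes i: "i \<in> {2..n}" and w: "w \<in> V" "j \<in> cln w" and nle: "i \<notin> cln w"
 shows "stab (meet (foot T (PMark i)) w)"
proof -
 let ?f = "foot T (PMark i)" let ?m = "meet ?f w"
 have f: "?f \<in> V" using foot_p i by simp
 note m = meet[OF f w(1)]
 have ij: "i \<in> cln ?m" "j \<in> cln ?m" using cln_iff[OF m(1)] m(2) i cln_mono[OF m(3)] w by auto
 have "i \<noteq> j" using w nle by blast
 hence "2 \<le> card (cln ?m)" using ij card_mono[of "cln ?m" "{i, j}"] by auto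
 moreover have "cln x \<noteq> cln ?m" if x: "x \<in> V" "?m \<preceq> x" "x \<noteq> ?m" for x
 proof
  assume "cln x = cln ?m"
  hence ix: "i \<in> cln x" "j \<in> cln x" using ij by auto
  hence xf: "x \<preceq> ?f" using cln_iff[OF x(1)] by blast
  have "x \<preceq> w \<or> w \<preceq> x" using cln_comparable x(1) w ix by blast
  moreover have "\<not> x \<preceq> w" using m(4)[OF x(1) xf] V_eq[OF x(1) m(1)] x by blast
  moreover have "\<not> w \<preceq> x" using nle cln_iff[OF w(1)] xf i by blast
  ultimately show False by blast
 qed
 ultimately show ?thesis unfolding stab_def using m(1) by blast
qed

lemma ex_stab_of_cln:
 assumes v: "v \<in> V" "2 \<le> card (cln v)"
 obtains s where "stab s" "cln s = cln v" "v \<preceq> s"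
proof -
 let ?S = "{w \<in> V. cln w = cln v}"
 obtain i where i: "i \<in> cln v" using v(2) by (metis card.empty ex_in_conv not_numeral_le_zero)
 have "\<exists>s. s \<in> ?S \<and> (\<forall>w\<in>?S. w \<preceq> s)"
 proof (rule ex_maximal[of ?S])
  show "u \<preceq> u' \<or> u' \<preceq> u" if "u \<in> ?S" "u' \<in> ?S" for u u' using cln_comparable[of u u' i] that i by auto
 qed (use v in blast)+
 then obtain s where s: "s \<in> ?S" "\<And>w. w \<in> ?S ==> w \<preceq> s" by blast
 have "stab s" unfolding stab_def
 proof (intro conjI ballI impI)
  show "s \<in> V" "2 \<le> card (cln s)" using s(1) v(2) by auto
  show "cln w \<noteq> cln s" if w: "w \<in> V" "s \<preceq> w" "w \<noteq> s" for w
  proof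
   assume "cln w = cln s"
   hence "w \<preceq> s" using s w(1) by auto
   thus False using V_eq[of w s] w s(1) by blast
  qed
 qed
 thus ?thesis using that s v by blast
qed

definition ClF :: "nat set set" where "ClF = cln ` {v. stab v}"

definition sv :: "nat set => nat" where "sv A = (THE v. stab v \<and> cln v = A)"

lemma sv_cln:
 assumes "stab v"
 shows "sv (cln v) = v"
 unfolding sv_def by (rule the_equality) (use assms stab_inj in auto)

lemma sv: "A \<in> ClF ==> stab (sv A)" "A \<in> ClF ==> cln (sv A) = A"
 unfolding ClF_def using sv_cln by auto

lemma top_ClF: "{2..n} \<in> ClF"
proof -
 have "2 \<le> card (cln rt)" unfolding cln_root using n by simp
 then obtain s where "stab s" "cln s = cln rt" using ex_stab_of_cln[OF K_root(1)] by metis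
 thus ?thesis unfolding ClF_def cln_root by force
qed

text \<open>The first stable vertex seen from the first marked point, and the origin for depths. It
  differs from \<open>rt\<close> when ends \<open>q\<close> sit on the leg of the first marked
  point.\<close>

abbreviation "rho \<equiv> sv {2..n}"

lemma rho: "stab rho" "cln rho = {2..n}" "rho \<in> V" using sv[OF top_ClF] stabD by auto

lemma rho_le: "stab v ==> rho \<preceq> v" using stab_le[OF rho(1)] rho(2) cln_sub by simp

lemma cln_cell:
 assumes "v \<in> V" "cln v \<noteq> {}"
 shows "cln v \<in> cells n ClF"
proof (cases "2 \<le> card (cln v)")
 case True
 then obtain s where "stab s" "cln s = cln v" using ex_stab_of_cln[OF assms(1)] by metis
 hence "cln v \<in> ClF" unfolding ClF_def by (intro image_eqI[of _ _ s]) simp_all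
 thus ?thesis unfolding cells_def by simp
next
 case False
 moreover have "card (cln v) \<noteq> 0" using assms(2) by simp
 ultimately have "card (cln v) = 1" by linarith
 then obtain i where "cln v = {i}" by (rule card_1_singletonE)
 thus ?thesis using cln_sub[of v] unfolding cells_def by auto
qed

lemma span_edges_eq: "span_edges (p_marks n) T = {{par z, z} | z. z \<in> V \<and> z \<noteq> rt \<and> cln z \<noteq> {}}"
proof (intro equalityI subsetI)
 fix e assume "e \<in> span_edges (p_marks n) T"
 then obtain i j where ij: "i \<in> {1..n}" "j \<in> {1..n}" "e \<in> path_edges T (foot T (PMark i)) (foot T (PMark j))"
  unfolding span_edges_def p_marks_def by blast
 then obtain z where z: "e = {par z, z}" "z \<in> V" "(z \<preceq> foot T (PMark i)) \<noteq> (z \<preceq> foot T (PMark j))"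
  unfolding path_edges_eq[OF foot_p[OF ij(1)] foot_p[OF ij(2)]] by blast
 have zr: "z \<noteq> rt" using z(3) le_root foot_p ij by blast
 have nr: "\<not> z \<preceq> rt" using le_root[OF z(2)] V_eq[OF z(2) K_root(1)] zr by blast
 obtain l where l: "l \<in> {1..n}" "z \<preceq> foot T (PMark l)" using z(3) ij by blast
 hence "l \<noteq> 1" using nr by blast
 hence "l \<in> cln z" using cln_iff[OF z(2), of l] l by auto
 thus "e \<in> {{par z, z} | z. z \<in> V \<and> z \<noteq> rt \<and> cln z \<noteq> {}}" using z zr by blast
next
 fix e assume "e \<in> {{par z, z} | z. z \<in> V \<and> z \<noteq> rt \<and> cln z \<noteq> {}}"
 then obtain z i where z: "e = {par z, z}" "z \<in> V" "z \<noteq> rt" "i \<in> cln z" by blast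
 hence i: "i \<in> {1..n}" "z \<preceq> foot T (PMark i)" using cln_iff[OF z(2), of i] by auto
 have "\<not> z \<preceq> rt" using le_root[OF z(2)] V_eq[OF z(2) K_root(1)] z(3) by blast
 hence "e \<in> path_edges T (foot T (PMark 1)) (foot T (PMark i))"
  unfolding path_edges_eq[OF K_root(1) foot_p[OF i(1)]] using z i by blast
 moreover have "PMark 1 \<in> p_marks n" "PMark i \<in> p_marks n" using i n unfolding p_marks_def by auto
 ultimately show "e \<in> span_edges (p_marks n) T" unfolding span_edges_def by blast
qed

text \<open>In the spanned subtree, the valence of a vertex with marked points behind it is one (the
  edge towards the root or, at the root, the first marked end) plus the number of feet of marked
  points there and of children with marked points behind them. There are at least two of these
  exactly when no single child inherits the whole of an at least two-element set.\<close>

lemma stable_verts_eq: "stable_verts (p_marks n) T = {v. stab v}"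
proof -
 have "3 \<le> card {e \<in> span_edges (p_marks n) T. v \<in> e} + card {l \<in> p_marks n. foot T l = v} \<longleftrightarrow> stab v" if v: "v \<in> V" for v
 proof -
  let ?Ch = "{w. cov v w \<and> cln w \<noteq> {}}" and ?Lb = "{i \<in> {2..n}. foot T (PMark i) = v}"
  have finCh: "finite ?Ch" by (rule finite_subset[OF _ finV]) (auto simp: cov_def)
  have chV: "w \<in> V" "v \<preceq> w" "w \<noteq> v" if "w \<in> ?Ch" for w using that unfolding cov_def by auto
  have clnU: "cln v = ?Lb \<union> (\<Union>w\<in>?Ch. cln w)"
  proof (intro equalityI subsetI)
   fix i assume i: "i \<in> cln v"
   hence i': "i \<in> {2..n}" "v \<preceq> foot T (PMark i)" using cln_iff[OF v] by auto
   have f: "foot T (PMark i) \<in> V" using foot_p i' by simp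
   show "i \<in> ?Lb \<union> (\<Union>w\<in>?Ch. cln w)"
   proof (cases "foot T (PMark i) = v")
    case False
    obtain c where c: "cov v c" "c \<preceq> foot T (PMark i)" by (rule child_toward[OF v f i'(2)]) (use False in auto)
    hence "i \<in> cln c" using cln_iff[of c i] i' unfolding cov_def by blast
    thus ?thesis using c by blast
   qed (use i' in simp)
  next
   fix i assume "i \<in> ?Lb \<union> (\<Union>w\<in>?Ch. cln w)"
   thus "i \<in> cln v" using cln_iff[OF v, of i] cln_mono chV by blast
  qed
  have disj1: "cln w \<inter> cln w' = {}" if w: "w \<in> ?Ch" "w' \<in> ?Ch" "w \<noteq> w'" for w w'
  proof (rule ccontr)
   assume "cln w \<inter> cln w' \<noteq> {}"
   hence "w \<preceq> w' \<or> w' \<preceq> w" using cln_comparable chV w by blast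
   thus False using w unfolding cov_def by blast
  qed
  have disj2: "?Lb \<inter> (\<Union>w\<in>?Ch. cln w) = {}"
  proof -
   have "\<not> w \<preceq> v" if "w \<in> ?Ch" for w using chV[OF that] V_eq v by blast
   thus ?thesis using cln_iff chV by blast
  qed
  have "card (cln v) = card ?Lb + (\<Sum>w\<in>?Ch. card (cln w))"
   unfolding clnU using disj1 disj2 finCh by (subst card_Un_disjoint) (auto simp: card_UN_disjoint)
  moreover have "(\<Sum>w\<in>?Ch. 1) \<le> (\<Sum>w\<in>?Ch. card (cln w))"
   by (rule sum_mono) (simp add: Suc_le_eq card_gt_0_iff)
  ultimately have parts: "card ?Lb + card ?Ch \<le> card (cln v)" by simp
  have "card {l \<in> p_marks n. foot T l = v} = card ?Lb + (if v = rt then 1 else 0)"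
  proof -
   have I: "{1..n} = insert 1 {2..n}" using n by auto
   have "{l \<in> p_marks n. foot T l = v} = PMark ` ?Lb \<union> (if v = rt then {PMark 1} else {})"
    unfolding p_marks_def I by auto
   moreover have "card (PMark ` ?Lb) = card ?Lb" by (rule card_image) (auto simp: inj_on_def)
   moreover have "PMark 1 \<notin> PMark ` ?Lb" by auto
   ultimately show ?thesis by (cases "v = rt") simp_all
  qed
  moreover have "card {e \<in> span_edges (p_marks n) T. v \<in> e} = card ?Ch + (if v \<noteq> rt \<and> cln v \<noteq> {} then 1 else 0)"
  proof -
   have "{e \<in> span_edges (p_marks n) T. v \<in> e} = (\<lambda>w. {v, w}) ` ?Ch \<union> (if v \<noteq> rt \<and> cln v \<noteq> {} then {{par v, v}} else {})"
    unfolding span_edges_eq using v cov_par by auto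
   moreover have "inj_on (\<lambda>w. {v, w}) ?Ch" by (auto simp: inj_on_def doubleton_eq_iff)
   moreover have "{par v, v} \<notin> (\<lambda>w. {v, w}) ` ?Ch" if "v \<noteq> rt"
   proof
    assume "{par v, v} \<in> (\<lambda>w. {v, w}) ` ?Ch"
    hence "cov v (par v)" using par_props(3)[OF v that] by (auto simp: doubleton_eq_iff)
    thus False using par_cov[OF v that] le_antisym unfolding cov_def by blast
   qed
   ultimately show ?thesis using finCh by (cases "v \<noteq> rt \<and> cln v \<noteq> {}") (auto simp: card_image)
  qed
  ultimately have tot: "card {e \<in> span_edges (p_marks n) T. v \<in> e} + card {l \<in> p_marks n. foot T l = v}
   = card ?Lb + card ?Ch + (if v = rt \<or> cln v \<noteq> {} then 1 else 0)" by auto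
  show ?thesis
  proof
   assume "3 \<le> card {e \<in> span_edges (p_marks n) T. v \<in> e} + card {l \<in> p_marks n. foot T l = v}"
   hence two: "2 \<le> card ?Lb + card ?Ch" unfolding tot by (simp split: if_splits)
   show "stab v"
    unfolding stab_def
   proof (intro conjI ballI impI)
    show "v \<in> V" "2 \<le> card (cln v)" using v two parts by auto
    fix w assume w: "w \<in> V" "v \<preceq> w" "w \<noteq> v"
    show "cln w \<noteq> cln v"
    proof
     assume eq: "cln w = cln v"
     obtain c where c: "cov v c" "c \<preceq> w" by (rule child_toward[OF v w(1,2)]) (use w in auto)
     have "v \<preceq> c" using c(1) by (simp add: cov_def)
     hence "cln c \<subseteq> cln v" by (rule cln_mono)
     moreover have "cln v \<subseteq> cln c" using cln_mono[OF c(2)] eq by simp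
     ultimately have ceq: "cln c = cln v" by (rule subset_antisym)
     have "card (cln v) \<noteq> 0" using two parts by linarith
     hence "cln v \<noteq> {}" by auto
     hence cCh: "c \<in> ?Ch" using c ceq by auto
     have "?Lb = {}" using disj2 cCh ceq clnU by blast
     hence "card ?Lb = 0" by (simp only: card.empty)
     moreover have "?Ch \<subseteq> {c}"
     proof
      fix c' assume c': "c' \<in> ?Ch"
      have "cln c' \<inter> cln c \<noteq> {}" using c' ceq clnU by blast
      thus "c' \<in> {c}" using disj1[OF c' cCh] by blast
     qed
     hence "card ?Ch \<le> card {c}" by (rule card_mono[rotated]) simp
     moreover have "card {c} = 1" by simp
     ultimately show False using two by linarith
    qed
   qed
  next
   assume s: "stab v"
   have "2 \<le> card ?Lb + card ?Ch"
   proof (rule ccontr)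
    assume "\<not> ?thesis"
    then consider "card ?Ch = 0" "card ?Lb \<le> 1" | "card ?Ch = 1" "card ?Lb = 0" by linarith
    thus False
    proof cases
     case 1
     hence "cln v = ?Lb" using clnU finCh by simp
     thus False using s 1 unfolding stab_def by simp
    next
     case 2
     obtain w where w: "?Ch = {w}" by (rule card_1_singletonE[OF 2(1)])
     have "finite ?Lb" by simp
     hence Lb: "?Lb = {}" using 2(2) by (rule card_0_eq[THEN iffD1])
     have "cln v = {} \<union> (\<Union>w\<in>{w}. cln w)" using clnU unfolding w Lb .
     hence "cln v = cln w" by simp
     thus False using s chV[of w] w unfolding stab_def by auto
    qed
   qed
   thus "3 \<le> card {e \<in> span_edges (p_marks n) T. v \<in> e} + card {l \<in> p_marks n. foot T l = v}"
    unfolding tot using stabD(2)[OF s] by simp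
  qed
 qed
 thus ?thesis unfolding stable_verts_def using stabD(1) by blast
qed

text \<open>Between comparable stable vertices, the stable vertices on the path are those with
  clusters in between. For incomparable ones the path passes through their meet, which is stable, so
  they are never joined by an edge.\<close>

lemma stab_path_iff:
 assumes u: "stab u" and w: "stab w" "u \<noteq> w"
 shows "set (tree_path T u w) \<inter> {v. stab v} = {u, w} \<longleftrightarrow>
  (cln w \<subset> cln u \<or> cln u \<subset> cln w) \<and> (\<forall>z. stab z \<longrightarrow> \<not> (cln w \<subset> cln z \<and> cln z \<subset> cln u) \<and> \<not> (cln u \<subset> cln z \<and> cln z \<subset> cln w))"
proof -
 have uV: "u \<in> V" and wV: "w \<in> V" using u w stabD by auto
 have down: "set (tree_path T u w) \<inter> {v. stab v} = {u, w} \<longleftrightarrow> (\<forall>z. stab z \<longrightarrow> \<not> (cln w \<subset> cln z \<and> cln z \<subset> cln u))"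
  if s: "stab u" "stab w" "u \<noteq> w" "cln w \<subset> cln u" for u w
 proof -
  have le: "u \<preceq> w" using stab_le s by blast
  have "z \<in> set (tree_path T u w) \<longleftrightarrow> cln w \<subseteq> cln z \<and> cln z \<subseteq> cln u" if "stab z" for z
   unfolding set_down_path[OF stabD(1)[OF s(1)] stabD(1)[OF s(2)] le] using stab_le that s stabD(1) by blast
  hence *: "set (tree_path T u w) \<inter> {v. stab v} = {z. stab z \<and> cln w \<subseteq> cln z \<and> cln z \<subseteq> cln u}" by blast
  show ?thesis unfolding *
  proof
   assume eq: "{z. stab z \<and> cln w \<subseteq> cln z \<and> cln z \<subseteq> cln u} = {u, w}"
   show "\<forall>z. stab z \<longrightarrow> \<not> (cln w \<subset> cln z \<and> cln z \<subset> cln u)"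
   proof (intro allI impI notI)
    fix z assume z: "stab z" "cln w \<subset> cln z \<and> cln z \<subset> cln u"
    hence "z \<in> {u, w}" unfolding eq[symmetric] by blast
    thus False using z(2) by auto
   qed
  next
   assume no: "\<forall>z. stab z \<longrightarrow> \<not> (cln w \<subset> cln z \<and> cln z \<subset> cln u)"
   have "z = u \<or> z = w" if z: "stab z" "cln w \<subseteq> cln z" "cln z \<subseteq> cln u" for z
   proof -
    have "cln z = cln w \<or> cln z = cln u" using no z by (metis psubsetI)
    thus ?thesis using stab_inj z(1) s(1,2) by metis
   qed
   thus "{z. stab z \<and> cln w \<subseteq> cln z \<and> cln z \<subseteq> cln u} = {u, w}" using s by auto
  qed
 qed
 have sym: "set (tree_path T u w) = set (tree_path T w u)"
 proof -
  have "meet u w = meet w u" unfolding meet_def by metis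
  thus ?thesis unfolding set_tree_path[OF uV wV] set_tree_path[OF wV uV] by auto
 qed
 consider "cln w \<subset> cln u" | "cln u \<subset> cln w" | "\<not> u \<preceq> w" "\<not> w \<preceq> u"
  using stab_le[OF u w(1)] stab_le[OF w(1) u] stab_inj[OF u w(1)] w(2) by blast
 thus ?thesis
 proof cases
  case 1
  show ?thesis unfolding down[OF u w 1] using 1 by blast
 next
  case 2
  show ?thesis unfolding sym insert_commute[of u w "{}"] down[OF w(1) u w(2)[symmetric] 2] using 2 by blast
 next
  case 3
  obtain i j where "i \<in> cln u" "j \<in> cln w" using stabD(2) u w by blast
  hence "stab (meet u w)" using stab_meet uV wV 3 by blast
  moreover have "meet u w \<in> set (tree_path T u w)" using set_tree_path[OF uV wV] meet(1)[OF uV wV] by blast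
  moreover have "meet u w \<noteq> u" "meet u w \<noteq> w" using meet(2,3)[OF uV wV] 3 by auto
  moreover have "\<not> (cln w \<subset> cln u \<or> cln u \<subset> cln w)" using 3 stab_le u w(1) by blast
  ultimately show ?thesis by blast
 qed
qed

text \<open>For \<open>i \<noteq> 1\<close> the new foot is the last stable vertex on the path from
  the root to the old foot; from the old foot to any other stable vertex, some further stable vertex
  is passed. The first marked point is attached at \<open>rho\<close>.\<close>

lemma stab_foot:
 assumes i: "i \<in> {1..n}"
 shows "\<exists>!w. w \<in> {v. stab v} \<and> set (tree_path T (foot T (PMark i)) w) \<inter> {v. stab v} = {w}"
  and "\<And>w. stab w ==> set (tree_path T (foot T (PMark i)) w) \<inter> {v. stab v} = {w} ==>
   if i = 1 then w = rho else (\<forall>v. stab v \<longrightarrow> (i \<in> cln v \<longleftrightarrow> cln w \<subseteq> cln v))"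
proof -
 let ?f = "foot T (PMark i)"
 have f: "?f \<in> V" by (rule foot_p[OF i])
 have A: "\<exists>w0. stab w0 \<and> (if i = 1 then w0 = rho else (\<forall>v. stab v \<longrightarrow> (i \<in> cln v \<longleftrightarrow> cln w0 \<subseteq> cln v))) \<and>
  (\<forall>w. stab w \<longrightarrow> (set (tree_path T ?f w) \<inter> {v. stab v} = {w} \<longleftrightarrow> w = w0))"
 proof (cases "i = 1")
  case True
  have "set (tree_path T ?f w) \<inter> {v. stab v} = {w} \<longleftrightarrow> w = rho" if w: "stab w" for w
  proof -
   have "set (tree_path T ?f w) = {z \<in> V. z \<preceq> w}" unfolding True by (rule set_root_path[OF stabD(1)[OF w]])
   hence *: "set (tree_path T ?f w) \<inter> {v. stab v} = {z. stab z \<and> z \<preceq> w}" using stabD(1) by blast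
   show ?thesis unfolding *
   proof
    assume eq: "{z. stab z \<and> z \<preceq> w} = {w}"
    have "rho \<in> {w}" unfolding eq[symmetric] using rho(1) rho_le[OF w] by simp
    thus "w = rho" by simp
   next
    assume wr: "w = rho"
    have "z = rho" if z: "stab z" "z \<preceq> rho" for z
     by (rule V_eq[OF stabD(1)[OF z(1)] rho(3) z(2) rho_le[OF z(1)]])
    thus "{z. stab z \<and> z \<preceq> w} = {w}" unfolding wr using rho(1) by auto
   qed
  qed
  thus ?thesis using True rho(1) by auto
 next
  case False
  hence i2: "i \<in> {2..n}" using i by auto
  let ?S = "{v. stab v \<and> v \<preceq> ?f}"
  have le_cln: "v \<preceq> ?f \<longleftrightarrow> i \<in> cln v" if "stab v" for v using cln_iff[OF stabD(1)[OF that], of i] i2 by blast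
  have "\<exists>s. s \<in> ?S \<and> (\<forall>w\<in>?S. w \<preceq> s)"
  proof (rule ex_maximal[of ?S])
   show "?S \<noteq> {}" using le_cln[OF rho(1)] rho i2 by blast
   show "u \<preceq> u' \<or> u' \<preceq> u" if "u \<in> ?S" "u' \<in> ?S" for u u' using le_chain[of u u' ?f] that f stabD by blast
  qed (use stabD in blast)+
  then obtain w0 where w0: "stab w0" "w0 \<preceq> ?f" "\<And>v. stab v ==> v \<preceq> ?f ==> v \<preceq> w0" by blast
  have w0V: "w0 \<in> V" using w0(1) stabD by blast
  have key: "i \<in> cln v \<longleftrightarrow> cln w0 \<subseteq> cln v" if v: "stab v" for v
  proof
   assume "i \<in> cln v"
   hence "v \<preceq> ?f" using le_cln[OF v] by simp
   thus "cln w0 \<subseteq> cln v" by (rule cln_mono[OF w0(3)[OF v]])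
  next
   assume "cln w0 \<subseteq> cln v"
   thus "i \<in> cln v" using le_cln[OF w0(1)] w0(2) by auto
  qed
  have ff: "meet ?f w = w" if "w \<in> V" "w \<preceq> ?f" for w
   using meet[OF f that(1)] that V_eq by blast
  have "set (tree_path T ?f w) \<inter> {v. stab v} = {w} \<longleftrightarrow> w = w0" if w: "stab w" for w
  proof -
   have wV: "w \<in> V" using w stabD by blast
   note path = set_tree_path[OF f wV]
   show ?thesis
   proof
    assume eq: "set (tree_path T ?f w) \<inter> {v. stab v} = {w}"
    show "w = w0"
    proof (cases "w \<preceq> ?f")
     case True
     hence ww: "w \<preceq> w0" using w0(3) w by blast
     have "w0 \<in> set (tree_path T ?f w)"
     proof (cases "w0 \<preceq> w")
      case True
      hence "w0 = w" using ww V_eq w0V wV by blast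
      thus ?thesis unfolding path ff[OF wV \<open>w \<preceq> ?f\<close>] using wV by simp
     next
      case False
      thus ?thesis unfolding path using w0(2) w0V by blast
     qed
     hence "w0 \<in> {w}" unfolding eq[symmetric] using w0(1) by simp
     thus ?thesis by simp
    next
     case False
     hence "i \<notin> cln w" using le_cln[OF w] by blast
     moreover obtain j where "j \<in> cln w" using stabD(2)[OF w] by blast
     ultimately have "stab (meet ?f w)" using stab_meet_foot[OF i2 wV] by blast
     moreover have "meet ?f w \<in> set (tree_path T ?f w)" unfolding path using meet(1)[OF f wV] by blast
     ultimately have "meet ?f w = w" using eq by blast
     thus ?thesis using meet(2)[OF f wV] False by simp
    qed
   next
    assume ww: "w = w0"
    have "z = w0" if z: "stab z" "z \<in> set (tree_path T ?f w0)" for z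
    proof -
     have zV: "z \<in> V" using z stabD by blast
     have "(z \<preceq> ?f) \<noteq> (z \<preceq> w0) \<or> z = w0" using z(2) unfolding set_tree_path[OF f w0V] ff[OF w0V w0(2)] by blast
     moreover have "z \<preceq> ?f \<longleftrightarrow> z \<preceq> w0" using w0 z(1) by blast
     ultimately show ?thesis by blast
    qed
    moreover have "w0 \<in> set (tree_path T ?f w0)" unfolding set_tree_path[OF f w0V] ff[OF w0V w0(2)] using w0V by blast
    ultimately show "set (tree_path T ?f w) \<inter> {v. stab v} = {w}" using w0(1) unfolding ww by blast
   qed
  qed
  thus ?thesis using False key w0(1) by auto
 qed
 then obtain w0 where w0: "stab w0" "if i = 1 then w0 = rho else (\<forall>v. stab v \<longrightarrow> (i \<in> cln v \<longleftrightarrow> cln w0 \<subseteq> cln v))"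
  "\<And>w. stab w ==> (set (tree_path T ?f w) \<inter> {v. stab v} = {w} \<longleftrightarrow> w = w0)" by blast
 show "\<exists>!w. w \<in> {v. stab v} \<and> set (tree_path T ?f w) \<inter> {v. stab v} = {w}" using w0(1,3) by blast
 show "if i = 1 then w = rho else (\<forall>v. stab v \<longrightarrow> (i \<in> cln v \<longleftrightarrow> cln w \<subseteq> cln v))"
  if "stab w" "set (tree_path T ?f w) \<inter> {v. stab v} = {w}" for w
 proof -
  have "w = w0" using w0(3) that by blast
  thus ?thesis using w0(2) by simp
 qed
qed

lemma PMark_image [simp]: "PMark ` A \<subseteq> PMark ` B \<longleftrightarrow> A \<subseteq> B" "PMark ` A = PMark ` B \<longleftrightarrow> A = B"
 by (auto simp: inj_image_subset_iff inj_image_eq_iff inj_def)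

section \<open>The stabilized tree in terms of clusters\<close>

lemma edges_stabilize:
 "edges (stabilize (p_marks n) T) = {{u, w} | u w. stab u \<and> stab w \<and> cln w \<subset> cln u \<and>
   (\<forall>z. stab z \<longrightarrow> \<not> (cln w \<subset> cln z \<and> cln z \<subset> cln u))}"
proof -
 have "edges (stabilize (p_marks n) T) = {{u, w} | u w. stab u \<and> stab w \<and> u \<noteq> w \<and> set (tree_path T u w) \<inter> {v. stab v} = {u, w}}"
  unfolding stabilize_def Let_def stable_verts_eq by simp
 also have "\<dots> = {{u, w} | u w. stab u \<and> stab w \<and> u \<noteq> w \<and> (cln w \<subset> cln u \<or> cln u \<subset> cln w) \<and> (\<forall>z. stab z \<longrightarrow> \<not> (cln w \<subset> cln z \<and> cln z \<subset> cln u) \<and> \<not> (cln u \<subset> cln z \<and> cln z \<subset> cln w))}"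
  by (intro Collect_cong ex_cong1 conj_cong refl stab_path_iff)
 also have "\<dots> = {{u, w} | u w. stab u \<and> stab w \<and> cln w \<subset> cln u \<and> (\<forall>z. stab z \<longrightarrow> \<not> (cln w \<subset> cln z \<and> cln z \<subset> cln u))}"
  (is "?A = ?B")
 proof
  show "?A \<subseteq> ?B"
  proof
   fix e assume "e \<in> ?A"
   thus "e \<in> ?B"
   proof (elim CollectE exE conjE)
    fix u w assume e: "e = {u, w}" "stab u" "stab w" "cln w \<subset> cln u \<or> cln u \<subset> cln w"
     "\<forall>z. stab z \<longrightarrow> \<not> (cln w \<subset> cln z \<and> cln z \<subset> cln u) \<and> \<not> (cln u \<subset> cln z \<and> cln z \<subset> cln w)"
    from e(4) show ?thesis
    proof
     assume "cln w \<subset> cln u"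
     with e show ?thesis by (intro CollectI exI[of _ u] exI[of _ w]) simp
    next
     assume "cln u \<subset> cln w"
     with e show ?thesis by (intro CollectI exI[of _ w] exI[of _ u]) (simp add: insert_commute)
    qed
   qed
  qed
  show "?B \<subseteq> ?A"
  proof
   fix e assume "e \<in> ?B"
   thus "e \<in> ?A"
   proof (elim CollectE exE conjE)
    fix u w assume e: "e = {u, w}" "stab u" "stab w" "cln w \<subset> cln u"
     "\<forall>z. stab z \<longrightarrow> \<not> (cln w \<subset> cln z \<and> cln z \<subset> cln u)"
    have "\<not> (cln u \<subset> cln z \<and> cln z \<subset> cln w)" for z using e(4) by auto
    moreover have "u \<noteq> w" using e(4) by auto
    ultimately show ?thesis using e by (intro CollectI exI[of _ u] exI[of _ w]) simp
   qed
  qed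
 qed
 finally show ?thesis .
qed

text \<open>Makes the isomorphism class of the stabilized tree readable: it is given by the clusters
  and their depths relative to \<open>rho\<close>.\<close>

lemma stabilize_keyed:
 "keyed_tree (p_marks n) (stabilize (p_marks n) T) (\<lambda>v. PMark ` cln v) (\<lambda>v. pot (len T) v - pot (len T) rho)"
proof
 let ?T = "stabilize (p_marks n) T"
 have vs: "verts ?T = {v. stab v}" unfolding stabilize_def Let_def stable_verts_eq by simp
 have ln: "len ?T = chain_len T (len T)" unfolding stabilize_def Let_def by simp
 have ft: "foot ?T (PMark i) \<in> {v. stab v} \<and> set (tree_path T (foot T (PMark i)) (foot ?T (PMark i))) \<inter> {v. stab v} = {foot ?T (PMark i)}"
  if "i \<in> {1..n}" for i
  unfolding stabilize_def Let_def stable_verts_eq mtree.simps by (rule theI'[OF stab_foot(1)[OF that]])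
 have one: "1 \<in> {1..n}" using n by simp
 have I: "{1..n} = insert 1 {2..n}" using n by auto
 have pm: "p_marks n - {PMark 1} = PMark ` {2..n}" unfolding p_marks_def I by auto
 show "finite (verts ?T)" unfolding vs by (rule finite_subset[OF _ finV]) (use stabD in blast)
 show "PMark 1 \<in> p_marks n" using n unfolding p_marks_def by simp
 show "inj_on (\<lambda>v. PMark ` cln v) (verts ?T)" unfolding vs using stab_inj by (auto simp: inj_on_def)
 show "PMark ` cln v \<noteq> {} \<and> PMark ` cln v \<subseteq> p_marks n - {PMark 1}" if "v \<in> verts ?T" for v
  unfolding pm using that stabD(2) cln_sub unfolding vs by simp
 show "PMark ` cln u \<subseteq> PMark ` cln v \<or> PMark ` cln v \<subseteq> PMark ` cln u \<or> PMark ` cln u \<inter> PMark ` cln v = {}"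
  if "u \<in> verts ?T" "v \<in> verts ?T" for u v
 proof -
  have s: "stab u" "stab v" using that unfolding vs by auto
  show ?thesis
  proof (cases "cln u \<inter> cln v = {}")
   case False
   hence "u \<preceq> v \<or> v \<preceq> u" using cln_comparable s stabD(1) by blast
   hence "cln v \<subseteq> cln u \<or> cln u \<subseteq> cln v" using cln_mono by metis
   thus ?thesis by (metis image_mono)
  qed auto
 qed
 show r: "foot ?T (PMark 1) \<in> verts ?T" unfolding vs using ft[OF one] by blast
 have fr: "foot ?T (PMark 1) = rho" using stab_foot(2)[OF one, of "foot ?T (PMark 1)"] ft[OF one] by simp
 show "PMark ` cln (foot ?T (PMark 1)) = p_marks n - {PMark 1}" unfolding fr rho(2) pm ..
 fix l assume l: "l \<in> p_marks n" "l \<noteq> PMark 1"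
 from l(1) obtain i where i: "l = PMark i" "i \<in> {1..n}" unfolding p_marks_def by (rule imageE)
 hence i1: "i \<noteq> 1" using l(2) by metis
 show "foot ?T l \<in> verts ?T" unfolding vs i(1) using ft[OF i(2)] by blast
 show "l \<in> PMark ` cln v \<longleftrightarrow> PMark ` cln (foot ?T l) \<subseteq> PMark ` cln v" if "v \<in> verts ?T" for v
  using stab_foot(2)[OF i(2), of "foot ?T l"] ft[OF i(2)] i i1 that unfolding vs by auto
next
 let ?T = "stabilize (p_marks n) T"
 have vs: "verts ?T = {v. stab v}" unfolding stabilize_def Let_def stable_verts_eq by simp
 have ln: "len ?T = chain_len T (len T)" unfolding stabilize_def Let_def by simp
 have ps: "PMark ` A \<subset> PMark ` B \<longleftrightarrow> A \<subset> B" for A B by (simp add: psubset_eq)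
 have "(\<forall>z. stab z \<longrightarrow> \<not> (cln w \<subset> cln z \<and> cln z \<subset> cln u)) \<longleftrightarrow> (\<forall>z\<in>{v. stab v}. cln w \<subseteq> cln z \<longrightarrow> cln z \<subseteq> cln u \<longrightarrow> cln z = cln u \<or> cln z = cln w)" for u w
  by blast
 thus "edges ?T = {{u, v} |u v. u \<in> verts ?T \<and> v \<in> verts ?T \<and> PMark ` cln v \<subset> PMark ` cln u \<and>
   (\<forall>z\<in>verts ?T. PMark ` cln v \<subseteq> PMark ` cln z \<longrightarrow> PMark ` cln z \<subseteq> PMark ` cln u \<longrightarrow> PMark ` cln z = PMark ` cln u \<or> PMark ` cln z = PMark ` cln v)}"
  unfolding edges_stabilize vs ps PMark_image by simp
 show "len ?T {u, v} = pot (len T) v - pot (len T) rho - (pot (len T) u - pot (len T) rho)"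
  if e: "{u, v} \<in> edges ?T" "PMark ` cln v \<subset> PMark ` cln u" for u v
 proof -
  have s: "stab u" "stab v" using e(1) unfolding edges_stabilize by (auto simp: doubleton_eq_iff)
  hence "u \<preceq> v" using stab_le e(2) unfolding ps by blast
  thus ?thesis unfolding ln using chain_len_pot[of u v "len T"] s stabD(1) by simp
 qed
qed

text \<open>The vertex at which the path to the end \<open>q\<^sub>l\<close> leaves the subtree spanned by the marked
 points.\<close>

definition attach :: "nat => nat" where
 "attach l = (THE p. p \<in> V \<and> cln p \<noteq> {} \<and> p \<preceq> foot T (QMark l) \<and> (\<forall>v\<in>V. cln v \<noteq> {} \<longrightarrow> v \<preceq> foot T (QMark l) \<longrightarrow> v \<preceq> p))"

lemma attach:
 assumes l: "l \<in> {1..m}"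
 shows "attach l \<in> V" "cln (attach l) \<noteq> {}" "attach l \<preceq> foot T (QMark l)"
  "\<And>v. v \<in> V ==> cln v \<noteq> {} ==> v \<preceq> foot T (QMark l) ==> v \<preceq> attach l"
proof -
 let ?S = "{v \<in> V. cln v \<noteq> {} \<and> v \<preceq> foot T (QMark l)}"
 have f: "foot T (QMark l) \<in> V" by (rule foot_q[OF l])
 have "\<exists>s. s \<in> ?S \<and> (\<forall>w\<in>?S. w \<preceq> s)"
 proof (rule ex_maximal[of ?S])
  have "cln rt \<noteq> {}" unfolding cln_root using n by simp
  thus "?S \<noteq> {}" using K_root(1) le_root[OF f] by blast
  show "u \<preceq> u' \<or> u' \<preceq> u" if "u \<in> ?S" "u' \<in> ?S" for u u' using le_chain[of u u'] that f by blast
 qed blast+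
 then obtain p where p: "p \<in> ?S" "\<And>v. v \<in> ?S ==> v \<preceq> p" by blast
 let ?P = "\<lambda>p. p \<in> V \<and> cln p \<noteq> {} \<and> p \<preceq> foot T (QMark l) \<and> (\<forall>v\<in>V. cln v \<noteq> {} \<longrightarrow> v \<preceq> foot T (QMark l) \<longrightarrow> v \<preceq> p)"
 have "?P p" using p by blast
 moreover have "p' = p" if "?P p'" for p'
 proof (rule V_eq)
  show "p' \<preceq> p" using p(2)[of p'] that by simp
  show "p \<preceq> p'" using that calculation by (elim conjE) simp
 qed (use that calculation in simp_all)
 ultimately have "?P (attach l)" unfolding attach_def by (rule theI)
 thus "attach l \<in> V" "cln (attach l) \<noteq> {}" "attach l \<preceq> foot T (QMark l)"
  "\<And>v. v \<in> V ==> cln v \<noteq> {} ==> v \<preceq> foot T (QMark l) ==> v \<preceq> attach l" by blast+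
qed

definition sdepth :: "(nat set => 'b::ab_group_add) => nat set => 'b" where
 "sdepth t A = pot t (sv A) - pot t rho"

text \<open>The common part of the paths from the first marked point to \<open>p_i\<close> and to
  \<open>q_l\<close> ends at the attaching vertex if \<open>p_i\<close> lies behind it, and
  otherwise at the stable vertex where \<open>p_i\<close> branches off. This is the origin of the
  case distinction in \<open>cell_base\<close> and \<open>cell_col\<close>.\<close>

lemma overlap:
 assumes l: "l \<in> {1..m}" and i: "i \<in> {2..n}"
 shows "(\<Sum>z | z \<in> V \<and> z \<preceq> foot T (PMark i) \<and> z \<preceq> foot T (QMark l) \<and> z \<noteq> rt. t {par z, z}) - pot t rho
   = (if i \<in> cln (attach l) then pot t (attach l) - pot t rho else sdepth t (join ClF (insert i (cln (attach l)))))"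
proof -
 let ?f = "foot T (PMark i)" and ?g = "foot T (QMark l)" and ?p = "attach l"
 note p = attach[OF l]
 have f: "?f \<in> V" using foot_p i by simp
 have g: "?g \<in> V" by (rule foot_q[OF l])
 have fp: "z \<preceq> ?p" if "z \<in> V" "z \<preceq> ?f" "z \<preceq> ?g" for z
  using p(4)[OF that(1)] cln_iff[OF that(1), of i] i that by blast
 show ?thesis
 proof (cases "i \<in> cln ?p")
  case True
  hence "?p \<preceq> ?f" using cln_iff[OF p(1)] by blast
  hence "{z. z \<in> V \<and> z \<preceq> ?f \<and> z \<preceq> ?g \<and> z \<noteq> rt} = {z. z \<in> V \<and> z \<preceq> ?p \<and> z \<noteq> rt}"
   using fp p(1,3) by blast
  thus ?thesis using True unfolding pot_def by simp
 next
  case False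
  let ?m = "meet ?f ?p"
  note m = meet[OF f p(1)]
  obtain j where j: "j \<in> cln ?p" using p(2) by blast
  have sm: "stab ?m" by (rule stab_meet_foot[OF i p(1) j False])
  have im: "i \<in> cln ?m" using cln_iff[OF m(1)] m(2) i by blast
  have "z \<preceq> ?f \<and> z \<preceq> ?g \<longleftrightarrow> z \<preceq> ?m" if z: "z \<in> V" for z
  proof
   assume "z \<preceq> ?f \<and> z \<preceq> ?g"
   thus "z \<preceq> ?m" using m(4)[OF z] fp[OF z] by simp
  next
   assume "z \<preceq> ?m"
   thus "z \<preceq> ?f \<and> z \<preceq> ?g" using m(2,3) p(3) by (meson subset_trans)
  qed
  hence "{z. z \<in> V \<and> z \<preceq> ?f \<and> z \<preceq> ?g \<and> z \<noteq> rt} = {z. z \<in> V \<and> z \<preceq> ?m \<and> z \<noteq> rt}" by blast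
  hence 1: "(\<Sum>z | z \<in> V \<and> z \<preceq> ?f \<and> z \<preceq> ?g \<and> z \<noteq> rt. t {par z, z}) = pot t ?m" unfolding pot_def by simp
  have "join ClF (insert i (cln ?p)) = cln ?m"
  proof
   have "cln ?m \<in> ClF" "insert i (cln ?p) \<subseteq> cln ?m"
    using sm im cln_mono[OF m(3)] unfolding ClF_def by auto
   thus "join ClF (insert i (cln ?p)) \<subseteq> cln ?m" unfolding join_def by blast
   have "cln ?m \<subseteq> cln s" if s: "stab s" "insert i (cln ?p) \<subseteq> cln s" for s
   proof -
    have sV: "s \<in> V" using s stabD by blast
    have sf: "s \<preceq> ?f" using cln_iff[OF sV] s by blast
    have "s \<preceq> ?p \<or> ?p \<preceq> s" using cln_comparable[OF sV p(1)] j s by blast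
    moreover have "\<not> ?p \<preceq> s" using False cln_iff[OF p(1), of i] sf i by blast
    ultimately have "s \<preceq> ?m" using m(4)[OF sV sf] by blast
    thus ?thesis by (rule cln_mono)
   qed
   thus "cln ?m \<subseteq> join ClF (insert i (cln ?p))" unfolding join_def ClF_def by blast
  qed
  thus ?thesis using False 1 sv_cln[OF sm] unfolding sdepth_def by simp
 qed
qed

end

section \<open>Parametrized curves\<close>

text \<open>By \<open>keyset_iso\<close> this is a complete invariant of stable metric trees, so
  isomorphism classes are compared as sets.\<close>

definition keyset :: "mark set => 'z mtree_scheme => (mark set \<times> real) set" where
 "keyset L T = (\<lambda>v. (clus L T v, depth T v)) ` verts T"

lemma depth_root: "metric_tree L T ==> PMark 1 \<in> L ==> depth T (foot T (PMark 1)) = 0"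
proof -
 assume T: "metric_tree L T" "PMark 1 \<in> L"
 hence r: "foot T (PMark 1) \<in> verts T" unfolding metric_tree_def by blast
 interpret otree_graph T "foot T (PMark 1)" "\<lambda>u v. u \<in> set (tree_path T (foot T (PMark 1)) v)"
  by (rule metric_tree_otree_graph[OF T(1) r])
 show ?thesis unfolding depth_def using chain_len_pot[OF r r le_refl[OF r], of "len T"] by simp
qed

lemma keyset_iso:
 assumes L: "finite L" "PMark 1 \<in> L" and T: "metric_tree L T" "metric_tree L T'"
 shows "(\<exists>\<sigma>. tree_iso L \<sigma> T T') \<longleftrightarrow> keyset L T = keyset L T'"
proof
 note k = metric_tree_keyed(1)[OF T(1) L(2,1)] metric_tree_keyed(1)[OF T(2) L(2,1)]
 { assume "\<exists>\<sigma>. tree_iso L \<sigma> T T'"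
  then obtain \<sigma> where s: "tree_iso L \<sigma> T T'" by blast
  have "clus L T' (\<sigma> v) = clus L T v" "depth T' (\<sigma> v) = depth T v" if "v \<in> verts T" for v
   using keyed_tree_iso_keys[OF k s that] depth_root[OF T(1) L(2)] depth_root[OF T(2) L(2)] by auto
  moreover have "verts T' = \<sigma> ` verts T" using s unfolding tree_iso_def bij_betw_def by blast
  ultimately show "keyset L T = keyset L T'" unfolding keyset_def by (auto simp: image_image) }
 assume "keyset L T = keyset L T'"
 thus "\<exists>\<sigma>. tree_iso L \<sigma> T T'" unfolding keyset_def by (rule keyed_tree_iso[OF k]) blast
qed

lemma p_marks_L: "finite (p_marks n)" "n \<ge> 1 ==> PMark 1 \<in> p_marks n"
 unfolding p_marks_def by auto

lemma pq_marks_L: "finite (pq_marks n m)" "n \<ge> 1 ==> PMark 1 \<in> pq_marks n m"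
 unfolding pq_marks_def by auto

lemma tree_rel_iff:
 assumes "n \<ge> 1"
 shows "(T, T') \<in> tree_rel n \<longleftrightarrow> metric_tree (p_marks n) T \<and> metric_tree (p_marks n) T' \<and> keyset (p_marks n) T = keyset (p_marks n) T'"
 unfolding tree_rel_def using keyset_iso[OF p_marks_L(1) p_marks_L(2)[OF assms], of T T'] by auto

lemma sum_end_dir:
 assumes "(\<Sum>l\<in>{1..m}. \<Delta> l) = 0"
 shows "(\<Sum>l\<in>{1..m}. end_dir \<Delta> (QMark l)) = 0"
proof -
 have "fst (\<Sum>l\<in>{1..m}. \<Delta> l) = 0" "snd (\<Sum>l\<in>{1..m}. \<Delta> l) = 0" using assms by auto
 hence "(\<Sum>l\<in>{1..m}. fst (\<Delta> l)) = 0" "(\<Sum>l\<in>{1..m}. snd (\<Delta> l)) = 0" by (auto simp: fst_sum snd_sum)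
 hence "(\<Sum>l\<in>{1..m}. real_of_int (fst (\<Delta> l))) = 0" "(\<Sum>l\<in>{1..m}. real_of_int (snd (\<Delta> l))) = 0"
  by (metis of_int_0 of_int_sum)+
 thus ?thesis by (simp add: prod_eq_iff fst_sum snd_sum)
qed

lemma end_sum: "(\<Sum>l | l \<in> pq_marks n m \<and> f l = v. end_dir \<Delta> l) = (\<Sum>l | l \<in> {1..m} \<and> f (QMark l) = v. end_dir \<Delta> (QMark l))"
proof -
 have "(\<Sum>l | l \<in> pq_marks n m \<and> f l = v. end_dir \<Delta> l) = (\<Sum>l\<in>QMark ` {l. l \<in> {1..m} \<and> f (QMark l) = v}. end_dir \<Delta> l)"
  by (rule sum.mono_neutral_right) (auto simp: pq_marks_def)
 thus ?thesis by (simp add: sum.reindex inj_on_def)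
qed

definition crd :: "nat => real \<times> real => real" where "crd r v = (if even r then fst v else snd v)"

context pq_tree
begin

text \<open>For the end directions this is the direction of the edge from \<open>par z\<close> to
  \<open>z\<close>, as shown in \<open>direction\<close>.\<close>

definition lsum :: "(nat => 'b::comm_monoid_add) => nat => 'b" where
 "lsum e z = (\<Sum>l | l \<in> {1..m} \<and> z \<preceq> foot T (QMark l). e l)"

lemma lsum_split:
 assumes z: "z \<in> V"
 shows "lsum e z = (\<Sum>l | l \<in> {1..m} \<and> foot T (QMark l) = z. e l) + (\<Sum>w | cov z w. lsum e w)"
proof -
 let ?A = "{l. l \<in> {1..m} \<and> foot T (QMark l) = z}" and ?B = "\<lambda>w. {l. l \<in> {1..m} \<and> w \<preceq> foot T (QMark l)}"
 have finCh: "finite {w. cov z w}" by (rule finite_subset[OF _ finV]) (auto simp: cov_def)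
 have covD: "w \<in> V \<and> z \<preceq> w \<and> z \<noteq> w" if "cov z w" for w using that unfolding cov_def by simp
 have "?B z = ?A \<union> (\<Union>w\<in>{w. cov z w}. ?B w)"
 proof (intro equalityI subsetI)
  fix l assume l: "l \<in> ?B z"
  hence f: "foot T (QMark l) \<in> V" "z \<preceq> foot T (QMark l)" using foot_q by auto
  show "l \<in> ?A \<union> (\<Union>w\<in>{w. cov z w}. ?B w)"
  proof (cases "foot T (QMark l) = z")
   case False
   obtain c where "cov z c" "c \<preceq> foot T (QMark l)" by (rule child_toward[OF z f]) (use False in auto)
   thus ?thesis using l by blast
  qed (use l in simp)
 next
  fix l assume "l \<in> ?A \<union> (\<Union>w\<in>{w. cov z w}. ?B w)"
  thus "l \<in> ?B z" using covD by blast
 qed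
 moreover have "?A \<inter> (\<Union>w\<in>{w. cov z w}. ?B w) = {}"
 proof -
  have "\<not> w \<preceq> z" if "cov z w" for w using covD[OF that] V_eq z by metis
  thus ?thesis by auto
 qed
 moreover have "?B w \<inter> ?B w' = {}" if w: "cov z w" "cov z w'" "w \<noteq> w'" for w w'
 proof (rule ccontr)
  assume "?B w \<inter> ?B w' \<noteq> {}"
  then obtain l where l: "l \<in> {1..m}" "w \<preceq> foot T (QMark l)" "w' \<preceq> foot T (QMark l)" by blast
  hence "w \<preceq> w' \<or> w' \<preceq> w" using le_chain covD w foot_q by metis
  thus False using w unfolding cov_def by metis
 qed
 moreover have "(\<Sum>l\<in>(\<Union>w\<in>{w. cov z w}. ?B w). e l) = (\<Sum>w | cov z w. lsum e w)"
  unfolding lsum_def by (rule sum.UNION_disjoint) (use finCh calculation(3) in auto)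
 ultimately show ?thesis using finCh unfolding lsum_def by (simp add: sum.union_disjoint)
qed

lemma lsum_root: "lsum e rt = (\<Sum>l\<in>{1..m}. e l)"
proof -
 have "{l. l \<in> {1..m} \<and> rt \<preceq> foot T (QMark l)} = {1..m}" using le_root foot_q by blast
 thus ?thesis unfolding lsum_def by simp
qed

lemma sum_below_par:
 fixes f :: "nat => 'b::comm_monoid_add"
 assumes "v \<in> V" "v \<noteq> rt"
 shows "(\<Sum>z | z \<in> V \<and> z \<preceq> v \<and> z \<noteq> rt. f z) = (\<Sum>z | z \<in> V \<and> z \<preceq> par v \<and> z \<noteq> rt. f z) + f v"
proof -
 note pp = par_props[OF assms]
 have "z \<in> V ==> z \<preceq> v \<longleftrightarrow> z \<preceq> par v \<or> z = v" for z
  using pp(4)[of z] subset_trans[OF pp(2), of "K z"] by blast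
 hence "{z. z \<in> V \<and> z \<preceq> v \<and> z \<noteq> rt} = insert v {z. z \<in> V \<and> z \<preceq> par v \<and> z \<noteq> rt}" using assms by blast
 moreover have "\<not> v \<preceq> par v" using pp V_eq assms by metis
 ultimately show ?thesis using finV by (simp add: add.commute)
qed

lemma sum_below_root: "(\<Sum>z | z \<in> V \<and> z \<preceq> rt \<and> z \<noteq> rt. f z) = 0"
proof -
 have e: "{z. z \<in> V \<and> z \<preceq> rt \<and> z \<noteq> rt} = {}" using V_eq le_root K_root(1) by blast
 show ?thesis unfolding e by (rule sum.empty)
qed

lemma nbr_sum:
 fixes f :: "nat => 'b::ab_group_add"
 assumes "v \<in> V"
 shows "(\<Sum>w | {v, w} \<in> edges T. f w) = (\<Sum>w | cov v w. f w) + (if v = rt then 0 else f (par v))"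
proof -
 have "{w. {v, w} \<in> edges T} = {w. cov v w} \<union> (if v = rt then {} else {par v})"
  unfolding edge_iff using cov_par[of _ v] assms by auto
 moreover have "finite {w. cov v w}" by (rule finite_subset[OF _ finV]) (auto simp: cov_def)
 moreover have "\<not> cov v (par v)" if "v \<noteq> rt" using par_cov[OF assms that] le_antisym unfolding cov_def by blast
 ultimately show ?thesis by (auto simp: add.commute)
qed

text \<open>The edge or leg of the stabilized tree on which an end sits. Columns are numbered from 0
  and ends from 1; the restriction makes \<open>sg\<close> an element of an extensional function
  space.\<close>

definition sg :: "nat => nat set" where "sg = (\<lambda>j\<in>{..<m}. cln (attach (Suc j)))"
definition Dt :: "(nat set => 'b::ab_group_add) => nat => 'b" where "Dt t j = pot t (attach (Suc j)) - pot t rho"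

text \<open>The displacement of a marked point is the sum over the edges on its path of length times
  the sum of the ends behind. Exchanging the sums, each end counts with the length of the overlap of
  its path with that of the marked point.\<close>

lemma flow_eq:
 fixes e :: "nat => real \<times> real" and t :: "nat set => real"
 assumes bal: "(\<Sum>l\<in>{1..m}. e l) = 0" and r: "r < 2 * (n - 1)"
 shows "crd r (\<Sum>z | z \<in> V \<and> z \<preceq> foot T (PMark (r div 2 + 2)) \<and> z \<noteq> rt. t {par z, z} *\<^sub>R lsum e z)
  = (\<Sum>j<m. cell_base ClF (sdepth t) (\<lambda>j r. crd r (e (Suc j))) j (sg j) r + Dt t j * cell_col (\<lambda>j r. crd r (e (Suc j))) j (sg j) r)"
proof -
 define i where "i = r div 2 + 2"
 have i: "i \<in> {2..n}" unfolding i_def using r by auto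
 define c where "c l = (\<Sum>z | z \<in> V \<and> z \<preceq> foot T (PMark i) \<and> z \<preceq> foot T (QMark l) \<and> z \<noteq> rt. t {par z, z})" for l
 let ?Z = "{z. z \<in> V \<and> z \<preceq> foot T (PMark i) \<and> z \<noteq> rt}"
 have finZ: "finite ?Z" using finV by simp
 have "(\<Sum>z\<in>?Z. t {par z, z} *\<^sub>R lsum e z) = (\<Sum>z\<in>?Z. \<Sum>l\<in>{1..m}. (if z \<preceq> foot T (QMark l) then t {par z, z} else 0) *\<^sub>R e l)"
  unfolding lsum_def scaleR_sum_right by (intro sum.cong sum.mono_neutral_cong_left) auto
 also have "\<dots> = (\<Sum>l\<in>{1..m}. (\<Sum>z\<in>?Z. if z \<preceq> foot T (QMark l) then t {par z, z} else 0) *\<^sub>R e l)"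
  by (subst sum.swap) (simp add: scaleR_sum_left)
 also have "\<dots> = (\<Sum>l\<in>{1..m}. c l *\<^sub>R e l)"
  unfolding c_def using finZ by (intro sum.cong refl arg_cong2[of _ _ _ _ scaleR] sum.mono_neutral_cong_right) auto
 \<comment> \<open>Since the \<open>e l\<close> sum to zero, every overlap may be measured from
   \<open>rho\<close> instead of the root.\<close>
 also have "\<dots> = (\<Sum>l\<in>{1..m}. (c l - pot t rho) *\<^sub>R e l)"
  unfolding scaleR_diff_left sum_subtractf scaleR_sum_right[symmetric] bal by simp
 also have "\<dots> = (\<Sum>j<m. (c (Suc j) - pot t rho) *\<^sub>R e (Suc j))"
  by (rule sum.reindex_bij_witness[of _ Suc "\<lambda>l. l - 1"]) auto
 finally have "crd r (\<Sum>z\<in>?Z. t {par z, z} *\<^sub>R lsum e z) = (\<Sum>j<m. (c (Suc j) - pot t rho) * crd r (e (Suc j)))"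
  unfolding crd_def by (simp add: fst_sum snd_sum)
 also have "\<dots> = (\<Sum>j<m. cell_base ClF (sdepth t) (\<lambda>j r. crd r (e (Suc j))) j (sg j) r + Dt t j * cell_col (\<lambda>j r. crd r (e (Suc j))) j (sg j) r)"
 proof (rule sum.cong[OF refl])
  fix j assume "j \<in> {..<m}"
  hence "Suc j \<in> {1..m}" "sg j = cln (attach (Suc j))" by (auto simp: sg_def)
  thus "(c (Suc j) - pot t rho) * crd r (e (Suc j)) = cell_base ClF (sdepth t) (\<lambda>j r. crd r (e (Suc j))) j (sg j) r + Dt t j * cell_col (\<lambda>j r. crd r (e (Suc j))) j (sg j) r"
   using overlap[OF _ i, of "Suc j" t] unfolding c_def cell_base_def cell_col_def i_def[symmetric] Dt_def by simp
 qed
 finally show ?thesis unfolding i_def .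
qed

end

locale pcurve_tree =
 fixes \<Delta> :: "nat => int \<times> int" and n m :: nat and C :: pcurve
 assumes curve: "param_curve \<Delta> n m C" and n3: "n \<ge> 3" and balance: "(\<Sum>l\<in>{1..m}. \<Delta> l) = 0"
begin

lemma metric: "metric_tree (pq_marks n m) C" using curve unfolding param_curve_def by blast

sublocale pq_tree n m C "clus (pq_marks n m) C" "depth C"
proof -
 have n1: "n \<ge> 1" using n3 by simp
 interpret keyed_tree "pq_marks n m" C "clus (pq_marks n m) C" "depth C"
  by (rule metric_tree_keyed(1)[OF metric pq_marks_L(2)[OF n1] pq_marks_L(1)])
 show "pq_tree n m C (clus (pq_marks n m) C) (depth C)" by unfold_locales (rule n3)
qed

abbreviation below (infix "\<preceq>" 50) where "u \<preceq> v \<equiv> le u v"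

lemma two_keys: "v \<in> V ==> 2 \<le> card (clus (pq_marks n m) C v)"
 using metric_tree_keyed(2)[OF metric pq_marks_L(2) pq_marks_L(1)] n3 by simp

lemma len_pos: "e \<in> edges C ==> 0 < len C e" using metric unfolding metric_tree_def by blast

lemma depth_pot: "v \<in> V ==> depth C v = pot (len C) v"
 using d_pot[of v] depth_root[OF metric root_mark] by simp

definition ed :: "nat => real \<times> real" where "ed l = end_dir \<Delta> (QMark l)"

lemma sum_ed: "(\<Sum>l\<in>{1..m}. ed l) = 0" unfolding ed_def by (rule sum_end_dir[OF balance])

lemma edge_dir_swap: "edge_dir C v u = - edge_dir C u v"
proof -
 have "{v, u} = {u, v}" by auto
 moreover have "pos C u - pos C v = - (pos C v - pos C u)" by simp
 ultimately show ?thesis unfolding edge_dir_def by (simp only: scaleR_minus_right)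
qed

text \<open>Balancing at \<open>z\<close>, with the directions towards the children known by
  induction, leaves the edge to the parent as the only unknown.\<close>

lemma direction:
 assumes "z \<in> V" "z \<noteq> rt"
 shows "edge_dir C (par z) z = lsum ed z"
 using assms
proof (induction "card {w \<in> V. z \<preceq> w}" arbitrary: z rule: less_induct)
 case (less z)
 have IH: "edge_dir C z w = lsum ed w" if w: "cov z w" for w
 proof -
  have wV: "w \<in> V" "w \<noteq> rt" "par w = z" using w cov_par by auto
  have "z \<preceq> w" "\<not> w \<preceq> z" using w V_eq unfolding cov_def by auto
  hence "{x \<in> V. w \<preceq> x} \<subset> {x \<in> V. z \<preceq> x}" using less.prems(1) by blast
  hence "card {x \<in> V. w \<preceq> x} < card {x \<in> V. z \<preceq> x}" using finV by (intro psubset_card_mono) auto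
  thus ?thesis using less.hyps wV by blast
 qed
 have "(\<Sum>w | {z, w} \<in> edges C. edge_dir C z w) + (\<Sum>l | l \<in> pq_marks n m \<and> foot C l = z. end_dir \<Delta> l) = 0"
  using curve less.prems(1) unfolding param_curve_def by blast
 hence "(\<Sum>w | cov z w. lsum ed w) + edge_dir C z (par z) + (\<Sum>l | l \<in> {1..m} \<and> foot C (QMark l) = z. ed l) = 0"
  unfolding nbr_sum[OF less.prems(1)] end_sum ed_def[symmetric] using less.prems(2) IH by simp
 thus ?case unfolding lsum_split[OF less.prems(1)] edge_dir_swap[of z "par z"]
  by (simp add: algebra_simps add_eq_0_iff)
qed

lemma pos_par:
 assumes "z \<in> V" "z \<noteq> rt"
 shows "pos C z = pos C (par z) + len C {par z, z} *\<^sub>R lsum ed z"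
proof -
 have "{par z, z} \<in> edges C" using edges_par assms by auto
 hence "len C {par z, z} \<noteq> 0" using len_pos by fastforce
 thus ?thesis using direction[OF assms] unfolding edge_dir_def by (simp flip: direction[OF assms] add: edge_dir_def)
qed

lemma pos_sum:
 assumes "v \<in> V"
 shows "pos C v = pos C rt + (\<Sum>z | z \<in> V \<and> z \<preceq> v \<and> z \<noteq> rt. len C {par z, z} *\<^sub>R lsum ed z)"
 using assms
proof (induction v rule: tree_induct)
 case base
 show ?case unfolding sum_below_root by simp
next
 case (step v)
 show ?case unfolding sum_below_par[OF step(1,2)] pos_par[OF step(1,2)] step(3) by (simp add: add.assoc)
qed

lemma cone_sum:
 assumes i: "i \<in> {1..n}"
 shows "snd (cone_map n C (t, b)) i = b + (\<Sum>z | z \<in> V \<and> z \<preceq> foot C (PMark i) \<and> z \<noteq> rt. t {par z, z} *\<^sub>R lsum ed z)"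
proof -
 note f = foot_p[OF i]
 have "(\<Sum>(x, y)\<leftarrow>path_steps C rt (foot C (PMark i)). t {x, y} *\<^sub>R edge_dir C x y)
   = (\<Sum>z | z \<in> V \<and> rt \<preceq> z \<and> z \<preceq> foot C (PMark i) \<and> z \<noteq> rt. t {par z, z} *\<^sub>R edge_dir C (par z) z)"
  by (rule sum_path_steps[OF K_root(1) f le_root[OF f]])
 also have "\<dots> = (\<Sum>z | z \<in> V \<and> z \<preceq> foot C (PMark i) \<and> z \<noteq> rt. t {par z, z} *\<^sub>R lsum ed z)"
  by (rule sum.cong) (use le_root direction in auto)
 finally show ?thesis unfolding cone_map_def by simp
qed

text \<open>The end directions fix all edge directions, so the metric tree together with the image
  of the first marked point fixes the map: positions propagate from the root.\<close>

lemma edge_dir_same: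
 assumes "pcurve_tree \<Delta> n m C'" and k: "keyset (pq_marks n m) C = keyset (pq_marks n m) C'" and e: "ev C 1 = ev C' 1"
 obtains \<sigma> where "tree_iso (pq_marks n m) \<sigma> C C'" "\<And>v. v \<in> V ==> pos C' (\<sigma> v) = pos C v"
proof -
 interpret C': pcurve_tree \<Delta> n m C' by fact
 obtain \<sigma> where s: "tree_iso (pq_marks n m) \<sigma> C C'"
  and sK: "\<And>v. v \<in> V ==> \<sigma> v \<in> C'.V \<and> clus (pq_marks n m) C' (\<sigma> v) = clus (pq_marks n m) C v \<and> depth C' (\<sigma> v) = depth C v"
  using k unfolding keyset_def by (rule keyed_tree_iso[OF keyed_tree_axioms C'.keyed_tree_axioms]) blast
 have fo: "foot C' l = \<sigma> (foot C l)" if "l \<in> pq_marks n m" for l using s that unfolding tree_iso_def by blast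
 have L: "lsum f v = C'.lsum f (\<sigma> v)" if "v \<in> V" for v and f :: "nat => real \<times> real"
 proof -
  have "v \<preceq> foot C (QMark l) \<longleftrightarrow> clus (pq_marks n m) C' (foot C' (QMark l)) \<subseteq> clus (pq_marks n m) C' (\<sigma> v)" if "l \<in> {1..m}" for l
   using sK[OF \<open>v \<in> V\<close>] sK[OF foot_q[OF that]] fo[OF pq_mark_in(2)[OF that]] by simp
  thus ?thesis unfolding lsum_def C'.lsum_def by (intro sum.cong) auto
 qed
 have "pos C' (\<sigma> v) = pos C v" if "v \<in> V" for v
  using that
 proof (induction v rule: tree_induct)
  case base
  thus ?case using e fo[OF root_mark] unfolding ev_def by simp
 next
  case (step v)
  note pp = par_props[OF step(1,2)]
  have eT: "{par v, v} \<in> edges C" using edges_par step(1,2) by auto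
  hence l: "len C' {\<sigma> (par v), \<sigma> v} = len C {par v, v}" using s unfolding tree_iso_def by force
  have "(\<lambda>e. \<sigma> ` e) {par v, v} \<in> edges C'" using s eT unfolding tree_iso_def by blast
  hence "{\<sigma> (par v), \<sigma> v} \<in> edges C'" by simp
  hence "C'.cov (\<sigma> (par v)) (\<sigma> v) \<or> C'.cov (\<sigma> v) (\<sigma> (par v))" using C'.edge_iff by blast
  moreover have "clus (pq_marks n m) C' (\<sigma> v) \<subseteq> clus (pq_marks n m) C' (\<sigma> (par v))" using sK step(1) pp(1,2) by simp
  ultimately have "C'.cov (\<sigma> (par v)) (\<sigma> v)" using C'.V_eq unfolding C'.cov_def by metis
  hence c: "\<sigma> v \<in> C'.V" "\<sigma> v \<noteq> C'.rt" "C'.par (\<sigma> v) = \<sigma> (par v)" using C'.cov_par by auto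
  show ?case unfolding pos_par[OF step(1,2)] C'.pos_par[OF c(1,2)] c(3) l step(3) L[OF step(1)] ..
 qed
 thus ?thesis using that s by blast
qed

end

lemma curve_rel_iff:
 assumes n: "n \<ge> 3" and bal: "(\<Sum>l\<in>{1..m}. \<Delta> l) = 0"
 shows "(C, C') \<in> curve_rel \<Delta> n m \<longleftrightarrow> param_curve \<Delta> n m C \<and> param_curve \<Delta> n m C' \<and>
  keyset (pq_marks n m) C = keyset (pq_marks n m) C' \<and> ev C 1 = ev C' 1"
proof
 have L: "finite (pq_marks n m)" "PMark 1 \<in> pq_marks n m" using pq_marks_L n by auto
 assume "(C, C') \<in> curve_rel \<Delta> n m"
 then obtain \<sigma> where c: "param_curve \<Delta> n m C" "param_curve \<Delta> n m C'" and s: "tree_iso (pq_marks n m) \<sigma> C C'" "\<forall>v\<in>verts C. pos C' (\<sigma> v) = pos C v"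
  unfolding curve_rel_def by blast
 have m: "metric_tree (pq_marks n m) C" "metric_tree (pq_marks n m) C'" using c unfolding param_curve_def by auto
 have "foot C (PMark 1) \<in> verts C" using m(1) L(2) unfolding metric_tree_def by blast
 hence "ev C 1 = ev C' 1" using s L(2) unfolding ev_def tree_iso_def by simp
 moreover have "keyset (pq_marks n m) C = keyset (pq_marks n m) C'" using keyset_iso[OF L m] s(1) by blast
 ultimately show "param_curve \<Delta> n m C \<and> param_curve \<Delta> n m C' \<and> keyset (pq_marks n m) C = keyset (pq_marks n m) C' \<and> ev C 1 = ev C' 1"
  using c by blast
next
 assume "param_curve \<Delta> n m C \<and> param_curve \<Delta> n m C' \<and> keyset (pq_marks n m) C = keyset (pq_marks n m) C' \<and> ev C 1 = ev C' 1"
 hence c: "param_curve \<Delta> n m C" "param_curve \<Delta> n m C'" and k: "keyset (pq_marks n m) C = keyset (pq_marks n m) C'" "ev C 1 = ev C' 1"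
  by simp_all
 interpret C: pcurve_tree \<Delta> n m C by (rule pcurve_tree.intro[OF c(1) n bal])
 obtain \<sigma> where s: "tree_iso (pq_marks n m) \<sigma> C C'" "\<And>v. v \<in> verts C ==> pos C' (\<sigma> v) = pos C v"
  by (rule C.edge_dir_same[OF pcurve_tree.intro[OF c(2) n bal] k]) blast
 hence "\<exists>\<sigma>. tree_iso (pq_marks n m) \<sigma> C C' \<and> (\<forall>v\<in>verts C. pos C' (\<sigma> v) = pos C v)"
  by (intro exI[of _ \<sigma>] conjI ballI)
 thus "(C, C') \<in> curve_rel \<Delta> n m" unfolding curve_rel_def mem_Collect_eq prod.case using c by simp
qed

section \<open>The curve of a solution\<close>

lemma (in keyed_tree) keyset_eq: "keyset L T = (\<lambda>v. (K v, d v - d (foot T (PMark 1)))) ` verts T"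
 unfolding keyset_def
proof (rule image_cong[OF refl])
 fix v assume v: "v \<in> verts T"
 have "depth T v = pot (len T) v - pot (len T) (foot T (PMark 1))"
  unfolding depth_def by (rule chain_len_pot[OF K_root(1) v le_root[OF v]])
 hence "depth T v = d v - d (foot T (PMark 1))" using d_pot[OF v] unfolding pot_root by simp
 moreover have "clus L T v = K v" unfolding clus_def K_by_paths[OF v] ..
 ultimately show "(clus L T v, depth T v) = (K v, d v - d (foot T (PMark 1)))" by simp
qed

text \<open>A vertex of the curve is recorded by the set of marked points behind it and its depth. The
 depths are relative to the first stable vertex, whereas the root of the curve is \<open>bot\<close>.\<close>

locale cell_points = hierarchy n F dpt for n F dpt +
 fixes m :: nat and \<sigma> :: "nat => nat set" and D :: "nat => real"
 assumes cell: "\<And>j. j < m ==> \<sigma> j \<in> cells n F"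
  and lower: "\<And>j. j < m ==> \<sigma> j \<noteq> {2..n} ==> dpt (above F (\<sigma> j)) < D j"
  and upper: "\<And>j. j < m ==> \<sigma> j \<in> F ==> D j < dpt (\<sigma> j)"
begin

text \<open>The vertices of the prospective curve: those of the tree and the attaching points of the
  ends, each given by its cell and its depth.\<close>

definition pts :: "(nat set \<times> real) set" where
 "pts = (\<lambda>R. (R, dpt R)) ` F \<union> (\<lambda>j. (\<sigma> j, D j)) ` {..<m}"

text \<open>\<open>p\<close> lies on the path from the first marked point to
  \<open>p'\<close>.\<close>

definition pre :: "nat set \<times> real => nat set \<times> real => bool" where
 "pre p p' \<longleftrightarrow> fst p' \<subset> fst p \<or> fst p' = fst p \<and> snd p \<le> snd p'"

definition key :: "nat set \<times> real => mark set" where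
 "key p = PMark ` fst p \<union> QMark ` {l \<in> {1..m}. pre p (\<sigma> (l - 1), D (l - 1))}"

text \<open>The least depth on the leg of the first marked point, possibly negative. It is
  subtracted in \<open>keys\<close> because \<open>depth\<close> starts at the root of the
  curve.\<close>

definition bot :: real where "bot = Min {\<delta>. ({2..n}, \<delta>) \<in> pts}"

definition keys :: "(mark set \<times> real) set" where "keys = (\<lambda>p. (key p, snd p - bot)) ` pts"

lemma finite_pts: "finite pts" unfolding pts_def using finite_F by simp

lemma pts_F: "R \<in> F ==> (R, dpt R) \<in> pts" unfolding pts_def by simp

lemma pts_D: "j < m ==> (\<sigma> j, D j) \<in> pts" unfolding pts_def by simp

lemma F_cell: "R \<in> F ==> R \<in> cells n F" unfolding cells_def by simp

lemma pts_cell: "p \<in> pts ==> fst p \<in> cells n F"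
 unfolding pts_def using cell F_cell by auto

lemma pts_max: "p \<in> pts ==> fst p \<in> F ==> snd p \<le> dpt (fst p)"
 unfolding pts_def using upper by force

lemma pts_min:
 assumes "p \<in> pts" "R \<in> F" "fst p \<subset> R"
 shows "dpt R < snd p"
proof -
 from assms(1) consider "fst p \<in> F" "snd p = dpt (fst p)" | j where "j < m" "p = (\<sigma> j, D j)" unfolding pts_def by auto
 thus ?thesis
 proof cases
  case 1
  thus ?thesis using dpt_less assms by simp
 next
  case 2
  have ne: "\<sigma> j \<noteq> {2..n}" using assms sub[of R] 2 by auto
  note ab = above_in[OF cell[OF 2(1)] ne]
  have "above F (\<sigma> j) \<subseteq> R" using ab(3) assms 2 by simp
  hence "dpt R \<le> dpt (above F (\<sigma> j))" using dpt_less[OF ab(1) assms(2)] by (cases "above F (\<sigma> j) = R") (simp_all add: psubset_eq)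
  thus ?thesis using lower[OF 2(1) ne] 2(2) by simp
 qed
qed

lemma big_cell: "Q \<in> cells n F ==> Q' \<in> cells n F ==> Q' \<subset> Q ==> Q \<in> F"
 using cell_sub(2)[of Q'] unfolding cells_def by auto

lemma pre_refl: "pre p p" unfolding pre_def by simp

lemma pre_trans: "pre p p' ==> pre p' p'' ==> pre p p''" unfolding pre_def by auto

text \<open>When the path passes from one cell to a smaller one, the depth of the vertex between
  them separates: points of a cell are at most as deep as its cluster, and points of smaller cells
  are deeper.\<close>

lemma pre_less:
 assumes "p \<in> pts" "p' \<in> pts" "pre p p'" "p \<noteq> p'"
 shows "snd p < snd p'"
proof (cases "fst p' = fst p")
 case False
 hence s: "fst p' \<subset> fst p" using assms(3) unfolding pre_def by blast
 hence "fst p \<in> F" using big_cell pts_cell assms by blast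
 thus ?thesis using pts_max[OF assms(1)] pts_min[OF assms(2)] s by fastforce
next
 case True
 hence "snd p \<noteq> snd p'" using assms(4) prod_eqI by metis
 thus ?thesis using assms(3) True unfolding pre_def by auto
qed

lemma key_P: "PMark i \<in> key p \<longleftrightarrow> i \<in> fst p" unfolding key_def by auto

lemma key_Q: "j < m ==> QMark (Suc j) \<in> key p \<longleftrightarrow> pre p (\<sigma> j, D j)" unfolding key_def by auto

lemma key_fst: "key p' \<subseteq> key p ==> fst p' \<subseteq> fst p" using key_P by blast

text \<open>Points with the same marked points behind them are told apart by depth. The second of
  them is either the vertex of the cluster, the deepest in its cell, or carries an end
  \<open>q\<close> that belongs to exactly the keys of points before it.\<close>

lemma key_mono:
 assumes "p \<in> pts" "p' \<in> pts"
 shows "key p' \<subseteq> key p \<longleftrightarrow> pre p p'"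
proof
 assume "pre p p'"
 moreover from this have "fst p' \<subseteq> fst p" unfolding pre_def by auto
 ultimately show "key p' \<subseteq> key p" unfolding key_def using pre_trans by blast
next
 assume k: "key p' \<subseteq> key p"
 have f: "fst p' \<subseteq> fst p" by (rule key_fst[OF k])
 show "pre p p'"
 proof (cases "fst p' = fst p")
  case True
  from assms(2) consider "fst p' \<in> F" "snd p' = dpt (fst p')" | j where "j < m" "p' = (\<sigma> j, D j)" unfolding pts_def by auto
  thus ?thesis
  proof cases
   case 1
   thus ?thesis using pts_max[OF assms(1)] True unfolding pre_def by simp
  next
   case 2
   hence "QMark (Suc j) \<in> key p'" using key_Q pre_refl by simp
   thus ?thesis using k key_Q[OF 2(1)] 2(2) by blast
  qed
 qed (use f in \<open>auto simp: pre_def\<close>)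
qed

lemma pre_antisym: "pre p p' ==> pre p' p ==> p = p'" unfolding pre_def by (auto intro: prod_eqI)

lemma key_inj: "p \<in> pts ==> p' \<in> pts ==> key p = key p' ==> p = p'"
 using key_mono[of p p'] key_mono[of p' p] pre_antisym by blast

lemma key_laminar:
 assumes "p \<in> pts" "p' \<in> pts"
 shows "key p \<subseteq> key p' \<or> key p' \<subseteq> key p \<or> key p \<inter> key p' = {}"
proof (cases "fst p \<inter> fst p' = {}")
 case True
 have "\<not> (pre p q \<and> pre p' q)" if "q \<in> pts" for q
  using cell_sub(2)[OF pts_cell[OF that]] True unfolding pre_def by blast
 hence "\<not> (pre p (\<sigma> (l - 1), D (l - 1)) \<and> pre p' (\<sigma> (l - 1), D (l - 1)))" if "l \<in> {1..m}" for l
  using pts_D[of "l - 1"] that by auto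
 thus ?thesis using True unfolding key_def by blast
next
 case False
 hence "fst p \<subseteq> fst p' \<or> fst p' \<subseteq> fst p" using cell_laminar pts_cell assms by blast
 hence "pre p p' \<or> pre p' p" unfolding pre_def by auto
 thus ?thesis using key_mono assms by blast
qed

lemma bot: "({2..n}, bot) \<in> pts" "\<And>p. p \<in> pts ==> pre ({2..n}, bot) p"
proof -
 let ?S = "{\<delta>. ({2..n}, \<delta>) \<in> pts}"
 have fin: "finite ?S" by (rule finite_subset[OF _ finite_imageI[OF finite_pts, of snd]]) force
 have "?S \<noteq> {}" using pts_F[OF top_in] by blast
 thus "({2..n}, bot) \<in> pts" using Min_in[OF fin] unfolding bot_def by blast
 show "pre ({2..n}, bot) p" if p: "p \<in> pts" for p
 proof (cases "fst p = {2..n}")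
  case True
  hence "snd p \<in> ?S" using p by (metis mem_Collect_eq prod.collapse)
  thus ?thesis using True Min_le[OF fin] unfolding pre_def bot_def by simp
 next
  case False
  thus ?thesis using cell_sub(1)[OF pts_cell[OF p]] unfolding pre_def by auto
 qed
qed

lemma key_bot: "key ({2..n}, bot) = pq_marks n m - {PMark 1}"
proof -
 have I: "{1..n} = insert 1 {2..n}" using n by auto
 have "pre ({2..n}, bot) (\<sigma> (l - 1), D (l - 1))" if "l \<in> {1..m}" for l
  using bot(2)[OF pts_D[of "l - 1"]] that by auto
 hence "{l \<in> {1..m}. pre ({2..n}, bot) (\<sigma> (l - 1), D (l - 1))} = {1..m}" by blast
 hence k: "key ({2..n}, bot) = PMark ` {2..n} \<union> QMark ` {1..m}" unfolding key_def by simp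
 show ?thesis unfolding k pq_marks_def I by auto
qed

lemma key_sub: "p \<in> pts ==> key p \<subseteq> pq_marks n m - {PMark 1}"
 using key_mono[OF bot(1)] bot(2) key_bot by metis

lemma key_card:
 assumes p: "p \<in> pts"
 shows "2 \<le> card (key p)"
proof -
 have fin: "finite (key p)" using finite_subset[OF key_sub[OF p]] pq_marks_L(1) by blast
 from p consider "fst p \<in> F" | j where "j < m" "p = (\<sigma> j, D j)" unfolding pts_def by auto
 thus ?thesis
 proof cases
  case 1
  have "card (PMark ` fst p) = card (fst p)" by (rule card_image) (auto simp: inj_on_def)
  moreover have "card (PMark ` fst p) \<le> card (key p)" by (rule card_mono[OF fin]) (auto simp: key_def)
  ultimately show ?thesis using sub[OF 1] by simp
 next
  case 2
  obtain i where "i \<in> \<sigma> j" using cell_sub(2)[OF cell[OF 2(1)]] by blast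
  hence "{PMark i, QMark (Suc j)} \<subseteq> key p" using key_P key_Q[OF 2(1)] pre_refl 2(2) by simp
  hence "card {PMark i, QMark (Suc j)} \<le> card (key p)" by (rule card_mono[OF fin])
  thus ?thesis by simp
 qed
qed

text \<open>The predicted keys form a laminar family with depths increasing away from the root, and
  each has two elements; so \<open>ex_keyed_tree\<close> realizes them by a stable tree.\<close>

lemma model_tree:
 obtains T :: mtree where "metric_tree (pq_marks n m) T" "keyset (pq_marks n m) T = keys"
proof -
 have L: "PMark 1 \<in> pq_marks n m" "finite (pq_marks n m)" using pq_marks_L n by auto
 define dd where "dd A = snd (THE p. p \<in> pts \<and> key p = A) - bot" for A
 have dd: "dd (key p) = snd p - bot" if "p \<in> pts" for p
 proof -
  have "(THE q. q \<in> pts \<and> key q = key p) = p" by (rule the_equality) (use that key_inj in auto)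
  thus ?thesis unfolding dd_def by simp
 qed
 obtain T :: mtree and K where T: "keyed_tree (pq_marks n m) T K (\<lambda>v. dd (K v))" "K ` verts T = key ` pts"
  "\<And>e. e \<in> edges T ==> 0 < len T e"
 proof (rule ex_keyed_tree[OF L(1), of "key ` pts" dd])
  show "finite (key ` pts)" using finite_pts by simp
  show "A \<noteq> {} \<and> A \<subseteq> pq_marks n m - {PMark 1}" if A: "A \<in> key ` pts" for A
  proof -
   obtain p where p: "p \<in> pts" "A = key p" using A by blast
   hence "card A \<noteq> 0" using key_card[OF p(1)] by simp
   thus ?thesis using key_sub[OF p(1)] p(2) by auto
  qed
  show "pq_marks n m - {PMark 1} \<in> key ` pts" using bot(1) key_bot by blast
  show "A \<subseteq> B \<or> B \<subseteq> A \<or> A \<inter> B = {}" if "A \<in> key ` pts" "B \<in> key ` pts" for A B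
   using that key_laminar by blast
  show "dd B < dd A" if AB: "A \<in> key ` pts" "B \<in> key ` pts" "A \<subset> B" for A B
  proof -
   obtain p q where pq: "p \<in> pts" "A = key p" "q \<in> pts" "B = key q" using AB by blast
   hence "pre q p" "q \<noteq> p" using key_mono[OF pq(3,1)] AB(3) by auto
   thus ?thesis using pre_less pq dd by simp
  qed
 qed blast
 interpret keyed_tree "pq_marks n m" T K "\<lambda>v. dd (K v)" by (rule T(1))
 have met: "metric_tree (pq_marks n m) T"
 proof (rule keyed_tree_metric[OF T(1) L(2) T(3)])
  fix v assume "v \<in> verts T"
  then obtain p where "p \<in> pts" "K v = key p" using T(2) by blast
  thus "2 \<le> card (K v)" using key_card by simp
 qed
 have "dd (K (foot T (PMark 1))) = 0" unfolding K_root(2) key_bot[symmetric] dd[OF bot(1)] by simp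
 hence "keyset (pq_marks n m) T = (\<lambda>A. (A, dd A)) ` K ` verts T"
  unfolding keyset_eq image_image by simp
 also have "\<dots> = keys" unfolding T(2) keys_def image_image by (rule image_cong) (simp_all add: dd)
 finally show ?thesis using that met by blast
qed

end

text \<open>The positions are obtained by integrating the forced edge directions along the paths
  from the root, starting at \<open>x\<close>. The root itself is balanced because all end
  directions sum to zero.\<close>

lemma ex_param_curve:
 fixes T :: mtree
 assumes T: "metric_tree (pq_marks n m) T" and n: "n \<ge> 3" and bal: "(\<Sum>l\<in>{1..m}. \<Delta> l) = 0"
 obtains C where "param_curve \<Delta> n m C" "keyset (pq_marks n m) C = keyset (pq_marks n m) T" "ev C 1 = x"
proof -
 have L: "finite (pq_marks n m)" "PMark 1 \<in> pq_marks n m" using pq_marks_L n by auto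
 interpret keyed_tree "pq_marks n m" T "clus (pq_marks n m) T" "depth T"
  by (rule metric_tree_keyed(1)[OF T L(2,1)])
 interpret pq_tree n m T "clus (pq_marks n m) T" "depth T" by unfold_locales (rule n)
 define ed where "ed l = end_dir \<Delta> (QMark l)" for l
 define ps where "ps v = x + (\<Sum>z | z \<in> V \<and> le z v \<and> z \<noteq> rt. len T {par z, z} *\<^sub>R lsum ed z)" for v
 define C where "C = mtree.extend T \<lparr>pos = ps\<rparr>"
 have C: "verts C = V" "edges C = edges T" "len C = len T" "foot C = foot T" "pos C = ps"
  unfolding C_def mtree.extend_def by simp_all
 have isp: "is_path C = is_path T" by (intro ext) (simp add: is_path_def C)
 hence tp: "tree_path C = tree_path T" by (intro ext) (simp add: tree_path_def)
 have pe: "path_edges C = path_edges T" by (intro ext) (simp add: path_edges_def path_steps_def tp)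
 have pr: "ps rt = x" unfolding ps_def sum_below_root by simp
 have ks: "keyset (pq_marks n m) C = keyset (pq_marks n m) T"
  unfolding keyset_def clus_def depth_def chain_len_def C tp pe ..
 have lpos: "0 < len T e" if "e \<in> edges T" for e using T that unfolding metric_tree_def by blast
 have dir: "edge_dir C u v = lsum ed v" "edge_dir C v u = - lsum ed v" if uv: "cov u v" for u v
 proof -
  have v: "v \<in> V" "v \<noteq> rt" "par v = u" using uv cov_par by auto
  have "len T {u, v} > 0" using uv edge_iff lpos by blast
  moreover have "ps v = ps u + len T {u, v} *\<^sub>R lsum ed v"
   unfolding ps_def sum_below_par[OF v(1,2)] v(3) by (simp add: add.assoc)
  ultimately show "edge_dir C u v = lsum ed v" "edge_dir C v u = - lsum ed v"
   unfolding edge_dir_def C by (simp_all add: insert_commute)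
 qed
 have int: "lsum ed v \<in> \<int> \<times> \<int>" for v
  unfolding lsum_def ed_def by (auto simp: mem_Times_iff fst_sum snd_sum intro!: Ints_sum)
 have "param_curve \<Delta> n m C"
  unfolding param_curve_def
 proof (intro conjI allI impI ballI)
  show "metric_tree (pq_marks n m) C" using T unfolding metric_tree_def valence_def C isp .
  show "edge_dir C u w \<in> \<int> \<times> \<int>" if "{u, w} \<in> edges C" for u w
  proof -
   consider "cov u w" | "cov w u" using \<open>{u, w} \<in> edges C\<close> edge_iff unfolding C by blast
   thus ?thesis using dir int by cases (auto simp: mem_Times_iff)
  qed
  fix v assume "v \<in> verts C"
  hence v: "v \<in> V" unfolding C .
  have "(\<Sum>w | cov v w. edge_dir C v w) + (\<Sum>l | l \<in> {1..m} \<and> foot T (QMark l) = v. ed l) = lsum ed v"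
   unfolding lsum_split[OF v] by (simp add: dir add.commute)
  moreover have "(if v = rt then 0 else edge_dir C v (par v)) = - lsum ed v"
  proof (cases "v = rt")
   case True
   thus ?thesis using lsum_root[of ed] sum_end_dir[OF bal] unfolding ed_def by simp
  next
   case False
   thus ?thesis using dir(2)[OF par_cov[OF v]] by simp
  qed
  ultimately show "(\<Sum>w | {v, w} \<in> edges C. edge_dir C v w) + (\<Sum>l | l \<in> pq_marks n m \<and> foot C l = v. end_dir \<Delta> l) = 0"
   unfolding C nbr_sum[OF v] end_sum ed_def[symmetric] by (simp add: algebra_simps)
 qed
 moreover have "ev C 1 = x" unfolding ev_def C pr ..
 ultimately show ?thesis using that ks by blast
qed

section \<open>Curves in a fibre\<close>

lemma keyed_fun_eq: "(\<lambda>R. (PMark ` R, f R)) ` A = (\<lambda>R. (PMark ` R, g R)) ` B \<longleftrightarrow> A = B \<and> (\<forall>R\<in>A. f R = g R)"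
proof
 assume eq: "(\<lambda>R. (PMark ` R, f R)) ` A = (\<lambda>R. (PMark ` R, g R)) ` B"
 have inj: "PMark ` R = PMark ` R' \<longleftrightarrow> R = R'" for R R' by (auto simp: inj_image_eq_iff inj_def)
 have 1: "R \<in> B \<and> f R = g R" if "R \<in> A" for R
 proof -
  have "(PMark ` R, f R) \<in> (\<lambda>R. (PMark ` R, g R)) ` B" unfolding eq[symmetric] using that by blast
  thus ?thesis using inj by auto
 qed
 have "R \<in> A" if "R \<in> B" for R
 proof -
  have "(PMark ` R, g R) \<in> (\<lambda>R. (PMark ` R, f R)) ` A" unfolding eq using that by blast
  thus ?thesis using inj by auto
 qed
 thus "A = B \<and> (\<forall>R\<in>A. f R = g R)" using 1 by blast
next
 assume "A = B \<and> (\<forall>R\<in>A. f R = g R)"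
 thus "(\<lambda>R. (PMark ` R, f R)) ` A = (\<lambda>R. (PMark ` R, g R)) ` B" by (intro image_cong) auto
qed

lemma (in hierarchy) cell_base_cong:
 assumes "Q \<in> cells n F" "r < 2 * (n - 1)" "\<And>R. R \<in> F ==> dpt R = dpt' R"
 shows "cell_base F dpt dl j Q r = cell_base F dpt' dl j Q r"
proof -
 have "insert (r div 2 + 2) Q \<subseteq> {2..n}" using cell_sub(1)[OF assms(1)] assms(2) by auto
 hence "join F (insert (r div 2 + 2) Q) \<in> F" by (intro join_in) auto
 thus ?thesis unfolding cell_base_def using assms(3) by simp
qed

lemma diff_vec_crd: "diff_vec x r = crd r (x (r div 2 + 2) - x 1)"
 unfolding diff_vec_def crd_def by simp

context pcurve_tree
begin

lemma pot_le: "u \<in> V ==> v \<in> V ==> u \<preceq> v ==> pot (len C) u \<le> pot (len C) v"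
 using pot_mono[of u v "len C"] len_pos by (cases "u = v") auto

lemma pot_strict: "u \<in> V ==> v \<in> V ==> u \<preceq> v ==> u \<noteq> v ==> pot (len C) u < pot (len C) v"
 using pot_mono[of u v "len C"] len_pos by auto

lemma stab_metric: "metric_tree (p_marks n) (stabilize (p_marks n) C)"
proof (rule keyed_tree_metric[OF stabilize_keyed p_marks_L(1)])
 let ?T = "stabilize (p_marks n) C"
 have vs: "verts ?T = {v. stab v}" unfolding stabilize_def Let_def stable_verts_eq by simp
 show "2 \<le> card (PMark ` cln v)" if "v \<in> verts ?T" for v
  using that card_image[of PMark "cln v"] unfolding vs stab_def by (simp add: inj_on_def)
 fix e assume "e \<in> edges ?T"
 then obtain u w where e: "e = {u, w}" "stab u" "stab w" "cln w \<subset> cln u" unfolding edges_stabilize by blast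
 have uw: "u \<preceq> w" "u \<noteq> w" using stab_le e by auto
 have "len ?T e = chain_len C (len C) {u, w}" unfolding e(1) stabilize_def Let_def by simp
 thus "0 < len ?T e" using chain_len_pot pot_strict uw stabD(1) e by simp
qed

lemma stab_root: "foot (stabilize (p_marks n) C) (PMark 1) = rho"
proof -
 interpret S: keyed_tree "p_marks n" "stabilize (p_marks n) C" "\<lambda>v. PMark ` cln v" "\<lambda>v. pot (len C) v - pot (len C) rho"
  by (rule stabilize_keyed)
 let ?r = "foot (stabilize (p_marks n) C) (PMark 1)"
 have I: "{1..n} = insert 1 {2..n}" using n by auto
 have "p_marks n - {PMark 1} = PMark ` {2..n}" unfolding p_marks_def I by auto
 hence c: "cln ?r = {2..n}" using S.K_root(2) by simp
 have "stab ?r" using S.K_root(1) unfolding stabilize_def Let_def stable_verts_eq by simp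
 thus ?thesis using stab_inj[OF _ rho(1)] c rho(2) by simp
qed

lemma stab_keyset: "keyset (p_marks n) (stabilize (p_marks n) C) = (\<lambda>R. (PMark ` R, sdepth (len C) R)) ` ClF"
proof -
 have vs: "verts (stabilize (p_marks n) C) = {v. stab v}" unfolding stabilize_def Let_def stable_verts_eq by simp
 show ?thesis
  unfolding keyed_tree.keyset_eq[OF stabilize_keyed] stab_root vs ClF_def image_image
  by (rule image_cong) (simp_all add: sv_cln sdepth_def)
qed

text \<open>Equality of classes in the target is equality of keysets, that is, the same clusters at
  the same depths.\<close>

lemma trop_tau_iff:
 assumes T: "metric_tree (p_marks n) T" "keyset (p_marks n) T = (\<lambda>R. (PMark ` R, dpt R)) ` F"
 shows "trop_tau n C = (tree_rel n `` {T}, restrict x {1..n}) \<longleftrightarrow>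
  ClF = F \<and> (\<forall>R\<in>F. sdepth (len C) R = dpt R) \<and> (\<forall>i\<in>{1..n}. ev C i = x i)"
proof -
 let ?S = "stabilize (p_marks n) C"
 have n1: "1 \<le> n" using n by simp
 have rel: "tree_rel n `` {A} = tree_rel n `` {B} \<longleftrightarrow> keyset (p_marks n) A = keyset (p_marks n) B"
  if "metric_tree (p_marks n) A" "metric_tree (p_marks n) B" for A B
 proof
  assume "tree_rel n `` {A} = tree_rel n `` {B}"
  moreover have "(A, A) \<in> tree_rel n" using tree_rel_iff[OF n1] that by simp
  ultimately have "(B, A) \<in> tree_rel n" by auto
  thus "keyset (p_marks n) A = keyset (p_marks n) B" using tree_rel_iff[OF n1] by simp
 next
  assume "keyset (p_marks n) A = keyset (p_marks n) B"
  thus "tree_rel n `` {A} = tree_rel n `` {B}" using tree_rel_iff[OF n1] that by auto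
 qed
 have "(\<lambda>i\<in>{1..n}. ev C i) = restrict x {1..n} \<longleftrightarrow> (\<forall>i\<in>{1..n}. ev C i = x i)"
  by (auto simp: restrict_def fun_eq_iff)
 thus ?thesis
  unfolding trop_tau_def prod.inject rel[OF stab_metric T(1)] stab_keyset T(2) keyed_fun_eq by auto
qed

lemma flow_ev:
 assumes "r < 2 * (n - 1)"
 shows "(\<Sum>j<m. cell_base ClF (sdepth (len C)) (\<lambda>j r. crd r (ed (Suc j))) j (sg j) r
  + Dt (len C) j * cell_col (\<lambda>j r. crd r (ed (Suc j))) j (sg j) r) = diff_vec (ev C) r"
proof -
 have "r div 2 + 2 \<in> {1..n}" using assms by auto
 hence "ev C (r div 2 + 2) - ev C 1 = (\<Sum>z | z \<in> V \<and> z \<preceq> foot C (PMark (r div 2 + 2)) \<and> z \<noteq> rt. len C {par z, z} *\<^sub>R lsum ed z)"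
  unfolding ev_def by (simp only: pos_sum[OF foot_p, of "r div 2 + 2"] add_diff_cancel_left')
 thus ?thesis unfolding diff_vec_crd using flow_eq[OF sum_ed assms, of "len C"] by simp
qed

lemma curve_equations:
 assumes h: "hierarchy n F dpt" and m: "m = 2 * (n - 1)" and F: "ClF = F" "\<And>R. R \<in> F ==> sdepth (len C) R = dpt R"
  and x: "\<And>i. i \<in> {1..n} ==> ev C i = x i" and r: "r < m"
 shows "(\<Sum>j<m. cell_base F dpt (\<lambda>j r. crd r (ed (Suc j))) j (sg j) r
  + Dt (len C) j * cell_col (\<lambda>j r. crd r (ed (Suc j))) j (sg j) r) = diff_vec x r"
proof -
 interpret hierarchy n F dpt by (rule h)
 have "sg j \<in> cells n F" if "j < m" for j
  using cln_cell attach(1,2)[of "Suc j"] that unfolding sg_def F by simp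
 hence "cell_base F (sdepth (len C)) dl j (sg j) r = cell_base F dpt dl j (sg j) r" if "j < m" for j dl
  using that cell_base_cong[of "sg j" r "sdepth (len C)"] F(2) r m by metis
 moreover have "diff_vec (ev C) r = diff_vec x r"
 proof -
  have "r div 2 + 2 \<in> {1..n}" "1 \<in> {1..n}" using r m n by auto
  thus ?thesis unfolding diff_vec_crd using x by simp
 qed
 ultimately show ?thesis using flow_ev[of r] r m unfolding F(1) by (simp cong: sum.cong_simp)
qed

lemma attach_cln: "l \<in> {1..m} ==> cln (foot C (QMark l)) \<noteq> {} ==> attach l = foot C (QMark l)"
 using attach(4)[of l "foot C (QMark l)"] attach(1,3) foot_q V_eq by blast

lemma key_mark:
 assumes v: "v \<in> V" and k: "k \<in> clus (pq_marks n m) C v"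
 shows "(\<exists>i\<in>cln v. k = PMark i) \<or> (\<exists>l\<in>{1..m}. k = QMark l)"
proof -
 have "k \<in> pq_marks n m" and k1: "k \<noteq> PMark 1" using K_sub[OF v] k by auto
 then consider i where "i \<in> {1..n}" "k = PMark i" | l where "l \<in> {1..m}" "k = QMark l" unfolding pq_marks_def by blast
 thus ?thesis
 proof cases
  case 1
  hence "i \<noteq> 1" using k1 by metis
  hence "i \<in> cln v" using 1 k unfolding cln_def by simp
  thus ?thesis using 1(2) by blast
 qed blast
qed

text \<open>Behind a vertex without marked points there would be at least two ends \<open>q\<close>.
  Their paths leave the spanned subtree at the same vertex, so two parameters would agree.\<close>

lemma cln_ne:
 assumes inj: "inj_on (Dt (len C)) {..<m}" and v: "v \<in> V"
 shows "cln v \<noteq> {}"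
proof
 assume e: "cln v = {}"
 let ?K = "clus (pq_marks n m) C v"
 have "?K \<subseteq> QMark ` {1..m}" using key_mark[OF v] e by blast
 moreover obtain a b where ab: "a \<in> ?K" "b \<in> ?K" "a \<noteq> b"
  using two_keys[OF v] card_le_Suc_iff[of 1 ?K] by (auto simp: numeral_2_eq_2 card_le_Suc_iff)
 ultimately obtain l l' where l: "a = QMark l" "l \<in> {1..m}" "b = QMark l'" "l' \<in> {1..m}" by blast
 have vf: "v \<preceq> foot C (QMark l)" "v \<preceq> foot C (QMark l')" using q_iff[OF v] l ab by auto
 have under: "p \<preceq> v" if "p \<in> V" "cln p \<noteq> {}" "p \<preceq> foot C (QMark k)" "v \<preceq> foot C (QMark k)" "k \<in> {1..m}" for p k
  using le_chain[OF that(1) v foot_q[OF that(5)]] that cln_mono[of p v] e by auto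
 have "p \<preceq> q" if "k \<in> {1..m}" "k' \<in> {1..m}" "v \<preceq> foot C (QMark k)" "v \<preceq> foot C (QMark k')" "p = attach k" "q = attach k'" for k k' p q
 proof -
  have "p \<preceq> v" using under attach(1-3)[OF that(1)] that by simp
  hence "p \<preceq> foot C (QMark k')" using that(4) by (rule subset_trans[rotated])
  thus ?thesis using attach(4)[OF that(2)] attach(1,2)[OF that(1)] that by simp
 qed
 hence "attach l = attach l'" using V_eq attach(1) l vf by metis
 hence "Dt (len C) (l - 1) = Dt (len C) (l' - 1)" using l unfolding Dt_def by simp
 hence "l - 1 = l' - 1" using inj l by (auto dest!: inj_onD)
 thus False using l ab by auto
qed

text \<open>If the marked points behind \<open>v\<close> all continue to one child \<open>c\<close>,
  the key of \<open>v\<close> still exceeds that of \<open>c\<close>, necessarily by an end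
  \<open>q\<close>. This end must be attached at \<open>v\<close>: another child on the way to it
  would have marked points behind it, hence be comparable with \<open>c\<close>. If only one marked
  point lies behind \<open>v\<close>, no vertex does, and the second element of the key is an end
  \<open>q\<close> at \<open>v\<close>.\<close>

lemma stab_or_attach:
 assumes ne: "\<And>v. v \<in> V ==> cln v \<noteq> {}" and v: "v \<in> V" "\<not> stab v"
 obtains l where "l \<in> {1..m}" "foot C (QMark l) = v"
proof -
 let ?K = "clus (pq_marks n m) C"
 have "\<exists>l\<in>{1..m}. foot C (QMark l) = v"
 proof (cases "\<exists>w\<in>V. v \<preceq> w \<and> w \<noteq> v \<and> cln w = cln v")
  case True
  then obtain w where w: "w \<in> V" "v \<preceq> w" "w \<noteq> v" "cln w = cln v" by blast
  obtain c where c: "cov v c" "c \<preceq> w" by (rule child_toward[OF v(1) w(1,2)]) (use w in auto)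
  have cV: "c \<in> V" "v \<preceq> c" "v \<noteq> c" using c(1) unfolding cov_def by auto
  have cc: "cln c = cln v" using cln_mono[OF c(2)] cln_mono[OF cV(2)] w(4) by blast
  have "?K c \<noteq> ?K v" using V_eq[OF v(1) cV(1)] cV by blast
  then obtain k where k: "k \<in> ?K v" "k \<notin> ?K c" using cV(2) by blast
  have "k \<noteq> PMark i" if "i \<in> cln v" for i using cc k that unfolding cln_def by blast
  then obtain l where l: "l \<in> {1..m}" "k = QMark l" using key_mark[OF v(1) k(1)] by blast
  have vl: "v \<preceq> foot C (QMark l)" "\<not> c \<preceq> foot C (QMark l)" using q_iff[OF v(1) l(1)] q_iff[OF cV(1) l(1)] k l by auto
  have "foot C (QMark l) = v"
  proof (rule ccontr)
   assume "foot C (QMark l) \<noteq> v"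
   then obtain c' where c': "cov v c'" "c' \<preceq> foot C (QMark l)" using child_toward[OF v(1) foot_q[OF l(1)] vl(1)] by metis
   have c'V: "c' \<in> V" "v \<preceq> c'" "v \<noteq> c'" using c'(1) unfolding cov_def by auto
   obtain i where i: "i \<in> cln c'" using ne[OF c'V(1)] by blast
   hence "i \<in> cln c" using cln_mono[OF c'V(2)] cc by blast
   hence "c \<preceq> c' \<or> c' \<preceq> c" using cln_comparable i cV c'V by blast
   hence "c = c'" using c(1) c'(1) cV(1) c'V(1) cV(2,3) c'V(2,3) unfolding cov_def by metis
   thus False using vl c' by blast
  qed
  thus ?thesis using l by blast
 next
  case False
  hence "\<not> 2 \<le> card (cln v)" using v unfolding stab_def by blast
  moreover have "card (cln v) \<noteq> 0" using ne[OF v(1)] by simp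
  ultimately have "card (cln v) = 1" by linarith
  then obtain i where i: "cln v = {i}" by (rule card_1_singletonE)
  have leaf: "w = v" if "w \<in> V" "v \<preceq> w" for w
   using False that ne[OF that(1)] cln_mono[OF that(2)] i by (metis subset_singletonD)
  have "\<not> ?K v \<subseteq> {PMark i}"
  proof
   assume "?K v \<subseteq> {PMark i}"
   hence "card (?K v) \<le> card {PMark i}" by (rule card_mono[rotated]) simp
   thus False using two_keys[OF v(1)] by simp
  qed
  then obtain k where k: "k \<in> ?K v" "k \<noteq> PMark i" by blast
  then obtain l where l: "l \<in> {1..m}" "k = QMark l" using key_mark[OF v(1) k(1)] i by auto
  have "v \<preceq> foot C (QMark l)" using q_iff[OF v(1) l(1)] k l by auto
  thus ?thesis using leaf[OF foot_q[OF l(1)]] l by blast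
 qed
 thus ?thesis using that by blast
qed

text \<open>For generic parameters the curve has no vertices besides the stable ones and the
  attaching points of the ends, so cells and depths determine its keyset. The bounds are strict
  because no parameter equals the depth of an end of its cell.\<close>

lemma curve_keys:
 assumes h: "hierarchy n F dpt" and F: "ClF = F" "\<And>R. R \<in> F ==> sdepth (len C) R = dpt R"
  and inj: "inj_on (Dt (len C)) {..<m}"
  and gen: "\<And>j. j < m ==> Dt (len C) j \<noteq> dpt (sg j) \<and> Dt (len C) j \<noteq> dpt (above F (sg j))"
 shows "cell_points n F dpt m sg (Dt (len C))"
  and "keyset (pq_marks n m) C = cell_points.keys n F dpt m sg (Dt (len C))"
  and "\<And>l. l \<in> {1..m} ==> foot C (QMark l) = attach l"
  and "\<And>l. l \<in> {1..m} ==> \<not> stab (attach l)"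
  and "V = {v. stab v} \<union> attach ` {1..m}"
proof -
 interpret h: hierarchy n F dpt by (rule h)
 let ?D = "Dt (len C) :: nat => real"
 have sg: "sg j = cln (attach (Suc j))" if "j < m" for j using that by (simp add: sg_def)
 have aV: "attach (Suc j) \<in> V" "sg j \<noteq> {}" "sg j \<in> cells n F" if "j < m" for j
  using attach(1,2)[of "Suc j"] cln_cell[of "attach (Suc j)"] that unfolding sg[OF that] F by auto
 have sdp: "pot (len C) (sv R) - pot (len C) rho = dpt R" if "R \<in> F" for R using F(2)[OF that] unfolding sdepth_def .
 have svF: "stab (sv R)" "cln (sv R) = R" if "R \<in> F" for R using sv that unfolding F by auto
 show cp: "cell_points n F dpt m sg ?D"
 proof
  show "sg j \<in> cells n F" if "j < m" for j using aV that by blast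
  show "dpt (above F (sg j)) < ?D j" if j: "j < m" "sg j \<noteq> {2..n}" for j
  proof -
   note ab = h.above_in[OF aV(3)[OF j(1)] j(2)]
   let ?a = "sv (above F (sg j))"
   have "\<not> attach (Suc j) \<preceq> ?a" using cln_mono[of ?a "attach (Suc j)"] svF[OF ab(1)] ab(2) sg[OF j(1)] by auto
   moreover obtain i where "i \<in> sg j" using aV[OF j(1)] by blast
   ultimately have "?a \<preceq> attach (Suc j)"
    using cln_comparable[OF stabD(1)[OF svF(1)[OF ab(1)]] aV(1)[OF j(1)]] svF[OF ab(1)] ab(2) sg[OF j(1)] by blast
   hence "pot (len C) ?a \<le> pot (len C) (attach (Suc j))" by (rule pot_le[OF stabD(1)[OF svF(1)[OF ab(1)]] aV(1)[OF j(1)]])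
   thus ?thesis using sdp[OF ab(1)] gen[OF j(1)] unfolding Dt_def by simp
  qed
  show "?D j < dpt (sg j)" if j: "j < m" "sg j \<in> F" for j
  proof -
   have "2 \<le> card (cln (attach (Suc j)))" using h.sub[OF j(2)] sg[OF j(1)] by simp
   then obtain s where s: "stab s" "cln s = sg j" "attach (Suc j) \<preceq> s" using ex_stab_of_cln[OF aV(1)[OF j(1)]] sg[OF j(1)] by metis
   hence "s = sv (sg j)" using sv_cln by metis
   moreover have "pot (len C) (attach (Suc j)) \<le> pot (len C) s" by (rule pot_le[OF aV(1)[OF j(1)] stabD(1)[OF s(1)] s(3)])
   ultimately show ?thesis using sdp[OF j(2)] gen[OF j(1)] unfolding Dt_def by simp
  qed
 qed
 interpret cell_points n F dpt m sg ?D by (rule cp)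
 have ne: "cln v \<noteq> {}" if "v \<in> V" for v by (rule cln_ne[OF inj that])
 show fa: "foot C (QMark l) = attach l" if "l \<in> {1..m}" for l using attach_cln[OF that] ne foot_q[OF that] by simp
 show ns: "\<not> stab (attach l)" if l: "l \<in> {1..m}" for l
 proof
  assume s: "stab (attach l)"
  define j where "j = l - 1"
  have j: "j < m" "Suc j = l" unfolding j_def using l by auto
  have "sg j \<in> F" using s sg[OF j(1)] unfolding F(1)[symmetric] ClF_def j by blast
  moreover have "sv (sg j) = attach l" using sv_cln[OF s] sg[OF j(1)] j by simp
  ultimately have "?D j = dpt (sg j)" using sdp[of "sg j"] unfolding Dt_def j by simp
  thus False using gen j by blast
 qed
 show Veq: "V = {v. stab v} \<union> attach ` {1..m}"
 proof (intro equalityI subsetI)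
  fix v assume v: "v \<in> V"
  show "v \<in> {v. stab v} \<union> attach ` {1..m}"
  proof (cases "stab v")
   case False
   obtain l where "l \<in> {1..m}" "foot C (QMark l) = v" by (rule stab_or_attach[OF ne v False])
   thus ?thesis using fa by auto
  qed simp
 qed (use attach(1) stabD(1) in auto)
 \<comment> \<open>The vertex as a cell with a depth relative to \<open>rho\<close>; this identifies
   the tree order with \<open>pre\<close> and the vertex set with \<open>pts\<close>.\<close>
 define pt where "pt v = (cln v, pot (len C) v - pot (len C) rho)" for v
 have pre_iff: "pre (pt u) (pt v) \<longleftrightarrow> u \<preceq> v" if uv: "u \<in> V" "v \<in> V" for u v
 proof
  assume "u \<preceq> v"
  thus "pre (pt u) (pt v)" using cln_mono[of v u] pot_le[OF uv] unfolding pre_def pt_def by auto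
 next
  assume p: "pre (pt u) (pt v)"
  hence "cln v \<subseteq> cln u" unfolding pre_def pt_def by auto
  hence "u \<preceq> v \<or> v \<preceq> u" using cln_comparable[OF uv] ne[OF uv(2)] by blast
  moreover have "u = v" if vu: "v \<preceq> u"
  proof (rule ccontr)
   assume "u \<noteq> v"
   hence "pot (len C) v < pot (len C) u" using pot_strict[OF uv(2,1) vu] by simp
   thus False using p cln_mono[OF vu] unfolding pre_def pt_def by auto
  qed
  ultimately show "u \<preceq> v" by blast
 qed
 have ptD: "pt (attach (Suc j)) = (sg j, ?D j)" if "j < m" for j unfolding pt_def Dt_def sg[OF that] ..
 have pts: "pts = pt ` V"
 proof -
  have "pt ` {v. stab v} = (\<lambda>R. (R, dpt R)) ` F"
   unfolding F(1)[symmetric] ClF_def image_image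
  proof (rule image_cong[OF refl])
   fix v assume v: "v \<in> {v. stab v}"
   hence "cln v \<in> F" unfolding F(1)[symmetric] ClF_def by blast
   thus "pt v = (cln v, dpt (cln v))" using sdp sv_cln v unfolding pt_def by fastforce
  qed
  moreover have "{1..m} = Suc ` {..<m}" unfolding image_Suc_lessThan ..
  hence "pt ` attach ` {1..m} = (\<lambda>j. (sg j, ?D j)) ` {..<m}" using ptD by (simp add: image_image)
  ultimately show ?thesis unfolding pts_def Veq image_Un by simp
 qed
 have keyv: "key (pt v) = clus (pq_marks n m) C v" if v: "v \<in> V" for v
 proof -
  have q: "pre (pt v) (sg (l - 1), ?D (l - 1)) \<longleftrightarrow> QMark l \<in> clus (pq_marks n m) C v" if l: "l \<in> {1..m}" for l
  proof -
   have "Suc (l - 1) = l" "l - 1 < m" using l by auto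
   hence "(sg (l - 1), ?D (l - 1)) = pt (foot C (QMark l))" using ptD[of "l - 1"] fa[OF l] by simp
   thus ?thesis using pre_iff[OF v foot_q[OF l]] q_iff[OF v l] by simp
  qed
  have "PMark i \<in> clus (pq_marks n m) C v" if "i \<in> cln v" for i using that unfolding cln_def by simp
  hence "clus (pq_marks n m) C v = PMark ` cln v \<union> QMark ` {l \<in> {1..m}. QMark l \<in> clus (pq_marks n m) C v}"
   using key_mark[OF v] by blast
  moreover have "{l \<in> {1..m}. QMark l \<in> clus (pq_marks n m) C v} = {l \<in> {1..m}. pre (pt v) (sg (l - 1), ?D (l - 1))}"
   using q by blast
  ultimately show ?thesis unfolding key_def by (simp add: pt_def)
 qed
 have "pt rt = ({2..n}, bot)"
 proof (rule pre_antisym)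
  obtain w where w: "w \<in> V" "pt w = ({2..n}, bot)" using bot(1) unfolding pts by auto
  thus "pre (pt rt) ({2..n}, bot)" using pre_iff[OF K_root(1) w(1)] le_root[OF w(1)] by simp
  show "pre ({2..n}, bot) (pt rt)" using bot(2) K_root(1) unfolding pts by blast
 qed
 \<comment> \<open>The root has potential 0, while the depths in \<open>pts\<close> are relative to
   \<open>rho\<close>.\<close>
 hence b: "bot = - pot (len C) rho" unfolding pt_def pot_root by simp
 show "keyset (pq_marks n m) C = keys"
  unfolding keyset_def keys_def pts image_image
  by (rule image_cong) (simp_all add: keyv depth_pot b, simp add: pt_def)
qed

end

section \<open>Lattice indices\<close>

text \<open>\<open>f\<close> reads off from an element of \<open>X\<close> the coordinates that
  matter modulo the lattice. Being onto, it identifies the classes in \<open>X\<close> with those of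
  the integer vectors, hence with \<open>R\<close>.\<close>

lemma card_quotient_transversal:
 fixes f :: "'y => nat => int"
 assumes R: "transversal k A R" and surj: "\<And>v. \<exists>y\<in>X. \<forall>i<k. f y i = v i"
  and rel: "\<And>y y'. (y, y') \<in> Q \<longleftrightarrow> y \<in> X \<and> y' \<in> X \<and> (\<exists>D. \<forall>i<k. f y i = f y' i + (\<Sum>j<k. A i j * D j))"
 shows "card (X // Q) = card R"
proof -
 define red where "red v r \<longleftrightarrow> (\<exists>D. \<forall>i<k. v i = r i + (\<Sum>j<k. A i j * D j))" for v r :: "nat => int"
 have ex1: "\<exists>!r. r \<in> R \<and> red v r" for v using R unfolding transversal_def red_def by blast
 have red_trans: "red v w ==> red w r ==> red v r" for v w r
 proof -
  assume "red v w" "red w r"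
  then obtain D D' where D: "\<And>i. i < k ==> v i = w i + (\<Sum>j<k. A i j * D j)" "\<And>i. i < k ==> w i = r i + (\<Sum>j<k. A i j * D' j)"
   unfolding red_def by blast
  show "red v r" unfolding red_def
   by (rule exI[of _ "\<lambda>j. D j + D' j"]) (simp add: D distrib_left sum.distrib)
 qed
 have red_sym: "red v w ==> red w v" for v w
 proof -
  assume "red v w"
  then obtain D where D: "\<And>i. i < k ==> v i = w i + (\<Sum>j<k. A i j * D j)" unfolding red_def by blast
  show "red w v" unfolding red_def by (rule exI[of _ "\<lambda>j. - D j"]) (simp add: D sum_negf)
 qed
 define g where "g y = (THE r. r \<in> R \<and> red (f y) r)" for y
 have g: "g y \<in> R" "red (f y) (g y)" for y using theI'[OF ex1[of "f y"]] unfolding g_def by auto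
 have g_eq: "red (f y) r ==> r \<in> R ==> g y = r" for y r using ex1[of "f y"] g[of y] by blast
 have Q: "(y, y') \<in> Q \<longleftrightarrow> y \<in> X \<and> y' \<in> X \<and> g y = g y'" for y y'
 proof -
  have "red (f y) (f y') \<longleftrightarrow> g y = g y'"
  proof
   assume "red (f y) (f y')"
   thus "g y = g y'" using g_eq[OF red_trans] g by blast
  next
   assume "g y = g y'"
   thus "red (f y) (f y')" using red_trans red_sym g by metis
  qed
  thus ?thesis unfolding rel red_def by blast
 qed
 have "X // Q = (\<lambda>r. {y \<in> X. g y = r}) ` R"
 proof (intro equalityI subsetI)
  fix c assume "c \<in> X // Q"
  then obtain y where y: "y \<in> X" "c = Q `` {y}" by (auto elim: quotientE)
  hence "c = {y' \<in> X. g y' = g y}" using Q by auto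
  thus "c \<in> (\<lambda>r. {y \<in> X. g y = r}) ` R" using g(1) by blast
 next
  fix c assume "c \<in> (\<lambda>r. {y \<in> X. g y = r}) ` R"
  then obtain r where r: "r \<in> R" "c = {y \<in> X. g y = r}" by blast
  obtain y where y: "y \<in> X" "\<forall>i<k. f y i = r i" using surj[of r] by blast
  have "red (f y) r" unfolding red_def by (rule exI[of _ "\<lambda>_. 0"]) (use y(2) in simp)
  hence "c = Q `` {y}" using g_eq[OF _ r(1)] Q r(2) y(1) by auto
  thus "c \<in> X // Q" using y(1) by (auto intro: quotientI)
 qed
 moreover have "inj_on (\<lambda>r. {y \<in> X. g y = r}) R"
 proof (rule inj_onI)
  fix r r' assume r: "r \<in> R" "r' \<in> R" "{y \<in> X. g y = r} = {y \<in> X. g y = r'}"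
  obtain y where y: "y \<in> X" "\<forall>i<k. f y i = r i" using surj[of r] by blast
  have "red (f y) r" unfolding red_def by (rule exI[of _ "\<lambda>_. 0"]) (use y(2) in simp)
  hence "y \<in> {y \<in> X. g y = r}" using g_eq[OF _ r(1)] y(1) by blast
  hence "y \<in> {y \<in> X. g y = r'}" unfolding r(3) .
  thus "r = r'" using \<open>y \<in> {y \<in> X. g y = r}\<close> by simp
 qed
 ultimately show ?thesis by (simp add: card_image)
qed

lemma crd_eqI:
 assumes "\<And>r. r < 2 * (n - 1) ==> crd r (f (r div 2 + 2)) = crd r (g (r div 2 + 2))" "i \<in> {2..n :: nat}"
 shows "f i = g i"
proof -
 have i: "2 * (i - 2) < 2 * (n - 1)" "2 * (i - 2) + 1 < 2 * (n - 1)" "i - 2 + 2 = i" using assms(2) by auto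
 have d: "2 * (i - 2) div 2 + 2 = i" "(2 * (i - 2) + 1) div 2 + 2 = i" using assms(2) by auto
 have o: "odd (2 * (i - 2) + 1)" "even (2 * (i - 2))" by simp_all
 have "fst (f i) = fst (g i)" using assms(1)[OF i(1)] o(2) unfolding d crd_def by simp
 moreover have "snd (f i) = snd (g i)" using assms(1)[OF i(2)] o(1) unfolding d crd_def by simp
 ultimately show ?thesis by (rule prod_eqI)
qed

lemma crd_diff: "crd r (u - v) = crd r u - crd r v" unfolding crd_def by simp

lemma crd_Ints: "v \<in> \<int> \<times> \<int> ==> crd r v \<in> \<int>" unfolding crd_def by auto

lemma cell_base_diff: "cell_base F (\<lambda>R. d R - d' R) dl j Q r = cell_base F d dl j Q r - cell_base F d' dl j Q r"
 unfolding cell_base_def by (simp add: left_diff_distrib)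

context pcurve_tree
begin

lemma stab_edgeD:
 assumes "e \<in> edges (stabilize (p_marks n) C)"
 obtains u w where "e = {u, w}" "stab u" "stab w" "u \<preceq> w"
 using assms stab_le unfolding edges_stabilize by blast

text \<open>The potential on the stabilized tree of a function on its own edges, in contrast to
  \<open>pot\<close>, which lives on the curve.\<close>

definition spot :: "(nat set => real) => nat => real" where
 "spot = otree_graph.pot (stabilize (p_marks n) C) (foot (stabilize (p_marks n) C) (PMark 1)) (\<lambda>u v. PMark ` cln v \<subseteq> PMark ` cln u)"

lemma stab_potential:
 shows spot_eq: "\<And>\<tau> f v. (\<And>u w. {u, w} \<in> edges (stabilize (p_marks n) C) ==> stab u ==> stab w ==> u \<preceq> w ==> \<tau> {u, w} = f w - f u) ==>
   stab v ==> spot \<tau> v = f v - f rho"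
  and spot_edge: "\<And>\<tau> u w. {u, w} \<in> edges (stabilize (p_marks n) C) ==> stab u ==> stab w ==> u \<preceq> w ==> \<tau> {u, w} = spot \<tau> w - spot \<tau> u"
  and spot_diff: "\<And>\<tau> \<tau>' v. spot (\<lambda>e. \<tau> e - \<tau>' e) v = spot \<tau> v - spot \<tau>' v"
  and spot_Ints: "\<And>\<tau> v. \<tau> \<in> edges (stabilize (p_marks n) C) \<rightarrow> \<int> ==> spot \<tau> v \<in> \<int>"
proof -
 let ?T = "stabilize (p_marks n) C"
 interpret S: keyed_tree "p_marks n" ?T "\<lambda>v. PMark ` cln v" "\<lambda>v. pot (len C) v - pot (len C) rho"
  by (rule stabilize_keyed)
 have vs: "verts ?T = {v. stab v}" unfolding stabilize_def Let_def stable_verts_eq by simp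
 have par: "stab (S.par v)" "S.par v \<preceq> v" "{S.par v, v} \<in> edges ?T" if "stab v" "v \<noteq> rho" for v
 proof -
  have v: "v \<in> verts ?T" "v \<noteq> foot ?T (PMark 1)" using that unfolding vs stab_root by auto
  show s: "stab (S.par v)" using S.par_props(1)[OF v] unfolding vs by simp
  show "S.par v \<preceq> v" using S.par_props(2)[OF v] stab_le[OF s that(1)] by simp
  show "{S.par v, v} \<in> edges ?T" using v unfolding S.edges_par by blast
 qed
 have sp: "spot = S.pot" unfolding spot_def ..
 {
  fix \<tau> :: "nat set => real" and f v
  assume tf: "\<And>u w. {u, w} \<in> edges ?T ==> stab u ==> stab w ==> u \<preceq> w ==> \<tau> {u, w} = f w - f u" and v: "stab v"
  have "v \<in> verts ?T" using v unfolding vs by simp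
  thus "spot \<tau> v = f v - f rho"
   unfolding sp
  proof (induction v rule: S.tree_induct)
   case base
   show ?case using S.pot_root[of \<tau>] unfolding stab_root by simp
  next
   case (step v)
   have v: "stab v" "v \<noteq> rho" using step(1,2) unfolding vs stab_root by auto
   show ?case unfolding S.pot_par[OF step(1,2)] step(3) using tf[OF par(3) par(1)] par(2) v by simp
  qed
 }
 {
  fix \<tau> :: "nat set => real" and u w
  assume e: "{u, w} \<in> edges ?T" and uw: "stab u" "stab w" "u \<preceq> w"
  have "\<not> S.cov w u"
  proof
   assume "S.cov w u"
   hence "cln u \<subseteq> cln w" "w \<noteq> u" unfolding S.cov_def by auto
   thus False using cln_mono[OF uw(3)] stab_inj[OF uw(1,2)] by blast
  qed
  hence "S.cov u w" using e S.edge_iff by blast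
  hence "w \<in> verts ?T" "w \<noteq> foot ?T (PMark 1)" "S.par w = u" using S.cov_par by auto
  thus "\<tau> {u, w} = spot \<tau> w - spot \<tau> u" unfolding sp using S.pot_par[of w \<tau>] by simp
 }
  show "spot (\<lambda>e. \<tau> e - \<tau>' e) v = spot \<tau> v - spot \<tau>' v" for \<tau> \<tau>' :: "nat set => real" and v
   unfolding sp S.pot_def by (rule sum_subtractf)
 {
  fix \<tau> :: "nat set => real" and v
  assume t: "\<tau> \<in> edges ?T \<rightarrow> \<int>"
  show "spot \<tau> v \<in> \<int>" unfolding sp S.pot_def
  proof (rule Ints_sum)
   fix z assume "z \<in> {z. z \<in> verts ?T \<and> PMark ` cln v \<subseteq> PMark ` cln z \<and> z \<noteq> foot ?T (PMark 1)}"
   hence "{S.par z, z} \<in> edges ?T" unfolding S.edges_par by blast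
   thus "\<tau> {S.par z, z} \<in> \<int>" using t by blast
  qed
 }
qed

text \<open>Integral edge lengths and integral vertex functions modulo constants are equivalent
  data: lengths are differences across edges. The inverse function recovers the lower vertex of an
  edge.\<close>

lemma edge_potential:
 fixes \<psi> :: "nat => real"
 assumes "\<psi> \<in> V \<rightarrow> \<int>"
 obtains t where "t \<in> edges C \<rightarrow>\<^sub>E \<int>" "\<And>v. v \<in> V ==> pot t v = \<psi> v - \<psi> rt"
proof
 define t where "t = (\<lambda>e\<in>edges C. \<psi> (inv_into (V - {rt}) (\<lambda>v. {par v, v}) e) - \<psi> (par (inv_into (V - {rt}) (\<lambda>v. {par v, v}) e)))"
 have t: "t {par z, z} = \<psi> z - \<psi> (par z)" "t {par z, z} \<in> \<int>" if z: "z \<in> V" "z \<noteq> rt" for z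
 proof -
  have "{par z, z} \<in> edges C" "z \<in> V - {rt}" using z unfolding edges_par by auto
  thus e: "t {par z, z} = \<psi> z - \<psi> (par z)" unfolding t_def using inv_into_f_f[OF par_edge_inj, of z] by simp
  show "t {par z, z} \<in> \<int>" unfolding e using funcset_mem[OF assms z(1)] funcset_mem[OF assms par_props(1)[OF z]] by (rule Ints_diff)
 qed
 show "t \<in> edges C \<rightarrow>\<^sub>E \<int>"
 proof
  show "t e \<in> \<int>" if "e \<in> edges C" for e using that t(2) unfolding edges_par by blast
 qed (simp add: t_def)
 show "pot t v = \<psi> v - \<psi> rt" if "v \<in> V" for v
  using that
 proof (induction v rule: tree_induct)
  case base
  show ?case unfolding pot_root by simp
 next
  case (step v)
  show ?case unfolding pot_par[OF step(1,2)] step(3) t(1)[OF step(1,2)] by simp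
 qed
qed

lemma pot_Ints:
 assumes "t \<in> edges C \<rightarrow>\<^sub>E \<int>"
 shows "pot t v \<in> (\<int> :: real set)"
 unfolding pot_def
proof (rule Ints_sum)
 fix z assume "z \<in> {z. z \<in> V \<and> clus (pq_marks n m) C v \<subseteq> clus (pq_marks n m) C z \<and> z \<noteq> rt}"
 hence "{par z, z} \<in> edges C" unfolding edges_par by blast
 thus "t {par z, z} \<in> \<int>" using assms by blast
qed

text \<open>In terms of potentials, the source lattice consists of integers at the stable vertices
  and at the attaching vertices, together with \<open>b\<close>. The first and the last match the
  lengths of the stabilized tree and the image of the first marked point in the target; after
  cancelling them, the map sends the integers at the attaching vertices to the differences of points
  by the matrix \<open>A\<close>.\<close>

lemma lattice_index_dt:
 fixes A :: "nat => nat => int"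
 assumes h: "hierarchy n ClF dpt" and m: "m = 2 * (n - 1)"
  and inj: "inj_on attach {1..m}" and ns: "\<And>l. l \<in> {1..m} ==> \<not> stab (attach l)" and V: "V = {v. stab v} \<union> attach ` {1..m}"
  and A: "A = (\<lambda>r j. of_bool (r div 2 + 2 \<in> sg j) * (if even r then fst (\<Delta> (Suc j)) else snd (\<Delta> (Suc j))))"
  and dt: "dt m A \<noteq> 0"
 shows "lattice_index n C = nat \<bar>dt m A\<bar>"
proof -
 interpret h: hierarchy n ClF dpt by (rule h)
 let ?ST = "stabilize (p_marks n) C"
 let ?dl = "\<lambda>j r. crd r (ed (Suc j))"
 define base where "base \<tau> r = (\<Sum>j<m. cell_base ClF (\<lambda>R. spot \<tau> (sv R)) ?dl j (sg j) r)" for \<tau> r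
 have sgc: "sg j \<in> cells n ClF" if "j < m" for j
  using cln_cell attach(1,2)[of "Suc j"] that unfolding sg_def by simp
 have col: "cell_col ?dl j (sg j) r = real_of_int (A r j)" for j r
  unfolding cell_col_def A crd_def ed_def by simp
 have flow: "crd r (snd (cone_map n C (t, b)) (r div 2 + 2) - b) = base \<tau> r + (\<Sum>j<m. real_of_int (A r j) * Dt t j)"
  if r: "r < m" and t: "\<And>e. e \<in> edges ?ST ==> \<tau> e = chain_len C t e" for t \<tau> b r
 proof -
  have sd: "sdepth t R = spot \<tau> (sv R)" if "R \<in> ClF" for R
  proof -
   have "spot \<tau> (sv R) = pot t (sv R) - pot t rho"
   proof (rule spot_eq[OF _ sv(1)[OF that]])
    fix u w assume "{u, w} \<in> edges ?ST" "stab u" "stab w" "u \<preceq> w"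
    thus "\<tau> {u, w} = pot t w - pot t u" using t chain_len_pot[of u w t] stabD(1) by simp
   qed
   thus ?thesis unfolding sdepth_def by simp
  qed
  have r': "r < 2 * (n - 1)" "r div 2 + 2 \<in> {1..n}" using r m by auto
  have "snd (cone_map n C (t, b)) (r div 2 + 2) - b = (\<Sum>z | z \<in> V \<and> z \<preceq> foot C (PMark (r div 2 + 2)) \<and> z \<noteq> rt. t {par z, z} *\<^sub>R lsum ed z)"
   unfolding cone_sum[OF r'(2)] by simp
  hence "crd r (snd (cone_map n C (t, b)) (r div 2 + 2) - b) = (\<Sum>j<m. cell_base ClF (sdepth t) ?dl j (sg j) r + Dt t j * cell_col ?dl j (sg j) r)"
   using flow_eq[OF sum_ed r'(1)] by simp
  also have "\<dots> = (\<Sum>j<m. cell_base ClF (\<lambda>R. spot \<tau> (sv R)) ?dl j (sg j) r + Dt t j * real_of_int (A r j))"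
  proof (rule sum.cong[OF refl])
   fix j assume "j \<in> {..<m}"
   hence "cell_base ClF dpt ?dl j (sg j) r = cell_base ClF dpt ?dl j (sg j) r" for dpt by simp
   have c: "cell_base ClF (sdepth t) ?dl j (sg j) r = cell_base ClF (\<lambda>R. spot \<tau> (sv R)) ?dl j (sg j) r"
   proof -
    have "insert (r div 2 + 2) (sg j) \<subseteq> {2..n}" using h.cell_sub(1)[OF sgc] \<open>j \<in> {..<m}\<close> r' by auto
    hence "join ClF (insert (r div 2 + 2) (sg j)) \<in> ClF" by (intro h.join_in) auto
    thus ?thesis unfolding cell_base_def using sd by simp
   qed
   show "cell_base ClF (sdepth t) ?dl j (sg j) r + Dt t j * cell_col ?dl j (sg j) r
    = cell_base ClF (\<lambda>R. spot \<tau> (sv R)) ?dl j (sg j) r + Dt t j * real_of_int (A r j)" unfolding c col ..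
  qed
  finally show ?thesis unfolding base_def by (simp add: sum.distrib mult.commute)
 qed
 have cone1: "snd (cone_map n C (t, b)) 1 = b" for t b
  using cone_sum[of 1 t b] n sum_below_root by simp
 \<comment> \<open>The differences of the points minus the displacement already caused by the
   lengths of the stabilized tree; what remains must come from the columns of
   \<open>A\<close>.\<close>
 define fr where "fr y r = crd r (snd y (r div 2 + 2) - snd y 1) - base (fst y) r" for y r
 have fr_diff: "fr y r - fr y' r = crd r ((snd y (r div 2 + 2) - snd y' (r div 2 + 2)) - (snd y 1 - snd y' 1)) - base (\<lambda>e. fst y e - fst y' e) r" for y y' r
  unfolding fr_def base_def spot_diff cell_base_diff sum_subtractf crd_diff by simp
 let ?X = "target_lattice n C"
 let ?Q = "{(y, y'). y \<in> ?X \<and> y' \<in> ?X \<and>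
    (\<exists>z\<in>source_lattice C.
      (\<forall>e\<in>edges ?ST. fst y e - fst y' e = fst (cone_map n C z) e) \<and>
      (\<forall>i\<in>{1..n}. snd y i - snd y' i = snd (cone_map n C z) i))}"
 have rel: "(y, y') \<in> ?Q \<longleftrightarrow> (\<exists>D :: nat => int. \<forall>r<m. fr y r = fr y' r + (\<Sum>j<m. real_of_int (A r j) * real_of_int (D j)))"
  if y: "y \<in> ?X" "y' \<in> ?X" for y y'
 proof
  define \<tau> where "\<tau> e = fst y e - fst y' e" for e
  define p where "p i = snd y i - snd y' i" for i
  { assume "(y, y') \<in> ?Q"
   then obtain t b where z: "(t, b) \<in> source_lattice C" "\<And>e. e \<in> edges ?ST ==> \<tau> e = chain_len C t e"
    "\<And>i. i \<in> {1..n} ==> p i = snd (cone_map n C (t, b)) i"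
    unfolding \<tau>_def p_def by (auto simp: cone_map_def)
   have tI: "t \<in> edges C \<rightarrow>\<^sub>E \<int>" using z(1) unfolding source_lattice_def by simp
   have D: "real_of_int \<lfloor>Dt t j\<rfloor> = Dt t j" for j
   proof -
    have "Dt t j \<in> \<int>" unfolding Dt_def using pot_Ints[OF tI] by simp
    thus ?thesis by (auto elim: Ints_cases)
   qed
   have "fr y r = fr y' r + (\<Sum>j<m. real_of_int (A r j) * real_of_int \<lfloor>Dt t j\<rfloor>)" if r: "r < m" for r
   proof -
    have "r div 2 + 2 \<in> {1..n}" "1 \<in> {1..n}" using r m n by auto
    hence "crd r (p (r div 2 + 2) - p 1) = base \<tau> r + (\<Sum>j<m. real_of_int (A r j) * Dt t j)"
     using flow[OF r z(2), of b] z(3) cone1 by simp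
    thus ?thesis using fr_diff[of y r y'] unfolding D \<tau>_def p_def by simp
   qed
   thus "\<exists>D :: nat => int. \<forall>r<m. fr y r = fr y' r + (\<Sum>j<m. real_of_int (A r j) * real_of_int (D j))"
    by (intro exI[of _ "\<lambda>j. \<lfloor>Dt t j\<rfloor>"]) blast }
  assume "\<exists>D :: nat => int. \<forall>r<m. fr y r = fr y' r + (\<Sum>j<m. real_of_int (A r j) * real_of_int (D j))"
  then obtain D :: "nat => int" where D: "\<And>r. r < m ==> fr y r = fr y' r + (\<Sum>j<m. real_of_int (A r j) * real_of_int (D j))" by blast
  have tauI: "\<tau> \<in> edges ?ST \<rightarrow> \<int>" and pI: "p 1 \<in> \<int> \<times> \<int>"
  proof -
   show "\<tau> \<in> edges ?ST \<rightarrow> \<int>" using y unfolding \<tau>_def target_lattice_def by (auto simp: PiE_def Pi_def)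
   have "snd y 1 \<in> \<int> \<times> \<int>" "snd y' 1 \<in> \<int> \<times> \<int>" using y n unfolding target_lattice_def by (auto simp: PiE_def Pi_def)
   thus "p 1 \<in> \<int> \<times> \<int>" unfolding p_def by (auto simp: mem_Times_iff)
  qed
  \<comment> \<open>The vertex function that realizes a given difference: lengths prescribe it at
    stable vertices, and \<open>D\<close> at attaching vertices, which are distinct and not stable.
    The subtraction of 1 undoes the shift between ends and columns.\<close>
  define \<psi> where "\<psi> v = (if stab v then spot \<tau> v else real_of_int (D (inv_into {1..m} attach v - 1)))" for v
  have "\<psi> \<in> V \<rightarrow> \<int>" unfolding \<psi>_def using spot_Ints[OF tauI] by auto
  then obtain t where t: "t \<in> edges C \<rightarrow>\<^sub>E \<int>" "\<And>v. v \<in> V ==> pot t v = \<psi> v - \<psi> rt" using edge_potential by metis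
  have \<psi>rho: "\<psi> rho = 0" using spot_eq[of \<tau> "spot \<tau>" rho] spot_edge rho(1) unfolding \<psi>_def by simp
  have tau: "\<tau> e = chain_len C t e" if e: "e \<in> edges ?ST" for e
  proof -
   obtain u w where u: "e = {u, w}" "stab u" "stab w" "u \<preceq> w" by (rule stab_edgeD[OF e])
   thus ?thesis using spot_edge[of u w \<tau>] e chain_len_pot[of u w t] t(2) stabD(1) unfolding \<psi>_def by simp
  qed
  have Dt: "Dt t j = real_of_int (D j)" if "j < m" for j
  proof -
   have l: "Suc j \<in> {1..m}" using that by simp
   have "\<psi> (attach (Suc j)) = real_of_int (D j)" unfolding \<psi>_def using ns[OF l] inv_into_f_f[OF inj l] by simp
   thus ?thesis unfolding Dt_def t(2)[OF attach(1)[OF l]] t(2)[OF rho(3)] \<psi>rho by simp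
  qed
  have "snd (cone_map n C (t, p 1)) i - p 1 = p i - p 1" if i: "i \<in> {2..n}" for i
  proof (rule crd_eqI[OF _ i])
   fix r assume r: "r < 2 * (n - 1)"
   hence r: "r < m" using m by simp
   have "crd r (p (r div 2 + 2) - p 1) = base \<tau> r + (\<Sum>j<m. real_of_int (A r j) * real_of_int (D j))"
    using fr_diff[of y r y'] D[OF r] unfolding \<tau>_def p_def by simp
   also have "\<dots> = crd r (snd (cone_map n C (t, p 1)) (r div 2 + 2) - p 1)"
    using flow[OF r tau, of "p 1"] sum.cong[OF refl, of "{..<m}" "\<lambda>j. real_of_int (A r j) * Dt t j"] Dt by simp
   finally show "crd r (snd (cone_map n C (t, p 1)) (r div 2 + 2) - p 1) = crd r (p (r div 2 + 2) - p 1)" ..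
  qed
  hence "snd (cone_map n C (t, p 1)) i = p i" if "i \<in> {1..n}" for i
   using that cone1[of t "p 1"] by (cases "i = 1") auto
  moreover have "(t, p 1) \<in> source_lattice C" unfolding source_lattice_def using t(1) pI by simp
  moreover have "fst (cone_map n C (t, p 1)) = chain_len C t" unfolding cone_map_def by simp
  ultimately show "(y, y') \<in> ?Q" using y tau unfolding \<tau>_def p_def
   by (intro CollectI case_prodI conjI bexI[of _ "(t, snd y 1 - snd y' 1)"]) simp_all
 qed
 have frI: "fr y r \<in> \<int>" if y: "y \<in> ?X" and r: "r < m" for y r
 proof -
  have "r div 2 + 2 \<in> {1..n}" "1 \<in> {1..n}" using r m n by auto
  hence "snd y (r div 2 + 2) \<in> \<int> \<times> \<int>" "snd y 1 \<in> \<int> \<times> \<int>" using y unfolding target_lattice_def by (auto simp: PiE_def Pi_def)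
  hence "snd y (r div 2 + 2) - snd y 1 \<in> \<int> \<times> \<int>" by (auto simp: mem_Times_iff)
  moreover have "base (fst y) r \<in> \<int>"
  proof -
   have "spot (fst y) v \<in> \<int>" for v using spot_Ints[of "fst y"] y unfolding target_lattice_def by (auto simp: PiE_def)
   thus ?thesis unfolding base_def cell_base_def crd_def ed_def by (auto intro!: Ints_sum Ints_mult)
  qed
  ultimately show ?thesis unfolding fr_def using crd_Ints by (intro Ints_diff) auto
 qed
 define f where "f y r = \<lfloor>fr y r\<rfloor>" for y r
 have f: "real_of_int (f y r) = fr y r" if "y \<in> ?X" "r < m" for y r using frI[OF that] unfolding f_def by (auto elim: Ints_cases)
 obtain R where R: "transversal m A R" "card R = nat \<bar>dt m A\<bar>" using lattice_transversal[OF dt] by blast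
 have "card (?X // ?Q) = card R"
 proof (rule card_quotient_transversal[OF R(1), of ?X f])
  fix v :: "nat => int"
  \<comment> \<open>With all lengths zero and the first point at the origin there is no displacement
    to subtract, so every integer vector occurs as a value of \<open>f\<close>.\<close>
  define y where "y = ((\<lambda>e\<in>edges ?ST. 0 :: real), (\<lambda>i\<in>{1..n}. if i = 1 then (0, 0) else (real_of_int (v (2 * (i - 2))), real_of_int (v (2 * (i - 2) + 1)))))"
  have y: "y \<in> ?X" unfolding y_def target_lattice_def by (auto intro!: PiE_I simp: PiE_def)
  have P0: "spot (fst y) u = 0" if "stab u" for u
  proof -
   have "fst y {v, w} = 0" if "{v, w} \<in> edges ?ST" for v w using that unfolding y_def by simp
   thus ?thesis using spot_eq[of "fst y" "\<lambda>_. 0" u] that by simp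
  qed
  have "f y r = v r" if r: "r < m" for r
  proof -
   have rd: "r div 2 + 2 \<in> {1..n}" "r div 2 + 2 \<noteq> 1" "r div 2 + 2 - 2 = r div 2" "1 \<in> {1..n}" using r m n by auto
   have "base (fst y) r = 0"
    unfolding base_def
   proof (rule sum.neutral, rule ballI)
    fix j assume "j \<in> {..<m}"
    hence "insert (r div 2 + 2) (sg j) \<subseteq> {2..n}" using h.cell_sub(1)[OF sgc] r m by auto
    hence "join ClF (insert (r div 2 + 2) (sg j)) \<in> ClF" by (intro h.join_in) auto
    thus "cell_base ClF (\<lambda>R. spot (fst y) (sv R)) ?dl j (sg j) r = 0" unfolding cell_base_def using P0 sv(1) by simp
   qed
   moreover have "snd y 1 = (0, 0)" unfolding y_def using rd(4) by simp
   moreover have "snd y (r div 2 + 2) = (real_of_int (v (2 * (r div 2))), real_of_int (v (2 * (r div 2) + 1)))"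
    unfolding y_def using rd by simp
   ultimately have "fr y r = real_of_int (v r)" unfolding fr_def crd_def
    by (cases "even r") (simp_all add: zero_prod_def[symmetric] odd_two_times_div_two_succ)
   thus ?thesis unfolding f_def by simp
  qed
  thus "\<exists>y\<in>?X. \<forall>i<m. f y i = v i" using y by blast
 next
  fix y y'
  have iff: "(\<forall>i<m. f y i = f y' i + (\<Sum>j<m. A i j * D j)) \<longleftrightarrow> (\<forall>r<m. fr y r = fr y' r + (\<Sum>j<m. real_of_int (A r j) * real_of_int (D j)))"
   if "y \<in> ?X" "y' \<in> ?X" for D
  proof -
   have "f y i = f y' i + (\<Sum>j<m. A i j * D j) \<longleftrightarrow> fr y i = fr y' i + (\<Sum>j<m. real_of_int (A i j) * real_of_int (D j))" if i: "i < m" for i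
   proof -
    have "f y i = f y' i + (\<Sum>j<m. A i j * D j) \<longleftrightarrow> real_of_int (f y i) = real_of_int (f y' i + (\<Sum>j<m. A i j * D j))"
     by (rule of_int_eq_iff[symmetric])
    thus ?thesis using f[OF \<open>y \<in> ?X\<close> i] f[OF \<open>y' \<in> ?X\<close> i] by simp
   qed
   thus ?thesis by blast
  qed
  show "(y, y') \<in> ?Q \<longleftrightarrow> y \<in> ?X \<and> y' \<in> ?X \<and> (\<exists>D. \<forall>i<m. f y i = f y' i + (\<Sum>j<m. A i j * D j))"
  proof (cases "y \<in> ?X \<and> y' \<in> ?X")
   case True
   hence y: "y \<in> ?X" "y' \<in> ?X" by simp_all
   show ?thesis unfolding rel[OF y] iff[OF y] using y by simp
  next
   case False
   thus ?thesis unfolding mem_Collect_eq prod.case by blast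
  qed
 qed
 thus ?thesis unfolding lattice_index_def R(2) .
qed

end

section \<open>Correspondence between curves in a fibre and solutions of the cell systems\<close>

lemma (in pcurve_tree) keys_curve:
 assumes cp: "cell_points n F dpt m \<sigma> D" and k: "keyset (pq_marks n m) C = cell_points.keys n F dpt m \<sigma> D"
 shows "ClF = F" and "\<And>R. R \<in> F ==> sdepth (len C) R = dpt R"
  and "\<And>j. j < m ==> sg j = \<sigma> j" and "\<And>j. j < m ==> Dt (len C) j = D j"
proof -
 interpret cell_points n F dpt m \<sigma> D by (rule cp)
 let ?K = "clus (pq_marks n m) C"
 \<comment> \<open>Adding \<open>bot\<close> undoes the normalization of depths in
   \<open>keys\<close>; by injectivity of \<open>key\<close> this identifies the vertices of the
   curve with \<open>pts\<close>, and all data can be read off.\<close>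
 define pt where "pt v = (cln v, depth C v + bot)" for v
 have pt_key: "pt v \<in> pts \<and> key (pt v) = ?K v" if v: "v \<in> V" for v
 proof -
  have "(?K v, depth C v) \<in> keys" unfolding k[symmetric] keyset_def using v by blast
  then obtain p where p: "p \<in> pts" "?K v = key p" "depth C v = snd p - bot" unfolding keys_def by blast
  have "cln v = fst p" using cell_sub(1)[OF pts_cell[OF p(1)]] unfolding cln_def p(2) key_P by blast
  hence "pt v = p" unfolding pt_def using p(3) by (simp add: prod_eq_iff)
  thus ?thesis using p by simp
 qed
 have pt_ex: "\<exists>v\<in>V. pt v = p" if p: "p \<in> pts" for p
 proof -
  have "(key p, snd p - bot) \<in> keyset (pq_marks n m) C" unfolding k keys_def using p by blast
  then obtain v where v: "v \<in> V" "?K v = key p" unfolding keyset_def by auto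
  hence "pt v = p" using key_inj[OF _ p] pt_key[OF v(1)] by simp
  thus ?thesis using v by blast
 qed
 have le_pre: "u \<preceq> v \<longleftrightarrow> pre (pt u) (pt v)" if "u \<in> V" "v \<in> V" for u v
  using key_mono[of "pt u" "pt v"] pt_key that by simp
 have pt_inj: "u = v" if "u \<in> V" "v \<in> V" "pt u = pt v" for u v
  using V_eq[OF that(1,2)] le_pre[of u v] le_pre[of v u] that pre_refl by simp
 have cell_v: "cln v \<in> cells n F" if "v \<in> V" for v using pts_cell[of "pt v"] pt_key[OF that] unfolding pt_def by simp
 \<comment> \<open>The stable vertices are the deepest points in the cells of clusters, since equal
   sets of marked points are separated by depth alone.\<close>
 have stab_iff: "stab v \<longleftrightarrow> v \<in> V \<and> cln v \<in> F \<and> pt v = (cln v, dpt (cln v))" for v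
 proof
  assume s: "stab v"
  hence v: "v \<in> V" "2 \<le> card (cln v)" unfolding stab_def by auto
  have F: "cln v \<in> F" using cell_v[OF v(1)] v(2) unfolding cells_def by auto
  obtain w where w: "w \<in> V" "pt w = (cln v, dpt (cln v))" using pt_ex[OF pts_F[OF F]] by blast
  have "snd (pt v) \<le> dpt (cln v)" using pts_max[of "pt v"] pt_key[OF v(1)] F unfolding pt_def by simp
  hence "pre (pt v) (cln v, dpt (cln v))" unfolding pre_def pt_def by simp
  hence "pre (pt v) (pt w)" unfolding w(2) .
  moreover have "cln w = cln v" using w(2) unfolding pt_def by simp
  ultimately have "w = v" using s w(1) le_pre[OF v(1) w(1)] unfolding stab_def by blast
  thus "v \<in> V \<and> cln v \<in> F \<and> pt v = (cln v, dpt (cln v))" using v F w by simp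
 next
  assume a: "v \<in> V \<and> cln v \<in> F \<and> pt v = (cln v, dpt (cln v))"
  show "stab v"
   unfolding stab_def
  proof (intro conjI ballI impI notI)
   show "v \<in> V" "2 \<le> card (cln v)" using a sub by auto
   fix w assume w: "w \<in> V" "v \<preceq> w" "w \<noteq> v" "cln w = cln v"
   have "pt v \<noteq> pt w" using pt_inj a w by metis
   hence "snd (pt v) < snd (pt w)" using pre_less[of "pt v" "pt w"] pt_key[of v] pt_key[OF w(1)] le_pre[of v w] a w(1,2) by blast
   moreover have "snd (pt w) \<le> dpt (cln v)" using pts_max[of "pt w"] pt_key[OF w(1)] a w(4) unfolding pt_def by simp
   moreover have "snd (pt v) = dpt (cln v)" using a by simp
   ultimately show False by simp
  qed
 qed
 have ex: "\<exists>v. stab v \<and> cln v = R \<and> pt v = (R, dpt R)" if R: "R \<in> F" for R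
 proof -
  obtain v where v: "v \<in> V" "pt v = (R, dpt R)" using pt_ex[OF pts_F[OF R]] by blast
  hence "cln v = R" unfolding pt_def by simp
  thus ?thesis using stab_iff[of v] v R by auto
 qed
 show F: "ClF = F" unfolding ClF_def using ex stab_iff by blast
 have dp: "depth C (sv R) + bot = dpt R" if R: "R \<in> F" for R
 proof -
  obtain v where v: "stab v" "cln v = R" "pt v = (R, dpt R)" using ex[OF R] by blast
  hence "sv R = v" using sv_cln by blast
  thus ?thesis using v(3) unfolding pt_def by simp
 qed
 have rho0: "depth C rho + bot = 0" using dp[OF top_in] dpt_top by simp
 show "sdepth (len C) R = dpt R" if R: "R \<in> F" for R
  using dp[OF R] rho0 depth_pot[OF rho(3)] depth_pot[OF stabD(1)[OF sv(1)], of R] R F unfolding sdepth_def by simp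
 have at: "attach (Suc j) \<in> V \<and> pt (attach (Suc j)) = (\<sigma> j, D j)" if j: "j < m" for j
 proof -
  have l: "Suc j \<in> {1..m}" using j by simp
  let ?f = "foot C (QMark (Suc j))"
  have f: "?f \<in> V" by (rule foot_q[OF l])
  obtain w where w: "w \<in> V" "pt w = (\<sigma> j, D j)" using pt_ex[OF pts_D[OF j]] by blast
  have iff: "v \<preceq> ?f \<longleftrightarrow> pre (pt v) (\<sigma> j, D j)" if "v \<in> V" for v
   using q_iff[OF that l] key_Q[OF j, of "pt v"] pt_key[OF that] by simp
  have "?f \<preceq> w" using iff[OF f] le_pre[OF f w(1)] w(2) by simp
  moreover have "w \<preceq> ?f" using iff[OF w(1)] w(2) pre_refl by simp
  ultimately have "?f = w" by (rule V_eq[OF f w(1)])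
  moreover have "attach (Suc j) = ?f" using attach_cln[OF l] cell_sub(2)[OF cell_v[OF f]] by simp
  ultimately show ?thesis using w by simp
 qed
 show "sg j = \<sigma> j" if j: "j < m" for j using at[OF j] j unfolding sg_def pt_def by simp
 show "Dt (len C) j = D j" if j: "j < m" for j
  using at[OF j] rho0 depth_pot[OF rho(3)] depth_pot[of "attach (Suc j)"] unfolding Dt_def pt_def by auto
qed

lemma (in cell_points) keys_cong:
 assumes "cell_points n F dpt m \<sigma> D'" "\<And>j. j < m ==> D j = D' j"
 shows "keys = cell_points.keys n F dpt m \<sigma> D'"
proof -
 interpret c: cell_points n F dpt m \<sigma> D' by fact
 have p: "pts = c.pts" unfolding pts_def c.pts_def using assms(2) by (intro arg_cong2[of _ _ _ _ "(\<union>)"] image_cong) auto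
 have "l - 1 < m" if "l \<in> {1..m}" for l using that by auto
 hence "key = c.key" unfolding key_def c.key_def using assms(2) by (intro ext arg_cong2[of _ _ _ _ "(\<union>)"] image_cong Collect_cong conj_cong refl) simp_all
 thus ?thesis unfolding keys_def c.keys_def bot_def c.bot_def p by simp
qed

lemma cell_solution_points:
 assumes "hierarchy n F dpt" "\<sigma> \<in> {..<2 * (n - 1)} \<rightarrow>\<^sub>E cells n F" "cell_solution n F dpt dl \<sigma> z D"
 shows "cell_points n F dpt (2 * (n - 1)) \<sigma> D"
 using assms unfolding cell_points_def cell_points_axioms_def cell_solution_def by auto

lemma linear_unique:
 fixes A :: "nat => nat => real"
 assumes "dt k A \<noteq> 0" "\<And>r. r < k ==> (\<Sum>j<k. b j r + D j * A r j) = (\<Sum>j<k. b j r + D' j * A r j)" "j < k"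
 shows "D j = D' j"
proof (rule ccontr)
 assume "D j \<noteq> D' j"
 hence "dt k A = 0"
  by (intro dt_zero_if_kernel[of j k "\<lambda>j. D j - D' j"])
   (use assms in \<open>auto simp: sum.distrib algebra_simps sum_subtractf\<close>)
 thus False using assms(1) by simp
qed

text \<open>A curve in the fibre yields its cells and depths, which solve the linear system;
  conversely, a solution within the bounds predicts a keyset, realized by exactly one curve class
  with the given first image point. General position makes the solution unique for given cells, so
  classes correspond to the choices of cells that admit one.\<close>

theorem fibre_count:
 fixes T :: mtree
 assumes n: "n \<ge> 3" and m: "m = 2 * (n - 1)" and bal: "(\<Sum>l\<in>{1..m}. \<Delta> l) = 0"
  and T: "metric_tree (p_marks n) T" "keyset (p_marks n) T = (\<lambda>R. (PMark ` R, dpt R)) ` F"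
  and h: "hierarchy n F dpt" and dl: "dl = (\<lambda>j r. crd r (end_dir \<Delta> (QMark (Suc j))))"
  and gen: "\<And>\<sigma> D. \<sigma> \<in> {..<m} \<rightarrow>\<^sub>E cells n F ==>
   (\<And>r. r < m ==> (\<Sum>j<m. cell_base F dpt dl j (\<sigma> j) r + D j * cell_col dl j (\<sigma> j) r) = diff_vec x r) ==>
   dt m (cell_matrix dl \<sigma>) \<noteq> 0 \<and> inj_on D {..<m} \<and> (\<forall>j<m. D j \<noteq> dpt (\<sigma> j) \<and> D j \<noteq> dpt (above F (\<sigma> j)))"
 shows "finite (fibre \<Delta> n m (tree_rel n `` {T}, restrict x {1..n}))"
  and "real (\<Sum>c\<in>fibre \<Delta> n m (tree_rel n `` {T}, restrict x {1..n}). lattice_index n (rep c))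
   = (\<Sum>\<sigma>\<in>{..<m} \<rightarrow>\<^sub>E cells n F. of_bool (\<exists>D. cell_solution n F dpt dl \<sigma> (diff_vec x) D) * \<bar>dt m (cell_matrix dl \<sigma>)\<bar>)"
proof -
 interpret h: hierarchy n F dpt by (rule h)
 let ?y = "(tree_rel n `` {T}, restrict x {1..n})"
 let ?W = "{..<m} \<rightarrow>\<^sub>E cells n F" and ?sol = "\<lambda>\<sigma> D. cell_solution n F dpt dl \<sigma> (diff_vec x) D"
 let ?keys = "\<lambda>\<sigma> D. cell_points.keys n F dpt m \<sigma> D"
 define S where "S = {\<sigma> \<in> ?W. \<exists>D. ?sol \<sigma> D}"
 define Ds where "Ds \<sigma> = (SOME D. ?sol \<sigma> D)" for \<sigma>
 \<comment> \<open>All curves with the predicted keyset and first image point: by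
   \<open>curve_rel_iff\<close> this is one full equivalence class.\<close>
 define cl where "cl \<sigma> = {C. param_curve \<Delta> n m C \<and> keyset (pq_marks n m) C = ?keys \<sigma> (Ds \<sigma>) \<and> ev C 1 = x 1}" for \<sigma>
 have Ds: "?sol \<sigma> (Ds \<sigma>)" if "\<sigma> \<in> S" for \<sigma> using that someI_ex[of "?sol \<sigma>"] unfolding S_def Ds_def by blast
 have eqs: "(\<Sum>j<m. cell_base F dpt dl j (\<sigma> j) r + D j * cell_col dl j (\<sigma> j) r) = diff_vec x r" if "?sol \<sigma> D" "r < m" for \<sigma> D r
  using that unfolding cell_solution_def m by blast
 have pts: "cell_points n F dpt m \<sigma> D" if "\<sigma> \<in> ?W" "?sol \<sigma> D" for \<sigma> D
  using cell_solution_points[OF h, of \<sigma>] that unfolding m by blast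
 have SW: "\<sigma> \<in> ?W" if "\<sigma> \<in> S" for \<sigma> using that unfolding S_def by blast
 have pc: "pcurve_tree \<Delta> n m C" if "param_curve \<Delta> n m C" for C by (rule pcurve_tree.intro[OF that n bal])
 have rel: "(C, C') \<in> curve_rel \<Delta> n m \<longleftrightarrow> param_curve \<Delta> n m C \<and> param_curve \<Delta> n m C' \<and>
  keyset (pq_marks n m) C = keyset (pq_marks n m) C' \<and> ev C 1 = ev C' 1" for C C' by (rule curve_rel_iff[OF n bal])
 have rep: "rep c \<in> c" if "c \<noteq> {}" for c :: "pcurve set" unfolding rep_def using that some_in_eq by blast
 have M: "param_curve \<Delta> n m (rep c) \<and> c = curve_rel \<Delta> n m `` {rep c}" if c: "c \<in> M_trop \<Delta> n m" for c
 proof -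
  obtain C where C: "param_curve \<Delta> n m C" "c = curve_rel \<Delta> n m `` {C}" using c unfolding M_trop_def by (auto elim: quotientE)
  hence "C \<in> c" using rel by simp
  hence "(C, rep c) \<in> curve_rel \<Delta> n m" using rep[of c] C(2) by blast
  thus ?thesis using C rel by auto
 qed
 have cl_rep: "cl \<sigma> \<in> M_trop \<Delta> n m \<and> rep (cl \<sigma>) \<in> cl \<sigma>" if s: "\<sigma> \<in> S" for \<sigma>
 proof -
  interpret cell_points n F dpt m \<sigma> "Ds \<sigma>" by (rule pts[OF SW[OF s] Ds[OF s]])
  obtain T' :: mtree where T': "metric_tree (pq_marks n m) T'" "keyset (pq_marks n m) T' = keys" by (rule model_tree)
  obtain C where C: "param_curve \<Delta> n m C" "keyset (pq_marks n m) C = keyset (pq_marks n m) T'" "ev C 1 = x 1"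
   by (rule ex_param_curve[OF T'(1) n bal])
  have "cl \<sigma> = curve_rel \<Delta> n m `` {C}" unfolding cl_def using rel C T'(2) by auto
  moreover have "C \<in> cl \<sigma>" unfolding cl_def using C T'(2) by simp
  ultimately show ?thesis using rep[of "cl \<sigma>"] C(1) unfolding M_trop_def by (auto intro: quotientI)
 qed
 have main: "trop_tau n C = ?y \<and> pq_tree.sg n m C (clus (pq_marks n m) C) = \<sigma> \<and> real (lattice_index n C) = \<bar>dt m (cell_matrix dl \<sigma>)\<bar>"
  if s: "\<sigma> \<in> S" and C: "C \<in> cl \<sigma>" for \<sigma> C
 proof -
  have C': "param_curve \<Delta> n m C" "keyset (pq_marks n m) C = ?keys \<sigma> (Ds \<sigma>)" "ev C 1 = x 1" using C unfolding cl_def by auto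
  interpret pcurve_tree \<Delta> n m C by (rule pc[OF C'(1)])
  note k = keys_curve[OF pts[OF SW[OF s] Ds[OF s]] C'(2)]
  have dl': "(\<lambda>j r. crd r (ed (Suc j))) = dl" unfolding dl ed_def ..
  have sg: "sg = \<sigma>" using SW[OF s] k(3) by (intro extensionalityI[of _ "{..<m}"]) (auto simp: sg_def PiE_def)
  have h': "hierarchy n ClF dpt" unfolding k(1) by (rule h)
  have "diff_vec (ev C) r = diff_vec x r" if r: "r < m" for r
  proof -
   have c: "cell_base ClF (sdepth (len C)) dl j (sg j) r = cell_base F dpt dl j (\<sigma> j) r" if "j < m" for j
   proof -
    have "\<sigma> j \<in> cells n F" using SW[OF s] that by auto
    thus ?thesis using h.cell_base_cong[of "\<sigma> j" r "sdepth (len C)" dl j] k(2) r m unfolding k(1) sg by metis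
   qed
   have "diff_vec (ev C) r = (\<Sum>j<m. cell_base ClF (sdepth (len C)) dl j (sg j) r + Dt (len C) j * cell_col dl j (sg j) r)"
    using flow_ev[of r] r m unfolding dl' by simp
   also have "\<dots> = (\<Sum>j<m. cell_base F dpt dl j (\<sigma> j) r + Ds \<sigma> j * cell_col dl j (\<sigma> j) r)"
    by (rule sum.cong) (use c k(4) sg in auto)
   finally show ?thesis using eqs[OF Ds[OF s] r] by simp
  qed
  hence "ev C i - ev C 1 = x i - x 1" if "i \<in> {2..n}" for i
   using crd_eqI[of n "\<lambda>i. ev C i - ev C 1" "\<lambda>i. x i - x 1" i] that m unfolding diff_vec_crd by simp
  hence "ev C i = x i" if "i \<in> {1..n}" for i using that C'(3) by (cases "i = 1") auto
  hence tau: "trop_tau n C = ?y" using trop_tau_iff[OF T] k(1,2) by simp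
  have gD: "dt m (cell_matrix dl \<sigma>) \<noteq> 0" "inj_on (Ds \<sigma>) {..<m}"
   "\<And>j. j < m ==> Ds \<sigma> j \<noteq> dpt (\<sigma> j) \<and> Ds \<sigma> j \<noteq> dpt (above F (\<sigma> j))"
   using gen[OF SW[OF s] eqs[OF Ds[OF s]]] by blast+
  have inj: "inj_on (Dt (len C)) {..<m}" using gD(2) k(4) by (simp add: inj_on_def)
  have ga: "Dt (len C) j \<noteq> dpt (sg j) \<and> Dt (len C) j \<noteq> dpt (above F (sg j))" if "j < m" for j
   using gD(3)[OF that] k(4)[OF that] sg by simp
  have ns: "\<not> stab (attach l)" if "l \<in> {1..m}" for l by (rule curve_keys(4)[OF h k(1,2) inj ga that])
  have V: "V = {v. stab v} \<union> attach ` {1..m}" by (rule curve_keys(5)[OF h k(1,2) inj ga])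
  have inja: "inj_on attach {1..m}"
  proof (rule inj_onI)
   fix l l' assume l: "l \<in> {1..m}" "l' \<in> {1..m}" "attach l = attach l'"
   hence "Dt (len C) (l - 1) = Dt (len C) (l' - 1)" unfolding Dt_def by simp
   hence "l - 1 = l' - 1" using inj l by (auto dest!: inj_onD)
   thus "l = l'" using l by auto
  qed
  define A where "A = (\<lambda>r j. of_bool (r div 2 + 2 \<in> sg j) * (if even r then fst (\<Delta> (Suc j)) else snd (\<Delta> (Suc j))))"
  have "real_of_int (A r j) = cell_matrix dl \<sigma> r j" for r j
   unfolding A_def sg cell_matrix_def cell_col_def dl crd_def by simp
  hence A: "real_of_int (dt m A) = dt m (cell_matrix dl \<sigma>)" unfolding of_int_dt by simp
  hence "dt m A \<noteq> 0" using gD(1) by auto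
  hence "lattice_index n C = nat \<bar>dt m A\<bar>" by (intro lattice_index_dt[OF h' m inja ns V A_def])
  hence "real (lattice_index n C) = \<bar>dt m (cell_matrix dl \<sigma>)\<bar>" unfolding A[symmetric] by simp
  thus ?thesis using tau sg by blast
 qed
 have surj: "\<exists>\<sigma>\<in>S. c = cl \<sigma>" if c: "c \<in> fibre \<Delta> n m ?y" for c
 proof -
  let ?C = "rep c"
  have cM: "c \<in> M_trop \<Delta> n m" and tau: "trop_tau n ?C = ?y" using c unfolding fibre_def by auto
  interpret pcurve_tree \<Delta> n m ?C by (rule pc) (use M[OF cM] in blast)
  have F: "ClF = F" "\<And>R. R \<in> F ==> sdepth (len ?C) R = dpt R" and x: "\<And>i. i \<in> {1..n} ==> ev ?C i = x i"
   using tau unfolding trop_tau_iff[OF T] by blast+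
  have dl': "(\<lambda>j r. crd r (ed (Suc j))) = dl" unfolding dl ed_def ..
  let ?D = "Dt (len ?C) :: nat => real"
  have W: "sg \<in> ?W" using cln_cell attach(1,2) unfolding sg_def F(1)[symmetric] by auto
  have eq: "(\<Sum>j<m. cell_base F dpt dl j (sg j) r + ?D j * cell_col dl j (sg j) r) = diff_vec x r" if "r < m" for r
   using curve_equations[OF h m F x that] unfolding dl' .
  have g: "dt m (cell_matrix dl sg) \<noteq> 0" "inj_on ?D {..<m}" "\<And>j. j < m ==> ?D j \<noteq> dpt (sg j) \<and> ?D j \<noteq> dpt (above F (sg j))"
   using gen[OF W eq] by blast+
  interpret cell_points n F dpt m sg ?D by (rule curve_keys(1)[OF h F g(2,3)])
  have ks: "keyset (pq_marks n m) ?C = keys" by (rule curve_keys(2)[OF h F g(2,3)])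
  have sol: "?sol sg ?D"
   unfolding cell_solution_def m[symmetric] using lower upper eq by blast
  hence S: "sg \<in> S" unfolding S_def using W by blast
  \<comment> \<open>\<open>Ds\<close> was an arbitrary choice; nonvanishing of the determinant
    identifies it with the depths of the curve.\<close>
  have "Ds sg j = ?D j" if "j < m" for j
   by (rule linear_unique[OF g(1) _ that, where b = "\<lambda>j. cell_base F dpt dl j (sg j)"])
    (use eq eqs[OF Ds[OF S]] in \<open>simp add: cell_matrix_def\<close>)
  hence "keys = ?keys sg (Ds sg)" by (intro keys_cong pts[OF W Ds[OF S]]) simp
  hence c1: "cl sg = {C. param_curve \<Delta> n m C \<and> keyset (pq_marks n m) C = keyset (pq_marks n m) ?C \<and> ev C 1 = ev ?C 1}"
   unfolding cl_def ks using x[of 1] n by simp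
  have "curve_rel \<Delta> n m `` {?C} = cl sg" unfolding c1 using conjunct1[OF M[OF cM]] rel by auto
  hence "c = cl sg" using M[OF cM] by simp
  thus ?thesis using S by blast
 qed
 have "bij_betw cl S (fibre \<Delta> n m ?y)"
  unfolding bij_betw_def
 proof
  show "inj_on cl S"
  proof (rule inj_onI)
   fix \<sigma> \<sigma>' assume s: "\<sigma> \<in> S" "\<sigma>' \<in> S" "cl \<sigma> = cl \<sigma>'"
   have r: "rep (cl \<sigma>) \<in> cl \<sigma>" "rep (cl \<sigma>) \<in> cl \<sigma>'" using cl_rep[OF s(1)] s(3) by auto
   show "\<sigma> = \<sigma>'" using main[OF s(1) r(1)] main[OF s(2) r(2)] by metis
  qed
  show "cl ` S = fibre \<Delta> n m ?y"
   using surj cl_rep main unfolding fibre_def by blast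
 qed
 note bij = this
 have finW: "finite ?W" by (rule finite_PiE) (use h.finite_cells in auto)
 hence finS: "finite S" unfolding S_def by simp
 thus "finite (fibre \<Delta> n m ?y)" using bij bij_betw_finite by blast
 have "real (\<Sum>c\<in>fibre \<Delta> n m ?y. lattice_index n (rep c)) = (\<Sum>\<sigma>\<in>S. real (lattice_index n (rep (cl \<sigma>))))"
  unfolding sum.reindex_bij_betw[OF bij, symmetric] by simp
 also have "\<dots> = (\<Sum>\<sigma>\<in>S. \<bar>dt m (cell_matrix dl \<sigma>)\<bar>)"
  by (rule sum.cong[OF refl]) (use main cl_rep in blast)
 also have "\<dots> = (\<Sum>\<sigma>\<in>?W. of_bool (\<exists>D. ?sol \<sigma> D) * \<bar>dt m (cell_matrix dl \<sigma>)\<bar>)"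
  unfolding S_def using finW by (intro sum.mono_neutral_cong_left) auto
 finally show "real (\<Sum>c\<in>fibre \<Delta> n m ?y. lattice_index n (rep c))
  = (\<Sum>\<sigma>\<in>?W. of_bool (\<exists>D. ?sol \<sigma> D) * \<bar>dt m (cell_matrix dl \<sigma>)\<bar>)" .
qed

section \<open>The degree\<close>

lemma inj_PMark: "inj PMark" by (simp add: inj_on_def)

text \<open>The clusters depend only on the combinatorial tree. The depth of a cluster is linear in
  the lengths, with coefficient 1 for the edges on the path to its vertex, so one choice of
  hyperplanes can serve the whole cone.\<close>

lemma tree_hierarchy:
 fixes T :: mtree
 assumes T: "metric_tree (p_marks n) T" and n: "n \<ge> 3"
 obtains F and c :: "nat set => nat set => real" where
  "\<And>t. (\<And>e. e \<in> edges T ==> 0 < t e) ==> hierarchy n F (\<lambda>R. \<Sum>e\<in>edges T. c R e * t e)"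
  "\<And>t. (\<And>e. e \<in> edges T ==> 0 < t e) ==> metric_tree (p_marks n) (T\<lparr>len := t\<rparr>)"
  "\<And>t. keyset (p_marks n) (T\<lparr>len := t\<rparr>) = (\<lambda>R. (PMark ` R, \<Sum>e\<in>edges T. c R e * t e)) ` F"
proof -
 have L: "finite (p_marks n)" "PMark 1 \<in> p_marks n" using p_marks_L n by auto
 let ?K = "clus (p_marks n) T" and ?r = "foot T (PMark 1)"
 interpret keyed_tree "p_marks n" T ?K "depth T" by (rule metric_tree_keyed(1)[OF T L(2,1)])
 have I: "{1..n} = insert 1 {2..n}" using n by auto
 have pm: "p_marks n - {PMark 1} = PMark ` {2..n}" unfolding p_marks_def I by auto
 define ix where "ix v = {i. PMark i \<in> ?K v}" for v
 have ix: "PMark ` ix v = ?K v" "ix v \<subseteq> {2..n}" if "v \<in> V" for v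
  using K_sub[OF that] unfolding pm ix_def by auto
 have ix_sub: "ix v \<subseteq> ix u \<longleftrightarrow> ?K v \<subseteq> ?K u" if "u \<in> V" "v \<in> V" for u v
  using inj_image_subset_iff[OF inj_PMark, of "ix v" "ix u"] ix(1) that by simp
 have ix_inj: "inj_on ix V" using K_inj ix(1) unfolding inj_on_def by metis
 define c where "c R e = (of_bool (e \<in> path_edges T ?r (inv_into V ix R)) :: real)" for R e
 have pot_c: "(\<Sum>e\<in>edges T. c (ix v) e * t e) = pot t v" if v: "v \<in> V" for v t
 proof -
  have sub: "path_edges T ?r v \<subseteq> edges T"
   unfolding path_edges_eq[OF K_root(1) v] edges_par using le_root[OF v] le_refl K_root(1) by blast
  have fin: "finite (edges T)" unfolding edges_par using finV by simp
  have "(\<Sum>e\<in>edges T. c (ix v) e * t e) = (\<Sum>e\<in>path_edges T ?r v. t e)"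
   unfolding c_def inv_into_f_f[OF ix_inj v] using sub fin by (intro sum.mono_neutral_cong_right) auto
  also have "\<dots> = pot t v"
   using sum_path_edges[OF K_root(1) v le_root[OF v], of t] pot_diff[OF K_root(1) v le_root[OF v], of t] pot_root[of t] by simp
  finally show ?thesis .
 qed
 have ixV: "ix v \<in> ix ` V" if "v \<in> V" for v using that by simp
 have isp: "is_path (T\<lparr>len := t\<rparr>) = is_path T" for t by (intro ext) (simp add: is_path_def)
 hence tp: "tree_path (T\<lparr>len := t\<rparr>) = tree_path T" for t by (intro ext) (simp add: tree_path_def)
 have pe: "path_edges (T\<lparr>len := t\<rparr>) = path_edges T" for t by (intro ext) (simp add: path_edges_def path_steps_def tp)
 show ?thesis
 proof (rule that[of "ix ` V" c])
  fix t :: "nat set => real" assume t: "\<And>e. e \<in> edges T ==> 0 < t e"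
  show "hierarchy n (ix ` V) (\<lambda>R. \<Sum>e\<in>edges T. c R e * t e)"
  proof
   have "PMark ` ix ?r = PMark ` {2..n}" using ix(1)[OF K_root(1)] K_root(2) unfolding pm by simp
   hence r: "ix ?r = {2..n}" by (simp only: inj_image_eq_iff[OF inj_PMark])
   show "{2..n} \<in> ix ` V" using ixV[OF K_root(1)] unfolding r .
   show "(\<Sum>e\<in>edges T. c {2..n} e * t e) = 0" using pot_c[OF K_root(1), of t] pot_root[of t] unfolding r by simp
   show "R \<subseteq> {2..n} \<and> 2 \<le> card R" if R: "R \<in> ix ` V" for R
   proof -
    obtain v where v: "v \<in> V" "R = ix v" using R by blast
    have "card (PMark ` ix v) = card (ix v)" by (rule card_image) (simp add: inj_on_def)
    thus ?thesis using metric_tree_keyed(2)[OF T L(2,1) v(1)] ix[OF v(1)] v(2) by simp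
   qed
   show "R \<subseteq> R' \<or> R' \<subseteq> R \<or> R \<inter> R' = {}" if R: "R \<in> ix ` V" "R' \<in> ix ` V" for R R'
   proof -
    obtain u v where "u \<in> V" "v \<in> V" "R = ix u" "R' = ix v" using R by blast
    thus ?thesis using K_laminar[of u v] ix_sub unfolding ix_def by blast
   qed
   show "(\<Sum>e\<in>edges T. c R' e * t e) < (\<Sum>e\<in>edges T. c R e * t e)" if R: "R \<in> ix ` V" "R' \<in> ix ` V" "R \<subset> R'" for R R'
   proof -
    obtain u v where uv: "u \<in> V" "v \<in> V" "R = ix u" "R' = ix v" using R by blast
    hence "?K u \<subseteq> ?K v" "u \<noteq> v" using ix_sub[of v u] R(3) by auto
    thus ?thesis unfolding uv(3,4) pot_c[OF uv(1)] pot_c[OF uv(2)] using pot_mono[OF uv(2,1)] t by blast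
   qed
  qed (rule n)
  show "metric_tree (p_marks n) (T\<lparr>len := t\<rparr>)"
   using T t unfolding metric_tree_def valence_def isp by simp
 next
  fix t :: "nat set => real"
  have "clus (p_marks n) (T\<lparr>len := t\<rparr>) v = ?K v" for v unfolding clus_def tp by simp
  moreover have "depth (T\<lparr>len := t\<rparr>) v = (\<Sum>e\<in>edges T. c (ix v) e * t e)" if v: "v \<in> V" for v
  proof -
   have "depth (T\<lparr>len := t\<rparr>) v = chain_len T t {?r, v}" unfolding depth_def chain_len_def pe by simp
   thus ?thesis unfolding pot_c[OF v] chain_len_pot[OF K_root(1) v le_root[OF v]] pot_root by simp
  qed
  ultimately show "keyset (p_marks n) (T\<lparr>len := t\<rparr>) = (\<lambda>R. (PMark ` R, \<Sum>e\<in>edges T. c R e * t e)) ` ix ` V"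
   unfolding keyset_def image_image by (intro image_cong) (simp_all add: ix(1))
 qed
qed

text \<open>The caterpillar with clusters \<open>{i..n}\<close>. Such a tree has to exist because
  otherwise \<open>has_degree\<close> would hold vacuously for every number.\<close>

lemma ex_trivalent:
 assumes n: "n \<ge> 3"
 obtains T :: mtree where "metric_tree (p_marks n) T" "\<forall>v\<in>verts T. valence (p_marks n) T v = 3"
proof -
 let ?L = "p_marks n" and ?S = "(\<lambda>i. PMark ` {i..n}) ` {2..n - 1}"
 have L: "finite ?L" "PMark 1 \<in> ?L" using p_marks_L n by auto
 have I: "{1..n} = insert 1 {2..n}" using n by auto
 have pm: "?L - {PMark 1} = PMark ` {2..n}" unfolding p_marks_def I by auto
 have cP: "card (PMark ` A) = card A" for A by (rule card_image) (simp add: inj_on_def)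
 obtain T :: mtree and K where T: "keyed_tree ?L T K (\<lambda>v. - real (card (K v)))" "K ` verts T = ?S" "\<And>e. e \<in> edges T ==> 0 < len T e"
 proof (rule ex_keyed_tree[OF L(2), of ?S "\<lambda>A. - real (card A)"])
  show "A \<noteq> {} \<and> A \<subseteq> ?L - {PMark 1}" if "A \<in> ?S" for A using that unfolding pm by auto
  show "?L - {PMark 1} \<in> ?S" unfolding pm using n by auto
  show "A \<subseteq> B \<or> B \<subseteq> A \<or> A \<inter> B = {}" if AB: "A \<in> ?S" "B \<in> ?S" for A B
  proof -
   obtain i j where "A = PMark ` {i..n}" "B = PMark ` {j..n}" using AB by blast
   thus ?thesis by (cases "i \<le> j") auto
  qed
  show "- real (card B) < - real (card A)" if AB: "A \<in> ?S" "B \<in> ?S" "A \<subset> B" for A B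
  proof -
   have "finite B" using AB(2) by auto
   thus ?thesis using psubset_card_mono[OF _ AB(3)] by simp
  qed
 qed auto
 interpret keyed_tree ?L T K "\<lambda>v. - real (card (K v))" by (rule T(1))
 have met: "metric_tree ?L T"
 proof (rule keyed_tree_metric[OF T(1) L(1) T(3)])
  fix v assume "v \<in> V"
  then obtain i where "i \<in> {2..n - 1}" "K v = PMark ` {i..n}" using T(2) by blast
  thus "2 \<le> card (K v)" unfolding \<open>K v = _\<close> cP using n by auto
 qed
 have inj: "inj_on (\<lambda>i. PMark ` {i..n}) {2..n - 1}"
 proof (rule inj_onI)
  fix i j assume "i \<in> {2..n - 1}" "j \<in> {2..n - 1}" "PMark ` {i..n} = PMark ` {j..n}"
  thus "i = j" by (auto simp: inj_image_eq_iff[OF inj_PMark] Icc_eq_Icc)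
 qed
 have "card V = card ?S" unfolding T(2)[symmetric] by (rule card_image[OF K_inj, symmetric])
 hence cV: "card V + 2 = n" unfolding card_image[OF inj] using n by simp
 have finE: "finite (edges T)" unfolding edges_par using finV by simp
 have cE: "card (edges T) + 1 = card V"
  unfolding edges_par card_image[OF par_edge_inj] using card_Suc_Diff1[OF finV K_root(1)] by simp
 have "(\<Sum>v\<in>V. card {e \<in> edges T. v \<in> e}) = 2 * card (edges T)"
 proof (rule sum_multicount[OF finV finE], rule ballI)
  fix e assume "e \<in> edges T"
  then obtain u w where e: "e = {u, w}" "u \<in> V" "w \<in> V" "u \<noteq> w" using met unfolding metric_tree_def by blast
  hence "{v \<in> V. v \<in> e} = {u, w}" by blast
  thus "card {v \<in> V. v \<in> e} = 2" using e(4) by simp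
 qed
 moreover have "(\<Sum>v\<in>V. card {l \<in> ?L. foot T l = v}) = 1 * card ?L"
 proof (rule sum_multicount[OF finV L(1)], rule ballI)
  fix l assume "l \<in> ?L"
  hence "foot T l \<in> V" using met unfolding metric_tree_def by blast
  hence "{v \<in> V. foot T l = v} = {foot T l}" by blast
  thus "card {v \<in> V. foot T l = v} = 1" by simp
 qed
 moreover have "card ?L = n" unfolding p_marks_def cP by simp
 \<comment> \<open>With \<open>n - 2\<close> vertices, \<open>n - 3\<close> edges and
   \<open>n\<close> ends, the valences add up to \<open>3 * (n - 2)\<close>; as each is at least 3,
   all are equal to 3.\<close>
 ultimately have tot: "(\<Sum>v\<in>V. valence ?L T v) = (\<Sum>v\<in>V. 3)"
  unfolding valence_def sum.distrib using cV cE by simp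
 have ge: "3 \<le> valence ?L T v" if "v \<in> V" for v using met that unfolding metric_tree_def by blast
 have "valence ?L T v = 3" if v: "v \<in> V" for v
 proof (rule ccontr)
  assume "valence ?L T v \<noteq> 3"
  hence "3 < valence ?L T v" using ge[OF v] by simp
  hence "(\<Sum>v\<in>V. 3) < (\<Sum>v\<in>V. valence ?L T v)" using ge v by (intro sum_strict_mono_ex1[OF finV]) auto
  thus False using tot by simp
 qed
 thus ?thesis using that met by blast
qed

text \<open>All lengths and coordinates together are taken on the moment curve; a positive parameter
  keeps the lengths positive.\<close>

lemma ex_generic_point:
 fixes H :: "(('e => real) \<times> (nat => real \<times> real)) set"
 assumes E: "finite E" and H: "finite H" "\<And>\<alpha> \<beta>. (\<alpha>, \<beta>) \<in> H ==> (\<exists>e\<in>E. \<alpha> e \<noteq> 0) \<or> (\<exists>i\<in>{1..n}. \<beta> i \<noteq> 0)"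
 obtains t x where "\<forall>e\<in>E. 0 < t e" "\<forall>(\<alpha>, \<beta>)\<in>H. form E n \<alpha> \<beta> t x \<noteq> 0"
proof -
 let ?p = "card E"
 obtain h where h: "bij_betw h {..<?p} E" using ex_bij_betw_nat_finite[OF E] by (auto simp: atLeast0LessThan)
 let ?g = "inv_into {..<?p} h"
 \<comment> \<open>Coefficients of the lengths come first, then pairs for the points. The pair
   number 0 is filled with zeros because points are numbered from 1.\<close>
 define y where "y = (\<lambda>(\<alpha> :: 'e => real, \<beta> :: nat => real \<times> real) r. if r < ?p then \<alpha> (h r)
  else if r - ?p < 2 then 0 else if even (r - ?p) then fst (\<beta> ((r - ?p) div 2)) else snd (\<beta> ((r - ?p) div 2)))"
 obtain s :: real where s: "s > 0" "\<And>z. z \<in> y ` H ==> (\<Sum>r<?p + 2 * (n + 1). z r * s ^ r) \<noteq> 0"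
 proof (rule avoid_roots[of "y ` H" "?p + 2 * (n + 1)" 0])
  fix z assume "z \<in> y ` H"
  then obtain \<alpha> \<beta> where z: "(\<alpha>, \<beta>) \<in> H" "z = y (\<alpha>, \<beta>)" by auto
  from H(2)[OF z(1)] show "\<exists>r<?p + 2 * (n + 1). z r \<noteq> 0"
  proof
   assume "\<exists>e\<in>E. \<alpha> e \<noteq> 0"
   then obtain e where e: "e \<in> E" "\<alpha> e \<noteq> 0" by blast
   hence "e \<in> h ` {..<?p}" using bij_betw_imp_surj_on[OF h] by simp
   then obtain r where "r < ?p" "\<alpha> (h r) \<noteq> 0" using e(2) by auto
   thus ?thesis unfolding z(2) y_def by (intro exI[of _ r]) simp
  next
   assume "\<exists>i\<in>{1..n}. \<beta> i \<noteq> 0"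
   then obtain i where i: "i \<in> {1..n}" "fst (\<beta> i) \<noteq> 0 \<or> snd (\<beta> i) \<noteq> 0" by (auto simp: prod_eq_iff)
   have "y (\<alpha>, \<beta>) (?p + 2 * i) = fst (\<beta> i)" "y (\<alpha>, \<beta>) (?p + (2 * i + 1)) = snd (\<beta> i)" using i(1) unfolding y_def by auto
   thus ?thesis using i unfolding z(2)
    by (elim disjE) (intro exI[of _ "?p + 2 * i"] exI[of _ "?p + (2 * i + 1)"], auto)+
  qed
 qed (use H(1) in simp_all)
 define t where "t e = s ^ ?g e" for e
 define x where "x i = (s ^ (?p + 2 * i), s ^ (?p + (2 * i + 1)))" for i
 have "form E n \<alpha> \<beta> t x = (\<Sum>r<?p + 2 * (n + 1). y (\<alpha>, \<beta>) r * s ^ r)" for \<alpha> \<beta>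
 proof -
  have "(\<Sum>r<?p. y (\<alpha>, \<beta>) r * s ^ r) = (\<Sum>r<?p. \<alpha> (h r) * t (h r))"
   unfolding t_def using bij_betw_inv_into_left[OF h] by (intro sum.cong) (auto simp: y_def)
  also have "\<dots> = (\<Sum>e\<in>E. \<alpha> e * t e)" by (rule sum.reindex_bij_betw[OF h])
  finally have 1: "(\<Sum>r<?p. y (\<alpha>, \<beta>) r * s ^ r) = (\<Sum>e\<in>E. \<alpha> e * t e)" .
  have "(\<Sum>r<2 * (n + 1). y (\<alpha>, \<beta>) (?p + r) * s ^ (?p + r))
   = (\<Sum>i<n + 1. y (\<alpha>, \<beta>) (?p + 2 * i) * s ^ (?p + 2 * i) + y (\<alpha>, \<beta>) (?p + (2 * i + 1)) * s ^ (?p + (2 * i + 1)))"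
   by (rule sum_even_odd)
  also have "\<dots> = (\<Sum>i\<in>{1..n}. \<beta> i \<bullet> x i)"
   by (rule sum.mono_neutral_cong_right) (auto simp: y_def x_def inner_prod_def)
  finally have 2: "(\<Sum>r<2 * (n + 1). y (\<alpha>, \<beta>) (?p + r) * s ^ (?p + r)) = (\<Sum>i\<in>{1..n}. \<beta> i \<bullet> x i)" .
  have "(\<Sum>r<?p + q. f r) = (\<Sum>r<?p. f r) + (\<Sum>r<q. f (?p + r))" for q and f :: "nat => real"
   by (induction q) simp_all
  thus ?thesis unfolding form_def 1[symmetric] 2[symmetric] by simp
 qed
 hence "\<forall>(\<alpha>, \<beta>)\<in>H. form E n \<alpha> \<beta> t x \<noteq> 0" using s(2) by auto
 moreover have "\<forall>e\<in>E. 0 < t e" unfolding t_def using s(1) by simp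
 ultimately show ?thesis using that by blast
qed

text \<open>For one trivalent tree, a point off both finite systems of hyperplanes has a fibre whose
  weighted count equals both numbers.\<close>

lemma has_degree_unique:
 assumes n: "n \<ge> 3" and d: "has_degree \<Delta> n m d" "has_degree \<Delta> n m d'"
 shows "d = d'"
proof -
 obtain T :: mtree where T: "metric_tree (p_marks n) T" "\<forall>v\<in>verts T. valence (p_marks n) T v = 3" by (rule ex_trivalent[OF n])
 let ?nz = "\<lambda>H. \<forall>(\<alpha>, \<beta>)\<in>H. (\<exists>e\<in>edges T. \<alpha> e \<noteq> 0) \<or> (\<exists>i\<in>{1..n}. \<beta> i \<noteq> (0 :: real \<times> real))"
 let ?fib = "\<lambda>t x. fibre \<Delta> n m (tree_rel n `` {T\<lparr>len := t\<rparr>}, restrict x {1..n})"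
 let ?Q = "\<lambda>H d. finite H \<and> ?nz H \<and> (\<forall>t x. (\<forall>e\<in>edges T. 0 < t e) \<and> (\<forall>(\<alpha>, \<beta>)\<in>H. form (edges T) n \<alpha> \<beta> t x \<noteq> 0) \<longrightarrow>
   finite (?fib t x) \<and> (\<Sum>c\<in>?fib t x. lattice_index n (rep c)) = d)"
 have ex: "\<exists>H. ?Q H d" if "has_degree \<Delta> n m d" for d
  using that[unfolded has_degree_def Let_def, THEN spec, THEN mp, OF conjI[OF T]] unfolding form_def .
 obtain H where H: "?Q H d" using ex[OF d(1)] by (rule exE)
 obtain H' where H': "?Q H' d'" using ex[OF d(2)] by (rule exE)
 have fin: "finite (edges T)"
  by (rule finite_subset[of _ "Pow (verts T)"]) (use T(1) in \<open>auto simp: metric_tree_def\<close>)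
 have nz: "?nz (H \<union> H')" unfolding ball_Un using H H' by simp
 obtain t x where tx: "\<forall>e\<in>edges T. 0 < t e" "\<forall>(\<alpha>, \<beta>)\<in>H \<union> H'. form (edges T) n \<alpha> \<beta> t x \<noteq> 0"
 proof (rule ex_generic_point[OF fin])
  show "finite (H \<union> H')" using H H' by simp
  show "(\<exists>e\<in>edges T. \<alpha> e \<noteq> 0) \<or> (\<exists>i\<in>{1..n}. \<beta> i \<noteq> 0)" if "(\<alpha>, \<beta>) \<in> H \<union> H'" for \<alpha> \<beta>
   using bspec[OF nz that] by simp
 qed
 hence "(\<Sum>c\<in>?fib t x. lattice_index n (rep c)) = d" "(\<Sum>c\<in>?fib t x. lattice_index n (rep c)) = d'"
  using H[THEN conjunct2, THEN conjunct2, THEN spec, THEN spec, THEN mp, of t x] H'[THEN conjunct2, THEN conjunct2, THEN spec, THEN spec, THEN mp, of t x]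
  unfolding ball_Un by simp_all
 thus ?thesis by simp
qed

lemma rank_bij:
 fixes A :: "nat set"
 assumes "finite A"
 shows "bij_betw (\<lambda>l. card {l' \<in> A. l' < l}) A {..<card A}"
proof -
 have lt: "card {l' \<in> A. l' < l} < card {l' \<in> A. l' < k}" if "l \<in> A" "l < k" for l k
  using that assms by (intro psubset_card_mono) auto
 have inj: "inj_on (\<lambda>l. card {l' \<in> A. l' < l}) A"
 proof (rule inj_onI)
  fix l k assume "l \<in> A" "k \<in> A" "card {l' \<in> A. l' < l} = card {l' \<in> A. l' < k}"
  thus "l = k" using lt[of l k] lt[of k l] by (cases l k rule: linorder_cases) auto
 qed
 have "(\<lambda>l. card {l' \<in> A. l' < l}) ` A \<subseteq> {..<card A}"
  using assms by (auto intro!: psubset_card_mono)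
 hence "(\<lambda>l. card {l' \<in> A. l' < l}) ` A = {..<card A}"
  by (rule card_subset_eq[rotated]) (simp_all add: card_image[OF inj])
 thus ?thesis using inj unfolding bij_betw_def by simp
qed

text \<open>Within each divisor the position of a marking is its rank among the markings sent there,
  so multiplicities indexed by markings are those listed in the vectors, rearranged.\<close>

lemma contact_mult:
 assumes c: "contact_order a m \<phi> \<mu>" and mn: "mn = (\<lambda>l. \<mu> (\<phi> l) ! card {l' \<in> {1..<l}. \<phi> l' = \<phi> l})"
 shows "\<And>l. l \<in> {1..m} ==> mn l > 0"
  and "(\<Prod>l\<in>{1..m}. mn l) = (\<Prod>i\<in>{1..4}. \<Prod>j<length (\<mu> i). \<mu> i ! j)"
proof -
 let ?A = "\<lambda>i. {l \<in> {1..m}. \<phi> l = i}"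
 have phi: "\<phi> l \<in> {1..4}" if "l \<in> {1..m}" for l using c that unfolding contact_order_def by blast
 have len: "length (\<mu> i) = card (?A i)" and pos: "\<And>k. k \<in> set (\<mu> i) ==> 0 < k" if "i \<in> {1..4}" for i
  using c that unfolding contact_order_def by blast+
 have bij: "bij_betw (\<lambda>l. card {l' \<in> ?A i. l' < l}) (?A i) {..<length (\<mu> i)}" if "i \<in> {1..4}" for i
  unfolding len[OF that] by (rule rank_bij) simp
 have mni: "mn l = \<mu> i ! card {l' \<in> ?A i. l' < l}" if l: "l \<in> ?A i" for i l
 proof -
  have "{l' \<in> {1..<l}. \<phi> l' = \<phi> l} = {l' \<in> ?A i. l' < l}" using l by auto
  thus ?thesis unfolding mn using l by simp
 qed
 show "mn l > 0" if l: "l \<in> {1..m}" for l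
 proof -
  have "card {l' \<in> ?A (\<phi> l). l' < l} < length (\<mu> (\<phi> l))" using bij_betwE[OF bij[OF phi[OF l]]] l by auto
  thus ?thesis using mni[of l "\<phi> l"] pos[OF phi[OF l]] l by simp
 qed
 have "(\<Prod>l\<in>{1..m}. mn l) = (\<Prod>i\<in>{1..4}. \<Prod>l\<in>?A i. mn l)"
  using phi by (intro prod.group[symmetric]) auto
 also have "\<dots> = (\<Prod>i\<in>{1..4}. \<Prod>j<length (\<mu> i). \<mu> i ! j)"
 proof (rule prod.cong[OF refl])
  fix i :: nat assume i: "i \<in> {1..4}"
  have "(\<Prod>l\<in>?A i. mn l) = (\<Prod>l\<in>?A i. \<mu> i ! card {l' \<in> ?A i. l' < l})" by (rule prod.cong[OF refl mni])
  thus "(\<Prod>l\<in>?A i. mn l) = (\<Prod>j<length (\<mu> i). \<mu> i ! j)" unfolding prod.reindex_bij_betw[OF bij[OF i]] .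
 qed
 finally show "(\<Prod>l\<in>{1..m}. mn l) = (\<Prod>i\<in>{1..4}. \<Prod>j<length (\<mu> i). \<mu> i ! j)" .
qed

theorem has_degree_formula:
 assumes a: "1 \<le> a" and n: "3 \<le> n" and m: "m = 2 * (n - 1)" and c: "contact_order a m \<phi> \<mu>"
 shows "has_degree (contact_vec a \<phi> \<mu>) n m
  (if length (\<mu> 1) \<le> n - 1 \<and> length (\<mu> 3) \<le> n - 1 \<and> length (\<mu> 2) + length (\<mu> 4) \<le> n - 1
   then (\<Prod>i\<in>{1..4}. fact (length (\<mu> i))) * (\<Prod>i\<in>{1..4}. \<Prod>j<length (\<mu> i). \<mu> i ! j)
    * a ^ (n - 1 - length (\<mu> 2) - length (\<mu> 4)) * ((n - 1 - length (\<mu> 4)) choose length (\<mu> 2)) else 0)"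
 unfolding has_degree_def
proof (intro allI impI, elim conjE)
 let ?\<Delta> = "contact_vec a \<phi> \<mu>"
 define mn where "mn = (\<lambda>l. \<mu> (\<phi> l) ! card {l' \<in> {1..<l}. \<phi> l' = \<phi> l})"
 note cm = contact_mult[OF c mn_def]
 \<comment> \<open>The default 4 agrees with the last branch of \<open>ray\<close>, so that
   \<open>dl_star\<close> holds for all indices, also beyond \<open>m\<close>.\<close>
 define ty where "ty j = (if \<phi> (Suc j) \<in> {1, 2, 3} then \<phi> (Suc j) else 4)" for j
 define mu where "mu j = real (mn (Suc j))" for j
 define J where "J = (\<lambda>t. card {j. j < m \<and> ty j = t})"
 define dl where "dl = (\<lambda>j r. crd r (end_dir ?\<Delta> (QMark (Suc j))))"
 have cv: "?\<Delta> l = (int (mn l) * fst (ray a (\<phi> l)), int (mn l) * snd (ray a (\<phi> l)))" for l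
  unfolding contact_vec_def mn_def Let_def by simp
 have dl_star: "dl = (\<lambda>j r. if even r then leg_x ty mu j else leg_y a ty mu j)"
  unfolding dl_def crd_def
  by (intro ext) (auto simp: cv ray_def ty_def mu_def leg_x_def leg_y_def)
 have phi: "\<phi> l \<in> {1..4}" if "l \<in> {1..m}" for l using c that unfolding contact_order_def by blast
 have ty: "ty j = \<phi> (Suc j)" if "j < m" for j using phi[of "Suc j"] that unfolding ty_def by auto
 have J: "J i = length (\<mu> i)" if "i \<in> {1..4}" for i
 proof -
  have "bij_betw Suc {j. j < m \<and> ty j = i} {l \<in> {1..m}. \<phi> l = i}"
   by (rule bij_betw_byWitness[of _ "\<lambda>l. l - 1"]) (auto simp: ty)
  hence "J i = card {l \<in> {1..m}. \<phi> l = i}" unfolding J_def by (rule bij_betw_same_card)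
  thus ?thesis using c that unfolding contact_order_def by simp
 qed
 have J4: "J 1 = length (\<mu> 1)" "J 2 = length (\<mu> 2)" "J 3 = length (\<mu> 3)" "J 4 = length (\<mu> 4)" using J by simp_all
 have bal: "(\<Sum>l\<in>{1..m}. ?\<Delta> l) = 0" using c unfolding contact_order_def by blast
 have "{1..m} = Suc ` {..<m}" unfolding image_Suc_lessThan ..
 hence prod_mu: "(\<Prod>j<m. mu j) = real (\<Prod>l\<in>{1..m}. mn l)" unfolding mu_def by (simp add: prod.reindex)
 have I4: "{1..4 :: nat} = {1, 2, 3, 4}" by auto
 let ?d = "if length (\<mu> 1) \<le> n - 1 \<and> length (\<mu> 3) \<le> n - 1 \<and> length (\<mu> 2) + length (\<mu> 4) \<le> n - 1
   then (\<Prod>i\<in>{1..4}. fact (length (\<mu> i))) * (\<Prod>i\<in>{1..4}. \<Prod>j<length (\<mu> i). \<mu> i ! j)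
    * a ^ (n - 1 - length (\<mu> 2) - length (\<mu> 4)) * ((n - 1 - length (\<mu> 4)) choose length (\<mu> 2)) else 0"
 have F4: "(\<Prod>i\<in>{1..4}. fact (length (\<mu> i))) = fact (length (\<mu> 1)) * fact (length (\<mu> 2)) * fact (length (\<mu> 3)) * (fact (length (\<mu> 4)) :: nat)"
  unfolding I4 by simp
 have ty4: "ty j \<in> {1, 2, 3, 4}" for j unfolding ty_def by auto
 have mu_pos: "mu j > 0" if "j < 2 * (n - 1)" for j using cm(1)[of "Suc j"] that m unfolding mu_def by simp
 fix T :: mtree assume T: "metric_tree (p_marks n) T"
 let ?fib = "\<lambda>t x. fibre ?\<Delta> n m (tree_rel n `` {T\<lparr>len := t\<rparr>}, restrict x {1..n})"
 show "\<exists>H. finite H \<and> (\<forall>(\<alpha>, \<beta>)\<in>H. (\<exists>e\<in>edges T. \<alpha> e \<noteq> 0) \<or> (\<exists>i\<in>{1..n}. \<beta> i \<noteq> 0)) \<and>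
  (\<forall>t x. (\<forall>e\<in>edges T. 0 < t e) \<and> (\<forall>(\<alpha>, \<beta>)\<in>H. (\<Sum>e\<in>edges T. \<alpha> e * t e) + (\<Sum>i\<in>{1..n}. \<beta> i \<bullet> x i) \<noteq> 0) \<longrightarrow>
   (let F = ?fib t x in finite F \<and> (\<Sum>c\<in>F. lattice_index n (rep c)) = ?d))" (is ?goal)
 proof (rule tree_hierarchy[OF T n])
  fix F and cc :: "nat set => nat set => real"
  assume F: "\<And>t. (\<And>e. e \<in> edges T ==> 0 < t e) ==> hierarchy n F (\<lambda>R. \<Sum>e\<in>edges T. cc R e * t e)"
   "\<And>t. (\<And>e. e \<in> edges T ==> 0 < t e) ==> metric_tree (p_marks n) (T\<lparr>len := t\<rparr>)"
   "\<And>t. keyset (p_marks n) (T\<lparr>len := t\<rparr>) = (\<lambda>R. (PMark ` R, \<Sum>e\<in>edges T. cc R e * t e)) ` F"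
  show ?goal
  proof (rule generic_cell_count[OF a n ty4 mu_pos F(1) dl_star J_def[unfolded m], folded m])
   fix H :: "((nat set => real) \<times> (nat => real \<times> real)) set"
   assume H: "finite H" "\<And>\<alpha> \<beta>. (\<alpha>, \<beta>) \<in> H ==> \<exists>i\<in>{1..n}. \<beta> i \<noteq> 0"
    "\<And>t x dpt. (\<And>e. e \<in> edges T ==> t e > 0) ==> (\<forall>(\<alpha>, \<beta>)\<in>H. form (edges T) n \<alpha> \<beta> t x \<noteq> 0) ==> dpt = (\<lambda>R. \<Sum>e\<in>edges T. cc R e * t e) ==>
     (\<Sum>\<sigma>\<in>{..<m} \<rightarrow>\<^sub>E cells n F. of_bool (\<exists>D. cell_solution n F dpt dl \<sigma> (diff_vec x) D) * \<bar>dt m (cell_matrix dl \<sigma>)\<bar>)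
     = (if J 1 \<le> n - 1 \<and> J 3 \<le> n - 1 \<and> J 2 + J 4 \<le> n - 1
       then fact (J 1) * fact (J 2) * fact (J 3) * fact (J 4) * (\<Prod>j<m. mu j)
        * real a ^ (n - 1 - J 2 - J 4) * real ((n - 1 - J 4) choose J 2) else 0)"
    "\<And>t x dpt \<sigma> D. (\<And>e. e \<in> edges T ==> t e > 0) ==> (\<forall>(\<alpha>, \<beta>)\<in>H. form (edges T) n \<alpha> \<beta> t x \<noteq> 0) ==> dpt = (\<lambda>R. \<Sum>e\<in>edges T. cc R e * t e) ==>
     \<sigma> \<in> {..<m} \<rightarrow>\<^sub>E cells n F ==>
     (\<And>r. r < m ==> (\<Sum>j<m. cell_base F dpt dl j (\<sigma> j) r + D j * cell_col dl j (\<sigma> j) r) = diff_vec x r) ==>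
     dt m (cell_matrix dl \<sigma>) \<noteq> 0 \<and> inj_on D {..<m} \<and> (\<forall>j<m. D j \<noteq> dpt (\<sigma> j) \<and> D j \<noteq> dpt (above F (\<sigma> j)))"
   have "finite (?fib t x) \<and> (\<Sum>c\<in>?fib t x. lattice_index n (rep c)) = ?d"
    if t: "\<forall>e\<in>edges T. 0 < t e" and x: "\<forall>(\<alpha>, \<beta>)\<in>H. form (edges T) n \<alpha> \<beta> t x \<noteq> 0" for t x
   proof -
    define dpt where "dpt = (\<lambda>R. \<Sum>e\<in>edges T. cc R e * t e)"
    have t': "0 < t e" if "e \<in> edges T" for e using t that by blast
    have met: "metric_tree (p_marks n) (T\<lparr>len := t\<rparr>)" by (rule F(2)[OF t'])
    have ks: "keyset (p_marks n) (T\<lparr>len := t\<rparr>) = (\<lambda>R. (PMark ` R, dpt R)) ` F" unfolding dpt_def by (rule F(3))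
    have hi: "hierarchy n F dpt" unfolding dpt_def by (rule F(1)[OF t'])
    note fc = fibre_count[OF n m bal met ks hi dl_def H(4)[OF t' x dpt_def]]
    have "real (\<Sum>c\<in>?fib t x. lattice_index n (rep c)) = (if J 1 \<le> n - 1 \<and> J 3 \<le> n - 1 \<and> J 2 + J 4 \<le> n - 1
       then fact (J 1) * fact (J 2) * fact (J 3) * fact (J 4) * (\<Prod>j<m. mu j)
        * real a ^ (n - 1 - J 2 - J 4) * real ((n - 1 - J 4) choose J 2) else 0)"
     by (rule trans[OF fc(2) H(3)[OF t' x dpt_def]])
    also have "\<dots> = real ?d"
     unfolding J4 prod_mu cm(2) F4 by simp
    finally have "(\<Sum>c\<in>?fib t x. lattice_index n (rep c)) = ?d" by (rule of_nat_eq_iff[THEN iffD1])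
    moreover have "finite (?fib t x)" by (rule fc(1))
    ultimately show ?thesis by blast
   qed
   note cnt = this
   have "\<forall>(\<alpha>, \<beta>)\<in>H. (\<exists>e\<in>edges T. \<alpha> e \<noteq> 0) \<or> (\<exists>i\<in>{1..n}. \<beta> i \<noteq> 0)" using H(2) by blast
   thus ?goal unfolding Let_def form_def[symmetric] using H(1) cnt by (intro exI[of _ H] conjI allI impI) simp_all
  qed
 qed
qed

theorem theorem7:
  fixes a n m :: nat and \<phi> :: "nat \<Rightarrow> nat" and \<mu> :: "nat \<Rightarrow> nat list"
  assumes "1 \<le> a" and "3 \<le> n" and "m = 2 * (n - 1)"
    and "contact_order a m \<phi> \<mu>"
  shows "((length (\<mu> 1) > n - 1 \<or> length (\<mu> 3) > n - 1) \<longrightarrow> trop_Tev a n m \<phi> \<mu> = 0) \<and>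
    (\<not> (length (\<mu> 1) > n - 1 \<or> length (\<mu> 3) > n - 1) \<longrightarrow>
      trop_Tev a n m \<phi> \<mu> =
        (if length (\<mu> 2) + length (\<mu> 4) > n - 1 then 0
         else (\<Prod>i\<in>{1..4}. fact (length (\<mu> i)) * (\<Prod>j<length (\<mu> i). real (\<mu> i ! j))
                            / real (aut_factor (\<mu> i)))
              * real a ^ (n - 1 - length (\<mu> 2) - length (\<mu> 4))
              * real ((n - 1 - length (\<mu> 4)) choose length (\<mu> 2))))"
proof -
  note d = has_degree_formula[OF assms]
  have "trop_degree (contact_vec a \<phi> \<mu>) n m =
    (if length (\<mu> 1) \<le> n - 1 \<and> length (\<mu> 3) \<le> n - 1 \<and> length (\<mu> 2) + length (\<mu> 4) \<le> n - 1
     then (\<Prod>i\<in>{1..4}. fact (length (\<mu> i))) * (\<Prod>i\<in>{1..4}. \<Prod>j<length (\<mu> i). \<mu> i ! j)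
       * a ^ (n - 1 - length (\<mu> 2) - length (\<mu> 4)) * ((n - 1 - length (\<mu> 4)) choose length (\<mu> 2)) else 0)"
    unfolding trop_degree_def by (rule the_equality) (rule d, rule has_degree_unique[OF assms(2) _ d])
  then show ?thesis
    unfolding trop_Tev_def by (simp add: prod_dividef prod.distrib not_less not_le)
qed

end
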